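(* Let $A^0,A^1,\dots,A^n,L$ be $m\times m$ real constant matrices satisfying conditions (A), (K), (S) and (S)$_1$ listed in the context. Let $l\ge0$ be an integer, $1\le q,r\le2$, and let $w_0\in W^{l,r}(\mathbb{R}^n)\cap L^q(\mathbb{R}^n)$ be $\mathbb{R}^m$-valued. Let $2\le p\le\infty$ and let $k,\ell$ be non-negative integers with $0\le k+\ell\le l$ and $\ell>n\left(\frac1r-\frac1p\right)$ (when $p=r=2$ it is only required that $\ell\ge0$). Then the solution $w(t,x)\in\mathbb{R}^m$ of $$A^0w_t+\sum_{j=1}^nA^jw_{x_j}+Lw=0\quad (t>0,\ x\in\mathbb{R}^n),\qquad w|_{t=0}=w_0,$$ satisfies, for all $t\ge0$, $$\|\partial_x^kw(t)\|_{L^p}\le C(1+t)^{-\gamma_2(q,p)-\frac k2}\|w_0\|_{L^q}+C(1+t)^{-\frac\ell2+\gamma_2(r,p)}\|\partial_x^{k+\ell}w_0\|_{L^r},$$ where $C>0$ is a constant independent of $t$ and $w_0$.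
   Context: $\gamma_2(q,p):=\frac n2\left(\frac1q-\frac1p\right)$; $\|\partial_x^kw\|_{L^p}$ is the $L^p(\mathbb{R}^n)$ norm of the collection of all spatial derivatives of order $k$. For a real square matrix $X$, $X_1=\frac12(X+X^\top)$ and $X_2=\frac12(X-X^\top)$ are its symmetric and skew-symmetric parts. For a subspace $V\subset\mathbb{C}^m$ and a complex matrix $X$, "$X\ge0$ on $V$" means $\mathrm{Re}\langle X\varphi,\varphi\rangle\ge0$ for all $\varphi\in V$, and "$X>0$ on $V$" means $\mathrm{Re}\langle X\varphi,\varphi\rangle>0$ for all $\varphi\in V\setminus\{0\}$, with $\langle\cdot,\cdot\rangle$ the standard inner product on $\mathbb{C}^m$. For $\omega\in\mathbb{S}^{n-1}$ put $A(\omega)=\sum_{j=1}^nA^j\omega_j$. Condition (A): $A^j$ is real symmetric for $j=0,1,\dots,n$; $A^0>0$ on $\mathbb{C}^m$; $L$ is real (not necessarily symmetric), $L\ge0$ on $\mathbb{C}^m$, and $\mathrm{Ker}(L)\neq\{0\}$. Condition (K): there is a real $m\times m$ matrix $K(\omega)$, depending smoothly on $\omega\in\mathbb{S}^{n-1}$, such that $K(-\omega)=-K(\omega)$, $(K(\omega)A^0)^\top=-K(\omega)A^0$, and $(K(\omega)A(\omega))_1>0$ on $\mathrm{Ker}(L)$, for every $\omega\in\mathbb{S}^{n-1}$. Condition (S): there is a real constant $m\times m$ matrix $S$ such that $(SA^0)^\top=SA^0$, $(SL)_1+L_1\ge0$ on $\mathbb{C}^m$, and $\mathrm{Ker}((SL)_1+L_1)=\mathrm{Ker}(L)$.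 Condition (S)$_1$: for every $\omega\in\mathbb{S}^{n-1}$, the matrix $S$ of condition (S) satisfies $i(SA(\omega))_2\ge0$ on $\mathrm{Ker}(L_1)$. *)

theory Defs
  imports "HOL-Analysis.Analysis" "HOL-Probability.Essential_Supremum"
begin

section \<open>Matrix notation\<close>

definition sym_part :: "real^'m^'m \<Rightarrow> real^'m^'m" where
  "sym_part X = (1/2) *\<^sub>R (X + transpose X)"

definition skew_part :: "real^'m^'m \<Rightarrow> real^'m^'m" where
  "skew_part X = (1/2) *\<^sub>R (X - transpose X)"

abbreviation cmat :: "real^'m^'m \<Rightarrow> complex^'m^'m" where
  "cmat X \<equiv> map_matrix complex_of_real X"

definition hinner :: "complex^'m \<Rightarrow> complex^'m \<Rightarrow> complex" where
  "hinner x y = (\<Sum>i\<in>UNIV. x $ i * cnj (y $ i))"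

definition nonneg_on :: "(complex^'m) set \<Rightarrow> complex^'m^'m \<Rightarrow> bool" where
  "nonneg_on V X \<longleftrightarrow> (\<forall>\<phi>\<in>V. Re (hinner (X *v \<phi>) \<phi>) \<ge> 0)"

definition pos_on :: "(complex^'m) set \<Rightarrow> complex^'m^'m \<Rightarrow> bool" where
  "pos_on V X \<longleftrightarrow> (\<forall>\<phi>\<in>V - {0}. Re (hinner (X *v \<phi>) \<phi>) > 0)"

definition Ker :: "real^'m^'m \<Rightarrow> (complex^'m) set" where
  "Ker X = {\<phi>. cmat X *v \<phi> = 0}"

definition symbol :: "('n::finite \<Rightarrow> real^'m^'m) \<Rightarrow> real^'n \<Rightarrow> real^'m^'m" where
  "symbol A \<omega> = (\<Sum>j\<in>UNIV. (\<omega> $ j) *\<^sub>R A j)"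


section \<open>Classical partial derivatives and smoothness\<close>

text \<open>
  Higher derivatives are indexed by the list of the directions in which one differentiates. The
  lists of length \<open>k\<close> enumerate all derivatives of order \<open>k\<close>; a mixed derivative is listed once
  for every ordering of its directions.
\<close>

definition partial_deriv ::
    "'n::finite \<Rightarrow> (real^'n \<Rightarrow> 'b::real_normed_vector) \<Rightarrow> real^'n \<Rightarrow> 'b" where
  "partial_deriv j f x = frechet_derivative f (at x) (axis j 1)"

fun partial_derivs ::
    "'n::finite list \<Rightarrow> (real^'n \<Rightarrow> 'b::real_normed_vector) \<Rightarrow> real^'n \<Rightarrow> 'b" where
  "partial_derivs [] f = f"
| "partial_derivs (j # js) f = partial_deriv j (partial_derivs js f)"

text \<open>On an open set \<open>U\<close>, this is membership in \<open>C\<^sup>\<infinity>(U)\<close>.\<close>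

definition smooth_on :: "(real^'n::finite) set \<Rightarrow> (real^'n \<Rightarrow> 'b::real_normed_vector) \<Rightarrow> bool" where
  "smooth_on U f \<longleftrightarrow> (\<forall>js. \<forall>x\<in>U. partial_derivs js f differentiable (at x))"

definition smooth_on_sphere :: "(real^'n::finite \<Rightarrow> 'b::real_normed_vector) \<Rightarrow> bool" where
  "smooth_on_sphere f \<longleftrightarrow>
     (\<exists>U F. open U \<and> sphere 0 1 \<subseteq> U \<and> smooth_on U F \<and> (\<forall>\<omega>\<in>sphere 0 1. F \<omega> = f \<omega>))"

definition test_function :: "(real^'n::finite \<Rightarrow> real) \<Rightarrow> bool" where
  "test_function \<phi> \<longleftrightarrow> smooth_on UNIV \<phi> \<and> bounded {x. \<phi> x \<noteq> 0}"


section \<open>Structural conditions\<close>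

definition condition_A :: "real^'m^'m \<Rightarrow> ('n::finite \<Rightarrow> real^'m^'m) \<Rightarrow> real^'m^'m \<Rightarrow> bool" where
  "condition_A A0 A L \<longleftrightarrow>
     transpose A0 = A0 \<and> (\<forall>j. transpose (A j) = A j) \<and>
     pos_on UNIV (cmat A0) \<and> nonneg_on UNIV (cmat L) \<and> Ker L \<noteq> {0}"

definition condition_K :: "real^'m^'m \<Rightarrow> ('n::finite \<Rightarrow> real^'m^'m) \<Rightarrow> real^'m^'m \<Rightarrow> bool" where
  "condition_K A0 A L \<longleftrightarrow>
     (\<exists>K :: real^'n \<Rightarrow> real^'m^'m. smooth_on_sphere K \<and>
        (\<forall>\<omega>\<in>sphere 0 1.
           K (- \<omega>) = - K \<omega> \<and>
           transpose (K \<omega> ** A0) = - (K \<omega> ** A0) \<and>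
           pos_on (Ker L) (cmat (sym_part (K \<omega> ** symbol A \<omega>)))))"

definition condition_S :: "real^'m^'m \<Rightarrow> real^'m^'m \<Rightarrow> real^'m^'m \<Rightarrow> bool" where
  "condition_S A0 L S \<longleftrightarrow>
     transpose (S ** A0) = S ** A0 \<and>
     nonneg_on UNIV (cmat (sym_part (S ** L) + sym_part L)) \<and>
     Ker (sym_part (S ** L) + sym_part L) = Ker L"

definition condition_S1 ::
    "('n::finite \<Rightarrow> real^'m^'m) \<Rightarrow> real^'m^'m \<Rightarrow> real^'m^'m \<Rightarrow> bool" where
  "condition_S1 A L S \<longleftrightarrow>
     (\<forall>\<omega>\<in>sphere 0 1. nonneg_on (Ker (sym_part L))
        (map_matrix (\<lambda>a. \<i> * complex_of_real a) (skew_part (S ** symbol A \<omega>))))"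


section \<open>Lebesgue and Sobolev spaces\<close>

text \<open>Exponents range over \<open>[1,\<infinity>]\<close>; note that \<^term>\<open>enn2real (inverse \<infinity>) = 0\<close>.\<close>

definition in_Lp :: "ennreal \<Rightarrow> (real^'n::finite \<Rightarrow> 'b::euclidean_space) \<Rightarrow> bool" where
  "in_Lp p f \<longleftrightarrow> f \<in> borel_measurable lebesgue \<and>
     (if p = \<infinity> then (\<exists>B. AE x in lebesgue. norm (f x) \<le> B)
      else integrable lebesgue (\<lambda>x. norm (f x) powr enn2real p))"

definition Lp_norm :: "ennreal \<Rightarrow> (real^'n::finite \<Rightarrow> 'b::euclidean_space) \<Rightarrow> real" where
  "Lp_norm p f =
     (if p = \<infinity> then enn2real (esssup lebesgue (\<lambda>x. ennreal (norm (f x))))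
      else (LINT x|lebesgue. norm (f x) powr enn2real p) powr (1 / enn2real p))"

definition locally_integrable :: "(real^'n::finite \<Rightarrow> 'b::euclidean_space) \<Rightarrow> bool" where
  "locally_integrable f \<longleftrightarrow> (\<forall>K. compact K \<longrightarrow> f absolutely_integrable_on K)"

definition has_weak_deriv ::
    "'n::finite list \<Rightarrow> (real^'n \<Rightarrow> 'b::euclidean_space) \<Rightarrow> (real^'n \<Rightarrow> 'b) \<Rightarrow> bool" where
  "has_weak_deriv js u v \<longleftrightarrow> locally_integrable u \<and> locally_integrable v \<and>
     (\<forall>\<phi>. test_function \<phi> \<longrightarrow>
        (LINT x|lebesgue. partial_derivs js \<phi> x *\<^sub>R u x)
          = (-1) ^ length js *\<^sub>R (LINT x|lebesgue. \<phi> x *\<^sub>R v x))"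

text \<open>Weak derivatives are unique up to null sets; this picks a representative if there is one.\<close>

definition weak_deriv ::
    "'n::finite list \<Rightarrow> (real^'n \<Rightarrow> 'b::euclidean_space) \<Rightarrow> real^'n \<Rightarrow> 'b" where
  "weak_deriv js u = (SOME v. has_weak_deriv js u v)"

definition derivs_in_Lp ::
    "nat \<Rightarrow> ennreal \<Rightarrow> (real^'n::finite \<Rightarrow> 'b::euclidean_space) \<Rightarrow> bool" where
  "derivs_in_Lp k p u \<longleftrightarrow> (\<forall>js. length js = k \<longrightarrow> (\<exists>v. has_weak_deriv js u v \<and> in_Lp p v))"

text \<open>
  The \<open>L\<^sup>p\<close> norm of the collection of all derivatives of order \<open>k\<close>, with the Euclidean norm of the
  collection at each point. It is meaningful only under \<^const>\<open>derivs_in_Lp\<close>.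
\<close>

definition derivs_Lp_norm ::
    "nat \<Rightarrow> ennreal \<Rightarrow> (real^'n::finite \<Rightarrow> 'b::euclidean_space) \<Rightarrow> real" where
  "derivs_Lp_norm k p u =
     Lp_norm p (\<lambda>x. L2_set (\<lambda>js. norm (weak_deriv js u x)) {js. length js = k})"

definition in_Sobolev ::
    "nat \<Rightarrow> ennreal \<Rightarrow> (real^'n::finite \<Rightarrow> 'b::euclidean_space) \<Rightarrow> bool" where
  "in_Sobolev l r u \<longleftrightarrow> in_Lp r u \<and> (\<forall>k\<le>l. derivs_in_Lp k r u)"


section \<open>The Cauchy problem\<close>

text \<open>
  Solutions in \<open>C([0,\<infinity>); L\<^sup>1\<^sub>l\<^sub>o\<^sub>c)\<close> of the system in the sense of distributions. No integrability at
  infinity and no differentiability is required: by finite speed of propagation, solutions are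
  unique in this class up to null sets for each \<open>t\<close>. For continuous functions of time with values
  in \<open>L\<^sup>1\<^sub>l\<^sub>o\<^sub>c\<close>, the distributional equation on \<open>(0,\<infinity>) \<times> \<real>\<^sup>n\<close> is equivalent to the
  differential equation below for the pairing with each test function in space.
\<close>

definition is_solution ::
    "real^'m^'m \<Rightarrow> ('n::finite \<Rightarrow> real^'m^'m) \<Rightarrow> real^'m^'m \<Rightarrow>
     (real^'n \<Rightarrow> real^'m) \<Rightarrow> (real \<Rightarrow> real^'n \<Rightarrow> real^'m) \<Rightarrow> bool" where
  "is_solution A0 A L w0 w \<longleftrightarrow>
     (\<forall>t\<ge>0. locally_integrable (w t)) \<and>
     (\<forall>K. compact K \<longrightarrow> (\<forall>t\<ge>0.
        ((\<lambda>s. LINT x:K|lebesgue. norm (w s x - w t x)) \<longlongrightarrow> 0) (at t within {0..}))) \<and>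
     (\<forall>\<phi>. test_function \<phi> \<longrightarrow> (\<forall>t>0.
        ((\<lambda>s. LINT x|lebesgue. \<phi> x *\<^sub>R (A0 *v w s x)) has_vector_derivative
           (LINT x|lebesgue. (\<Sum>j\<in>UNIV. partial_deriv j \<phi> x *\<^sub>R (A j *v w t x))
                              - \<phi> x *\<^sub>R (L *v w t x))) (at t))) \<and>
     (AE x in lebesgue. w 0 x = w0 x)"

definition gamma2 :: "'n::finite itself \<Rightarrow> ennreal \<Rightarrow> ennreal \<Rightarrow> real" where
  "gamma2 _ q p = real CARD('n) / 2 * (enn2real (inverse q) - enn2real (inverse p))"

end

theory Submission
 imports Defs "HOL-Probability.Characteristic_Functions"
begin

text \<open>In Fourier space the system is an ordinary differential equation for each frequency \<open>\<xi>\<close>. Besides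
the energy \<open>\<langle>A\<^sup>0 u, u\<rangle>\<close> it has the quadratic forms of \<open>S A\<^sup>0\<close> and \<open>i K(\<omega>) A\<^sup>0\<close>; with weights of the
orders \<open>1\<close>, \<open>1/(1 + |\<xi>|\<^sup>2)\<close> and \<open>|\<xi>|/(1 + |\<xi>|\<^sup>2)\<^sup>2\<close> they add up to a Lyapunov function that decays at the
rate \<open>|\<xi>|\<^sup>2/(1 + |\<xi>|\<^sup>2)\<^sup>2\<close>. At low frequencies this is heat-like decay; at high frequencies the rate is of
the order \<open>|\<xi>|\<^sup>-\<^sup>2\<close>, and decay in time is bought with \<open>\<ell>\<close> derivatives of the data. The Hausdorff--Young
inequality turns the pointwise bound into the estimate for smooth, compactly supported data. Finite
speed of propagation identifies a distributional solution locally, after mollification in space, with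
the Fourier solution for mollified and truncated data, and the estimate passes to the limit.\<close>

text \<open>The energy dissipates only through the symmetric part of \<open>L\<close>, whose kernel
  may exceed \<open>Ker L\<close>. Adding the form of \<open>S\<close> gives a dissipation with
  kernel exactly \<open>Ker L\<close>, on which \<open>K\<close> is coercive. The price is the form
  of \<open>i S A(\<omega>)\<close>: condition (S)_1, read at both \<omega> and -\<omega>, makes it
  vanish on the kernel of the symmetric part, so it is at most a multiple of |u| times the square
  root of the \<open>L\<close> dissipation. Absorbing it together with its factor |\<xi>| forces the
  decreasing weights, hence the loss of regularity.

  A distributional solution may be arbitrary at infinity, so its Fourier transform need not exist
  and only local comparison is available. Since p may be infinite, density arguments are confined to
  the data norms, whose exponents are finite; the estimate applied to differences of approximate
  data then gives the Cauchy property in L^p.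

  Exponents are carried as reciprocals, so that Hoelder's inequality adds them and infinity becomes
  0. Norm bounds are predicates with untracked constants, so crude sums can replace Minkowski's
  inequality.\<close>

abbreviation borel_functions ("\<B>") where "\<B> \<equiv> borel_measurable borel"

abbreviation L1 :: "('a::euclidean_space \<Rightarrow> 'b::{banach, second_countable_topology}) \<Rightarrow> bool" where
 "L1 \<equiv> integrable lborel"

abbreviation nn :: "('a::euclidean_space \<Rightarrow> ennreal) \<Rightarrow> ennreal" where
 "nn \<equiv> nn_integral lborel"

abbreviation nnint :: "('a::euclidean_space \<Rightarrow> real) \<Rightarrow> ennreal" where
 "nnint f \<equiv> nn (\<lambda>x. ennreal (f x))"

abbreviation ball_ind :: "real \<Rightarrow> 'a::euclidean_space \<Rightarrow> real" where
 "ball_ind R \<equiv> indicat_real (cball 0 R)"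

abbreviation cplx :: "real \<Rightarrow> complex" where "cplx \<equiv> complex_of_real"

abbreviation pd :: "'n::finite \<Rightarrow> (real^'n \<Rightarrow> 'b::real_normed_vector) \<Rightarrow> real^'n \<Rightarrow> 'b" where
 "pd \<equiv> partial_deriv"

abbreviation pds :: "'n::finite list \<Rightarrow> (real^'n \<Rightarrow> 'b::real_normed_vector) \<Rightarrow> real^'n \<Rightarrow> 'b" where
 "pds \<equiv> partial_derivs"

abbreviation rate :: "'a::real_normed_vector \<Rightarrow> real" where
 "rate \<xi> \<equiv> (norm \<xi>)^2 / (1 + (norm \<xi>)^2)^2"

lemmas int_bound = Bochner_Integration.integrable_bound

section \<open>Differentiation under the integral sign\<close>

text \<open>Dominated convergence for the remainder of the difference quotient along an arbitrary
  sequence. The bound on \<open>f'\<close> holds on a convex set, so the mean value inequality turns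
  it into a bound on the increments of \<open>f\<close>.\<close>

lemma has_derivative_lebesgue_integral:
 fixes f :: "'a::real_normed_vector \<Rightarrow> 'x \<Rightarrow> 'c::{banach, second_countable_topology}"
 assumes S: "open S" "convex S" "x0 \<in> S"
  and int: "\<And>x. x \<in> S \<Longrightarrow> integrable M (f x)"
  and der: "\<And>x y. x \<in> S \<Longrightarrow> ((\<lambda>x. f x y) has_derivative f' x y) (at x)"
  and bound: "\<And>x y h. x \<in> S \<Longrightarrow> norm (f' x y h) \<le> g y * norm h"
  and meas: "\<And>h. (\<lambda>y. f' x0 y h) \<in> borel_measurable M"
  and g: "integrable M g"
 shows "((\<lambda>x. \<integral>y. f x y \<partial>M) has_derivative (\<lambda>h. \<integral>y. f' x0 y h \<partial>M)) (at x0)"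
proof -
 have intf': "integrable M (\<lambda>y. f' x0 y h)" for h
 proof (rule int_bound[OF _ meas])
  show "integrable M (\<lambda>y. g y * norm h)" using g by simp
  have "norm (f' x0 y h) \<le> norm (g y * norm h)" for y
   using bound[OF S(3), of y h] by (metis abs_ge_self order_trans real_norm_def)
  then show "AE y in M. norm (f' x0 y h) \<le> norm (g y * norm h)" by simp
 qed
 have lin: "bounded_linear (f' x0 y)" for y using der[OF S(3), of y] by (rule has_derivative_bounded_linear)
 have bl: "bounded_linear (\<lambda>h. \<integral>y. f' x0 y h \<partial>M)"
 proof (rule bounded_linear_intro[where K = "\<integral>y. g y \<partial>M"])
  show "(\<integral>y. f' x0 y (h + h') \<partial>M) = (\<integral>y. f' x0 y h \<partial>M) + (\<integral>y. f' x0 y h' \<partial>M)" for h h'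
   using intf' lin by (simp add: linear_simps(1)[OF lin])
  show "(\<integral>y. f' x0 y (r *\<^sub>R h) \<partial>M) = r *\<^sub>R (\<integral>y. f' x0 y h \<partial>M)" for r h
   using intf' by (simp add: linear_simps(5)[OF lin])
  show "norm (\<integral>y. f' x0 y h \<partial>M) \<le> norm h * (\<integral>y. g y \<partial>M)" for h
  proof -
   have "norm (\<integral>y. f' x0 y h \<partial>M) \<le> (\<integral>y. norm (f' x0 y h) \<partial>M)" by simp
   also have "\<dots> \<le> (\<integral>y. g y * norm h \<partial>M)"
    using g bound[OF S(3)] by (intro integral_mono integrable_norm intf') auto
   finally show ?thesis by (simp add: mult.commute)
  qed
 qed
 have "((\<lambda>x. (1 / norm (x - x0)) *\<^sub>R ((\<integral>y. f x y \<partial>M) - ((\<integral>y. f x0 y \<partial>M) + (\<integral>y. f' x0 y (x - x0) \<partial>M))))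
   \<longlongrightarrow> 0) (at x0 within S)" unfolding tendsto_at_iff_sequentially
 proof (intro allI impI)
  fix X assume X: "\<forall>i. X i \<in> S - {x0}" "X \<longlonglongrightarrow> x0"
  define s where "s i y = (1 / norm (X i - x0)) *\<^sub>R (f (X i) y - (f x0 y + f' x0 y (X i - x0)))" for i y
  have "(\<lambda>i. \<integral>y. s i y \<partial>M) \<longlonglongrightarrow> (\<integral>y. 0 \<partial>M)"
  \<comment> \<open>One \<open>g\<close> comes from the increment of \<open>f\<close> by the mean
    value inequality, the other from the linear term.\<close>
  proof (rule integral_dominated_convergence[where w = "\<lambda>y. 2 * g y"])
   show "s i \<in> borel_measurable M" for i unfolding s_def using int[OF S(3)] int[of "X i"] X(1) meas by (auto simp: s_def)
   show "integrable M (\<lambda>y. 2 * g y)" using g by simp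
   have "(\<lambda>i. s i y) \<longlonglongrightarrow> 0" for y using der[OF S(3), of y, THEN has_derivative_at_withinI, of S] X
    unfolding has_derivative_within tendsto_at_iff_sequentially s_def comp_def by (auto simp: algebra_simps)
   then show "AE y in M. (\<lambda>i. s i y) \<longlonglongrightarrow> 0" by simp
   have "norm (s i y) \<le> 2 * g y" for i y
   proof -
    have n0: "norm (X i - x0) > 0" using X by auto
    have gy: "g y \<ge> 0" using bound[OF S(3), of y "X i - x0"] n0 by (smt (verit) norm_ge_zero zero_le_mult_iff)
    have "norm (f (X i) y - f x0 y) \<le> g y * norm (X i - x0)"
    proof (rule differentiable_bound[OF S(2)])
     show "((\<lambda>x. f x y) has_derivative f' x y) (at x within S)" if "x \<in> S" for x
      using der[OF that] by (rule has_derivative_at_withinI)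
     show "onorm (f' x y) \<le> g y" if "x \<in> S" for x using bound[OF that] gy by (intro onorm_bound)
    qed (use X S in auto)
    moreover have "norm (f' x0 y (X i - x0)) \<le> g y * norm (X i - x0)" using bound S by auto
    moreover have "norm (f (X i) y - (f x0 y + f' x0 y (X i - x0))) \<le> norm (f (X i) y - f x0 y) + norm (f' x0 y (X i - x0))"
     using norm_triangle_ineq4[of "f (X i) y - f x0 y" "f' x0 y (X i - x0)"] by (simp only: diff_diff_add)
    ultimately have "norm (f (X i) y - (f x0 y + f' x0 y (X i - x0))) \<le> 2 * g y * norm (X i - x0)" by linarith
    then show ?thesis unfolding s_def using n0 by (simp add: divide_simps mult_ac)
   qed
   then show "AE y in M. norm (s i y) \<le> 2 * g y" for i by simp
  qed auto
  moreover have "(\<integral>y. s i y \<partial>M) = (1 / norm (X i - x0)) *\<^sub>R ((\<integral>y. f (X i) y \<partial>M) - ((\<integral>y. f x0 y \<partial>M) + (\<integral>y. f' x0 y (X i - x0) \<partial>M)))" for i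
   unfolding s_def using int[OF S(3)] int[of "X i"] X(1) intf' by (auto simp: algebra_simps)
  ultimately show "((\<lambda>x. (1 / norm (x - x0)) *\<^sub>R ((\<integral>y. f x y \<partial>M) - ((\<integral>y. f x0 y \<partial>M) + (\<integral>y. f' x0 y (x - x0) \<partial>M)))) \<circ> X) \<longlonglongrightarrow> 0"
   by (simp add: comp_def)
 qed
 then have "((\<lambda>x. \<integral>y. f x y \<partial>M) has_derivative (\<lambda>h. \<integral>y. f' x0 y h \<partial>M)) (at x0 within S)"
  unfolding has_derivative_within using bl by auto
 then show ?thesis using S at_within_open by metis
qed

lemma has_vector_derivative_lebesgue_integral:
 fixes f :: "real \<Rightarrow> 'x \<Rightarrow> 'c::{banach, second_countable_topology}"
 assumes S: "t \<in> {a<..<b}"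
  and int: "\<And>s. s \<in> {a<..<b} \<Longrightarrow> integrable M (f s)"
  and der: "\<And>s y. s \<in> {a<..<b} \<Longrightarrow> ((\<lambda>s. f s y) has_vector_derivative f' s y) (at s)"
  and bound: "\<And>s y. s \<in> {a<..<b} \<Longrightarrow> norm (f' s y) \<le> g y"
  and meas: "f' t \<in> borel_measurable M"
  and g: "integrable M g"
 shows "((\<lambda>s. \<integral>y. f s y \<partial>M) has_vector_derivative (\<integral>y. f' t y \<partial>M)) (at t)"
proof -
 have "((\<lambda>s. \<integral>y. f s y \<partial>M) has_derivative (\<lambda>h. \<integral>y. h *\<^sub>R f' t y \<partial>M)) (at t)"
 proof (rule has_derivative_lebesgue_integral[where S = "{a<..<b}" and g = g and f' = "\<lambda>s y h. h *\<^sub>R f' s y"])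
  show "norm (h *\<^sub>R f' s y) \<le> g y * norm h" if "s \<in> {a<..<b}" for s y h
   using bound[OF that, of y] by (simp add: mult.commute mult_left_mono)
  show "((\<lambda>s. f s y) has_derivative (\<lambda>h. h *\<^sub>R f' s y)) (at s)" if "s \<in> {a<..<b}" for s y
   using der[OF that] unfolding has_vector_derivative_def .
 qed (use assms in auto)
 then show ?thesis unfolding has_vector_derivative_def by simp
qed


section \<open>Affine changes of variables and integrals of directional derivatives\<close>

lemma nn_integral_lborel_affine:
 fixes t :: "'a::euclidean_space"
 assumes [measurable]: "f \<in> \<B>" and c: "c \<noteq> 0"
 shows "nn (\<lambda>x. f x) = ennreal (\<bar>c\<bar> ^ DIM('a)) * nn (\<lambda>x. f (t + c *\<^sub>R x))"
 by (subst lborel_affine[OF c, of t])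
  (simp add: nn_integral_density nn_integral_distr nn_integral_cmult flip: ennreal_power)

lemma integrable_lborel_affine:
 fixes f :: "'a::euclidean_space \<Rightarrow> 'b::{banach, second_countable_topology}"
 assumes f: "L1 f" and c: "c \<noteq> 0"
 shows "L1 (\<lambda>x. f (t + c *\<^sub>R x))"
 using f f[THEN borel_measurable_integrable] c unfolding integrable_iff_bounded
 by (subst (asm) nn_integral_lborel_affine[where c=c and t=t]) (auto simp: ennreal_mult_less_top)

lemma integral_lborel_affine:
 fixes f :: "'a::euclidean_space \<Rightarrow> 'b::{banach, second_countable_topology}"
 assumes c: "c \<noteq> 0"
 shows "(\<integral>x. f x \<partial>lborel) = (\<bar>c\<bar> ^ DIM('a)) *\<^sub>R (\<integral>x. f (t + c *\<^sub>R x) \<partial>lborel)"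
proof cases
 assume f[measurable]: "L1 f" then show ?thesis
  using c f f[THEN borel_measurable_integrable] integrable_lborel_affine[OF f c, of t] by (subst lborel_affine[OF c, of t])
   (simp add: integral_density integral_distr)
next
 \<comment> \<open>Non-integrable functions have Bochner integral 0, so it is enough that the
   inverse substitution carries non-integrability over.\<close>
 assume nf: "\<not> L1 f"
 have "\<not> L1 (\<lambda>x. f (t + c *\<^sub>R x))"
 proof
  assume "L1 (\<lambda>x. f (t + c *\<^sub>R x))"
  from integrable_lborel_affine[OF this, of "1/c" "- (1/c) *\<^sub>R t"] have "L1 f" using c by (simp add: algebra_simps)
  with nf show False by simp
 qed
 with nf show ?thesis by (simp add: not_integrable_integral_eq)
qed

lemma integral_lborel_reflect:
 fixes f :: "'a::euclidean_space \<Rightarrow> 'b::{banach, second_countable_topology}"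
 shows "(\<integral>y. f (x - y) \<partial>lborel) = (\<integral>y. f y \<partial>lborel)"
 using integral_lborel_affine[of "-1" f x] by simp

lemma nn_integral_lborel_shift:
 fixes x :: "'a::euclidean_space"
 assumes "f \<in> \<B>"
 shows "nn (\<lambda>y. f (x + y)) = nn (\<lambda>y. f y)"
 using nn_integral_lborel_affine[of f "1" x] assms by simp

text \<open>The integral of \<open>f (x + s e)\<close> does not depend on \<open>s\<close>; differentiate at \<open>s = 0\<close>.\<close>

lemma integral_directional_derivative_eq_0:
 fixes f :: "'a::euclidean_space \<Rightarrow> 'b::{banach, second_countable_topology}"
 assumes der: "\<And>x. ((\<lambda>s. f (x + s *\<^sub>R e)) has_vector_derivative f' x) (at 0)"
  and bound: "\<And>x. norm (f' x) \<le> B"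
  and supp: "\<And>x. norm x > R \<Longrightarrow> f x = 0"
  and meas[measurable]: "f \<in> \<B>" "f' \<in> \<B>"
  and int: "L1 f"
 shows "(LBINT x. f' x) = 0"
proof -
 have der': "((\<lambda>s. f (x + s *\<^sub>R e)) has_vector_derivative f' (x + s *\<^sub>R e)) (at s)" for s x
 proof -
  have "((\<lambda>h. f ((x + s *\<^sub>R e) + h *\<^sub>R e)) has_vector_derivative f' (x + s *\<^sub>R e)) (at 0)" by (rule der)
  then have *: "((\<lambda>h. f ((x + s *\<^sub>R e) + h *\<^sub>R e)) has_vector_derivative f' (x + s *\<^sub>R e)) (at (s - s))"
   by simp
  have "((\<lambda>s'. s' - s) has_vector_derivative 1) (at s)"
   by (auto intro!: derivative_eq_intros simp: has_vector_derivative_def)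
  from vector_diff_chain_at[OF this *]
  have "((\<lambda>s'. f ((x + s *\<^sub>R e) + (s' - s) *\<^sub>R e)) has_vector_derivative 1 *\<^sub>R f' (x + s *\<^sub>R e)) (at s)"
   by (simp only: comp_def)
  then show ?thesis by (simp add: algebra_simps)
 qed
 have supp': "f' x = 0" if x: "norm x > R" for x
 proof -
  have "((\<lambda>s. f (x + s *\<^sub>R e)) has_vector_derivative 0) (at 0)"
  proof (rule has_vector_derivative_transform_within_open[of "\<lambda>s. 0"])
   have "continuous_on UNIV (\<lambda>s. norm (x + s *\<^sub>R e))" by (intro continuous_intros)
   then show "open {s. R < norm (x + s *\<^sub>R e)}" by (rule open_Collect_less[OF continuous_on_const])
  qed (use x supp in auto)
  then show ?thesis using der[of x] by (metis vector_derivative_at)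
 qed
 \<comment> \<open>For |s| < 1 the translated derivative is supported in the ball of radius
   \<open>R + norm e\<close>, where the constant \<open>B\<close> is an integrable majorant.\<close>
 have "((\<lambda>s. LBINT x. f (x + s *\<^sub>R e)) has_vector_derivative (LBINT x. f' (x + 0 *\<^sub>R e))) (at 0)"
 proof (rule has_vector_derivative_lebesgue_integral[where a = "-1" and b = 1 and f' = "\<lambda>s x. f' (x + s *\<^sub>R e)"
    and g = "\<lambda>x. indicator (cball 0 (R + norm e)) x * B"])
  show "L1 (\<lambda>x. f (x + s *\<^sub>R e))" for s
   using integrable_lborel_affine[OF int, of 1 "s *\<^sub>R e"] by (simp add: add.commute)
  show "norm (f' (x + s *\<^sub>R e)) \<le> indicator (cball 0 (R + norm e)) x * B" if "s \<in> {-1<..<1}" for s x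
  proof (cases "norm x \<le> R + norm e")
   case False
   have "norm x \<le> norm (x + s *\<^sub>R e) + norm (s *\<^sub>R e)" by (metis add_diff_cancel norm_triangle_ineq4)
   moreover have "norm (s *\<^sub>R e) \<le> norm e" using that by (auto intro: mult_left_le_one_le)
   ultimately have "norm (x + s *\<^sub>R e) > R" using False by simp
   then show ?thesis using supp' False by (auto simp: indicator_def)
  qed (use bound in auto)
  have "L1 (indicat_real (cball 0 (R + norm e) :: 'a set))"
   using emeasure_lborel_cball_finite by (intro integrable_real_indicator) auto
  then show "L1 (\<lambda>x::'a. ball_ind (R + norm e) x * B)" by simp
 qed (use der' in auto)
 moreover have "(LBINT x. f (x + s *\<^sub>R e)) = (LBINT x. f x)" for s
  using integral_lborel_affine[of 1 f "s *\<^sub>R e"] by (simp add: add.commute)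
 ultimately have "((\<lambda>s::real. LBINT x. f x) has_vector_derivative (LBINT x. f' x)) (at 0)" by simp
 then show ?thesis using has_vector_derivative_const vector_derivative_at by metis
qed

section \<open>Smooth functions\<close>

lemma partial_derivs_append: "pds (js @ js') f = pds js (pds js' f)"
 by (induction js) auto

lemma partial_deriv_eqI:
 "(f has_derivative f') (at x) \<Longrightarrow> pd j f x = f' (axis j 1)"
 unfolding partial_deriv_def by (metis frechet_derivative_at)

lemma has_derivative_partial_deriv:
 assumes "f differentiable (at x)"
 shows "(f has_derivative (\<lambda>h. \<Sum>j\<in>UNIV. (h $ j) *\<^sub>R pd j f x)) (at x)"
proof -
 have d: "(f has_derivative frechet_derivative f (at x)) (at x)" using assms frechet_derivative_works by blast
 then interpret bounded_linear "frechet_derivative f (at x)" by (rule has_derivative_bounded_linear)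
 have "frechet_derivative f (at x) h = (\<Sum>j\<in>UNIV. (h $ j) *\<^sub>R pd j f x)" for h
 proof -
  have "h = (\<Sum>j\<in>UNIV. (h $ j) *\<^sub>R axis j 1)" using basis_expansion[of h] by (simp add: scalar_mult_eq_scaleR)
  then have "frechet_derivative f (at x) h = frechet_derivative f (at x) (\<Sum>j\<in>UNIV. (h $ j) *\<^sub>R axis j 1)" by simp
  also have "\<dots> = (\<Sum>j\<in>UNIV. (h $ j) *\<^sub>R pd j f x)" by (simp add: sum scaleR partial_deriv_def)
  finally show ?thesis .
 qed
 then show ?thesis using d by presburger
qed

lemma axis_sum_scaleR [simp]:
 "(\<Sum>k\<in>UNIV. (axis j (1::real) $ k) *\<^sub>R v k) = (v j :: 'b::real_normed_vector)" for j :: "'n::finite"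
proof -
 have "(\<Sum>k\<in>UNIV. (axis j (1::real) $ k) *\<^sub>R v k) = (\<Sum>k\<in>UNIV. if k = j then v k else 0)"
  by (intro sum.cong) (auto simp: axis_def)
 then show ?thesis by simp
qed

lemma partial_deriv_add:
 assumes "f differentiable (at x)" "g differentiable (at x)"
 shows "pd j (\<lambda>x. f x + g x) x = pd j f x + pd j g x"
 using partial_deriv_eqI[OF has_derivative_add[OF assms[THEN has_derivative_partial_deriv]]] by simp

lemma partial_deriv_scaleR:
 assumes "f differentiable (at x)" "g differentiable (at x)"
 shows "pd j (\<lambda>x. f x *\<^sub>R g x) x = pd j f x *\<^sub>R g x + f x *\<^sub>R pd j g x"
 using partial_deriv_eqI[OF has_derivative_scaleR[OF assms[THEN has_derivative_partial_deriv]], of j]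
 by (simp add: axis_sum_scaleR[where 'b = real, simplified])

lemma partial_deriv_linear:
 assumes "bounded_linear T" "f differentiable (at x)"
 shows "pd j (\<lambda>x. T (f x)) x = T (pd j f x)"
 using partial_deriv_eqI[OF bounded_linear.has_derivative[OF assms(1) has_derivative_partial_deriv[OF assms(2)]], of j] by simp

lemma has_derivative_affine:
 assumes "f differentiable (at (a + c *\<^sub>R x))"
 shows "((\<lambda>x. f (a + c *\<^sub>R x)) has_derivative (\<lambda>h. \<Sum>j\<in>UNIV. (c * h $ j) *\<^sub>R pd j f (a + c *\<^sub>R x))) (at x)"
proof -
 have 1: "((\<lambda>x. a + c *\<^sub>R x) has_derivative (\<lambda>h. c *\<^sub>R h)) (at x)"
  by (auto intro!: derivative_eq_intros)
 show ?thesis using diff_chain_at[OF 1 has_derivative_partial_deriv[OF assms]] by (simp add: comp_def)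
qed

lemma partial_deriv_affine:
 assumes "f differentiable (at (a + c *\<^sub>R x))"
 shows "pd j (\<lambda>x. f (a + c *\<^sub>R x)) x = c *\<^sub>R pd j f (a + c *\<^sub>R x)"
 using partial_deriv_eqI[OF has_derivative_affine[OF assms], of j]
 by (simp add: axis_def if_distrib if_distribR sum.delta cong: if_cong)

text \<open>Smoothness truncated at order \<open>N\<close>: closure under sums, products and
  substitutions is proved by induction on \<open>N\<close>, for which quantification over all lists
  of directions offers no handle.\<close>

definition smooth_upto :: "nat \<Rightarrow> (real^'n::finite \<Rightarrow> 'b::real_normed_vector) \<Rightarrow> bool" where
 "smooth_upto N f \<longleftrightarrow> (\<forall>js x. length js \<le> N \<longrightarrow> pds js f differentiable (at x))"

lemma smooth_on_UNIV_upto: "smooth_on UNIV f \<longleftrightarrow> (\<forall>N. smooth_upto N f)"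
 unfolding smooth_on_def smooth_upto_def by auto

lemma smooth_upto_0 [simp]: "smooth_upto 0 f \<longleftrightarrow> (\<forall>x. f differentiable (at x))"
 unfolding smooth_upto_def by auto

text \<open>\<open>partial_derivs\<close> adds the outermost derivative at the head of the list,
  while this recursion removes the innermost one; hence the case split from the rear end of the
  list.\<close>

lemma smooth_upto_Suc:
 "smooth_upto (Suc N) f \<longleftrightarrow> (\<forall>x. f differentiable (at x)) \<and> (\<forall>j. smooth_upto N (pd j f))"
proof (intro iffI conjI allI)
 assume s: "smooth_upto (Suc N) f"
 show "f differentiable (at x)" for x using s unfolding smooth_upto_def by (metis length_0_conv list.size(3) partial_derivs.simps(1) zero_le)
 show "smooth_upto N (pd j f)" for j unfolding smooth_upto_def
 proof (intro allI impI)
  fix js x assume "length (js::'a list) \<le> N"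
  then have "pds (js @ [j]) f differentiable (at x)" using s unfolding smooth_upto_def by simp
  then show "pds js (pd j f) differentiable (at x)" by (simp add: partial_derivs_append)
 qed
next
 assume s: "(\<forall>x. f differentiable (at x)) \<and> (\<forall>j. smooth_upto N (pd j f))"
 show "smooth_upto (Suc N) f" unfolding smooth_upto_def
 proof (intro allI impI)
  fix js x assume l: "length (js::'a list) \<le> Suc N"
  show "pds js f differentiable (at x)"
  proof (cases js rule: rev_cases)
   case (snoc ks j)
   then have "pds ks (pd j f) differentiable (at x)" using s l unfolding smooth_upto_def by auto
   then show ?thesis using snoc by (simp add: partial_derivs_append)
  qed (use s in auto)
 qed
qed

lemma smooth_upto_differentiable: "smooth_upto N f \<Longrightarrow> f differentiable (at x)"
 by (cases N) (auto simp: smooth_upto_Suc)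

lemma smooth_upto_Suc_D: "smooth_upto (Suc N) f \<Longrightarrow> smooth_upto N f"
 unfolding smooth_upto_def by auto

lemma smooth_differentiable: "smooth_on UNIV f \<Longrightarrow> f differentiable (at x)"
 by (auto simp: smooth_on_UNIV_upto intro: smooth_upto_differentiable)

lemma smooth_partial_derivs: "smooth_on UNIV f \<Longrightarrow> smooth_on UNIV (pds js f)"
 unfolding smooth_on_def by (metis partial_derivs_append)

lemma smooth_partial_deriv: "smooth_on UNIV f \<Longrightarrow> smooth_on UNIV (pd j f)"
 using smooth_partial_derivs[of f "[j]"] by simp

lemma smooth_upto_add: "smooth_upto N f \<Longrightarrow> smooth_upto N g \<Longrightarrow> smooth_upto N (\<lambda>x. f x + g x)"
proof (induction N arbitrary: f g)
 case (Suc N)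
 then have "pd j (\<lambda>x. f x + g x) = (\<lambda>x. pd j f x + pd j g x)" for j
  by (intro ext partial_deriv_add) (auto simp: smooth_upto_Suc)
 then show ?case using Suc by (auto simp: smooth_upto_Suc)
qed auto

lemma smooth_upto_scaleR: "smooth_upto N f \<Longrightarrow> smooth_upto N g \<Longrightarrow> smooth_upto N (\<lambda>x. f x *\<^sub>R g x)"
proof (induction N arbitrary: f g)
 case (Suc N)
 then have "pd j (\<lambda>x. f x *\<^sub>R g x) = (\<lambda>x. pd j f x *\<^sub>R g x + f x *\<^sub>R pd j g x)" for j
  by (intro ext partial_deriv_scaleR) (auto simp: smooth_upto_Suc)
 moreover have "smooth_upto N f" "smooth_upto N g" using Suc.prems smooth_upto_Suc_D by blast+
 moreover have "(\<lambda>x. f x *\<^sub>R g x) differentiable (at x)" for x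
  using Suc.prems by (intro differentiable_scaleR) (auto simp: smooth_upto_Suc)
 ultimately show ?case using Suc unfolding smooth_upto_Suc by (simp add: smooth_upto_add)
qed (auto intro: differentiable_scaleR)

lemma smooth_upto_const: "smooth_upto N (\<lambda>x::real^'n::finite. c)"
proof (induction N arbitrary: c)
 case (Suc N)
 have "pd j (\<lambda>x::real^'n. c) = (\<lambda>x. 0)" for j by (auto intro!: ext partial_deriv_eqI)
 then show ?case using Suc unfolding smooth_upto_Suc by simp
qed auto

lemma smooth_upto_linear:
 assumes T: "bounded_linear T" shows "smooth_upto N f \<Longrightarrow> smooth_upto N (\<lambda>x. T (f x))"
proof (induction N arbitrary: f)
 case 0
 then show ?case unfolding smooth_upto_0
  by (intro allI differentiableI[OF bounded_linear.has_derivative[OF T has_derivative_partial_deriv]]) simp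
next
 case (Suc N)
 have "pd j (\<lambda>x. T (f x)) = (\<lambda>x. T (pd j f x))" for j
  using Suc.prems by (intro ext partial_deriv_linear T) (auto simp: smooth_upto_Suc)
 moreover have "(\<lambda>x. T (f x)) differentiable (at x)" for x
  by (intro differentiableI[OF bounded_linear.has_derivative[OF T has_derivative_partial_deriv]]
    smooth_upto_differentiable[OF Suc.prems])
 ultimately show ?case using Suc unfolding smooth_upto_Suc by simp
qed

lemma smooth_upto_affine: "smooth_upto N f \<Longrightarrow> smooth_upto N (\<lambda>x. f (a + c *\<^sub>R x))"
proof (induction N arbitrary: f)
 case 0
 then show ?case unfolding smooth_upto_0 by (intro allI differentiableI[OF has_derivative_affine]) simp
next
 case (Suc N)
 have "pd j (\<lambda>x. f (a + c *\<^sub>R x)) = (\<lambda>x. c *\<^sub>R pd j f (a + c *\<^sub>R x))" for j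
  using Suc.prems by (intro ext partial_deriv_affine) (auto simp: smooth_upto_Suc)
 moreover have "(\<lambda>x. f (a + c *\<^sub>R x)) differentiable (at x)" for x
  by (intro differentiableI[OF has_derivative_affine] smooth_upto_differentiable[OF Suc.prems])
 ultimately show ?case using Suc unfolding smooth_upto_Suc by (simp add: smooth_upto_linear[OF bounded_linear_scaleR_right])
qed

lemma smooth_scaleR: "smooth_on UNIV f \<Longrightarrow> smooth_on UNIV g \<Longrightarrow> smooth_on UNIV (\<lambda>x. f x *\<^sub>R g x)"
 by (simp add: smooth_on_UNIV_upto smooth_upto_scaleR)

lemma smooth_affine: "smooth_on UNIV f \<Longrightarrow> smooth_on UNIV (\<lambda>x. f (a + c *\<^sub>R x))"
 by (simp add: smooth_on_UNIV_upto smooth_upto_affine)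

lemma smooth_linear: "bounded_linear T \<Longrightarrow> smooth_on UNIV f \<Longrightarrow> smooth_on UNIV (\<lambda>x. T (f x))"
 by (simp add: smooth_on_UNIV_upto smooth_upto_linear)

lemma partial_derivs_affine:
 assumes "smooth_on UNIV f"
 shows "pds js (\<lambda>x. f (a + c *\<^sub>R x)) = (\<lambda>x. c ^ length js *\<^sub>R pds js f (a + c *\<^sub>R x))"
proof (induction js)
 case (Cons j js)
 have d: "pds js f differentiable (at y)" for y using assms smooth_partial_derivs smooth_differentiable by blast
 have "pd j (\<lambda>x. c ^ length js *\<^sub>R pds js f (a + c *\<^sub>R x)) x =
   c ^ length js *\<^sub>R c *\<^sub>R pd j (pds js f) (a + c *\<^sub>R x)" for x
  using partial_deriv_linear[OF bounded_linear_scaleR_right, of "\<lambda>x. pds js f (a + c *\<^sub>R x)"]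
   partial_deriv_affine[OF d] differentiableI[OF has_derivative_affine[OF d]] by simp
 then show ?case using Cons.IH by (auto simp: mult.commute)
qed simp

lemma partial_derivs_linear:
 assumes "bounded_linear T" "smooth_on UNIV f"
 shows "pds js (\<lambda>x. T (f x)) = (\<lambda>x. T (pds js f x))"
proof (induction js)
 case (Cons j js)
 have "pd j (\<lambda>x. T (pds js f x)) = (\<lambda>x. T (pd j (pds js f) x))"
  by (intro ext partial_deriv_linear assms smooth_differentiable smooth_partial_derivs)
 then show ?case using Cons.IH by simp
qed simp

text \<open>All ways to distribute the directions of a list over two factors, repetitions included.
  Indexing the Leibniz rule in this way avoids binomial coefficients.\<close>

fun splits :: "'a list \<Rightarrow> ('a list \<times> 'a list) list" where
 "splits [] = [([], [])]"
| "splits (j # js) = map (\<lambda>(a, b). (j # a, b)) (splits js) @ map (\<lambda>(a, b). (a, j # b)) (splits js)"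

lemma splits_length: "(a, b) \<in> set (splits js) \<Longrightarrow> length a + length b = length js"
 by (induction js arbitrary: a b) auto

lemma partial_deriv_sum_list:
 "(\<And>i. i \<in> set I \<Longrightarrow> f i differentiable (at x)) \<Longrightarrow>
  pd j (\<lambda>x. \<Sum>i\<leftarrow>I. f i x) x = (\<Sum>i\<leftarrow>I. pd j (f i) x) \<and>
  (\<lambda>x. \<Sum>i\<leftarrow>I. f i x) differentiable (at x)"
proof (induction I)
 case Nil then show ?case using partial_deriv_eqI[OF has_derivative_const[of 0]] by simp
next
 case (Cons i I) then show ?case using partial_deriv_add[of "f i" x "\<lambda>x. \<Sum>i\<leftarrow>I. f i x" j] by simp
qed

lemma partial_derivs_scaleR:
 assumes "smooth_on UNIV f" "smooth_on UNIV g"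
 shows "pds js (\<lambda>x. f x *\<^sub>R g x) =
  (\<lambda>x. \<Sum>s\<leftarrow>splits js. pds (fst s) f x *\<^sub>R pds (snd s) g x)"
proof (induction js)
 case (Cons j js)
 have d: "pds a f differentiable (at x)" "pds a g differentiable (at x)" for a x
  using assms smooth_partial_derivs smooth_differentiable by blast+
 have "pd j (\<lambda>x. \<Sum>s\<leftarrow>splits js. pds (fst s) f x *\<^sub>R pds (snd s) g x) x =
  (\<Sum>s\<leftarrow>splits (j # js). pds (fst s) f x *\<^sub>R pds (snd s) g x)" for x
  using partial_deriv_sum_list[of "splits js" "\<lambda>s x. pds (fst s) f x *\<^sub>R pds (snd s) g x" x j] d
  by (auto simp: case_prod_beta partial_deriv_scaleR differentiable_scaleR comp_def sum_list_addf)
 then show ?case using Cons.IH by auto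
qed simp

section \<open>Compact support and local integrability\<close>

text \<open>Test functions with values in any normed space: the approximate data are vector-valued
  and their Fourier components complex-valued.\<close>

definition smooth_csupp :: "(real^'n::finite \<Rightarrow> 'b::real_normed_vector) \<Rightarrow> bool" where
 "smooth_csupp f \<longleftrightarrow> smooth_on UNIV f \<and> (\<exists>R. \<forall>x. norm x > R \<longrightarrow> f x = 0)"

lemma test_function_iff: "test_function \<phi> \<longleftrightarrow> smooth_csupp \<phi>"
proof -
 have "bounded {x. \<phi> x \<noteq> 0} \<longleftrightarrow> (\<exists>R. \<forall>x. norm x > R \<longrightarrow> \<phi> x = 0)"
  unfolding bounded_iff using not_le by blast
 then show ?thesis unfolding test_function_def smooth_csupp_def by simp
qed

lemma partial_derivs_vanish:
 assumes "\<And>x. norm x > R \<Longrightarrow> f x = 0"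
 shows "norm x > R \<Longrightarrow> pds js f x = 0"
proof (induction js arbitrary: x)
 case (Cons j js)
 have "((\<lambda>x. 0) has_derivative (\<lambda>h. 0)) (at x)" by simp
 then have "(pds js f has_derivative (\<lambda>h. 0)) (at x)"
 proof (rule has_derivative_transform_within_open)
  have "continuous_on UNIV (\<lambda>x::real^'a. norm x)" by (intro continuous_intros)
  then show "open {x::real^'a. R < norm x}" by (rule open_Collect_less[OF continuous_on_const])
 qed (use Cons in auto)
 then show ?case by (auto dest: partial_deriv_eqI)
qed (use assms in auto)

lemma smooth_csupp_partial_derivs: "smooth_csupp f \<Longrightarrow> smooth_csupp (pds js f)"
 unfolding smooth_csupp_def using smooth_partial_derivs partial_derivs_vanish by metis

lemma smooth_csupp_partial_deriv: "smooth_csupp f \<Longrightarrow> smooth_csupp (pd j f)"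
 using smooth_csupp_partial_derivs[of f "[j]"] by simp

lemma smooth_continuous: "smooth_on UNIV f \<Longrightarrow> continuous_on A f"
 by (meson continuous_at_imp_continuous_on differentiable_imp_continuous_within smooth_differentiable)

lemma smooth_borel_measurable: "smooth_on UNIV f \<Longrightarrow> f \<in> \<B>"
 by (intro borel_measurable_continuous_onI smooth_continuous)

lemma smooth_csupp_bounded:
 assumes "smooth_csupp f" obtains B where "B > 0" "\<And>x. norm (f x) \<le> B"
proof -
 obtain R where R: "\<And>x. norm x > R \<Longrightarrow> f x = 0" using assms unfolding smooth_csupp_def by blast
 have "compact (f ` cball 0 R)" using assms unfolding smooth_csupp_def by (intro compact_continuous_image smooth_continuous) auto
 then obtain B where B: "\<And>y. y \<in> f ` cball 0 R \<Longrightarrow> norm y \<le> B"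
  using compact_imp_bounded[of "f ` cball 0 R"] by (auto simp: bounded_iff)
 have "norm (f x) \<le> max B 1" for x
 proof (cases "norm x \<le> R")
  case True then show ?thesis using B[of "f x"] by force
 next
  case False then show ?thesis using R[of x] by simp
 qed
 then show ?thesis using that[of "max B 1"] by auto
qed

text \<open>Local integrability for Borel functions, tested on balls about the origin. Borel
  representatives are used throughout because the Fubini arguments take place over
  \<open>lborel\<close>.\<close>

definition locint :: "('a::euclidean_space \<Rightarrow> 'b::{banach, second_countable_topology}) \<Rightarrow> bool" where
 "locint f \<longleftrightarrow> f \<in> \<B> \<and> (\<forall>R. L1 (\<lambda>y. ball_ind R y *\<^sub>R f y))"

lemma locint_measurable: "locint f \<Longrightarrow> f \<in> \<B>"
 by (simp add: locint_def)

lemma integrable_csupp_mult: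
 fixes \<phi> :: "'a::euclidean_space \<Rightarrow> real"
 assumes f: "locint f" and \<phi>: "\<phi> \<in> \<B>" "\<And>x. \<bar>\<phi> x\<bar> \<le> B" "\<And>x. norm x > R \<Longrightarrow> \<phi> x = 0"
 shows "L1 (\<lambda>y. \<phi> y *\<^sub>R f y)"
proof (rule int_bound)
 show "L1 (\<lambda>y. B *\<^sub>R (ball_ind R y *\<^sub>R f y))"
  using f unfolding locint_def by (intro integrable_scaleR_right) auto
 have "0 \<le> B" using \<phi>(2)[of 0] by linarith
 then show "AE x in lborel. norm (\<phi> x *\<^sub>R f x) \<le> norm (B *\<^sub>R (ball_ind R x *\<^sub>R f x))"
  using \<phi>(2,3) by (auto simp: indicator_def intro!: mult_right_mono)
qed (use f \<phi> in \<open>auto simp: locint_def intro: borel_measurable_scaleR\<close>)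

lemma locint_const: "locint (\<lambda>x::'a::euclidean_space. c::'b::{banach, second_countable_topology})"
proof -
 have "L1 (indicat_real (cball 0 R :: 'a set))" for R using emeasure_lborel_cball_finite by (intro integrable_real_indicator) auto
 then show ?thesis unfolding locint_def by auto
qed

lemma smooth_csupp_integrable:
 fixes f :: "real^'n::finite \<Rightarrow> 'b::{banach, second_countable_topology}"
 assumes "smooth_csupp f" shows "L1 f"
proof -
 obtain R where R: "\<And>x. norm x > R \<Longrightarrow> f x = 0" using assms unfolding smooth_csupp_def by blast
 obtain B where "B > 0" and B: "\<And>x. norm (f x) \<le> B" by (rule smooth_csupp_bounded[OF assms]) auto
 have "L1 (\<lambda>x::real^'n. ball_ind R x *\<^sub>R B)"
  using locint_const[where c = B and 'a = "real^'n"] unfolding locint_def by (elim conjE allE)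
 then show ?thesis
 proof (rule int_bound)
  show "AE x in lborel. norm (f x) \<le> norm (ball_ind R x *\<^sub>R B)"
   using R order_trans[OF B abs_ge_self] by (auto simp: indicator_def not_le)
 qed (use assms smooth_borel_measurable in \<open>auto simp: smooth_csupp_def\<close>)
qed

section \<open>Bump functions and mollification\<close>

text \<open>exp(-1/s) / s^k extended by 0. The index \<open>k\<close> closes the family under
  differentiation, so that smoothness at all orders follows by one induction.\<close>

definition bumpfun :: "nat \<Rightarrow> real \<Rightarrow> real" where
 "bumpfun k s = (if s > 0 then exp (- (1 / s)) / s ^ k else 0)"

lemma power_div_fact_le_exp:
 fixes x :: real
 assumes "0 \<le> x" shows "x ^ n / fact n \<le> exp x"
proof -
 have s: "(\<lambda>n. x ^ n /\<^sub>R fact n) sums exp x" by (rule exp_converges)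
 have "(\<Sum>i\<in>{n}. x ^ i /\<^sub>R fact i) \<le> (\<Sum>i. x ^ i /\<^sub>R fact i)"
  using assms s by (intro sum_le_suminf) (auto simp: sums_iff)
 then show ?thesis using s by (simp add: sums_iff divide_inverse mult.commute)
qed

text \<open>A quadratic bound gives differentiability at 0 with derivative 0. It results from
  keeping the single term of order k + 2 in the series of exp(1/s).\<close>

lemma bumpfun_bound: "\<bar>bumpfun k s\<bar> \<le> fact (k + 2) * s^2"
proof (cases "s > 0")
 case True
 have "(1 / s) ^ (k + 2) / fact (k + 2) \<le> exp (1 / s)" using True by (intro power_div_fact_le_exp) simp
 then have "inverse (exp (1 / s)) \<le> inverse ((1 / s) ^ (k + 2) / fact (k + 2))" using True by (intro le_imp_inverse_le) auto
 then have "exp (- (1 / s)) \<le> fact (k + 2) * s ^ (k + 2)"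
  by (simp only: exp_minus) (simp only: power_divide inverse_divide, simp)
 then have "exp (- (1 / s)) / s ^ k \<le> fact (k + 2) * s ^ (k + 2) / s ^ k" using True by (intro divide_right_mono) auto
 also have "\<dots> = fact (k + 2) * s^2" using True by (simp only: power_add) simp
 finally show ?thesis using True by (simp add: bumpfun_def)
qed (simp add: bumpfun_def)

lemma DERIV_bumpfun:
 "(bumpfun k has_real_derivative (bumpfun (k + 2) s - k * bumpfun (k + 1) s)) (at s)"
proof -
 consider "s > 0" | "s < 0" | "s = 0" by linarith
 then show ?thesis
 proof cases
  case 1
  have "((\<lambda>s. exp (- (1 / s)) / s ^ k) has_real_derivative (bumpfun (k + 2) s - k * bumpfun (k + 1) s)) (at s)"
   using 1 by (auto intro!: derivative_eq_intros simp: bumpfun_def)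
    (cases k; auto simp: field_simps power2_eq_square)
  then show ?thesis
   by (rule has_field_derivative_transform_within_open[of _ _ _ "{0<..}"]) (use 1 in \<open>auto simp: bumpfun_def\<close>)
 next
  case 2
  have "((\<lambda>s. 0) has_real_derivative (bumpfun (k + 2) s - k * bumpfun (k + 1) s)) (at s)"
   using 2 by (auto simp: bumpfun_def)
  then show ?thesis
   by (rule has_field_derivative_transform_within_open[of _ _ _ "{..<0}"]) (use 2 in \<open>auto simp: bumpfun_def\<close>)
 next
  case 3
  have "((\<lambda>h. bumpfun k h / h) \<longlongrightarrow> 0) (at 0)"
  proof (rule Lim_null_comparison[where g = "\<lambda>h. fact (k + 2) * \<bar>h\<bar>"])
   show "\<forall>\<^sub>F h in at 0. norm (bumpfun k h / h) \<le> fact (k + 2) * \<bar>h\<bar>" unfolding eventually_at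
   proof (intro exI[of _ 1] conjI ballI impI)
    fix h :: real
    show "norm (bumpfun k h / h) \<le> fact (k + 2) * \<bar>h\<bar>"
    proof -
     have "\<bar>bumpfun k h\<bar> / \<bar>h\<bar> \<le> fact (k + 2) * h^2 / \<bar>h\<bar>"
      by (intro divide_right_mono bumpfun_bound) simp
     also have "\<dots> = fact (k + 2) * (\<bar>h\<bar> * \<bar>h\<bar> / \<bar>h\<bar>)"
      by (simp only: power2_eq_square abs_mult_self_eq times_divide_eq_right)
     also have "\<bar>h\<bar> * \<bar>h\<bar> / \<bar>h\<bar> = \<bar>h\<bar>" by (simp del: abs_mult_self_eq)
     finally show ?thesis by (simp only: real_norm_def abs_divide)
    qed
   qed simp
   show "((\<lambda>h::real. fact (k + 2) * \<bar>h\<bar>) \<longlongrightarrow> 0) (at 0)" by (rule tendsto_eq_intros | simp)+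
  qed
  then show ?thesis using 3 by (simp add: has_field_derivative_iff bumpfun_def)
 qed
qed

lemma smooth_upto_bumpfun:
 fixes q :: "real^'n::finite \<Rightarrow> real"
 assumes q: "smooth_on UNIV q"
 shows "smooth_upto N (\<lambda>x. bumpfun k (q x))"
proof -
 have der: "((\<lambda>x. bumpfun k (q x)) has_derivative
   (\<lambda>h. (\<Sum>j\<in>UNIV. (h $ j) *\<^sub>R pd j q x) * (bumpfun (k + 2) (q x) - real k * bumpfun (k + 1) (q x)))) (at x)" for k :: nat and x :: "real^'n"
  using has_derivative_compose[OF has_derivative_partial_deriv[OF smooth_differentiable[OF q]]
    DERIV_bumpfun[unfolded has_field_derivative_def]] by (simp add: mult.commute)
 show ?thesis
 proof (induction N arbitrary: k)
  case 0 then show ?case unfolding smooth_upto_0 by (intro allI differentiableI[OF der])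
 next
  case (Suc N)
  have "pd j (\<lambda>x. bumpfun k (q x)) =
    (\<lambda>x. pd j q x *\<^sub>R (bumpfun (k + 2) (q x) + (- real k) *\<^sub>R bumpfun (k + 1) (q x)))" for j
  proof
   fix x
   show "pd j (\<lambda>x. bumpfun k (q x)) x =
    pd j q x *\<^sub>R (bumpfun (k + 2) (q x) + (- real k) *\<^sub>R bumpfun (k + 1) (q x))"
    using partial_deriv_eqI[OF der, of j k x] axis_sum_scaleR[of j "\<lambda>j. pd j q x"] by simp
  qed
  moreover have "smooth_upto N (pd j q)" for j using smooth_partial_deriv[OF q] by (simp add: smooth_on_UNIV_upto)
  ultimately show ?case unfolding smooth_upto_Suc
   using Suc.IH by (simp only:) (intro conjI allI differentiableI[OF der] smooth_upto_scaleR smooth_upto_add smooth_upto_linear[OF bounded_linear_scaleR_right])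
 qed
qed

lemma smooth_quadratic: "smooth_on UNIV (\<lambda>x::real^'n::finite. 1 - x \<bullet> x)"
 unfolding smooth_on_UNIV_upto
proof
 fix N
 have der: "((\<lambda>x::real^'n. 1 - x \<bullet> x) has_derivative (\<lambda>h. - 2 * (x \<bullet> h))) (at x)" for x
  by (auto intro!: derivative_eq_intros simp: inner_commute)
 have lin: "bounded_linear (\<lambda>x::real^'n. - 2 * (x \<bullet> axis j 1))" for j
  by (intro bounded_linear_const_mult bounded_linear_inner_left)
 have "smooth_upto N (\<lambda>x::real^'n. T x)" if "bounded_linear T" for T :: "real^'n \<Rightarrow> real" and N
 proof (cases N)
  case 0 then show ?thesis using that by (simp add: bounded_linear_imp_differentiable)
 next
  case (Suc M)
  have "pd j T = (\<lambda>x. T (axis j 1))" for j :: 'n by (intro ext partial_deriv_eqI bounded_linear_imp_has_derivative that)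
  then show ?thesis using Suc that by (simp add: smooth_upto_Suc bounded_linear_imp_differentiable smooth_upto_const)
 qed
 moreover have "pd j (\<lambda>x::real^'n. 1 - x \<bullet> x) = (\<lambda>x. - 2 * (x \<bullet> axis j 1))" for j
  by (intro ext partial_deriv_eqI der)
 ultimately show "smooth_upto N (\<lambda>x::real^'n. 1 - x \<bullet> x)"
  using der lin differentiableI by (cases N) (auto simp: smooth_upto_Suc)
qed

lemma mollifier_exists:
 obtains r :: "real^'n::finite \<Rightarrow> real"
 where "smooth_csupp r" "\<And>x. r x \<ge> 0" "\<And>x. norm x > 1 \<Longrightarrow> r x = 0" "(LBINT x. r x) = 1"
proof -
 define b where "b = (\<lambda>x::real^'n. bumpfun 0 (1 - x \<bullet> x))"
 have v: "b x = 0" if "norm x > 1" for x using that by (simp add: b_def bumpfun_def dot_square_norm abs_square_less_1)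
 have sm: "smooth_csupp b" unfolding smooth_csupp_def using v smooth_upto_bumpfun[OF smooth_quadratic]
  by (auto simp: smooth_on_UNIV_upto b_def)
 have nn: "b x \<ge> 0" for x by (simp add: b_def bumpfun_def)
 have int: "L1 b" using sm by (rule smooth_csupp_integrable)
 have "(LBINT x. b x) \<noteq> 0"
 proof
  assume "(LBINT x. b x) = 0"
  then have "AE x in lborel. b x = 0" using integral_nonneg_eq_0_iff_AE[OF int] nn by simp
  moreover have "b x > 0" if "x \<in> ball 0 1" for x
   using that by (simp add: b_def bumpfun_def dot_square_norm power_less_one_iff)
  ultimately have "AE x in lborel. x \<notin> ball (0::real^'n) 1" by (auto elim!: eventually_mono) force
  then have "emeasure lborel (ball (0::real^'n) 1) = 0" by (subst (asm) AE_iff_measurable[where N = "ball 0 1"]) auto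
  then show False using content_ball_pos[of 1 "0::real^'n"] by (simp add: measure_def)
 qed
 moreover have "(LBINT x. b x) \<ge> 0" using nn by simp
 ultimately have pos: "(LBINT x. b x) > 0" by simp
 define c where "c = 1 / (LBINT x. b x)"
 show ?thesis
 proof (rule that[of "\<lambda>x. c *\<^sub>R b x"])
  show "smooth_csupp (\<lambda>x. c *\<^sub>R b x)"
   using sm smooth_linear[OF bounded_linear_scaleR_right, of b c] v unfolding smooth_csupp_def by auto
 qed (use pos nn v in \<open>auto simp: c_def\<close>)
qed

definition conv :: "(real^'n::finite \<Rightarrow> real) \<Rightarrow> (real^'n \<Rightarrow> 'b::{banach, second_countable_topology}) \<Rightarrow> real^'n \<Rightarrow> 'b" where
 "conv r f x = (LBINT y. r (x - y) *\<^sub>R f y)"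

lemma conv_integrable:
 assumes r: "smooth_csupp r" and f: "locint f"
 shows "L1 (\<lambda>y. r (x - y) *\<^sub>R f y)"
proof -
 obtain R where R: "\<And>x. norm x > R \<Longrightarrow> r x = 0" using r unfolding smooth_csupp_def by blast
 obtain B where "B > 0" and B: "\<And>x. norm (r x) \<le> B" by (rule smooth_csupp_bounded[OF r]) auto
 have [measurable]: "r \<in> \<B>" using r smooth_borel_measurable unfolding smooth_csupp_def by blast
 show ?thesis
 proof (rule integrable_csupp_mult[OF f, of _ B "norm x + R"])
  show "r (x - y) = 0" if "norm y > norm x + R" for y
   using that norm_triangle_ineq2[of y x] by (intro R) (simp add: norm_minus_commute)
 qed (use B in auto)
qed

lemma conv_has_derivative:
 assumes r: "smooth_csupp r" and f: "locint f"
 shows "(conv r f has_derivative (\<lambda>h. \<Sum>j\<in>UNIV. (h $ j) *\<^sub>R conv (pd j r) f x)) (at x)"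
proof -
 obtain R where R: "\<And>x. norm x > R \<Longrightarrow> r x = 0" using r unfolding smooth_csupp_def by blast
 have R': "pd j r x = 0" if "norm x > R" for j x using partial_derivs_vanish[of R r x "[j]"] R that by simp
 have "\<exists>B. \<forall>x. norm (pd j r x) \<le> B" for j
  using smooth_csupp_bounded[OF smooth_csupp_partial_deriv[OF r]] by metis
 then obtain B where B: "\<And>j x. norm (pd j r x) \<le> B j" by metis
 define D where "D x h = (\<Sum>j\<in>UNIV. (h $ j) *\<^sub>R pd j r x)" for x h
 have D: "(r has_derivative D x) (at x)" for x
  unfolding D_def using r by (intro has_derivative_partial_deriv smooth_differentiable) (simp add: smooth_csupp_def)
 have Dmeas: "(\<lambda>x. D x h) \<in> \<B>" for h unfolding D_def using smooth_csupp_partial_deriv[OF r] smooth_borel_measurable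
  by (intro borel_measurable_sum borel_measurable_scaleR) (auto simp: smooth_csupp_def)
 have [measurable]: "f \<in> \<B>" using f by (rule locint_measurable)
 have Dbound: "norm (D z h) \<le> (\<Sum>j\<in>UNIV. B j) * norm h" for z h unfolding D_def sum_distrib_right
 proof (rule order_trans[OF norm_sum sum_mono])
  show "norm ((h $ j) *\<^sub>R pd j r z) \<le> B j * norm h" for j
   using mult_mono[OF B[of j z] component_le_norm_cart[of h j]] order_trans[OF norm_ge_zero B[of j z]]
   by (simp add: mult.commute abs_mult)
 qed
 \<comment> \<open>For \<open>z\<close> within distance 1 of \<open>x\<close> the integrand lives in
   |y| \<le> |x| + 1 + R, so local integrability of \<open>f\<close> supplies a majorant that does
   not depend on \<open>z\<close>.\<close>
 have "((\<lambda>x. LBINT y. r (x - y) *\<^sub>R f y) has_derivative (\<lambda>h. LBINT y. D (x - y) h *\<^sub>R f y)) (at x)"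
 proof (rule has_derivative_lebesgue_integral[where S = "ball x 1" and f' = "\<lambda>x y h. D (x - y) h *\<^sub>R f y"
    and g = "\<lambda>y. (\<Sum>j\<in>UNIV. B j) * norm (ball_ind (norm x + 1 + R) y *\<^sub>R f y)"])
  show "L1 (\<lambda>y. r (z - y) *\<^sub>R f y)" for z by (rule conv_integrable[OF r f])
  show "((\<lambda>z. r (z - y) *\<^sub>R f y) has_derivative (\<lambda>h. D (z - y) h *\<^sub>R f y)) (at z)" for z y
  proof -
   have "((\<lambda>z. r (z - y)) has_derivative (\<lambda>h. D (z - y) h)) (at z)"
    by (rule has_derivative_compose[of "\<lambda>z. z - y" "\<lambda>h. h" z UNIV r, OF _ D])
     (auto intro!: derivative_eq_intros)
   then show ?thesis by (rule has_derivative_scaleR_left)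
  qed
  show "norm (D (z - y) h *\<^sub>R f y) \<le> (\<Sum>j\<in>UNIV. B j) * norm (ball_ind (norm x + 1 + R) y *\<^sub>R f y) * norm h"
   if z: "z \<in> ball x 1" for z y h
  proof (cases "norm y \<le> norm x + 1 + R")
   case False
   have "norm (z - x) < 1" using z by (simp add: dist_norm norm_minus_commute)
   then have "norm (z - y) > R"
    using False norm_triangle_ineq2[of y z] norm_triangle_ineq2[of z x] by (simp add: norm_minus_commute)
   then show ?thesis using False R' by (simp add: D_def)
  next
   case True
   then show ?thesis using mult_right_mono[OF Dbound[of "z - y" h] norm_ge_zero[of "f y"]] by (simp add: mult_ac)
  qed
  show "(\<lambda>y. D (x - y) h *\<^sub>R f y) \<in> borel_measurable lborel" for h
   using measurable_compose[OF _ Dmeas[of h], of "\<lambda>y. x - y" lborel] by auto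
  show "L1 (\<lambda>y. (\<Sum>j\<in>UNIV. B j) * norm (ball_ind (norm x + 1 + R) y *\<^sub>R f y))"
   using f unfolding locint_def by (intro integrable_mult_right integrable_norm) auto
 qed auto
 moreover have "(LBINT y. D (x - y) h *\<^sub>R f y) = (\<Sum>j\<in>UNIV. (h $ j) *\<^sub>R conv (pd j r) f x)" for h
  unfolding D_def conv_def scaleR_sum_left using conv_integrable[OF smooth_csupp_partial_deriv[OF r] f]
  by (subst Bochner_Integration.integral_sum) (auto simp flip: scaleR_scaleR)
 ultimately show ?thesis unfolding conv_def[abs_def] by simp
qed

lemma partial_deriv_conv:
 assumes "smooth_csupp r" "locint f"
 shows "pd j (conv r f) = conv (pd j r) f"
 using partial_deriv_eqI[OF conv_has_derivative[OF assms], of j] by (auto intro!: ext)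

lemma partial_derivs_conv:
 assumes "smooth_csupp r" "locint f"
 shows "pds js (conv r f) = conv (pds js r) f"
 by (induction js) (use assms in \<open>simp_all add: partial_deriv_conv smooth_csupp_partial_derivs\<close>)

lemma smooth_conv:
 assumes "smooth_csupp r" "locint f"
 shows "smooth_on UNIV (conv r f)"
 unfolding smooth_on_def partial_derivs_conv[OF assms]
 using conv_has_derivative[OF smooth_csupp_partial_derivs[OF assms(1)] assms(2)] differentiableI by blast

section \<open>Lebesgue norm bounds\<close>

text \<open>\<open>Lb a B f\<close> says that the \<open>L\<^sup>p\<close> norm of \<open>f\<close> is at most \<open>B\<close>, where \<open>a = 1/p\<close>; in particular
 \<open>a = 0\<close> is the case \<open>p = \<infinity>\<close>.\<close>

definition Lb :: "real \<Rightarrow> real \<Rightarrow> ('a::euclidean_space \<Rightarrow> 'b::euclidean_space) \<Rightarrow> bool" where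
 "Lb a B f \<longleftrightarrow> f \<in> \<B> \<and> 0 \<le> B \<and>
  (if a = 0 then AE x in lborel. norm (f x) \<le> B
   else (nnint (\<lambda>x. norm (f x) powr (1 / a))) \<le> ennreal (B powr (1 / a)))"

lemma Lb_measurable: "Lb a B f \<Longrightarrow> f \<in> \<B>"
 and Lb_nonneg: "Lb a B f \<Longrightarrow> 0 \<le> B"
 by (auto simp: Lb_def)

lemma Lb_mono:
 assumes f: "Lb a B f" and g[measurable]: "g \<in> \<B>"
  and le: "AE x in lborel. norm (g x) \<le> norm (f x)" and "B \<le> C" "0 \<le> a"
 shows "Lb a C g"
proof (cases "a = 0")
 case True
 have "AE x in lborel. norm (f x) \<le> B" using f True by (simp add: Lb_def)
 with le have "AE x in lborel. norm (g x) \<le> C" by eventually_elim (use \<open>B \<le> C\<close> in linarith)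
 then show ?thesis using True f \<open>B \<le> C\<close> g by (simp add: Lb_def)
next
 case False
 have "nnint (\<lambda>x. norm (g x) powr (1 / a)) \<le> nnint (\<lambda>x. norm (f x) powr (1 / a))"
  by (intro nn_integral_mono_AE, use le in eventually_elim)
   (use \<open>0 \<le> a\<close> in \<open>auto intro!: ennreal_leI powr_mono2\<close>)
 also have "\<dots> \<le> ennreal (B powr (1 / a))" using f False by (simp add: Lb_def)
 also have "\<dots> \<le> ennreal (C powr (1 / a))" using f assms by (intro ennreal_leI powr_mono2) (auto simp: Lb_def)
 finally show ?thesis using False f \<open>B \<le> C\<close> g by (simp add: Lb_def)
qed

lemma Lb_weaken: "Lb a B f \<Longrightarrow> B \<le> C \<Longrightarrow> 0 \<le> a \<Longrightarrow> Lb a C f"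
 by (rule Lb_mono) (auto simp: Lb_measurable)

lemma Lb_cong_norm:
 "Lb a B f \<Longrightarrow> g \<in> \<B> \<Longrightarrow> (\<And>x. norm (g x) \<le> norm (f x)) \<Longrightarrow> 0 \<le> a \<Longrightarrow> Lb a B g"
 by (rule Lb_mono) auto

lemma Lb_scaleR:
 assumes "Lb a B f" "0 \<le> a" shows "Lb a (\<bar>c\<bar> * B) (\<lambda>x. c *\<^sub>R f x)"
proof (cases "a = 0")
 case True
 have "AE x in lborel. norm (f x) \<le> B" using assms True by (simp add: Lb_def)
 then have "AE x in lborel. norm (c *\<^sub>R f x) \<le> \<bar>c\<bar> * B" by eventually_elim (simp add: mult_left_mono)
 moreover have "(\<lambda>x. c *\<^sub>R f x) \<in> \<B>" using Lb_measurable[OF assms(1)] by simp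
 ultimately show ?thesis using True assms(1) by (simp add: Lb_def)
next
 case False
 have [measurable]: "f \<in> \<B>" using assms by (simp add: Lb_def)
 have "nnint (\<lambda>x. norm (c *\<^sub>R f x) powr (1 / a))
   = nn (\<lambda>x. ennreal (\<bar>c\<bar> powr (1 / a)) * ennreal (norm (f x) powr (1 / a)))"
  by (simp add: powr_mult flip: ennreal_mult)
 also have "\<dots> = ennreal (\<bar>c\<bar> powr (1 / a)) * nnint (\<lambda>x. norm (f x) powr (1 / a))"
  by (rule nn_integral_cmult) auto
 also have "\<dots> \<le> ennreal (\<bar>c\<bar> powr (1 / a)) * ennreal (B powr (1 / a))"
  using assms False by (intro mult_left_mono) (auto simp: Lb_def)
 also have "\<dots> = ennreal ((\<bar>c\<bar> * B) powr (1 / a))" using assms by (simp add: powr_mult Lb_def flip: ennreal_mult)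
 finally show ?thesis using False assms by (simp add: Lb_def)
qed

lemma powr_sum_le:
 fixes u :: "'i \<Rightarrow> real"
 assumes "finite J" "\<And>j. j \<in> J \<Longrightarrow> 0 \<le> u j" "1 \<le> p"
 shows "(\<Sum>j\<in>J. u j) powr p \<le> real (card J) powr p * (\<Sum>j\<in>J. u j powr p)"
proof (cases "J = {}")
 case False
 define m where "m = Max (u ` J)"
 have m: "m \<in> u ` J" "\<And>j. j \<in> J \<Longrightarrow> u j \<le> m" unfolding m_def using assms False by auto
 then obtain j where j: "j \<in> J" "m = u j" by auto
 have m0: "0 \<le> m" using j assms by auto
 have "(\<Sum>j\<in>J. u j) \<le> real (card J) * m" using m(2) by (rule sum_bounded_above)
 then have "(\<Sum>j\<in>J. u j) powr p \<le> (real (card J) * m) powr p"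
  using assms by (intro powr_mono2) (auto intro: sum_nonneg)
 also have "\<dots> = real (card J) powr p * u j powr p" using m0 j by (simp add: powr_mult)
 also have "\<dots> \<le> real (card J) powr p * (\<Sum>j\<in>J. u j powr p)"
  using j assms by (intro mult_left_mono member_le_sum) auto
 finally show ?thesis .
qed simp

text \<open>Minkowski's inequality up to a constant. With N terms, (\<Sum> u)^p \<le> N^p \<Sum>
  u^p; summing the N integrals gives one more factor N \<le> N^p, so N^2 serves for every exponent,
  infinity included.\<close>

lemma Lb_sum:
 assumes "finite J" "0 \<le> a" "a \<le> 1" "0 \<le> B" "\<And>j. j \<in> J \<Longrightarrow> Lb a B (f j)"
 shows "Lb a (real (card J) ^ 2 * B) (\<lambda>x. \<Sum>j\<in>J. f j x)"
proof -
 have meas[measurable]: "(\<lambda>x. \<Sum>j\<in>J. f j x) \<in> \<B>"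
  using assms by (intro borel_measurable_sum) (auto simp: Lb_def)
 have fm[measurable]: "f j \<in> \<B>" if "j \<in> J" for j using assms that by (auto simp: Lb_def)
 define N where "N = real (card J)"
 have N: "J \<noteq> {} \<Longrightarrow> 1 \<le> N" using assms by (simp add: N_def Suc_le_eq card_gt_0_iff)
 show ?thesis
 proof (cases "a = 0")
  case True
  have "AE x in lborel. \<forall>j\<in>J. norm (f j x) \<le> B" using assms True by (intro AE_finite_allI) (auto simp: Lb_def)
  then have "AE x in lborel. norm (\<Sum>j\<in>J. f j x) \<le> N ^ 2 * B"
  proof eventually_elim
   case (elim x)
   then have "norm (\<Sum>j\<in>J. f j x) \<le> N * B" unfolding N_def by (intro order_trans[OF norm_sum] sum_bounded_above) auto
   also have "\<dots> \<le> N ^ 2 * B"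
   proof (cases "J = {}")
    case False
    then have "N * 1 \<le> N * N" using N by (intro mult_left_mono) auto
    then show ?thesis using assms by (simp add: power2_eq_square mult_right_mono)
   qed (simp add: N_def)
   finally show ?case .
  qed
  then show ?thesis using True assms by (simp add: Lb_def N_def)
 next
  case False
  define p where "p = 1 / a"
  have p: "1 \<le> p" using False assms by (simp add: p_def)
  have "nnint (\<lambda>x. norm (\<Sum>j\<in>J. f j x) powr p)
   \<le> nn (\<lambda>x. ennreal (N powr p) * (\<Sum>j\<in>J. ennreal (norm (f j x) powr p)))"
  proof (rule nn_integral_mono)
   fix x
   have "norm (\<Sum>j\<in>J. f j x) powr p \<le> (\<Sum>j\<in>J. norm (f j x)) powr p"
    using p by (intro powr_mono2 norm_sum) auto
   also have "\<dots> \<le> N powr p * (\<Sum>j\<in>J. norm (f j x) powr p)"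
    unfolding N_def using assms p by (intro powr_sum_le) auto
   finally show "ennreal (norm (\<Sum>j\<in>J. f j x) powr p) \<le> ennreal (N powr p) * (\<Sum>j\<in>J. ennreal (norm (f j x) powr p))"
    by (simp add: sum_ennreal sum_nonneg ennreal_leI flip: ennreal_mult)
  qed
  also have "\<dots> = ennreal (N powr p) * (\<Sum>j\<in>J. \<integral>\<^sup>+x. ennreal (norm (f j x) powr p) \<partial>lborel)"
   by (subst nn_integral_cmult, measurable, subst nn_integral_sum) auto
  also have "\<dots> \<le> ennreal (N powr p) * (\<Sum>j\<in>J. ennreal (B powr p))"
   using assms False by (intro mult_left_mono sum_mono) (auto simp: Lb_def p_def)
  also have "\<dots> = ennreal (N powr p * (N * B powr p))" by (simp add: N_def ennreal_mult ennreal_of_nat_eq_real_of_nat)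
  also have "\<dots> \<le> ennreal ((N ^ 2 * B) powr p)"
  proof (rule ennreal_leI)
   have "N \<le> N powr p" using N p powr_mono[of 1 p N] by (cases "J = {}") (auto simp: N_def)
   then have "N powr p * (N * B powr p) \<le> N powr p * (N powr p * B powr p)" by (intro mult_left_mono mult_right_mono) auto
   also have "\<dots> = (N ^ 2 * B) powr p" using assms by (simp add: power2_eq_square powr_mult N_def mult_ac)
   finally show "N powr p * (N * B powr p) \<le> (N ^ 2 * B) powr p" .
  qed
  finally show ?thesis using False assms meas by (simp add: Lb_def N_def p_def)
 qed
qed

lemma Lb_add:
 assumes "0 \<le> a" "a \<le> 1" "Lb a B f" "Lb a C g"
 shows "Lb a (4 * (B + C)) (\<lambda>x. f x + g x)"
proof -
 have "Lb a (real (card (UNIV::bool set)) ^ 2 * (B + C)) (\<lambda>x. \<Sum>b\<in>UNIV. if b then f x else g x)"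
 proof (rule Lb_sum)
  show "Lb a (B + C) (\<lambda>x. if b then f x else g x)" for b using assms Lb_nonneg[OF assms(3)] Lb_nonneg[OF assms(4)]
   by (cases b) (auto intro: Lb_weaken)
 qed (use assms Lb_nonneg in \<open>auto intro: add_nonneg_nonneg\<close>)
 then show ?thesis by (simp add: UNIV_bool add.commute)
qed

text \<open>After normalisation by \<open>B\<close> and \<open>C\<close>, Young's inequality with
  weights a/s and b/s, s = a + b, bounds the product by a convex combination of two functions of
  integral at most 1. A vanishing reciprocal means an essentially bounded factor and is treated
  apart.\<close>

lemma Lb_holder:
 assumes f: "Lb a B f" and g: "Lb b C g" and ab: "0 \<le> a" "0 \<le> b" and BC: "0 < B" "0 < C"
  and h[measurable]: "h \<in> \<B>" and le: "\<And>x. norm (h x) \<le> norm (f x) * norm (g x)"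
 shows "Lb (a + b) (B * C) h"
proof -
 have [measurable]: "f \<in> \<B>" "g \<in> \<B>" using f g by (auto simp: Lb_def)
 consider "a = 0" | "b = 0" | "a > 0" "b > 0" using ab by linarith
 then show ?thesis
 proof cases
  case 1
  have "AE x in lborel. norm (f x) \<le> B" using f 1 by (simp add: Lb_def)
  then have "AE x in lborel. norm (h x) \<le> norm (B *\<^sub>R g x)"
  proof eventually_elim
   case (elim x)
   then show ?case using le[of x] mult_right_mono[OF elim norm_ge_zero[of "g x"]] BC by simp
  qed
  moreover have "Lb b (\<bar>B\<bar> * C) (\<lambda>x. B *\<^sub>R g x)" using g ab(2) by (rule Lb_scaleR)
  ultimately show ?thesis using 1 BC ab by (auto intro: Lb_mono)
 next
  case 2
  have "AE x in lborel. norm (g x) \<le> C" using g 2 by (simp add: Lb_def)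
  then have "AE x in lborel. norm (h x) \<le> norm (C *\<^sub>R f x)"
  proof eventually_elim
   case (elim x)
   then show ?case using le[of x] mult_left_mono[OF elim norm_ge_zero[of "f x"]] BC by (simp add: mult.commute)
  qed
  moreover have "Lb a (\<bar>C\<bar> * B) (\<lambda>x. C *\<^sub>R f x)" using f ab(1) by (rule Lb_scaleR)
  ultimately show ?thesis using 2 BC ab by (auto intro: Lb_mono simp: mult.commute)
 next
  case 3
  define s where "s = a + b"
  have s: "s > 0" "a / s + b / s = 1" using 3 by (auto simp: s_def add_divide_distrib[symmetric])
  define u where "u x = (norm (f x) / B) powr (1 / a)" for x
  define v where "v x = (norm (g x) / C) powr (1 / b)" for x
  have [measurable]: "u \<in> \<B>" "v \<in> \<B>" unfolding u_def v_def by measurable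
  have u1: "nnint (\<lambda>x. u x) \<le> 1"
  proof -
   have "nnint (\<lambda>x. u x) = nn (\<lambda>x. ennreal (1 / B powr (1 / a)) * ennreal (norm (f x) powr (1 / a)))"
    using BC by (intro nn_integral_cong) (simp add: u_def powr_divide flip: ennreal_mult)
   also have "\<dots> = ennreal (1 / B powr (1 / a)) * nnint (\<lambda>x. norm (f x) powr (1 / a))"
    by (rule nn_integral_cmult) auto
   also have "\<dots> \<le> ennreal (1 / B powr (1 / a)) * ennreal (B powr (1 / a))"
    using f 3 by (intro mult_left_mono) (auto simp: Lb_def)
   also have "\<dots> = 1" using BC by (simp flip: ennreal_mult)
   finally show ?thesis .
  qed
  have v1: "nnint (\<lambda>x. v x) \<le> 1"
  proof -
   have "nnint (\<lambda>x. v x) = nn (\<lambda>x. ennreal (1 / C powr (1 / b)) * ennreal (norm (g x) powr (1 / b)))"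
    using BC by (intro nn_integral_cong) (simp add: v_def powr_divide flip: ennreal_mult)
   also have "\<dots> = ennreal (1 / C powr (1 / b)) * nnint (\<lambda>x. norm (g x) powr (1 / b))"
    by (rule nn_integral_cmult) auto
   also have "\<dots> \<le> ennreal (1 / C powr (1 / b)) * ennreal (C powr (1 / b))"
    using g 3 by (intro mult_left_mono) (auto simp: Lb_def)
   also have "\<dots> = 1" using BC by (simp flip: ennreal_mult)
   finally show ?thesis .
  qed
  have key: "norm (h x) powr (1 / s) \<le> (B * C) powr (1 / s) * (a / s * u x + b / s * v x)" for x
  proof (cases "f x = 0 \<or> g x = 0")
   case True
   then have "norm (h x) = 0" using le[of x] by auto
   then show ?thesis using 3 s by (simp add: u_def v_def)
  next
   case False
   have "norm (h x) powr (1 / s) \<le> (norm (f x) * norm (g x)) powr (1 / s)" using s le by (intro powr_mono2) auto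
   also have "\<dots> = (B * C) powr (1 / s) * ((norm (f x) / B) powr (1 / s) * (norm (g x) / C) powr (1 / s))"
    using BC by (simp add: powr_mult powr_divide)
   also have "(norm (f x) / B) powr (1 / s) = u x powr (a / s)" using 3 by (simp add: u_def powr_powr)
   also have "(norm (g x) / C) powr (1 / s) = v x powr (b / s)" using 3 by (simp add: v_def powr_powr)
   also have "u x powr (a / s) * v x powr (b / s) \<le> a / s * u x + b / s * v x"
    using False 3 s BC by (intro Youngs_inequality_0) (auto simp: u_def v_def)
   finally show ?thesis by (simp add: mult_left_mono)
  qed
  have "nnint (\<lambda>x. norm (h x) powr (1 / s))
   \<le> nn (\<lambda>x. ennreal ((B * C) powr (1 / s)) * (ennreal (a / s) * ennreal (u x) + ennreal (b / s) * ennreal (v x)))"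
  proof (rule nn_integral_mono)
   fix x
   have "0 \<le> u x" "0 \<le> v x" by (auto simp: u_def v_def)
   then show "ennreal (norm (h x) powr (1 / s)) \<le> ennreal ((B * C) powr (1 / s)) * (ennreal (a / s) * ennreal (u x) + ennreal (b / s) * ennreal (v x))"
    using key[of x] 3 s by (simp flip: ennreal_mult ennreal_plus)
  qed
  also have "\<dots> = ennreal ((B * C) powr (1 / s)) * (ennreal (a / s) * nnint (\<lambda>x. u x) + ennreal (b / s) * nnint (\<lambda>x. v x))"
   by (simp add: nn_integral_cmult nn_integral_add)
  also have "\<dots> \<le> ennreal ((B * C) powr (1 / s)) * (ennreal (a / s) * 1 + ennreal (b / s) * 1)"
   by (intro mult_left_mono add_mono u1 v1) auto
  also have "\<dots> = ennreal ((B * C) powr (1 / s))" using 3 s by (simp flip: ennreal_plus)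
  finally show ?thesis using BC s 3 by (simp add: Lb_def s_def)
 qed
qed

lemma Lb_affine:
 fixes f :: "'a::euclidean_space \<Rightarrow> 'b::euclidean_space"
 assumes f: "Lb a B f" and c: "\<bar>c\<bar> = 1"
 shows "Lb a B (\<lambda>x. f (h + c *\<^sub>R x))"
proof -
 have [measurable]: "f \<in> \<B>" using f by (simp add: Lb_def)
 have c0: "c \<noteq> 0" using c by auto
 have int: "nn (\<lambda>x. g (h + c *\<^sub>R x)) = nn (\<lambda>x. g x)" if "g \<in> \<B>" for g :: "'a \<Rightarrow> ennreal"
  using nn_integral_lborel_affine[OF that c0, of h] c by simp
 show ?thesis
 proof (cases "a = 0")
  case True
  have "AE x in lborel. norm (f x) \<le> B" using f True by (simp add: Lb_def)
  then have "AE x in density (distr lborel borel (\<lambda>x. h + c *\<^sub>R x)) (\<lambda>_. \<bar>c\<bar>^DIM('a)). norm (f x) \<le> B"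
   by (simp only: lborel_affine[OF c0, of h, symmetric])
  then have "AE x in lborel. norm (f (h + c *\<^sub>R x)) \<le> B" using c by (simp add: AE_density AE_distr_iff)
  then show ?thesis using True f by (simp add: Lb_def)
 next
  case False
  then show ?thesis using f int[of "\<lambda>x. ennreal (norm (f x) powr (1 / a))"] by (simp add: Lb_def)
 qed
qed

text \<open>Lower semicontinuity of the norm under almost everywhere convergence; it covers the
  essential supremum as well, which integrals of powers do not reach.\<close>

lemma Lb_Fatou:
 fixes f :: "nat \<Rightarrow> 'a::euclidean_space \<Rightarrow> 'b::euclidean_space"
 assumes f: "\<And>i. Lb a B (f i)" and g[measurable]: "g \<in> \<B>"
  and lim: "AE x in lborel. (\<lambda>i. f i x) \<longlonglongrightarrow> g x" and a: "0 \<le> a"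
 shows "Lb a B g"
proof (cases "a = 0")
 case True
 have "AE x in lborel. \<forall>i. norm (f i x) \<le> B" unfolding AE_all_countable using f True by (simp add: Lb_def)
 with lim have "AE x in lborel. norm (g x) \<le> B"
 proof eventually_elim
  case (elim x)
  then show ?case by (intro tendsto_le[OF _ tendsto_const tendsto_norm[OF elim(1)]]) auto
 qed
 then show ?thesis using True f[of 0] by (simp add: Lb_def)
next
 case False
 have [measurable]: "f i \<in> \<B>" for i using f by (simp add: Lb_def)
 have "nnint (\<lambda>x. norm (g x) powr (1 / a)) = nn (\<lambda>x. liminf (\<lambda>i. ennreal (norm (f i x) powr (1 / a))))"
 proof (rule nn_integral_cong_AE, use lim in eventually_elim)
  case (elim x)
  have "(\<lambda>i. ennreal (norm (f i x) powr (1 / a))) \<longlonglongrightarrow> ennreal (norm (g x) powr (1 / a))"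
   using False a elim by (intro tendsto_ennrealI tendsto_powr2 tendsto_norm tendsto_const) auto
  from lim_imp_Liminf[OF _ this] show ?case by simp
 qed
 also have "\<dots> \<le> liminf (\<lambda>i. \<integral>\<^sup>+x. ennreal (norm (f i x) powr (1 / a)) \<partial>lborel)"
  by (rule nn_integral_liminf) auto
 also have "\<dots> \<le> ennreal (B powr (1 / a))" using f False by (intro Liminf_le) (auto simp: Lb_def)
 finally show ?thesis using False f[of 0] by (simp add: Lb_def)
qed

text \<open>On a ball |f| \<le> 1 + |f|^(1/a), because 1/a \<ge> 1; this pointwise bound takes the
  place of Hoelder's inequality.\<close>

lemma Lb_locint:
 assumes f: "Lb a B f" and a: "0 \<le> a" "a \<le> 1"
 shows "locint f"
 unfolding locint_def
proof (intro conjI allI)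
 show fm: "f \<in> \<B>" using f by (rule Lb_measurable)
 note fm[measurable]
 fix R :: real
 have [measurable]: "cball (0::'a) R \<in> sets borel" by simp
 have ic: "L1 (\<lambda>y::'a. ball_ind R y *\<^sub>R c)" for c :: real
  using locint_const[where c = c and 'a = 'a] unfolding locint_def by (elim conjE allE)
 show "L1 (\<lambda>y. ball_ind R y *\<^sub>R f y)"
 proof (cases "a = 0")
  case True
  have "AE x in lborel. norm (f x) \<le> B" using f True by (simp add: Lb_def)
  then show ?thesis by (intro int_bound[OF ic[of B]]) (auto simp: indicator_def elim!: eventually_mono)
 next
  case False
  have "L1 (\<lambda>x. norm (f x) powr (1 / a))"
  proof (rule integrableI_bounded)
   show "nnint (\<lambda>x. norm (norm (f x) powr (1 / a))) < \<infinity>"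
    using f False unfolding Lb_def by (auto intro: le_less_trans)
  qed measurable
  then have "L1 (\<lambda>x. ball_ind R x *\<^sub>R 1 + norm (f x) powr (1 / a))"
   using ic[of 1] by (intro Bochner_Integration.integrable_add)
  then show ?thesis
  proof (rule int_bound)
   have "norm (ball_ind R x *\<^sub>R f x) \<le> norm (ball_ind R x *\<^sub>R 1 + norm (f x) powr (1 / a))" for x
   proof (cases "norm (f x) \<le> 1")
    case True then show ?thesis by (auto simp: indicator_def intro: order_trans)
   next
    case False': False
    then have "norm (f x) powr 1 \<le> norm (f x) powr (1 / a)" using a False by (intro powr_mono) auto
    then have "norm (f x) \<le> norm (f x) powr (1 / a)" using False' by simp
    then show ?thesis by (auto simp: indicator_def)
   qed
   then show "AE x in lborel. norm (ball_ind R x *\<^sub>R f x) \<le> norm (ball_ind R x *\<^sub>R 1 + norm (f x) powr (1 / a))"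
    by simp
  qed simp
 qed
qed

text \<open>Riesz--Fischer along a rapidly converging subsequence; the dominating function \<open>G\<close> is
 built from the sum of the \<open>p\<close>-th powers \<open>(2\<^sup>j d\<^sub>j)\<^sup>p\<close>, which avoids Minkowski's inequality.\<close>

lemma Lb_complete:
 fixes h :: "nat \<Rightarrow> 'a::euclidean_space \<Rightarrow> 'b::euclidean_space"
 assumes a: "0 \<le> a" "a \<le> 1"
  and cauchy: "\<And>\<epsilon>. \<epsilon> > 0 \<Longrightarrow> \<exists>N. \<forall>i\<ge>N. \<forall>j\<ge>N. Lb a \<epsilon> (\<lambda>x. h i x - h j x)"
  and bdd: "\<And>j. Lb a M (h j)"
 obtains g \<sigma> where "strict_mono \<sigma>" "g \<in> \<B>" "AE x in lborel. (\<lambda>j. h (\<sigma> j) x) \<longlonglongrightarrow> g x"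
  "\<And>\<psi> R C. \<psi> \<in> \<B> \<Longrightarrow> (\<And>x. \<bar>\<psi> x\<bar> \<le> C) \<Longrightarrow> (\<And>x. norm x > R \<Longrightarrow> \<psi> x = 0) \<Longrightarrow>
   (\<lambda>j. LBINT x. \<psi> x *\<^sub>R h (\<sigma> j) x) \<longlonglongrightarrow> (LBINT x. \<psi> x *\<^sub>R g x)"
proof -
 have hm[measurable]: "h j \<in> \<B>" for j using bdd by (rule Lb_measurable)
 obtain N where N: "\<And>k i j. i \<ge> N k \<Longrightarrow> j \<ge> N k \<Longrightarrow> Lb a ((1/4) ^ k) (\<lambda>x. h i x - h j x)"
 proof -
  have "\<forall>k. \<exists>N. \<forall>i\<ge>N. \<forall>j\<ge>N. Lb a ((1/4) ^ k) (\<lambda>x. h i x - h j x)" using cauchy by simp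
  then show ?thesis using that by metis
 qed
 \<comment> \<open>Adding the partial sums of \<open>N\<close> makes \<sigma> strictly increasing
   and keeps \<open>\<sigma> j\<close> beyond every \<open>N k\<close> with k \<le> j.\<close>
 define \<sigma> where "\<sigma> j = j + (\<Sum>i\<le>j. N i)" for j
 have mono: "strict_mono \<sigma>" unfolding strict_mono_Suc_iff by (simp add: \<sigma>_def)
 have \<sigma>N: "N k \<le> \<sigma> j" if "k \<le> j" for k j
  using member_le_sum[of k "{..j}" N] that by (simp add: \<sigma>_def)
 define d where "d j x = norm (h (\<sigma> (Suc j)) x - h (\<sigma> j) x)" for j x
 have [measurable]: "d j \<in> \<B>" for j unfolding d_def by measurable
 have dL: "Lb a ((1/4) ^ j) (d j)" for j using N[OF \<sigma>N[of j "Suc j"] \<sigma>N[of j j]] unfolding d_def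
  by (rule Lb_cong_norm) (use a in auto)
 obtain G where G: "locint G" "\<And>x. 0 \<le> G x" "AE x in lborel. \<forall>j. d j x \<le> (1/2) ^ j * G x"
 proof (cases "a = 0")
  case True
  have "AE x in lborel. \<forall>j. d j x \<le> (1/4) ^ j" unfolding AE_all_countable using dL True by (auto simp: Lb_def d_def)
  then have "AE x in lborel. \<forall>j. d j x \<le> (1/2) ^ j * 1"
  proof eventually_elim
   case (elim x)
   have "(1/4::real) ^ j \<le> (1/2) ^ j" for j by (intro power_mono) auto
   then show ?case using elim order_trans by fastforce
  qed
  then show ?thesis by (intro that[of "\<lambda>x. 1"] locint_const) auto
 next
  case False
  define p where "p = 1 / a"
  have p: "1 \<le> p" using False a by (simp add: p_def)
  \<comment> \<open>The j-th term has integral at most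
    \<open>((1/2) ^ j) powr p \<le> (1/2) ^ j\<close>, the tolerance 1/4^j having been chosen to
    survive the factor 2^j. So \<open>S\<close> is finite almost everywhere, and each
    \<open>d j\<close> is at most 2^(-j) times the p-th root of \<open>S\<close>.\<close>
  define S where "S x = (\<Sum>j. ennreal ((2 ^ j * d j x) powr p))" for x
  have Sm[measurable]: "S \<in> \<B>" unfolding S_def by measurable
  have "nn (\<lambda>x. S x) = (\<Sum>j. \<integral>\<^sup>+x. ennreal ((2 ^ j * d j x) powr p) \<partial>lborel)"
   unfolding S_def by (rule nn_integral_suminf) measurable
  also have "\<dots> \<le> (\<Sum>j. ennreal ((1/2) ^ j))"
  proof (intro suminf_le summableI)
   fix j
   have "Lb a (\<bar>2 ^ j\<bar> * (1/4) ^ j) (\<lambda>x. 2 ^ j *\<^sub>R d j x)" using dL a(1) by (rule Lb_scaleR)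
   moreover have "\<bar>2 ^ j\<bar> * (1/4) ^ j = (1/2::real) ^ j" by (simp flip: power_mult_distrib)
   ultimately have "nnint (\<lambda>x. (2 ^ j * d j x) powr p) \<le> ennreal (((1/2) ^ j) powr p)"
    using False by (simp add: Lb_def p_def d_def abs_mult)
   also have "\<dots> \<le> ennreal (((1/2) ^ j) powr 1)" using p by (intro ennreal_leI powr_mono') (auto simp: power_le_one)
   finally show "nnint (\<lambda>x. (2 ^ j * d j x) powr p) \<le> ennreal ((1/2) ^ j)" by simp
  qed
  also have "\<dots> = ennreal (\<Sum>j. (1/2) ^ j)" by (intro suminf_ennreal2 summable_geometric) auto
  finally have Sint: "nn (\<lambda>x. S x) < \<infinity>" using le_less_trans ennreal_less_top by fastforce
  have AES: "AE x in lborel. S x \<noteq> \<infinity>" using Sint by (intro nn_integral_PInf_AE) auto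
  define G where "G x = enn2real (S x) powr a" for x
  have Gm[measurable]: "G \<in> \<B>" unfolding G_def by measurable
  have "Lb a (enn2real (nn (\<lambda>x. S x)) powr a) G" unfolding Lb_def
  proof (intro conjI)
   have "nnint (\<lambda>x. norm (G x) powr (1 / a)) = nn (\<lambda>x. S x)"
    by (intro nn_integral_cong_AE, use AES in eventually_elim)
     (use False a in \<open>simp add: G_def powr_powr ennreal_enn2real_if\<close>)
   also have "\<dots> = ennreal ((enn2real (nn (\<lambda>x. S x)) powr a) powr (1 / a))"
    using Sint False a by (simp add: powr_powr ennreal_enn2real_if)
   finally show "if a = 0 then AE x in lborel. norm (G x) \<le> enn2real (nn (\<lambda>x. S x)) powr a
    else (nnint (\<lambda>x. norm (G x) powr (1 / a))) \<le> ennreal ((enn2real (nn (\<lambda>x. S x)) powr a) powr (1 / a))"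
    using False by simp
  qed auto
  then have "locint G" using a by (rule Lb_locint)
  moreover have "AE x in lborel. \<forall>j. d j x \<le> (1/2) ^ j * G x" using AES
  proof eventually_elim
   case (elim x)
   show ?case
   proof
    fix j
    have "ennreal ((2 ^ j * d j x) powr p) \<le> S x"
    proof -
     have "(\<Sum>j\<in>{j}. ennreal ((2 ^ j * d j x) powr p)) \<le> S x"
      unfolding S_def by (rule sum_le_suminf[OF summableI]) auto
     then show ?thesis by (simp only: sum.insert sum.empty finite.emptyI empty_iff not_False_eq_True add_0_right)
    qed
    then have "(2 ^ j * d j x) powr p \<le> enn2real (S x)"
     using elim enn2real_mono[of "ennreal ((2 ^ j * d j x) powr p)" "S x"] by (simp add: top.not_eq_extremum)
    then have "((2 ^ j * d j x) powr p) powr a \<le> G x" unfolding G_def using a by (intro powr_mono2) auto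
    then have "2 ^ j * d j x \<le> G x" using False a by (simp add: powr_powr p_def d_def)
    then show "d j x \<le> (1/2) ^ j * G x" by (simp add: field_simps)
   qed
  qed
  ultimately show ?thesis using that[of G] by (simp add: G_def)
 qed
 have conv: "AE x in lborel. convergent (\<lambda>j. h (\<sigma> j) x) \<and> (\<forall>j. norm (h (\<sigma> j) x) \<le> norm (h (\<sigma> 0) x) + 2 * G x)"
  using G(3)
 proof eventually_elim
  case (elim x)
  define e where "e j = h (\<sigma> (Suc j)) x - h (\<sigma> j) x" for j
  have e: "norm (e j) \<le> (1/2) ^ j * G x" for j using elim by (simp add: e_def d_def)
  have geo: "(\<lambda>j. (1/2) ^ j * G x) sums (2 * G x)" using sums_mult2[OF geometric_sums[of "1/2::real"], of "G x"] by simp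
  have sn: "summable (\<lambda>j. norm (e j))"
  proof (rule summable_comparison_test'[where N = 0])
   show "summable (\<lambda>j. (1/2) ^ j * G x)" using geo by (rule sums_summable)
   show "norm (norm (e j)) \<le> (1/2) ^ j * G x" for j using e[of j] by (simp only: real_norm_def abs_norm_cancel)
  qed
  have tel: "h (\<sigma> j) x = h (\<sigma> 0) x + (\<Sum>i<j. e i)" for j by (induction j) (auto simp: e_def)
  have "(\<lambda>j. \<Sum>i<j. e i) \<longlonglongrightarrow> suminf e" by (rule summable_LIMSEQ[OF summable_norm_cancel[OF sn]])
  then have "(\<lambda>j. h (\<sigma> j) x) \<longlonglongrightarrow> h (\<sigma> 0) x + suminf e"
   by (subst tel) (intro tendsto_add tendsto_const)
  moreover have "norm (h (\<sigma> j) x) \<le> norm (h (\<sigma> 0) x) + 2 * G x" for j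
  proof -
   have "norm (\<Sum>i<j. e i) \<le> (\<Sum>i<j. (1/2) ^ i * G x)" using e by (intro order_trans[OF norm_sum sum_mono]) auto
   also have "\<dots> \<le> 2 * G x"
    using geo G(2)[of x] sum_le_suminf[of "\<lambda>j. (1/2) ^ j * G x" "{..<j}"] by (auto simp: sums_iff)
   finally show ?thesis using norm_triangle_ineq[of "h (\<sigma> 0) x" "\<Sum>i<j. e i"] by (subst tel) linarith
  qed
  ultimately show ?case by (auto simp: convergent_def)
 qed
 define g where "g x = lim (\<lambda>j. h (\<sigma> j) x)" for x
 have gm[measurable]: "g \<in> \<B>" unfolding g_def by (rule borel_measurable_lim_metric) auto
 have lim: "AE x in lborel. (\<lambda>j. h (\<sigma> j) x) \<longlonglongrightarrow> g x"
  using conv by eventually_elim (simp add: g_def convergent_LIMSEQ_iff)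
 show ?thesis
 proof (rule that[OF mono gm lim])
  fix \<psi> :: "'a \<Rightarrow> real" and R C
  assume [measurable]: "\<psi> \<in> \<B>" and \<psi>: "\<And>x. \<bar>\<psi> x\<bar> \<le> C" "\<And>x. norm x > R \<Longrightarrow> \<psi> x = 0"
  show "(\<lambda>j. LBINT x. \<psi> x *\<^sub>R h (\<sigma> j) x) \<longlonglongrightarrow> (LBINT x. \<psi> x *\<^sub>R g x)"
  proof (rule integral_dominated_convergence[where w = "\<lambda>x. norm (\<psi> x *\<^sub>R h (\<sigma> 0) x) + \<bar>\<psi> x\<bar> *\<^sub>R (2 * G x)"])
   have "L1 (\<lambda>x. \<psi> x *\<^sub>R h (\<sigma> 0) x)"
    using \<psi> by (intro integrable_csupp_mult[OF Lb_locint[OF bdd a]]) auto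
   moreover have "L1 (\<lambda>x. \<bar>\<psi> x\<bar> *\<^sub>R G x)"
    using \<psi> by (intro integrable_csupp_mult[OF G(1), of _ C R]) auto
   then have "L1 (\<lambda>x. 2 * (\<bar>\<psi> x\<bar> *\<^sub>R G x))" by (rule integrable_mult_right)
   ultimately show "L1 (\<lambda>x. norm (\<psi> x *\<^sub>R h (\<sigma> 0) x) + \<bar>\<psi> x\<bar> *\<^sub>R (2 * G x))"
    by (intro Bochner_Integration.integrable_add integrable_norm) (auto simp: mult_ac)
   show "AE x in lborel. (\<lambda>j. \<psi> x *\<^sub>R h (\<sigma> j) x) \<longlonglongrightarrow> \<psi> x *\<^sub>R g x"
    using lim by eventually_elim (intro tendsto_intros)
   show "AE x in lborel. norm (\<psi> x *\<^sub>R h (\<sigma> j) x) \<le> norm (\<psi> x *\<^sub>R h (\<sigma> 0) x) + \<bar>\<psi> x\<bar> *\<^sub>R (2 * G x)" for j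
    using conv
   proof eventually_elim
    case (elim x)
    then have "\<bar>\<psi> x\<bar> * norm (h (\<sigma> j) x) \<le> \<bar>\<psi> x\<bar> * (norm (h (\<sigma> 0) x) + 2 * G x)"
     by (intro mult_left_mono) auto
    then show ?case by (simp add: algebra_simps)
   qed
  qed auto
 qed
qed

section \<open>Jensen's inequality and approximation in Lebesgue norms\<close>

text \<open>Convexity of the power in tangent form. It is Young's inequality for the pair s^p, c^p;
  the cases s = 0 and c = 0 are separate because Young's inequality is applied to positive
  numbers.\<close>

lemma young_tangent:
 fixes s c p :: real
 assumes "0 \<le> s" "0 \<le> c" "1 \<le> p"
 shows "c powr p + p * c powr (p - 1) * (s - c) \<le> s powr p"
proof (cases "s = 0 \<or> c = 0")
 case True
 then show ?thesis
 proof
  assume "s = 0"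
  have "c powr p = c powr (p - 1) * c" using assms by (cases "c = 0") (auto simp: powr_diff)
  then show ?thesis using assms \<open>s = 0\<close>
   by (simp add: algebra_simps) (metis mult_right_mono mult.commute mult_1 powr_ge_zero mult_nonneg_nonneg)
 qed (use assms in \<open>cases "p = 1"; simp\<close>)
next
 case False
 have "(s powr p) powr (1 / p) * (c powr p) powr (1 - 1 / p) \<le> 1 / p * s powr p + (1 - 1 / p) * c powr p"
  using False assms by (intro Youngs_inequality_0) auto
 moreover have "(s powr p) powr (1 / p) = s" "(c powr p) powr (1 - 1 / p) = c powr (p - 1)"
  using False assms by (auto simp: powr_powr algebra_simps)
 ultimately have "p * (s * c powr (p - 1)) \<le> p * (1 / p * s powr p + (1 - 1 / p) * c powr p)"
  using assms by (intro mult_left_mono) auto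
 also have "\<dots> = s powr p + (p - 1) * c powr p" using assms by (simp add: field_simps)
 finally have "p * (s * c powr (p - 1)) \<le> s powr p + (p - 1) * c powr p" .
 moreover have "c powr p = c powr (p - 1) * c" using False assms by (simp add: powr_diff)
 ultimately show ?thesis by (simp add: algebra_simps)
qed

text \<open>Jensen's inequality for the probability weight \<open>r\<close>: the tangent at
  \<open>c\<close>, the norm of the mean, is integrated against \<open>r\<close>. Its linear part
  contributes a non-negative amount, since \<open>c\<close> is at most the mean of the norms.
  Nothing is to be shown when the right-hand side is infinite.\<close>

lemma powr_average_le:
 fixes F :: "'x \<Rightarrow> 'c::{banach, second_countable_topology}"
 assumes p: "1 \<le> p" and r: "integrable M r" "(\<integral>y. r y \<partial>M) = 1" "\<And>y. 0 \<le> r y"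
  and F: "integrable M (\<lambda>y. r y *\<^sub>R F y)" "F \<in> borel_measurable M"
 shows "ennreal (norm (\<integral>y. r y *\<^sub>R F y \<partial>M) powr p) \<le> (\<integral>\<^sup>+y. ennreal (r y * norm (F y) powr p) \<partial>M)"
proof (cases "(\<integral>\<^sup>+y. ennreal (r y * norm (F y) powr p) \<partial>M) = \<infinity>")
 case False
 have [measurable]: "r \<in> borel_measurable M" "F \<in> borel_measurable M" using r F by auto
 have int: "integrable M (\<lambda>y. r y * norm (F y) powr p)"
  using False r by (intro integrableI_bounded) (auto simp: top.not_eq_extremum abs_mult)
 have int1: "integrable M (\<lambda>y. r y * norm (F y))" using integrable_norm[OF F(1)] r(3) by simp
 define c where "c = norm (\<integral>y. r y *\<^sub>R F y \<partial>M)"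
 have c: "0 \<le> c" "c \<le> (\<integral>y. r y * norm (F y) \<partial>M)"
  using integral_norm_bound[of M "\<lambda>y. r y *\<^sub>R F y"] r(3) by (auto simp: c_def)
 have "c powr p \<le> c powr p + p * c powr (p - 1) * ((\<integral>y. r y * norm (F y) \<partial>M) - c)" using c p by simp
 also have "\<dots> = (\<integral>y. r y * (c powr p - p * c powr (p - 1) * c) + p * c powr (p - 1) * (r y * norm (F y)) \<partial>M)"
  unfolding Bochner_Integration.integral_add[OF integrable_mult_left[OF r(1)] integrable_mult_right[OF int1]]
  by (simp only: integral_mult_left_zero integral_mult_right_zero r(2)) (simp add: right_diff_distrib)
 also have "\<dots> \<le> (\<integral>y. r y * norm (F y) powr p \<partial>M)"
 proof (rule integral_mono)
  fix y
  show "r y * (c powr p - p * c powr (p - 1) * c) + p * c powr (p - 1) * (r y * norm (F y)) \<le> r y * norm (F y) powr p"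
   using mult_left_mono[OF young_tangent[of "norm (F y)" c p] r(3)[of y]] c p by (simp add: algebra_simps)
 qed (use int int1 r in auto)
 finally have "ennreal (c powr p) \<le> ennreal (\<integral>y. r y * norm (F y) powr p \<partial>M)" by (rule ennreal_leI)
 also have "\<dots> = (\<integral>\<^sup>+y. ennreal (r y * norm (F y) powr p) \<partial>M)"
  using int r(3) by (intro nn_integral_eq_integral[symmetric]) auto
 finally show ?thesis by (simp add: c_def)
qed simp

text \<open>Dominated convergence for the integral of the 1/a-th power. It fails for the essential
  supremum, whence 0 < a; all density arguments below inherit this restriction, and they are applied
  only to the norms of the data.\<close>

lemma Lb_tendsto_0:
 fixes u :: "nat \<Rightarrow> 'a::euclidean_space \<Rightarrow> 'b::euclidean_space"
 assumes a: "0 < a" "a \<le> 1" and u: "\<And>n. u n \<in> \<B>" and w: "Lb a B w"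
  and le: "\<And>n. AE x in lborel. norm (u n x) \<le> norm (w x)"
  and lim: "AE x in lborel. (\<lambda>n. u n x) \<longlonglongrightarrow> 0" and \<delta>: "0 < \<delta>"
 shows "\<exists>N. \<forall>n\<ge>N. Lb a \<delta> (u n)"
proof -
 note [measurable] = u Lb_measurable[OF w]
 have "(\<lambda>n. \<integral>\<^sup>+x. ennreal (norm (u n x) powr (1 / a)) \<partial>lborel) \<longlonglongrightarrow> (nn (\<lambda>x::'a. 0))"
 proof (rule nn_integral_dominated_convergence[where w = "\<lambda>x. ennreal (norm (w x) powr (1 / a))"])
  show "nnint (\<lambda>x. norm (w x) powr (1 / a)) < \<infinity>" using w a unfolding Lb_def by (auto intro: le_less_trans)
  show "AE x in lborel. ennreal (norm (u n x) powr (1 / a)) \<le> ennreal (norm (w x) powr (1 / a))" for n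
   using le[of n] by eventually_elim (use a in \<open>auto intro!: ennreal_leI powr_mono2\<close>)
  show "AE x in lborel. (\<lambda>n. ennreal (norm (u n x) powr (1 / a))) \<longlonglongrightarrow> 0" using lim
  proof eventually_elim
   case (elim x)
   have "(\<lambda>n. ennreal (norm (u n x) powr (1 / a))) \<longlonglongrightarrow> ennreal (norm (0::'b) powr (1 / a))"
    using a elim by (intro tendsto_ennrealI tendsto_powr2 tendsto_norm tendsto_const) auto
   then show ?case by simp
  qed
 qed measurable
 then have "(\<lambda>n. \<integral>\<^sup>+x. ennreal (norm (u n x) powr (1 / a)) \<partial>lborel) \<longlonglongrightarrow> 0" by simp
 then have "\<forall>\<^sub>F n in sequentially. (nnint (\<lambda>x. norm (u n x) powr (1 / a))) < ennreal (\<delta> powr (1 / a))"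
  using \<delta> by (intro order_tendstoD(2)) auto
 then show ?thesis unfolding eventually_sequentially using a \<delta> u by (auto simp: Lb_def intro: less_imp_le)
qed

lemma Lb_finite_measure:
 fixes g :: "'a::euclidean_space \<Rightarrow> 'b::euclidean_space"
 assumes a: "0 < a" and g: "g \<in> \<B>" "\<And>x. norm (g x) \<le> C" "\<And>x. norm x > R \<Longrightarrow> g x = 0"
 shows "Lb a (C * measure lborel (cball (0::'a) R) powr a) g"
proof -
 have C: "0 \<le> C" using g(2)[of 0] norm_ge_zero order_trans by blast
 have fin: "emeasure lborel (cball (0::'a) R) < \<infinity>" by (rule emeasure_lborel_cball_finite)
 have "nnint (\<lambda>x. norm (g x) powr (1 / a)) \<le> nn (\<lambda>x. ennreal (C powr (1 / a)) * indicator (cball (0::'a) R) x)"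
 proof (rule nn_integral_mono)
  fix x :: 'a
  show "ennreal (norm (g x) powr (1 / a)) \<le> ennreal (C powr (1 / a)) * indicator (cball 0 R) x"
   using g(2,3)[of x] a by (auto simp: indicator_def intro!: ennreal_leI powr_mono2)
 qed
 also have "\<dots> = ennreal (C powr (1 / a)) * emeasure lborel (cball (0::'a) R)" by (rule nn_integral_cmult_indicator) simp
 also have "\<dots> = ennreal ((C * measure lborel (cball (0::'a) R) powr a) powr (1 / a))"
  using fin a C by (simp add: powr_mult powr_powr emeasure_eq_ennreal_measure ennreal_mult)
 finally show ?thesis using g(1) a C by (simp add: Lb_def)
qed

text \<open>\<open>f\<close> is first truncated in space and in size. The truncation is an almost
  everywhere limit of continuous functions, and these are modified so as to be dominated without
  losing continuity.\<close>

lemma Lb_approx_continuous: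
 fixes f :: "'a::euclidean_space \<Rightarrow> 'b::euclidean_space"
 assumes a: "0 < a" "a \<le> 1" and f: "Lb a B f" and \<delta>: "0 < \<delta>"
 obtains g R where "continuous_on UNIV g" "\<And>x. norm x > R \<Longrightarrow> g x = 0" "Lb a \<delta> (\<lambda>x. f x - g x)"
proof -
 note fm[measurable] = Lb_measurable[OF f]
 define T where "T n x = (if norm x \<le> real n \<and> norm (f x) \<le> real n then f x else 0)" for n x
 have Tm[measurable]: "T n \<in> \<B>" for n unfolding T_def by measurable
 have "\<exists>N. \<forall>n\<ge>N. Lb a (\<delta> / 8) (\<lambda>x. f x - T n x)"
 proof (rule Lb_tendsto_0[OF a _ f])
  show "AE x in lborel. (\<lambda>n. f x - T n x) \<longlonglongrightarrow> 0"
  proof (rule AE_I2, rule tendsto_eventually)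
   fix x
   obtain n0 where n0: "real n0 \<ge> max (norm x) (norm (f x))" using real_arch_simple by blast
   show "\<forall>\<^sub>F n in sequentially. f x - T n x = 0"
    using eventually_ge_at_top[of n0] by eventually_elim (use n0 in \<open>auto simp: T_def\<close>)
  qed
 qed (use \<delta> in \<open>auto simp: T_def\<close>)
 then obtain n where n: "Lb a (\<delta> / 8) (\<lambda>x. f x - T n x)" by auto
 define N where "N = real n"
 have "T n \<in> borel_measurable lebesgue" by (rule measurable_completion) simp
 then have "T n measurable_on UNIV" by (simp add: measurable_on_iff_borel_measurable)
 then obtain Z G where Z: "negligible Z" and G: "\<And>i. continuous_on UNIV (G i)" "\<And>x. x \<notin> Z \<Longrightarrow> (\<lambda>i. G i x) \<longlonglongrightarrow> T n x"
  unfolding measurable_on_def by auto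
 \<comment> \<open>The ramp \<open>c\<close> is 1 up to radius N and 0 beyond N + 1, and values are
   projected to the nearest point of the ball of radius N. Neither changes the limit: the truncation
   is supported in radius N and has values in that ball.\<close>
 define c where "c x = max 0 (min 1 (N + 1 - norm x))" for x :: 'a
 define H where "H i x = c x *\<^sub>R closest_point (cball 0 N) (G i x)" for i x
 have N0: "cball (0::'b) N \<noteq> {}" by (simp add: N_def)
 have Hc: "continuous_on UNIV (H i)" for i unfolding H_def c_def
  by (intro continuous_intros continuous_on_compose2[OF continuous_on_closest_point[of "cball 0 N" UNIV] G(1)])
   (use N0 in auto)
 have clip: "norm (closest_point (cball 0 N) y) \<le> N" for y :: 'b
  using closest_point_in_set[of "cball 0 N" y] N0 by (simp add: )
 have Hb: "norm (H i x) \<le> N" for i x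
  unfolding H_def using clip[of "G i x"] by (auto simp: c_def intro!: mult_le_one[THEN order_trans] order_trans[OF mult_left_le_one_le])
 have Hs: "H i x = 0" if "norm x > N + 1" for i x using that by (simp add: H_def c_def)
 have "\<exists>M. \<forall>i\<ge>M. Lb a (\<delta> / 8) (\<lambda>x. T n x - H i x)"
 proof (rule Lb_tendsto_0[OF a])
  let ?w = "\<lambda>x::'a. ball_ind (N + 1) x *\<^sub>R (2 * N)"
  have "cball (0::'a) (N + 1) \<in> sets borel" by simp
  then show "Lb a (2 * N * measure lborel (cball (0::'a) (N + 1)) powr a) ?w"
   using a by (intro Lb_finite_measure) (auto simp: indicator_def N_def)
  show "(\<lambda>x. T n x - H i x) \<in> \<B>" for i
   using Tm borel_measurable_continuous_onI[OF Hc] by (rule borel_measurable_diff)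
  have Tb: "norm (T n x) \<le> N" for x by (simp add: T_def N_def)
  have "norm (T n x - H i x) \<le> norm (?w x)" for i x
  proof (cases "norm x > N + 1")
   case True then show ?thesis using Hs by (simp add: T_def N_def)
  next
   case False then show ?thesis using norm_triangle_ineq4[of "T n x" "H i x"] Hb[of i x] Tb[of x] by (simp add: N_def)
  qed
  then show "AE x in lborel. norm (T n x - H i x) \<le> norm (?w x)" for i by simp
  have "(\<lambda>i. T n x - H i x) \<longlonglongrightarrow> 0" if x: "x \<notin> Z" for x
  proof -
   have "isCont (closest_point (cball 0 N)) (T n x)" using continuous_on_closest_point[of "cball (0::'b) N" UNIV] N0
    by (simp add: continuous_on_eq_continuous_at)
   then have "(\<lambda>i. closest_point (cball 0 N) (G i x)) \<longlonglongrightarrow> closest_point (cball 0 N) (T n x)"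
    using G(2)[OF x] by (rule isCont_tendsto_compose)
   moreover have "closest_point (cball 0 N) (T n x) = T n x" by (rule closest_point_self) (simp add: T_def N_def)
   ultimately have "(\<lambda>i. H i x) \<longlonglongrightarrow> c x *\<^sub>R T n x" unfolding H_def by (intro tendsto_intros) auto
   moreover have "c x *\<^sub>R T n x = T n x" by (simp add: T_def c_def N_def)
   ultimately have "(\<lambda>i. H i x) \<longlonglongrightarrow> T n x" by simp
   from tendsto_diff[OF tendsto_const[of "T n x"] this] show ?thesis by simp
  qed
  moreover have "AE x in lebesgue. x \<notin> Z" using Z by (intro AE_not_in) (simp add: negligible_iff_null_sets)
  then have "AE x in lborel. x \<notin> Z" by (simp add: AE_completion_iff)
  ultimately show "AE x in lborel. (\<lambda>i. T n x - H i x) \<longlonglongrightarrow> 0" by (auto elim!: eventually_mono)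
 qed (use \<delta> in auto)
 then obtain i where i: "Lb a (\<delta> / 8) (\<lambda>x. T n x - H i x)" by auto
 have "Lb a (4 * (\<delta> / 8 + \<delta> / 8)) (\<lambda>x. (f x - T n x) + (T n x - H i x))" using a by (intro Lb_add n i) auto
 then show ?thesis using that[OF Hc[of i] Hs[of _ i]] by simp
qed

lemma Lb_translation_continuous:
 fixes f :: "'a::euclidean_space \<Rightarrow> 'b::euclidean_space"
 assumes a: "0 < a" "a \<le> 1" and f: "Lb a B f" and \<delta>: "0 < \<delta>"
 obtains \<eta> where "0 < \<eta>" "\<And>y. norm y < \<eta> \<Longrightarrow> Lb a \<delta> (\<lambda>x. f (x - y) - f x)"
proof -
 \<comment> \<open>Three differences are added at the end, which costs 3^2 = 9 in
   \<open>Lb_sum\<close>.\<close>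
 have "0 < \<delta> / 9" using \<delta> by simp
 from Lb_approx_continuous[OF a f this] obtain g R where g: "continuous_on UNIV g" "\<And>x. norm x > R \<Longrightarrow> g x = 0"
  and fg: "Lb a (\<delta> / 9) (\<lambda>x. f x - g x)" by metis
 define V where "V = measure lborel (cball (0::'a) (R + 1)) powr a"
 have V: "0 \<le> V" by (simp add: V_def)
 define \<omega> where "\<omega> = \<delta> / 9 / (V + 1)"
 have \<omega>: "0 < \<omega>" using \<delta> V by (simp add: \<omega>_def)
 have "uniformly_continuous_on (cball 0 (R + 2)) g"
  using g by (intro compact_uniformly_continuous) (auto intro: continuous_on_subset)
 then obtain d where d: "d > 0" "\<And>x x'. x \<in> cball 0 (R + 2) \<Longrightarrow> x' \<in> cball 0 (R + 2) \<Longrightarrow> dist x' x < d \<Longrightarrow> dist (g x') (g x) < \<omega>"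
  using \<omega> unfolding uniformly_continuous_on_def by metis
 have gm: "g \<in> \<B>" using g(1) by (rule borel_measurable_continuous_onI)
 have gy: "Lb a (\<delta> / 9) (\<lambda>x. g (x - y) - g x)" if y: "norm y < min d 1" for y
 proof (rule Lb_weaken[OF Lb_finite_measure[where C = \<omega> and R = "R + 1"]])
  show "(\<lambda>x. g (x - y) - g x) \<in> \<B>"
   using measurable_compose[OF _ gm, of "\<lambda>x. x - y" borel] gm by (intro borel_measurable_diff) auto
  have t: "norm x \<le> norm (x - y) + norm y" for x using norm_triangle_ineq[of "x - y" y] by simp
  have t': "norm (x - y) \<le> norm x + norm y" for x by (rule norm_triangle_ineq4)
  show z: "g (x - y) - g x = 0" if "norm x > R + 1" for x using that y t[of x] g(2)[of x] g(2)[of "x - y"] by simp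
  show "norm (g (x - y) - g x) \<le> \<omega>" for x
  proof (cases "norm x > R + 1")
   case True then show ?thesis using z \<omega> by simp
  next
   case False
   then have "dist (g (x - y)) (g x) < \<omega>" using y t'[of x] by (intro d(2)) (auto simp: dist_norm norm_minus_commute)
   then show ?thesis by (simp add: dist_norm)
  qed
  have "\<omega> * V \<le> \<omega> * (V + 1)" using \<omega> by simp
  also have "\<dots> = \<delta> / 9" unfolding \<omega>_def by (rule nonzero_eq_divide_eq[THEN iffD1]) (use V in auto)
  finally show "\<omega> * measure lborel (cball (0::'a) (R + 1)) powr a \<le> \<delta> / 9" by (simp only: V_def)
 qed (use a in auto)
 show ?thesis
 proof (rule that[of "min d 1"])
  fix y :: 'a assume y: "norm y < min d 1"
  define F where "F i x = (if i = 0 then f (x - y) - g (x - y) else if i = 1 then g (x - y) - g x else g x - f x)" for i :: nat and x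
  have "Lb a (real (card {0, 1, 2::nat}) ^ 2 * (\<delta> / 9)) (\<lambda>x. \<Sum>i\<in>{0, 1, 2}. F i x)"
  proof (rule Lb_sum)
   fix i :: nat
   have "Lb a (\<delta> / 9) (\<lambda>x. f (x - y) - g (x - y))" using Lb_affine[OF fg, of 1 "- y"] by simp
   moreover have "Lb a (\<delta> / 9) (\<lambda>x. g x - f x)" using Lb_scaleR[OF fg, of "-1"] a by simp
   ultimately show "Lb a (\<delta> / 9) (F i)" using gy[OF y] by (cases "i = 0"; cases "i = 1") (simp_all add: F_def[abs_def])
  qed (use a \<delta> in auto)
  then show "Lb a \<delta> (\<lambda>x. f (x - y) - f x)" by (simp add: F_def)
 qed (use d in auto)
qed

section \<open>Mollification in Lebesgue norms\<close>

definition mollifier :: "(real^'n::finite \<Rightarrow> real) \<Rightarrow> real \<Rightarrow> bool" where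
 "mollifier r \<epsilon> \<longleftrightarrow> smooth_csupp r \<and> (\<forall>x. 0 \<le> r x) \<and> (\<forall>x. norm x > \<epsilon> \<longrightarrow> r x = 0) \<and> (LBINT x. r x) = 1"

lemma mollifier_sequence_exists:
 obtains r :: "nat \<Rightarrow> real^'n::finite \<Rightarrow> real" where "\<And>j. mollifier (r j) (1 / real (Suc j))"
proof -
 obtain r :: "real^'n \<Rightarrow> real" where r: "smooth_csupp r" "\<And>x. r x \<ge> 0" "\<And>x. norm x > 1 \<Longrightarrow> r x = 0" "(LBINT x. r x) = 1"
  using mollifier_exists by metis
 define r' where "r' j x = (real (Suc j) ^ CARD('n)) *\<^sub>R r (0 + real (Suc j) *\<^sub>R x)" for j x
 have "mollifier (r' j) (1 / real (Suc j))" for j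
 proof -
  have sm: "smooth_on UNIV (r' j)"
   unfolding r'_def using r(1) by (intro smooth_linear[OF bounded_linear_scaleR_right] smooth_affine) (simp add: smooth_csupp_def)
  have v: "r' j x = 0" if "norm x > 1 / real (Suc j)" for x
   using that r(3)[of "real (Suc j) *\<^sub>R x"] by (simp add: r'_def field_simps del: of_nat_Suc)
  have "(LBINT x. r' j x) = 1"
   using integral_lborel_affine[of "real (Suc j)" r 0] r(4) by (simp add: r'_def[abs_def] del: of_nat_Suc)
  moreover have "0 \<le> r' j x" for x using r(2) by (simp add: r'_def)
  ultimately show ?thesis unfolding mollifier_def smooth_csupp_def using sm v by auto
 qed
 then show ?thesis by (rule that)
qed

lemma conv_flip: "conv r f x = (LBINT y. r y *\<^sub>R f (x - y))"
 unfolding conv_def using integral_lborel_reflect[of "\<lambda>y. r y *\<^sub>R f (x - y)" x] by simp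

text \<open>Jensen's inequality moves the power inside the average over \<open>y\<close>, and
  Tonelli's theorem leaves translations by |y| \<le> \<epsilon>, the only ones that \<open>r\<close>
  weighs.\<close>

lemma conv_Lb_diff:
 fixes f :: "real^'n::finite \<Rightarrow> 'b::euclidean_space"
 assumes a: "0 < a" "a \<le> 1" and f: "Lb a B f" and r: "mollifier r \<epsilon>"
  and \<delta>: "0 < \<delta>" "\<And>y. norm y \<le> \<epsilon> \<Longrightarrow> Lb a \<delta> (\<lambda>x. f (x - y) - f x)"
 shows "Lb a \<delta> (\<lambda>x. conv r f x - f x)"
proof -
 have li: "locint f" using f a by (intro Lb_locint) auto
 note fm[measurable] = Lb_measurable[OF f]
 have r': "smooth_csupp r" "\<And>x. 0 \<le> r x" "\<And>x. norm x > \<epsilon> \<Longrightarrow> r x = 0" "(LBINT x. r x) = 1"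
  using r by (auto simp: mollifier_def)
 have ri: "L1 r" using r'(1) by (rule smooth_csupp_integrable)
 have rm[measurable]: "r \<in> \<B>" using ri by (simp add: borel_measurable_integrable)
 define p where "p = 1 / a"
 have p: "1 \<le> p" using a by (simp add: p_def)
 have cm: "conv r f \<in> \<B>" using smooth_conv[OF r'(1) li] by (rule smooth_borel_measurable)
 have i1: "L1 (\<lambda>y. r y *\<^sub>R f (x - y))" for x
  using integrable_lborel_affine[OF conv_integrable[OF r'(1) li, of x], of "-1" x] by simp
 have int: "L1 (\<lambda>y. r y *\<^sub>R (f (x - y) - f x))" for x using i1[of x] ri by (simp add: scaleR_diff_right)
 have eq: "conv r f x - f x = (LBINT y. r y *\<^sub>R (f (x - y) - f x))" for x
  using i1[of x] ri r'(4) by (simp add: conv_flip scaleR_diff_right)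
 have "nnint (\<lambda>x. norm (conv r f x - f x) powr p)
   \<le> nn (\<lambda>x. nn (\<lambda>y. ennreal (r y * norm (f (x - y) - f x) powr p)))" unfolding eq
 proof (rule nn_integral_mono)
  show "ennreal (norm (LBINT y. r y *\<^sub>R (f (x - y) - f x)) powr p)
   \<le> nnint (\<lambda>y. r y * norm (f (x - y) - f x) powr p)" for x by (rule powr_average_le[OF p ri r'(4,2) int]) measurable
 qed
 also have "\<dots> = nn (\<lambda>y. nn (\<lambda>x. ennreal (r y * norm (f (x - y) - f x) powr p)))"
  by (rule lborel_pair.Fubini') measurable
 also have "\<dots> \<le> nn (\<lambda>y. ennreal (r y) * ennreal (\<delta> powr p))"
 proof (rule nn_integral_mono)
  fix y
  have "nnint (\<lambda>x. r y * norm (f (x - y) - f x) powr p) = ennreal (r y) * nnint (\<lambda>x. norm (f (x - y) - f x) powr p)"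
   using r'(2) by (subst nn_integral_cmult[symmetric]) (auto simp: ennreal_mult)
  also have "\<dots> \<le> ennreal (r y) * ennreal (\<delta> powr p)"
  proof (cases "norm y \<le> \<epsilon>")
   case True
   then show ?thesis using \<delta>(2)[OF True] a by (intro mult_left_mono) (auto simp: Lb_def p_def)
  qed (use r'(3) in auto)
  finally show "nnint (\<lambda>x. r y * norm (f (x - y) - f x) powr p) \<le> ennreal (r y) * ennreal (\<delta> powr p)" .
 qed
 also have "\<dots> = nnint (\<lambda>y. r y) * ennreal (\<delta> powr p)" by (rule nn_integral_multc) measurable
 also have "nnint (\<lambda>y. r y) = 1" using nn_integral_eq_integral[OF ri] r' by simp
 finally show ?thesis using a cm fm \<delta> by (simp add: Lb_def p_def)
qed

lemma mollify_Lb: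
 fixes f :: "real^'n::finite \<Rightarrow> 'b::euclidean_space"
 assumes a: "0 < a" "a \<le> 1" and f: "Lb a B f" and r: "\<And>j. mollifier (r j) (1 / real (Suc j))" and \<delta>: "0 < \<delta>"
 shows "\<exists>N. \<forall>j\<ge>N. Lb a \<delta> (\<lambda>x. conv (r j) f x - f x)"
proof -
 obtain \<eta> where \<eta>: "0 < \<eta>" "\<And>y. norm y < \<eta> \<Longrightarrow> Lb a \<delta> (\<lambda>x. f (x - y) - f x)"
  by (rule Lb_translation_continuous[OF a f \<delta>]) (rule that)
 obtain N where N: "1 / real (Suc N) < \<eta>" using nat_approx_posE[OF \<eta>(1)] by auto
 have "Lb a \<delta> (\<lambda>x. conv (r j) f x - f x)" if "j \<ge> N" for j
 proof (rule conv_Lb_diff[OF a f r \<delta>])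
  fix y :: "real^'n" assume "norm y \<le> 1 / real (Suc j)"
  also have "\<dots> \<le> 1 / real (Suc N)" using that by (simp add: field_simps)
  finally show "Lb a \<delta> (\<lambda>x. f (x - y) - f x)" using N by (intro \<eta>(2)) simp
 qed
 then show ?thesis by blast
qed

section \<open>The Fourier transform\<close>

definition FT :: "(real^'n::finite \<Rightarrow> complex) \<Rightarrow> real^'n \<Rightarrow> complex" where
 "FT f \<xi> = (LBINT x. cis (- (x \<bullet> \<xi>)) * f x)"

lemma FT_integrable:
 assumes "L1 f"
 shows "L1 (\<lambda>x. cis (- (x \<bullet> \<xi>)) * f x)"
proof (rule int_bound[OF assms])
 have "(\<lambda>x. cis (- (x \<bullet> \<xi>))) \<in> \<B>" by (intro borel_measurable_continuous_onI continuous_intros)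
 then show "(\<lambda>x. cis (- (x \<bullet> \<xi>)) * f x) \<in> borel_measurable lborel" using assms by auto
qed (simp add: norm_mult)

lemma FT_norm_le: "L1 f \<Longrightarrow> norm (FT f \<xi>) \<le> (LBINT x. norm (f x))"
 unfolding FT_def by (rule order_trans[OF integral_norm_bound]) (simp add: norm_mult)

lemma FT_measurable:
 assumes [measurable]: "f \<in> \<B>" shows "FT f \<in> \<B>"
proof -
 have [measurable]: "cis \<in> \<B>" by (intro borel_measurable_continuous_onI continuous_intros)
 show ?thesis unfolding FT_def[abs_def] by measurable
qed

lemma FT_add: "L1 f \<Longrightarrow> L1 g \<Longrightarrow> FT (\<lambda>x. f x + g x) \<xi> = FT f \<xi> + FT g \<xi>"
 unfolding FT_def by (simp add: distrib_left FT_integrable)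

lemma FT_cmult: "FT (\<lambda>x. c * f x) \<xi> = c * FT f \<xi>"
 unfolding FT_def by (simp add: mult.left_commute[of _ c])

lemma FT_sum: "(\<And>i. i \<in> I \<Longrightarrow> L1 (f i)) \<Longrightarrow> FT (\<lambda>x. \<Sum>i\<in>I. f i x) \<xi> = (\<Sum>i\<in>I. FT (f i) \<xi>)"
 unfolding FT_def by (simp add: sum_distrib_left FT_integrable)

lemma FT_multiplication:
 assumes f: "L1 f" and g: "L1 g"
 shows "(LBINT x. FT f x * g x) = (LBINT x. f x * FT g x)"
proof -
 have [measurable]: "f \<in> \<B>" "g \<in> \<B>" using f g by auto
 have [measurable]: "cis \<in> \<B>" by (intro borel_measurable_continuous_onI continuous_intros)
 have int: "integrable (lborel \<Otimes>\<^sub>M lborel) (\<lambda>(x, y). cis (- (y \<bullet> x)) * f y * g x)"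
 proof (rule lborel_pair.Fubini_integrable)
  show "L1 (\<lambda>x. LBINT y. norm (case (x, y) of (x, y) \<Rightarrow> cis (- (y \<bullet> x)) * f y * g x))"
   using g by (simp add: norm_mult)
  show "AE x in lborel. L1 (\<lambda>y. case (x, y) of (x, y) \<Rightarrow> cis (- (y \<bullet> x)) * f y * g x)"
   using FT_integrable[OF f] by simp
 qed measurable
 have "(LBINT x. FT f x * g x) = (LBINT x. LBINT y. cis (- (y \<bullet> x)) * f y * g x)" unfolding FT_def by simp
 also have "\<dots> = (LBINT y. LBINT x. cis (- (y \<bullet> x)) * f y * g x)"
  by (rule lborel_pair.Fubini_integral[OF int, symmetric])
 also have "\<dots> = (LBINT y. f y * FT g y)"
  unfolding FT_def by (simp add: inner_commute mult_ac flip: integral_mult_right_zero)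
 finally show ?thesis .
qed

text \<open>Gaussian regularisation. Only the total mass of the transformed Gaussian matters,
 so its exact value is hidden in the constant \<open>\<kappa>\<close>.\<close>

lemma FT_gaussian_real:
 fixes y :: real
 shows "(LBINT t. cis (- (t * y)) * of_real (exp (- (t^2) / 2))) = of_real (sqrt (2 * pi) * exp (- (y^2) / 2))"
proof -
 have "char std_normal_distribution (- y) = (LBINT t. std_normal_density t *\<^sub>R cis (- y * t))"
  unfolding char_def by (subst integral_density) (auto simp: cis_conv_exp mult_ac)
 also have "\<dots> = (LBINT t. of_real (1 / sqrt (2 * pi)) * (cis (- (t * y)) * of_real (exp (- (t^2) / 2))))"
  by (intro Bochner_Integration.integral_cong) (auto simp: std_normal_density_def scaleR_conv_of_real mult_ac)
 finally have "of_real (exp (- (y^2) / 2)) = of_real (1 / sqrt (2 * pi)) * (LBINT t. cis (- (t * y)) * of_real (exp (- (t^2) / 2)))"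
  by (simp add: char_std_normal_distribution)
 then show ?thesis by (simp add: field_simps)
qed

lemma integral_lborel_prod:
 fixes f :: "'a::euclidean_space \<Rightarrow> real \<Rightarrow> complex"
 assumes "\<And>b. b \<in> Basis \<Longrightarrow> L1 (f b)"
 shows "(LBINT x. (\<Prod>b\<in>Basis. f b (x \<bullet> b))) = (\<Prod>b\<in>Basis. (LBINT t. f b t))"
  and "L1 (\<lambda>x. (\<Prod>b\<in>Basis. f b (x \<bullet> b)))"
proof -
 interpret finite_product_sigma_finite "\<lambda>_::'a. lborel :: real measure" Basis by standard simp
 have [measurable]: "f b \<in> \<B>" if "b \<in> Basis" for b using assms[OF that] by auto
 have pm: "(\<lambda>x. \<Prod>b\<in>Basis. f b (x \<bullet> b)) \<in> \<B>" by measurable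
 have T: "(\<lambda>g. \<Sum>b\<in>Basis. g b *\<^sub>R b) \<in> (\<Pi>\<^sub>M b\<in>Basis. lborel) \<rightarrow>\<^sub>M (borel :: 'a measure)" by measurable
 show "(LBINT x. (\<Prod>b\<in>Basis. f b (x \<bullet> b))) = (\<Prod>b\<in>Basis. (LBINT t. f b t))"
  unfolding lborel_eq[where 'a = 'a] integral_distr[OF T pm]
  using product_integral_prod[OF finite_Basis assms] by (simp cong: prod.cong)
 show "L1 (\<lambda>x. (\<Prod>b\<in>Basis. f b (x \<bullet> b)))" unfolding lborel_eq[where 'a = 'a] integrable_distr_eq[OF T pm]
  using product_integrable_prod[OF finite_Basis assms] by (simp cong: prod.cong)
qed

definition gauss :: "real^'n::finite \<Rightarrow> real" where
 "gauss x = exp (- (x \<bullet> x) / 2)"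

lemma gauss_prod: "cplx (gauss x) * cis (- (x \<bullet> \<xi>)) = (\<Prod>b\<in>Basis. cis (- ((x \<bullet> b) * (\<xi> \<bullet> b))) * of_real (exp (- ((x \<bullet> b)^2) / 2)))"
proof -
 have "x \<bullet> \<xi> = (\<Sum>b\<in>Basis. (x \<bullet> b) * (\<xi> \<bullet> b))" "x \<bullet> x = (\<Sum>b\<in>Basis. (x \<bullet> b)^2)"
  unfolding power2_eq_square by (rule euclidean_inner)+
 then have "cplx (gauss x) * cis (- (x \<bullet> \<xi>))
   = exp (\<Sum>b\<in>Basis. \<i> * of_real (- ((x \<bullet> b) * (\<xi> \<bullet> b))) + of_real (- ((x \<bullet> b)^2) / 2))"
  by (simp add: gauss_def cis_conv_exp sum.distrib sum_negf sum_subtractf sum_distrib_left sum_divide_distrib add.commute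
    flip: exp_of_real exp_add)
 also have "\<dots> = (\<Prod>b\<in>Basis. cis (- ((x \<bullet> b) * (\<xi> \<bullet> b))) * of_real (exp (- ((x \<bullet> b)^2) / 2)))"
  by (subst exp_sum) (simp_all add: mult_exp_exp cis_conv_exp flip: exp_of_real)
 finally show ?thesis .
qed

lemma gauss_real_integrable: "L1 (\<lambda>t::real. cis (- (t * y)) * cplx (exp (- (t^2) / 2)))"
proof (rule int_bound)
 have "L1 (\<lambda>t. sqrt (2 * pi) * std_normal_density t)"
  using integrable_std_normal_distribution_moment[of 0] by (intro integrable_mult_right) (simp add: integrable_density)
 then show "L1 (\<lambda>t::real. exp (- (t^2) / 2))" by (simp add: std_normal_density_def)
 have "(\<lambda>t. cis (- (t * y)) * cplx (exp (- (t^2) / 2))) \<in> \<B>"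
  by (intro borel_measurable_continuous_onI continuous_intros) auto
 then show "(\<lambda>t. cis (- (t * y)) * cplx (exp (- (t^2) / 2))) \<in> borel_measurable lborel" by simp
qed (simp add: norm_mult)

lemma gauss_integrable: "L1 (gauss :: real^'n::finite \<Rightarrow> real)"
proof -
 have "L1 (\<lambda>x::real^'n. cplx (gauss x) * cis (- (x \<bullet> 0)))"
  unfolding gauss_prod by (rule integral_lborel_prod(2)) (rule gauss_real_integrable)
 then have "L1 (\<lambda>x::real^'n. Re (cplx (gauss x)))" by (intro integrable_Re) simp
 then show ?thesis by simp
qed

definition \<kappa> :: "'n::finite itself \<Rightarrow> real" where
 "\<kappa> _ = (2 * pi) ^ CARD('n)"

lemma \<kappa>_pos: "0 < \<kappa> TYPE('n::finite)" by (simp add: \<kappa>_def)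

lemma FT_gauss: "FT (\<lambda>x. of_real (gauss x)) \<xi> = of_real (sqrt (\<kappa> TYPE('n)) * gauss \<xi>)" for \<xi> :: "real^'n::finite"
proof -
 have "FT (\<lambda>x. of_real (gauss x)) \<xi> = (\<Prod>b\<in>Basis. LBINT t. cis (- (t * (\<xi> \<bullet> b))) * of_real (exp (- (t^2) / 2)))"
  unfolding FT_def mult.commute[of "cis (- (_ \<bullet> \<xi>))"] gauss_prod by (rule integral_lborel_prod(1)) (rule gauss_real_integrable)
 also have "\<dots> = (\<Prod>b\<in>Basis. of_real (sqrt (2 * pi)) * of_real (exp (- ((\<xi> \<bullet> b)^2) / 2)))"
  by (simp only: FT_gaussian_real of_real_mult)
 also have "\<dots> = of_real (sqrt (2 * pi) ^ CARD('n)) * of_real (gauss \<xi>)"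
 proof -
  have "gauss \<xi> = (\<Prod>b\<in>Basis. exp (- ((\<xi> \<bullet> b)^2) / 2))"
   unfolding gauss_def euclidean_inner[of \<xi> \<xi>] by (simp add: sum_negf sum_divide_distrib power2_eq_square flip: exp_sum)
  then show ?thesis by (simp only: prod.distrib prod_constant of_real_prod of_real_power) simp
 qed
 also have "sqrt (2 * pi) ^ CARD('n) = sqrt (\<kappa> TYPE('n))" by (simp only: \<kappa>_def real_sqrt_power)
 finally show ?thesis by simp
qed

lemma gauss_mass: "(LBINT x. gauss (x :: real^'n::finite)) = sqrt (\<kappa> TYPE('n))"
proof -
 have "FT (\<lambda>x. of_real (gauss x)) (0 :: real^'n) = of_real (LBINT x. gauss (x :: real^'n))"
  unfolding FT_def by (simp flip: integral_complex_of_real)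
 also have "FT (\<lambda>x. of_real (gauss x)) (0 :: real^'n) = of_real (sqrt (\<kappa> TYPE('n)))"
  unfolding FT_gauss by (simp add: gauss_def)
 finally show ?thesis by (simp only: of_real_eq_iff)
qed

text \<open>The transform of the Gaussian dilated by \<open>s\<close>: an approximate identity as s
  tends to 0, of total mass \<kappa> instead of 1.\<close>

definition gauss_kernel :: "real \<Rightarrow> real^'n::finite \<Rightarrow> real" where
 "gauss_kernel s x = (1 / s) ^ CARD('n) * (sqrt (\<kappa> TYPE('n)) * gauss ((1 / s) *\<^sub>R x))"

lemma FT_gauss_scaled:
 fixes y :: "real^'n::finite"
 assumes s: "0 < s"
 shows "FT (\<lambda>x. of_real (gauss (s *\<^sub>R x))) y = of_real (gauss_kernel s y)"
proof -
 have "FT (\<lambda>x. of_real (gauss x)) ((1 / s) *\<^sub>R y) = (\<bar>s\<bar> ^ DIM(real^'n)) *\<^sub>R FT (\<lambda>x. of_real (gauss (s *\<^sub>R x))) y"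
  unfolding FT_def using s by (subst integral_lborel_affine[of s _ 0]) auto
 then show ?thesis using s by (simp add: FT_gauss gauss_kernel_def scaleR_conv_of_real field_simps)
qed

lemma gauss_kernel_integral:
 assumes s: "0 < s"
 shows "L1 (gauss_kernel s :: real^'n::finite \<Rightarrow> real)" "(LBINT x. gauss_kernel s (x :: real^'n)) = \<kappa> TYPE('n)"
proof -
 show "L1 (gauss_kernel s :: real^'n \<Rightarrow> real)"
  unfolding gauss_kernel_def[abs_def] using integrable_lborel_affine[OF gauss_integrable, of "1/s" 0] s by auto
 have "sqrt (\<kappa> TYPE('n)) = (1 / s) ^ CARD('n) * (LBINT x. gauss ((1 / s) *\<^sub>R (x :: real^'n)))"
  using integral_lborel_affine[of "1/s" "gauss :: real^'n \<Rightarrow> real" 0] s by (simp add: gauss_mass)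
 then have "(LBINT x. gauss_kernel s (x :: real^'n)) = sqrt (\<kappa> TYPE('n)) * sqrt (\<kappa> TYPE('n))"
  unfolding gauss_kernel_def by simp
 then show "(LBINT x. gauss_kernel s (x :: real^'n)) = \<kappa> TYPE('n)" using \<kappa>_pos[where 'n = 'n] by simp
qed

section \<open>Plancherel's inequality and Fourier inversion\<close>

lemma cis_measurable [measurable]: "cis \<in> \<B>"
 by (intro borel_measurable_continuous_onI continuous_intros)

lemma cnj_measurable [measurable]: "cnj \<in> \<B>"
 by (intro borel_measurable_continuous_onI continuous_intros)

lemma norm_integral_le_nn_integral:
 fixes f :: "'x \<Rightarrow> 'c::{banach, second_countable_topology}"
 shows "ennreal (norm (integral\<^sup>L M f)) \<le> (\<integral>\<^sup>+x. ennreal (norm (f x)) \<partial>M)"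
 by (cases "integrable M f") (auto simp: not_integrable_integral_eq intro: integral_norm_bound_ennreal)

lemma gauss_kernel_nonneg: "0 \<le> s \<Longrightarrow> 0 \<le> gauss_kernel s x"
 by (simp add: gauss_kernel_def gauss_def \<kappa>_def)

lemma gauss_le_1: "gauss x \<le> 1" "0 < gauss x"
 by (simp_all add: gauss_def)

lemma gauss_measurable [measurable]: "gauss \<in> \<B>"
 unfolding gauss_def[abs_def] by measurable

lemma gauss_kernel_measurable [measurable]: "gauss_kernel s \<in> \<B>"
 unfolding gauss_kernel_def[abs_def] by measurable

lemma gauss_scaled_integrable:
 assumes "s \<noteq> 0" shows "L1 (\<lambda>x::real^'n::finite. cplx (gauss (s *\<^sub>R x)))"
 using integrable_lborel_affine[OF gauss_integrable, of s 0] assms by (intro integrable_of_real) simp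

text \<open>With g the conjugate of \<open>FT f\<close> times a Gaussian, the left side is
  \<integral> \<open>FT f\<close> g = \<integral> f \<open>FT g\<close>, and \<open>FT g\<close>
  averages conjugate translates of \<open>f\<close> against the Gaussian kernel. The bound |f(x)|
  |f(x - y)| \<le> (|f(x)|^2 + |f(x - y)|^2) / 2 and translation invariance leave the mass \<kappa>.
  The right side may be infinite: only integrability of \<open>f\<close> is assumed.\<close>

lemma plancherel_regularised:
 fixes f :: "real^'n::finite \<Rightarrow> complex"
 assumes f: "L1 f" and s: "0 < s"
 shows "nn (\<lambda>\<xi>. ennreal ((norm (FT f \<xi>))^2 * gauss (s *\<^sub>R \<xi>))) \<le> ennreal (\<kappa> TYPE('n)) * nnint (\<lambda>x. (norm (f x))^2)"
proof -
 have [measurable]: "f \<in> \<B>" using f by auto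
 note [measurable] = FT_measurable[of f]
 have gi: "L1 (\<lambda>x::real^'n. cplx (gauss (s *\<^sub>R x)))" using s by (intro gauss_scaled_integrable) simp
 define M where "M = (LBINT x. norm (f x))"
 have M: "norm (FT f \<xi>) \<le> M" for \<xi> unfolding M_def using f by (rule FT_norm_le)
 define g where "g \<xi> = cnj (FT f \<xi>) * cplx (gauss (s *\<^sub>R \<xi>))" for \<xi>
 have g: "L1 g"
 proof (rule int_bound)
  show "L1 (\<lambda>x::real^'n. M * cplx (gauss (s *\<^sub>R x)))" by (intro integrable_mult_right gi)
  show "AE x in lborel. norm (g x) \<le> norm (cplx M * cplx (gauss (s *\<^sub>R x)))"
   using M order_trans[OF M abs_ge_self] by (auto simp: g_def norm_mult intro!: mult_right_mono)
 qed (simp add: g_def[abs_def])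
 have Fg: "FT g x = (LBINT y. cnj (f (x - y)) * cplx (gauss_kernel s y))" for x
 proof -
  have fx: "L1 (\<lambda>y. cnj (f (x - y)))" using integrable_lborel_affine[OF f, of "-1" x] by simp
  have "FT (\<lambda>y. cnj (f (x - y))) \<xi> = cis (- (\<xi> \<bullet> x)) * cnj (FT f \<xi>)" for \<xi>
  proof -
   have "FT (\<lambda>y. cnj (f (x - y))) \<xi> = (LBINT y. cis (- ((x - y) \<bullet> \<xi>)) * cnj (f (x - (x - y))))"
    unfolding FT_def by (rule integral_lborel_reflect[symmetric])
   also have "\<dots> = (LBINT y. cis (- (\<xi> \<bullet> x)) * cnj (cis (- (y \<bullet> \<xi>)) * f y))"
    by (simp add: inner_diff_left inner_diff_right inner_commute[of \<xi>] cis_cnj mult.assoc[symmetric] cis_mult)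
   finally show ?thesis by (simp only: FT_def integral_mult_right_zero Bochner_Integration.integral_cnj)
  qed
  then have "FT g x = (LBINT \<xi>. FT (\<lambda>y. cnj (f (x - y))) \<xi> * cplx (gauss (s *\<^sub>R \<xi>)))"
   unfolding FT_def[of g] g_def by (simp add: mult.assoc)
  also have "\<dots> = (LBINT y. cnj (f (x - y)) * FT (\<lambda>\<xi>. cplx (gauss (s *\<^sub>R \<xi>))) y)"
   by (rule FT_multiplication[OF fx gi])
  finally show ?thesis by (simp add: FT_gauss_scaled[OF s])
 qed
 define N where "N = nnint (\<lambda>x. (norm (f x))^2)"
 let ?K = "\<lambda>x y. gauss_kernel s y * (((norm (f x))^2 + (norm (f (x - y)))^2) / 2)"
 have shift: "nnint (\<lambda>x. (norm (f (x - y)))^2) = N" for y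
  unfolding N_def using nn_integral_lborel_shift[of "\<lambda>x. ennreal ((norm (f x))^2)" "- y"] by simp
 have "(LBINT \<xi>. FT f \<xi> * g \<xi>) = (LBINT \<xi>. cplx ((norm (FT f \<xi>))^2 * gauss (s *\<^sub>R \<xi>)))"
  unfolding g_def by (intro Bochner_Integration.integral_cong) (simp_all only: of_real_mult complex_norm_square mult_ac)
 then have eq: "cplx (LBINT \<xi>. (norm (FT f \<xi>))\<^sup>2 * gauss (s *\<^sub>R \<xi>)) = (LBINT x. f x * FT g x)"
  using FT_multiplication[OF f g] by (simp only: integral_complex_of_real)
 have int: "L1 (\<lambda>\<xi>. (norm (FT f \<xi>))^2 * gauss (s *\<^sub>R \<xi>))"
 proof (rule int_bound)
  show "L1 (\<lambda>x::real^'n. M^2 * cplx (gauss (s *\<^sub>R x)))" by (intro integrable_mult_right gi)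
  show "AE x in lborel. norm ((norm (FT f x))^2 * gauss (s *\<^sub>R x)) \<le> norm (cplx (M^2) * cplx (gauss (s *\<^sub>R x)))"
   using M by (auto simp: norm_mult abs_mult norm_power intro!: mult_right_mono power_mono)
 qed simp
 have "nn (\<lambda>\<xi>. ennreal ((norm (FT f \<xi>))^2 * gauss (s *\<^sub>R \<xi>))) = ennreal (LBINT \<xi>. (norm (FT f \<xi>))\<^sup>2 * gauss (s *\<^sub>R \<xi>))"
  using int by (intro nn_integral_eq_integral) (auto simp: less_imp_le[OF gauss_le_1(2)])
 also have "\<dots> \<le> ennreal (norm (LBINT x. f x * FT g x))" unfolding eq[symmetric] by (intro ennreal_leI) simp
 also have "\<dots> \<le> nnint (\<lambda>x. norm (f x * FT g x))" by (rule norm_integral_le_nn_integral)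
 also have "\<dots> \<le> nn (\<lambda>x. nn (\<lambda>y. ennreal (?K x y)))"
 proof (rule nn_integral_mono)
  fix x
  have "ennreal (norm (f x * FT g x)) \<le> ennreal (norm (f x)) * nnint (\<lambda>y. norm (cnj (f (x - y)) * cplx (gauss_kernel s y)))"
   unfolding Fg norm_mult[of "f x"] ennreal_mult[OF norm_ge_zero norm_ge_zero]
   by (intro mult_left_mono norm_integral_le_nn_integral) simp
  also have "\<dots> = nnint (\<lambda>y. gauss_kernel s y * (norm (f x) * norm (f (x - y))))"
  proof (subst nn_integral_cmult[symmetric])
   show "nn (\<lambda>y. ennreal (norm (f x)) * ennreal (norm (cnj (f (x - y)) * cplx (gauss_kernel s y))))
    = nnint (\<lambda>y. gauss_kernel s y * (norm (f x) * norm (f (x - y))))" using s by (intro nn_integral_cong)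
     (simp add: norm_mult gauss_kernel_nonneg mult_ac flip: ennreal_mult)
  qed measurable
  also have "\<dots> \<le> nnint (\<lambda>y. ?K x y)"
  proof (intro nn_integral_mono ennreal_leI mult_left_mono gauss_kernel_nonneg)
   show "norm (f x) * norm (f (x - y)) \<le> ((norm (f x))^2 + (norm (f (x - y)))^2) / 2" for y
    using sum_squares_bound[of "norm (f x)" "norm (f (x - y))"] by simp
  qed (use s in auto)
  finally show "ennreal (norm (f x * FT g x)) \<le> nnint (\<lambda>y. ?K x y)" .
 qed
 also have "\<dots> = nn (\<lambda>y. nn (\<lambda>x. ennreal (?K x y)))" by (rule lborel_pair.Fubini') measurable
 also have "\<dots> = nn (\<lambda>y. ennreal (gauss_kernel s (y::real^'n)) * N)"
 proof (rule nn_integral_cong)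
  fix y :: "real^'n"
  have "nnint (\<lambda>x. ?K x y)
   = nn (\<lambda>x. ennreal (gauss_kernel s y / 2) * (ennreal ((norm (f x))^2) + ennreal ((norm (f (x - y)))^2)))"
   using gauss_kernel_nonneg[of s y] s by (intro nn_integral_cong) (simp flip: ennreal_plus ennreal_mult)
  also have "\<dots> = ennreal (gauss_kernel s y / 2) * (N + N)"
   by (simp add: nn_integral_cmult nn_integral_add shift) (simp add: N_def)
  also have "\<dots> = ennreal (gauss_kernel s y / 2) * (ennreal 2 * N)" by (simp add: mult_2)
  also have "\<dots> = ennreal (gauss_kernel s y) * N"
   using gauss_kernel_nonneg[of s y] s by (simp add: mult.assoc[symmetric] ennreal_mult[symmetric] del: ennreal_numeral)
  finally show "nnint (\<lambda>x. ?K x y) = ennreal (gauss_kernel s y) * N" .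
 qed
 also have "\<dots> = nnint (\<lambda>y. gauss_kernel s (y::real^'n)) * N" by (rule nn_integral_multc) measurable
 also have "nnint (\<lambda>y. gauss_kernel s (y::real^'n)) = ennreal (\<kappa> TYPE('n))"
  using gauss_kernel_integral[OF s, where 'n = 'n] gauss_kernel_nonneg[of s] s by (subst nn_integral_eq_integral) auto
 finally show ?thesis by (simp add: N_def)
qed

text \<open>The Gaussian factor is removed by Fatou's lemma. The inequality is the L^2 endpoint of
  Hausdorff--Young.\<close>

lemma plancherel_le:
 fixes f :: "real^'n::finite \<Rightarrow> complex"
 assumes f: "L1 f"
 shows "nn (\<lambda>\<xi>. ennreal ((norm (FT f \<xi>))^2)) \<le> ennreal (\<kappa> TYPE('n)) * nnint (\<lambda>x. (norm (f x))^2)"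
proof -
 have [measurable]: "f \<in> \<B>" using f by auto
 note [measurable] = FT_measurable[of f]
 have "nn (\<lambda>\<xi>. ennreal ((norm (FT f \<xi>))^2))
   = nn (\<lambda>\<xi>. liminf (\<lambda>j. ennreal ((norm (FT f \<xi>))^2 * gauss (inverse (real (Suc j)) *\<^sub>R \<xi>))))"
 proof (rule nn_integral_cong)
  fix \<xi> :: "real^'n"
  have "isCont gauss (0 :: real^'n)" unfolding gauss_def[abs_def] by (intro continuous_intros) auto
  moreover have "(\<lambda>j. inverse (real (Suc j)) *\<^sub>R \<xi>) \<longlonglongrightarrow> 0 *\<^sub>R \<xi>"
   by (intro tendsto_intros LIMSEQ_inverse_real_of_nat)
  ultimately have "(\<lambda>j. gauss (inverse (real (Suc j)) *\<^sub>R \<xi>)) \<longlonglongrightarrow> gauss (0 :: real^'n)"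
   by (intro isCont_tendsto_compose[of "0 :: real^'n" gauss]) simp_all
  then have "(\<lambda>j. ennreal ((norm (FT f \<xi>))^2 * gauss (inverse (real (Suc j)) *\<^sub>R \<xi>))) \<longlonglongrightarrow> ennreal ((norm (FT f \<xi>))^2 * gauss (0 :: real^'n))"
   by (intro tendsto_ennrealI tendsto_intros)
  from lim_imp_Liminf[OF _ this]
  show "ennreal ((norm (FT f \<xi>))^2) = liminf (\<lambda>j. ennreal ((norm (FT f \<xi>))^2 * gauss (inverse (real (Suc j)) *\<^sub>R \<xi>)))"
   by (simp add: gauss_def)
 qed
 also have "\<dots> \<le> liminf (\<lambda>j. \<integral>\<^sup>+\<xi>. ennreal ((norm (FT f \<xi>))^2 * gauss (inverse (real (Suc j)) *\<^sub>R \<xi>)) \<partial>lborel)"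
  by (rule nn_integral_liminf) measurable
 also have "\<dots> \<le> ennreal (\<kappa> TYPE('n)) * nnint (\<lambda>x. (norm (f x))^2)"
  using plancherel_regularised[OF f] by (intro Liminf_le) auto
 finally show ?thesis .
qed

text \<open>A Gaussian factor is inserted into the inversion integral. By the multiplication formula
  the result is an average of \<open>f\<close> around \<open>x\<close> at scale s. Integrability of
  \<open>FT f\<close> gives the limit on one side, boundedness and continuity of \<open>f\<close> on
  the other.\<close>

lemma fourier_inversion:
 fixes f :: "real^'n::finite \<Rightarrow> complex"
 assumes f: "L1 f" "\<And>x. norm (f x) \<le> B" "continuous_on UNIV f" and Ff: "L1 (FT f)"
 shows "FT (FT f) (- x) = cplx (\<kappa> TYPE('n)) * f x"
proof -
 have [measurable]: "f \<in> \<B>" using f by auto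
 note [measurable] = FT_measurable[of f]
 define s where "s j = inverse (real (Suc j))" for j
 let ?Z = "\<lambda>j \<xi>::real^'n. FT f \<xi> * (cis (x \<bullet> \<xi>) * cplx (gauss (s j *\<^sub>R \<xi>)))"
 let ?Y = "\<lambda>z::real^'n. cplx (sqrt (\<kappa> TYPE('n)) * gauss z)"
 have s: "s j > 0" for j by (simp add: s_def)
 have s0: "s \<longlonglongrightarrow> 0" unfolding s_def by (rule LIMSEQ_inverse_real_of_nat)
 have gcont: "isCont (gauss :: real^'n \<Rightarrow> real) 0" unfolding gauss_def[abs_def] by (intro continuous_intros) auto
 have key: "(LBINT \<xi>. (?Z j \<xi>))
   = (LBINT z. f (x + s j *\<^sub>R z) * (?Y z))" for j
 proof -
  let ?g = "\<lambda>\<xi>. cis (x \<bullet> \<xi>) * cplx (gauss (s j *\<^sub>R \<xi>))"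
  have gi: "L1 (\<lambda>x::real^'n. cplx (gauss (s j *\<^sub>R x)))" using s[of j] by (intro gauss_scaled_integrable) simp
  have gi': "L1 ?g" using FT_integrable[OF gi, of "- x"] by (simp add: inner_commute)
  have "FT ?g y = cplx (gauss_kernel (s j) (y - x))" for y
  proof -
   have "FT ?g y = FT (\<lambda>x. cplx (gauss (s j *\<^sub>R x))) (y - x)"
    unfolding FT_def by (simp add: mult.assoc[symmetric] cis_mult inner_diff_right inner_commute)
   then show ?thesis by (simp add: FT_gauss_scaled[OF s])
  qed
  then have "(LBINT \<xi>. FT f \<xi> * ?g \<xi>) = (LBINT y. f y * cplx (gauss_kernel (s j) (y - x)))"
   using FT_multiplication[OF f(1) gi'] by simp
  also have "\<dots> = \<bar>s j\<bar> ^ DIM(real^'n) *\<^sub>R (LBINT z. f (x + s j *\<^sub>R z) * cplx (gauss_kernel (s j) (x + s j *\<^sub>R z - x)))"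
   using s[of j] by (intro integral_lborel_affine) simp
  also have "\<dots> = (LBINT z. f (x + s j *\<^sub>R z) * (?Y z))"
  proof -
   have gk: "gauss_kernel (s j) (x + s j *\<^sub>R z - x) * \<bar>s j\<bar> ^ DIM(real^'n) = sqrt (\<kappa> TYPE('n)) * gauss z" for z
    using s[of j] by (simp add: gauss_kernel_def power_divide)
   have "r *\<^sub>R (a * cplx b) = a * cplx (b * r)" for r b :: real and a by (simp add: scaleR_conv_of_real)
   then show ?thesis by (simp only: integral_scaleR_right[symmetric] gk)
  qed
  finally show ?thesis .
 qed
 have "(\<lambda>j. LBINT \<xi>. (?Z j \<xi>)) \<longlonglongrightarrow> (LBINT \<xi>. FT f \<xi> * (cis (x \<bullet> \<xi>) * 1))"
 proof (rule integral_dominated_convergence[where w = "\<lambda>\<xi>. norm (FT f \<xi>)"])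
  show "AE \<xi> in lborel. (\<lambda>j. (?Z j \<xi>)) \<longlonglongrightarrow> FT f \<xi> * (cis (x \<bullet> \<xi>) * 1)"
  proof (rule AE_I2)
   fix \<xi> :: "real^'n"
   have "(\<lambda>j. s j *\<^sub>R \<xi>) \<longlonglongrightarrow> 0 *\<^sub>R \<xi>" using s0 by (intro tendsto_intros)
   then have "(\<lambda>j. gauss (s j *\<^sub>R \<xi>)) \<longlonglongrightarrow> gauss (0 :: real^'n)"
    using gcont by (intro isCont_tendsto_compose[of "0 :: real^'n" gauss]) simp_all
   then have "(\<lambda>j. cplx (gauss (s j *\<^sub>R \<xi>))) \<longlonglongrightarrow> cplx (gauss (0 :: real^'n))"
    by (rule tendsto_of_real)
   then show "(\<lambda>j. (?Z j \<xi>)) \<longlonglongrightarrow> FT f \<xi> * (cis (x \<bullet> \<xi>) * 1)"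
    by (intro tendsto_intros) (simp add: gauss_def)
  qed
  show "AE \<xi> in lborel. norm (?Z j \<xi>) \<le> norm (FT f \<xi>)" for j
   by (auto simp: norm_mult abs_of_pos[OF gauss_le_1(2)] intro!: mult_left_le gauss_le_1(1))
 qed (use Ff in \<open>auto intro!: integrable_norm\<close>)
 moreover have "(\<lambda>j. LBINT z. f (x + s j *\<^sub>R z) * (?Y z)) \<longlonglongrightarrow> (LBINT z. f x * cplx (sqrt (\<kappa> TYPE('n)) * gauss (z::real^'n)))"
 proof (rule integral_dominated_convergence[where w = "\<lambda>z. B * (sqrt (\<kappa> TYPE('n)) * gauss z)"])
  show "L1 (\<lambda>z::real^'n. B * (sqrt (\<kappa> TYPE('n)) * gauss z))"
   using gauss_integrable by (intro integrable_mult_right) auto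
  show "AE z in lborel. norm (f (x + s j *\<^sub>R z) * (?Y z)) \<le> B * (sqrt (\<kappa> TYPE('n)) * gauss z)" for j
   using f(2) \<kappa>_pos[where 'n = 'n]
   by (auto simp: norm_mult abs_mult abs_of_pos[OF gauss_le_1(2)] less_imp_le[OF gauss_le_1(2)] intro!: mult_right_mono)
  show "AE z in lborel. (\<lambda>j. f (x + s j *\<^sub>R z) * (?Y z)) \<longlonglongrightarrow> f x * (?Y z)"
  proof (rule AE_I2)
   fix z :: "real^'n"
   have "(\<lambda>j. x + s j *\<^sub>R z) \<longlonglongrightarrow> x + 0 *\<^sub>R z" using s0 by (intro tendsto_intros)
   then have "(\<lambda>j. f (x + s j *\<^sub>R z)) \<longlonglongrightarrow> f x"
    using f(3) by (intro isCont_tendsto_compose[of x f]) (auto simp: continuous_on_eq_continuous_at)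
   then show "(\<lambda>j. f (x + s j *\<^sub>R z) * (?Y z)) \<longlonglongrightarrow> f x * (?Y z)" by (intro tendsto_intros)
  qed
 qed auto
 ultimately have "(LBINT \<xi>. FT f \<xi> * (cis (x \<bullet> \<xi>) * 1)) = (LBINT z. f x * cplx (sqrt (\<kappa> TYPE('n)) * gauss (z::real^'n)))"
  unfolding key by (rule LIMSEQ_unique)
 also have "\<dots> = f x * cplx (sqrt (\<kappa> TYPE('n)) * (LBINT z. gauss (z::real^'n)))"
  by (simp only: integral_mult_right_zero integral_complex_of_real)
 also have "\<dots> = cplx (\<kappa> TYPE('n)) * f x"
  using \<kappa>_pos[where 'n = 'n] by (simp only: gauss_mass real_sqrt_mult_self) simp
 finally show ?thesis unfolding FT_def[of "FT f"] by (simp add: inner_commute mult.commute)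
qed

section \<open>The Hausdorff--Young inequality\<close>

lemma nn_integral_powr_from_0:
 assumes a: "a > -1" and c: "0 \<le> c"
 shows "nn (\<lambda>s. ennreal (s powr a) * indicator {0..c} s) = ennreal (c powr (a + 1) / (a + 1))"
proof -
 have "nnint (\<lambda>s. indicator {0..c} s * s powr a) = ennreal (c powr (a + 1) / (a + 1))"
  using has_integral_powr_from_0[OF a c] by (intro nn_integral_has_integral_lebesgue) auto
 moreover have "ennreal (indicator {0..c} s * s powr a) = ennreal (s powr a) * indicator {0..c} s" for s :: real
  by (auto simp: indicator_def)
 ultimately show ?thesis by simp
qed

text \<open>Marcinkiewicz interpolation between \<open>L\<^sup>1 \<rightarrow> L\<^sup>\<infinity>\<close> and \<open>L\<^sup>2 \<rightarrow> L\<^sup>2\<close>: the part of \<open>f\<close> above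
 the height \<open>A s\<close> has a transform bounded by \<open>s/2\<close>, so only the part below contributes to the
 distribution function at \<open>s\<close>.\<close>

lemma FT_distribution_bound:
 fixes f :: "real^'n::finite \<Rightarrow> complex"
 assumes f: "L1 f" and q: "1 < q"
  and norm1: "nnint (\<lambda>x. norm (f x) powr q) \<le> 1" and s: "0 < s"
 shows "emeasure lborel {\<xi>. s < norm (FT f \<xi>)} \<le> ennreal (4 * \<kappa> TYPE('n) / s^2) *
  nn (\<lambda>x. ennreal ((norm (f x))^2) * indicator {x. norm (f x) \<le> (s / 2) powr (- 1 / (q - 1))} x)"
proof -
 have [measurable]: "f \<in> \<B>" using f by auto
 \<comment> \<open>This height satisfies \<open>A powr (1 - q) = s / 2\<close>. Where |f| > A one
   has |f| \<le> A^(1-q) |f|^q, so the normalisation bounds the L^1 norm of the upper part by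
   s/2.\<close>
 define A where "A = (s / 2) powr (- 1 / (q - 1))"
 have A: "0 < A" using s by (simp add: A_def)
 have Aq: "A powr (1 - q) = s / 2"
 proof -
  have "A powr (1 - q) = (s / 2) powr ((- 1 / (q - 1)) * (1 - q))" by (simp only: A_def powr_powr)
  also have "(- 1 / (q - 1)) * (1 - q) = 1" using q by (simp add: field_simps)
  finally show ?thesis using s by simp
 qed
 define f1 where "f1 x = (if norm (f x) \<le> A then 0 else f x)" for x
 define f2 where "f2 x = (if norm (f x) \<le> A then f x else 0)" for x
 have m[measurable]: "f1 \<in> \<B>" "f2 \<in> \<B>" unfolding f1_def[abs_def] f2_def[abs_def] by measurable
 have i1: "L1 f1" by (rule int_bound[OF f]) (auto simp: f1_def)
 have i2: "L1 f2" by (rule int_bound[OF f]) (auto simp: f2_def)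
 note [measurable] = FT_measurable[OF m(1)] FT_measurable[OF m(2)]
 have "nnint (\<lambda>x. norm (f1 x)) \<le> nn (\<lambda>x. ennreal (A powr (1 - q)) * ennreal (norm (f x) powr q))"
 proof (rule nn_integral_mono)
  fix x
  show "ennreal (norm (f1 x)) \<le> ennreal (A powr (1 - q)) * ennreal (norm (f x) powr q)"
  proof (cases "norm (f x) \<le> A")
   case False
   have "norm (f x) = norm (f x) powr (1 - q) * norm (f x) powr q" using False A by (simp flip: powr_add)
   also have "\<dots> \<le> A powr (1 - q) * norm (f x) powr q" using False A q by (intro mult_right_mono powr_mono2') auto
   finally show ?thesis using False by (simp add: f1_def ennreal_leI flip: ennreal_mult)
  qed (simp add: f1_def)
 qed
 also have "\<dots> = ennreal (A powr (1 - q)) * nnint (\<lambda>x. norm (f x) powr q)" by (rule nn_integral_cmult) measurable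
 also have "\<dots> \<le> ennreal (A powr (1 - q)) * 1" by (intro mult_left_mono norm1) simp
 finally have "nnint (\<lambda>x. norm (f1 x)) \<le> ennreal (s / 2)" by (simp add: Aq)
 then have "(LBINT x. norm (f1 x)) \<le> s / 2"
  using s by (subst (asm) nn_integral_eq_integral) (auto intro: integrable_norm[OF i1])
 then have F1: "norm (FT f1 \<xi>) \<le> s / 2" for \<xi> using FT_norm_le[OF i1, of \<xi>] by linarith
 have split: "FT f \<xi> = FT f1 \<xi> + FT f2 \<xi>" for \<xi>
 proof -
  have "f = (\<lambda>x. f1 x + f2 x)" by (auto simp: f1_def f2_def)
  then show ?thesis using FT_add[OF i1 i2, of \<xi>] by simp
 qed
 have "emeasure lborel {\<xi>. s < norm (FT f \<xi>)} \<le> emeasure lborel {\<xi>. s / 2 \<le> norm (FT f2 \<xi>)}"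
 proof (rule emeasure_mono)
  show "{\<xi>. s < norm (FT f \<xi>)} \<subseteq> {\<xi>. s / 2 \<le> norm (FT f2 \<xi>)}"
  proof safe
   fix \<xi> assume "s < norm (FT f \<xi>)"
   then show "s / 2 \<le> norm (FT f2 \<xi>)" using norm_triangle_ineq[of "FT f1 \<xi>" "FT f2 \<xi>"] F1[of \<xi>] split[of \<xi>] by simp
  qed
 qed measurable
 also have "\<dots> = nn (\<lambda>\<xi>. indicator {\<xi>. s / 2 \<le> norm (FT f2 \<xi>)} \<xi>)" by (rule nn_integral_indicator[symmetric]) measurable
 also have "\<dots> \<le> nn (\<lambda>\<xi>. ennreal (4 / s^2) * ennreal ((norm (FT f2 \<xi>))^2))"
 proof (rule nn_integral_mono)
  fix \<xi>
  show "indicator {\<xi>. s / 2 \<le> norm (FT f2 \<xi>)} \<xi> \<le> ennreal (4 / s^2) * ennreal ((norm (FT f2 \<xi>))^2)"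
  proof (cases "s / 2 \<le> norm (FT f2 \<xi>)")
   case True
   have "1 \<le> 4 / s^2 * (norm (FT f2 \<xi>))^2" using s power_mono[OF True, of 2] by (simp add: field_simps)
   then show ?thesis using True by (simp flip: ennreal_mult)
  qed simp
 qed
 also have "\<dots> = ennreal (4 / s^2) * nn (\<lambda>\<xi>. ennreal ((norm (FT f2 \<xi>))^2))" by (rule nn_integral_cmult) measurable
 also have "\<dots> \<le> ennreal (4 / s^2) * (ennreal (\<kappa> TYPE('n)) * nnint (\<lambda>x. (norm (f2 x))^2))"
  by (intro mult_left_mono plancherel_le i2) simp
 also have "\<dots> = ennreal (4 * \<kappa> TYPE('n) / s^2) * nnint (\<lambda>x. (norm (f2 x))^2)"
  using \<kappa>_pos[where 'n = 'n] by (simp add: mult.assoc[symmetric] ennreal_mult[symmetric])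
 also have "nnint (\<lambda>x. (norm (f2 x))^2) = nn (\<lambda>x. ennreal ((norm (f x))^2) * indicator {x. norm (f x) \<le> A} x)"
  by (intro nn_integral_cong) (auto simp: f2_def)
 finally show ?thesis by (simp only: A_def)
qed

text \<open>The layer-cake formula reduces the L^p norm to the distribution function. After the
  bound of \<open>FT_distribution_bound\<close> and a change of order, the inner integral of s^(p-3)
  extends to 2 |f|^(1-q). It converges because p > 2, and conjugacy of the exponents turns |f|^2
  |f|^((1-q)(p-2)) into |f|^q. The constant degenerates as p tends to 2.\<close>

lemma hausdorff_young_normalised:
 fixes f :: "real^'n::finite \<Rightarrow> complex"
 assumes f: "L1 f" and q: "1 < q" "q < 2" and p: "1 / p = 1 - 1 / q"
  and norm1: "nnint (\<lambda>x. norm (f x) powr q) \<le> 1"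
 shows "nn (\<lambda>\<xi>. ennreal (norm (FT f \<xi>) powr p)) \<le> ennreal (p * (4 * \<kappa> TYPE('n)) * (2 powr (p - 2) / (p - 2)))"
proof -
 have fm[measurable]: "f \<in> \<B>" using f by auto
 note [measurable] = FT_measurable[OF fm]
 have pq: "p = q / (q - 1)"
 proof -
  have "p = 1 / (1 / p)" by simp
  also have "\<dots> = q / (q - 1)" unfolding p using q by (simp add: field_simps)
  finally show ?thesis .
 qed
 have p2: "2 < p" unfolding pq using q by (simp add: field_simps)
 have p3: "(1 - q) * (p - 2) = q - 2" unfolding pq using q by (simp add: field_simps)
 let ?A = "\<lambda>s. (s / 2) powr (- 1 / (q - 1))"
 let ?k = "p * (4 * \<kappa> TYPE('n))" and ?M = "2 powr (p - 2) / (p - 2)"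
 let ?E = "\<lambda>s y::real. ennreal (p * s powr (p - 1)) * indicator {0<..} s * indicator {s. s < y} s"
 let ?D = "\<lambda>s y::real. ennreal (s powr (p - 3)) * indicator {0<..} s * indicator {s. y \<le> ?A s} s"
 let ?H = "\<lambda>x s. ennreal ?k * (ennreal ((norm (f x))^2) * ?D s (norm (f x)))"
 have "nn (\<lambda>\<xi>. ennreal (norm (FT f \<xi>) powr p))
  = nn (\<lambda>\<xi>. nn (\<lambda>s. ?E s (norm (FT f \<xi>))))"
 proof (rule nn_integral_cong)
  fix \<xi> :: "real^'n"
  let ?c = "norm (FT f \<xi>)"
  have "nn (\<lambda>s. ?E s ?c)
   = nn (\<lambda>s. ennreal p * (ennreal (s powr (p - 1)) * indicator {0..?c} s))"
  \<comment> \<open>The two end points are null sets, so the open interval of the layer-cake formula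
    may be closed.\<close>
  proof (rule nn_integral_cong_AE)
   have "AE s in lborel. s \<noteq> ?c" by (rule AE_lborel_singleton)
   moreover have "AE s in lborel. s \<noteq> (0::real)" by (rule AE_lborel_singleton)
   ultimately show "AE s in lborel. ?E s ?c
    = ennreal p * (ennreal (s powr (p - 1)) * indicator {0..?c} s)"
    by eventually_elim (use p2 in \<open>auto simp: indicator_def ennreal_mult\<close>)
  qed
  also have "\<dots> = ennreal p * nn (\<lambda>s. ennreal (s powr (p - 1)) * indicator {0..?c} s)"
   by (rule nn_integral_cmult) measurable
  also have "\<dots> = ennreal (?c powr p)" using p2 by (subst nn_integral_powr_from_0) (auto simp flip: ennreal_mult)
  finally show "ennreal (?c powr p) = nn (\<lambda>s. ?E s ?c)" ..
 qed
 also have "\<dots> = nn (\<lambda>s. nn (\<lambda>\<xi>. ?E s (norm (FT f \<xi>))))"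
  by (rule lborel_pair.Fubini') (simp add: indicator_def)
 also have "\<dots> \<le> nn (\<lambda>s. nn (\<lambda>x. ?H x s))"
 proof (rule nn_integral_mono)
  fix s :: real
  show "nn (\<lambda>\<xi>. ?E s (norm (FT f \<xi>)))
   \<le> nn (\<lambda>x. ?H x s)"
  proof (cases "0 < s")
   case True
   have "nn (\<lambda>\<xi>. ?E s (norm (FT f \<xi>)))
    = nn (\<lambda>\<xi>. ennreal (p * s powr (p - 1)) * indicator {\<xi>. s < norm (FT f \<xi>)} \<xi>)"
    using True by (intro nn_integral_cong) (auto simp: indicator_def)
   also have "\<dots> = ennreal (p * s powr (p - 1)) * emeasure lborel {\<xi>. s < norm (FT f \<xi>)}"
    by (rule nn_integral_cmult_indicator) measurable
   also have "\<dots> \<le> ennreal (p * s powr (p - 1)) * (ennreal (4 * \<kappa> TYPE('n) / s^2) *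
     nn (\<lambda>x. ennreal ((norm (f x))^2) * indicator {x. norm (f x) \<le> ?A s} x))"
    by (intro mult_left_mono FT_distribution_bound f q norm1 True) simp
   also have "\<dots> = ennreal (?k * s powr (p - 3)) * nn (\<lambda>x. ennreal ((norm (f x))^2) * indicator {x. norm (f x) \<le> ?A s} x)"
   proof -
    have "s powr (p - 1) = s powr (p - 3) * s^2" using True powr_add[of s "p - 3" 2] by simp
    then have "p * s powr (p - 1) * (4 * \<kappa> TYPE('n) / s^2) = ?k * s powr (p - 3)" using True by simp
    moreover have "0 \<le> p * s powr (p - 1)" "0 \<le> 4 * \<kappa> TYPE('n) / s^2" using p2 \<kappa>_pos[where 'n = 'n] by auto
    ultimately show ?thesis by (simp only: mult.assoc[symmetric] ennreal_mult[symmetric])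
   qed
   also have "\<dots> = nn (\<lambda>x. ennreal (?k * s powr (p - 3)) * (ennreal ((norm (f x))^2) * indicator {x. norm (f x) \<le> ?A s} x))"
    by (rule nn_integral_cmult[symmetric]) measurable
   also have "\<dots> = nn (\<lambda>x. ?H x s)"
    using True p2 \<kappa>_pos[where 'n = 'n] by (intro nn_integral_cong) (auto simp: indicator_def ennreal_mult mult_ac)
   finally show ?thesis .
  qed simp
 qed
 also have "\<dots> = nn (\<lambda>x. nn (\<lambda>s. ?H x s))"
  by (rule lborel_pair.Fubini'[symmetric]) (simp only: indicator_def mem_Collect_eq greaterThan_iff, measurable)
 also have "\<dots> \<le> nn (\<lambda>x. ennreal (?k * ?M) * ennreal (norm (f x) powr q))"
 proof (rule nn_integral_mono)
  fix x
  let ?f = "norm (f x)"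
  have "nn (\<lambda>s. ?H x s)
   = ennreal ?k * (ennreal (?f\<^sup>2) * nn (\<lambda>s. ?D s ?f))"
   by (subst nn_integral_cmult, measurable, subst nn_integral_cmult) auto
  also have "\<dots> \<le> ennreal (?k * ?M) * ennreal (?f powr q)"
  proof (cases "f x = 0")
   case False
   let ?b = "2 * ?f powr (1 - q)"
   have "nn (\<lambda>s. ?D s ?f)
    \<le> nn (\<lambda>s. ennreal (s powr (p - 3)) * indicator {0..?b} s)"
   proof (rule nn_integral_mono)
    fix s :: real
    have "s \<le> ?b" if "0 < s" "?f \<le> ?A s"
    proof -
     have "(?A s) powr (1 - q) \<le> ?f powr (1 - q)" using that False q by (intro powr_mono2') auto
     moreover have "(?A s) powr (1 - q) = s / 2"
     proof -
      have "(?A s) powr (1 - q) = (s / 2) powr ((- 1 / (q - 1)) * (1 - q))" by (simp only: powr_powr)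
      also have "(- 1 / (q - 1)) * (1 - q) = 1" using q by (simp add: field_simps)
      finally show ?thesis using that by simp
     qed
     ultimately show ?thesis by simp
    qed
    then show "?D s ?f \<le> ennreal (s powr (p - 3)) * indicator {0..?b} s" by (auto simp: indicator_def)
   qed
   also have "\<dots> = ennreal (?b powr (p - 3 + 1) / (p - 3 + 1))" using p2 by (intro nn_integral_powr_from_0) auto
   also have "?b powr (p - 3 + 1) / (p - 3 + 1) = ?M * ?f powr (q - 2)" by (simp add: powr_mult powr_powr p3)
   finally have "ennreal ?k * (ennreal (?f\<^sup>2) * nn (\<lambda>s. ?D s ?f))
    \<le> ennreal ?k * (ennreal (?f\<^sup>2) * ennreal (?M * ?f powr (q - 2)))" by (intro mult_left_mono) auto
   also have "\<dots> = ennreal (?k * ?M * (?f\<^sup>2 * ?f powr (q - 2)))"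
    using p2 \<kappa>_pos[where 'n = 'n] by (simp add: ennreal_mult[symmetric] mult_ac)
   also have "?f\<^sup>2 * ?f powr (q - 2) = ?f powr q" using False powr_add[of ?f 2 "q - 2"] by simp
   also have "ennreal (?k * ?M * ?f powr q)
    = ennreal (?k * ?M) * ennreal (?f powr q)" using p2 \<kappa>_pos[where 'n = 'n] by (intro ennreal_mult) auto
   finally show ?thesis .
  qed simp
  finally show "nn (\<lambda>s. ?H x s)
   \<le> ennreal (?k * ?M) * ennreal (?f powr q)" .
 qed
 also have "\<dots> = ennreal (?k * ?M) * nnint (\<lambda>x. norm (f x) powr q)" by (rule nn_integral_cmult) measurable
 also have "\<dots> \<le> ennreal (?k * ?M) * 1" by (intro mult_left_mono norm1) simp
 finally show ?thesis by simp
qed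

lemma hausdorff_young:
 assumes a: "1 / 2 \<le> a" "a \<le> 1"
 obtains C where "0 < C" "\<And>(f :: real^'n::finite \<Rightarrow> complex) B. L1 f \<Longrightarrow> 0 < B \<Longrightarrow> Lb a B f \<Longrightarrow> Lb (1 - a) (C * B) (FT f)"
proof -
 have FTm: "FT f \<in> \<B>" if "L1 f" for f :: "real^'n \<Rightarrow> complex" using that by (intro FT_measurable) auto
 consider "a = 1" | "a = 1 / 2" | "1 / 2 < a" "a < 1" using a by linarith
 then show ?thesis
 proof cases
  case 1
  show ?thesis
  proof (rule that[of 1])
   fix f :: "real^'n \<Rightarrow> complex" and B :: real
   assume f: "L1 f" "0 < B" "Lb a B f"
   have "ennreal (LBINT x. norm (f x)) = nnint (\<lambda>x. norm (f x))"
    by (rule nn_integral_eq_integral[symmetric]) (auto intro: integrable_norm f)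
   also have "\<dots> \<le> ennreal B" using f 1 by (simp add: Lb_def)
   finally have "(LBINT x. norm (f x)) \<le> B" using f by simp
   then have "norm (FT f \<xi>) \<le> B" for \<xi> using FT_norm_le[OF f(1), of \<xi>] by linarith
   then show "Lb (1 - a) (1 * B) (FT f)" using 1 f FTm by (simp add: Lb_def)
  qed simp
 next
  case 2
  show ?thesis
  proof (rule that[of "sqrt (\<kappa> TYPE('n))"])
   fix f :: "real^'n \<Rightarrow> complex" and B :: real
   assume f: "L1 f" "0 < B" "Lb a B f"
   have "nn (\<lambda>\<xi>. ennreal ((norm (FT f \<xi>))^2)) \<le> ennreal (\<kappa> TYPE('n)) * nnint (\<lambda>x. (norm (f x))^2)"
    by (rule plancherel_le[OF f(1)])
   also have "\<dots> \<le> ennreal (\<kappa> TYPE('n)) * ennreal (B^2)" using f 2 by (intro mult_left_mono) (auto simp: Lb_def)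
   also have "\<dots> = ennreal ((sqrt (\<kappa> TYPE('n)) * B)^2)"
    using \<kappa>_pos[where 'n = 'n] by (simp add: power_mult_distrib flip: ennreal_mult)
   finally show "Lb (1 - a) (sqrt (\<kappa> TYPE('n)) * B) (FT f)"
    using f FTm[OF f(1)] \<kappa>_pos[where 'n = 'n] by (simp add: Lb_def 2)
  qed (simp add: \<kappa>_pos)
 next
  case 3
  define p where "p = 1 / (1 - a)"
  define K where "K = p * (4 * \<kappa> TYPE('n)) * (2 powr (p - 2) / (p - 2))"
  have p2: "2 < p" using 3 by (simp add: p_def field_simps)
  have K: "0 < K" using p2 \<kappa>_pos[where 'n = 'n] by (simp add: K_def)
  show ?thesis
  proof (rule that[of "K powr (1 - a)"])
   fix f :: "real^'n \<Rightarrow> complex" and B :: real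
   assume f: "L1 f" "0 < B" "Lb a B f"
   define h where "h x = cplx (1 / B) * f x" for x
   have "Lb a (\<bar>1 / B\<bar> * B) (\<lambda>x. (1 / B) *\<^sub>R f x)" using a by (intro Lb_scaleR f) auto
   then have hL: "Lb a 1 h" using f(2) unfolding h_def[abs_def] scaleR_conv_of_real by simp
   have hi: "L1 h" unfolding h_def[abs_def] by (intro integrable_mult_right f(1))
   have "nn (\<lambda>\<xi>. ennreal (norm (FT h \<xi>) powr p)) \<le> ennreal K" unfolding K_def
    by (rule hausdorff_young_normalised[OF hi, of "1 / a"]) (use 3 hL in \<open>simp_all add: p_def Lb_def, simp add: field_simps\<close>)
   also have "K = (K powr (1 - a)) powr p" using 3 K by (simp add: powr_powr p_def)
   finally have "Lb (1 - a) (K powr (1 - a)) (FT h)" using 3 FTm[OF hi] by (simp add: Lb_def p_def)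
   then have "Lb (1 - a) (\<bar>B\<bar> * K powr (1 - a)) (\<lambda>\<xi>. B *\<^sub>R FT h \<xi>)"
    using 3 by (intro Lb_scaleR) auto
   moreover have "B *\<^sub>R FT h \<xi> = FT f \<xi>" for \<xi>
    unfolding h_def[abs_def] FT_cmult using f(2) by (simp add: scaleR_conv_of_real)
   ultimately show "Lb (1 - a) (K powr (1 - a) * B) (FT f)" using f(2) by (simp add: mult.commute)
  qed (use K in simp)
 qed
qed

section \<open>Decay and multipliers\<close>

lemma has_vector_derivative_partial_deriv:
 assumes "f differentiable (at x)"
 shows "((\<lambda>s. f (x + s *\<^sub>R axis j 1)) has_vector_derivative pd j f x) (at 0)"
proof -
 have "((\<lambda>s. x + s *\<^sub>R axis j 1) has_derivative (\<lambda>s. s *\<^sub>R axis j 1)) (at 0)"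
  by (auto intro!: derivative_eq_intros)
 moreover have "(f has_derivative (\<lambda>h. \<Sum>k\<in>UNIV. (h $ k) *\<^sub>R pd k f x)) (at (x + 0 *\<^sub>R axis j 1))"
  using has_derivative_partial_deriv[OF assms] by simp
 ultimately have "((\<lambda>s. f (x + s *\<^sub>R axis j 1)) has_derivative (\<lambda>s. \<Sum>k\<in>UNIV. ((s *\<^sub>R axis j 1) $ k) *\<^sub>R pd k f x)) (at 0)"
  by (rule has_derivative_compose)
 moreover have "(\<Sum>k\<in>UNIV. ((s *\<^sub>R axis j 1) $ k) *\<^sub>R pd k f x) = s *\<^sub>R pd j f x" for s
  by (simp flip: scaleR_scaleR scaleR_sum_right)
 ultimately show ?thesis unfolding has_vector_derivative_def by simp
qed

lemma has_vector_derivative_cis: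
 "((\<lambda>s. cis (a + s * b)) has_vector_derivative (\<i> * of_real b * cis (a + t * b))) (at t)"
proof -
 have "((\<lambda>z. exp (\<i> * (of_real a + z * of_real b))) has_field_derivative (\<i> * of_real b * exp (\<i> * (of_real a + of_real t * of_real b)))) (at (of_real t))"
  by (auto intro!: derivative_eq_intros)
 from has_vector_derivative_real_field[OF this]
 show ?thesis by (simp add: cis_conv_exp)
qed

lemma FT_partial_deriv:
 fixes f :: "real^'n::finite \<Rightarrow> complex"
 assumes f: "smooth_csupp f"
 shows "FT (pd j f) \<xi> = \<i> * of_real (\<xi> $ j) * FT f \<xi>"
proof -
 obtain R where R: "\<And>x. norm x > R \<Longrightarrow> f x = 0" using f unfolding smooth_csupp_def by blast
 obtain B0 where "B0 > 0" and B0: "\<And>x. norm (f x) \<le> B0" by (rule smooth_csupp_bounded[OF f]) auto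
 obtain B1 where "B1 > 0" and B1: "\<And>x. norm (pd j f x) \<le> B1"
  by (rule smooth_csupp_bounded[OF smooth_csupp_partial_deriv[OF f]]) auto
 have fi: "L1 f" "L1 (pd j f)" using f smooth_csupp_partial_deriv[OF f] smooth_csupp_integrable by blast+
 have [measurable]: "f \<in> \<B>" "pd j f \<in> \<B>" using fi by auto
 let ?h' = "\<lambda>x. cis (- (x \<bullet> \<xi>)) * pd j f x + \<i> * of_real (- (\<xi> $ j)) * cis (- (x \<bullet> \<xi>)) * f x"
 have "(LBINT x. ?h' x) = 0"
 proof (rule integral_directional_derivative_eq_0[where f = "\<lambda>x. cis (- (x \<bullet> \<xi>)) * f x" and e = "axis j 1" and B = "B1 + \<bar>\<xi> $ j\<bar> * B0" and R = R])
  fix x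
  have "((\<lambda>s. cis (- (x \<bullet> \<xi>) + s * - (\<xi> $ j))) has_vector_derivative (\<i> * of_real (- (\<xi> $ j)) * cis (- (x \<bullet> \<xi>) + 0 * - (\<xi> $ j)))) (at 0)"
   by (rule has_vector_derivative_cis)
  then have "((\<lambda>s. cis (- ((x + s *\<^sub>R axis j 1) \<bullet> \<xi>))) has_vector_derivative (\<i> * of_real (- (\<xi> $ j)) * cis (- (x \<bullet> \<xi>)))) (at 0)"
   by (simp add: inner_add_left inner_axis' algebra_simps)
  moreover have "f differentiable (at x)" using f smooth_differentiable unfolding smooth_csupp_def by auto
  ultimately show "((\<lambda>s. cis (- ((x + s *\<^sub>R axis j 1) \<bullet> \<xi>)) * f (x + s *\<^sub>R axis j 1)) has_vector_derivative ?h' x) (at 0)"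
   using has_vector_derivative_mult[OF _ has_vector_derivative_partial_deriv[of f x j]] by fastforce
  show "norm (?h' x) \<le> B1 + \<bar>\<xi> $ j\<bar> * B0"
   using B0 B1 by (intro order_trans[OF norm_triangle_ineq] add_mono) (auto simp: norm_mult mult_left_mono)
 qed (use R FT_integrable[OF fi(1)] in auto)
 also have "(LBINT x. ?h' x) = FT (pd j f) \<xi> + \<i> * of_real (- (\<xi> $ j)) * FT f \<xi>"
  unfolding FT_def using FT_integrable[OF fi(1)] FT_integrable[OF fi(2)] by (simp add: mult.assoc)
 finally show ?thesis by (simp add: add_eq_0_iff)
qed

text \<open>The Fourier symbol of the derivative along \<open>js\<close>.\<close>

definition mon :: "'n::finite list \<Rightarrow> real^'n \<Rightarrow> complex" where
 "mon js \<xi> = (\<Prod>j\<leftarrow>js. \<i> * of_real (\<xi> $ j))"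

lemma mon_simps [simp]: "mon [] \<xi> = 1" "mon (j # js) \<xi> = \<i> * of_real (\<xi> $ j) * mon js \<xi>"
 by (simp_all add: mon_def)

lemma mon_measurable [measurable]: "mon js \<in> \<B>"
proof (induction js)
 case (Cons j js)
 then have [measurable]: "mon js \<in> \<B>" .
 have "(\<lambda>\<xi>. cplx (\<xi> $ j)) \<in> \<B>" by (intro borel_measurable_continuous_onI continuous_intros)
 then show ?case unfolding mon_simps(2)[abs_def] by measurable
qed (simp add: mon_def[abs_def])

lemma mon_norm_le: "norm (mon js \<xi>) \<le> norm \<xi> ^ length js"
 by (induction js) (auto simp: norm_mult intro!: mult_mono component_le_norm_cart)

lemma mon_minus: "mon js (- \<xi>) = (-1) ^ length js * mon js \<xi>"
 by (induction js) auto

lemma FT_partial_derivs: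
 assumes "smooth_csupp f" shows "FT (pds js f) \<xi> = mon js \<xi> * FT f \<xi>"
 using assms by (induction js) (simp_all add: FT_partial_deriv smooth_csupp_partial_derivs mult.assoc)

lemma finite_lists: "finite {js :: 'n::finite list. length js = N}"
 using finite_lists_length_eq[of "UNIV :: 'n set" N] by simp

lemma sum_lists_Suc:
 "(\<Sum>js\<in>{js :: 'n::finite list. length js = Suc N}. g js) = (\<Sum>j\<in>UNIV. \<Sum>js\<in>{js. length js = N}. g (j # js))"
proof -
 have eq: "{js :: 'n list. length js = Suc N} = (\<lambda>(j, js). j # js) ` (UNIV \<times> {js. length js = N})"
  by (auto simp: length_Suc_conv image_iff)
 have "inj_on (\<lambda>(j, js). j # js) (UNIV \<times> {js :: 'n list. length js = N})" by (auto simp: inj_on_def)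
 then show ?thesis unfolding eq by (subst sum.reindex) (auto simp: sum.cartesian_product comp_def case_prod_beta)
qed

text \<open>Expansion of (|\<xi>_1| + ... + |\<xi>_n|)^N over lists of length N. It trades powers of
  |\<xi>| for derivatives, both for the decay of transforms and for the high-frequency
  estimate.\<close>

lemma norm_power_le_mon: "norm \<xi> ^ N \<le> (\<Sum>js\<in>{js. length js = N}. norm (mon js (\<xi> :: real^'n::finite)))"
proof (induction N)
 case (Suc N)
 have "norm \<xi> * norm \<xi> ^ N \<le> (\<Sum>j\<in>UNIV. \<bar>\<xi> $ j\<bar>) * (\<Sum>js\<in>{js. length js = N}. norm (mon js \<xi>))"
  using Suc norm_le_l1_cart[of \<xi>] by (intro mult_mono) (auto intro: sum_nonneg)
 also have "\<dots> = (\<Sum>js\<in>{js. length js = Suc N}. norm (mon js \<xi>))"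
  by (simp add: sum_lists_Suc norm_mult sum_product)
 finally show ?case by simp
qed simp

lemma FT_decay:
 fixes f :: "real^'n::finite \<Rightarrow> complex"
 assumes f: "smooth_csupp f"
 obtains C where "\<And>\<xi>. (1 + norm \<xi>) ^ N * norm (FT f \<xi>) \<le> C"
proof -
 have "\<exists>C. \<forall>\<xi>. norm \<xi> ^ N * norm (FT f \<xi>) \<le> C" for N
 proof -
  have "norm \<xi> ^ N * norm (FT f \<xi>) \<le> (\<Sum>js\<in>{js. length js = N}. LBINT x. norm (pds js f x))" for \<xi>
  proof -
   have "norm \<xi> ^ N * norm (FT f \<xi>) \<le> (\<Sum>js\<in>{js. length js = N}. norm (mon js \<xi>)) * norm (FT f \<xi>)"
    by (intro mult_right_mono norm_power_le_mon) simp
   also have "\<dots> = (\<Sum>js\<in>{js. length js = N}. norm (FT (pds js f) \<xi>))"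
    by (simp add: FT_partial_derivs[OF f] norm_mult sum_distrib_right)
   also have "\<dots> \<le> (\<Sum>js\<in>{js. length js = N}. LBINT x. norm (pds js f x))"
    by (intro sum_mono FT_norm_le smooth_csupp_integrable smooth_csupp_partial_derivs f)
   finally show ?thesis .
  qed
  then show ?thesis by blast
 qed
 then obtain C0 C1 where C: "\<And>\<xi>. norm \<xi> ^ 0 * norm (FT f \<xi>) \<le> C0" "\<And>\<xi>. norm \<xi> ^ N * norm (FT f \<xi>) \<le> C1"
  by metis
 have "(1 + norm \<xi>) ^ N * norm (FT f \<xi>) \<le> 2 ^ N * (C0 + C1)" for \<xi>
 proof -
  have "(1 + norm \<xi>) ^ N \<le> (2 * max 1 (norm \<xi>)) ^ N" by (intro power_mono) auto
  also have "\<dots> = 2 ^ N * max 1 (norm \<xi>) ^ N" by (simp add: power_mult_distrib)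
  also have "max 1 (norm \<xi>) ^ N \<le> 1 + norm \<xi> ^ N" by (auto simp: max_def)
  finally have "(1 + norm \<xi>) ^ N * norm (FT f \<xi>) \<le> 2 ^ N * (1 + norm \<xi> ^ N) * norm (FT f \<xi>)"
   by (intro mult_right_mono) auto
  also have "\<dots> = 2 ^ N * (norm (FT f \<xi>) + norm \<xi> ^ N * norm (FT f \<xi>))" by (simp add: algebra_simps)
  also have "\<dots> \<le> 2 ^ N * (C0 + C1)" using C[of \<xi>] by (intro mult_left_mono add_mono) auto
  finally show ?thesis .
 qed
 then show ?thesis by (rule that)
qed

text \<open>Integrability at infinity without polar coordinates: \<open>(1 + |x|)\<^sup>n \<ge> \<Prod>\<^sub>i (1 + |x\<^sub>i|)\<close>.\<close>

lemma nn_integral_japanese_real: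
 fixes c :: real
 assumes c: "1 < c"
 shows "nnint (\<lambda>t. (1 + \<bar>t\<bar>) powr (- c)) < \<infinity>"
proof -
 let ?g = "\<lambda>t. ennreal (indicator {1..} t * t powr (- c))"
 have g: "nn (\<lambda>t. ?g t) = ennreal (- (1 powr (- c + 1)) / (- c + 1))"
  using c by (intro nn_integral_has_integral_lebesgue has_integral_powr_to_inf) auto
 have "nnint (\<lambda>t. (1 + \<bar>t\<bar>) powr (- c)) \<le> nn (\<lambda>t. ?g (1 + 1 * t) + ?g (1 + (- 1) * t))"
  by (intro nn_integral_mono) (auto simp: indicator_def abs_if)
 also have "\<dots> = nn (\<lambda>t. ?g (1 + 1 * t)) + nn (\<lambda>t. ?g (1 + (- 1) * t))" by (rule nn_integral_add) measurable
 also have "\<dots> = nn (\<lambda>t. ?g t) + nn (\<lambda>t. ?g t)"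
  using nn_integral_real_affine[of ?g 1 1] nn_integral_real_affine[of ?g "-1" 1] by simp
 finally show ?thesis unfolding g by (rule le_less_trans) (simp flip: ennreal_plus add: ennreal_add_eq_top less_top)
qed

lemma nn_integral_japanese:
 assumes b: "real CARD('n::finite) < b"
 shows "nnint (\<lambda>x. (1 + norm (x :: real^'n)) powr (- b)) < \<infinity>"
proof -
 define c where "c = b / CARD('n)"
 have c: "1 < c" using b by (simp add: c_def field_simps)
 have "nnint (\<lambda>x. (1 + norm (x :: real^'n)) powr (- b)) \<le> nnint (\<lambda>x. \<Prod>i\<in>Basis. (1 + \<bar>(x :: real^'n) \<bullet> i\<bar>) powr (- c))"
 proof (intro nn_integral_mono ennreal_leI)
  fix x :: "real^'n"
  have "(1 + norm x) powr (- b) = (\<Prod>i\<in>(Basis :: (real^'n) set). (1 + norm x) powr (- c))"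
  proof -
   have "((1 + norm x) powr (- c)) ^ CARD('n) = ((1 + norm x) powr (- c)) powr real CARD('n)"
    by (rule powr_realpow[symmetric]) (use add_pos_nonneg[OF zero_less_one norm_ge_zero[of x]] in simp)
   also have "\<dots> = (1 + norm x) powr (- b)" by (simp add: powr_powr c_def)
   finally show ?thesis by simp
  qed
  also have "\<dots> \<le> (\<Prod>i\<in>Basis. (1 + \<bar>x \<bullet> i\<bar>) powr (- c))"
   using c by (intro prod_mono conjI powr_mono2') (auto simp: Basis_le_norm)
  finally show "(1 + norm x) powr (- b) \<le> (\<Prod>i\<in>Basis. (1 + \<bar>x \<bullet> i\<bar>) powr (- c))" .
 qed
 also have "\<dots> = nn (\<lambda>x. (\<Prod>i\<in>Basis. ennreal ((1 + \<bar>(x :: real^'n) \<bullet> i\<bar>) powr (- c))))"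
  by (simp add: prod_ennreal)
 also have "\<dots> = (\<Prod>i\<in>(Basis :: (real^'n) set). \<integral>\<^sup>+t. ennreal ((1 + \<bar>t\<bar>) powr (- c)) \<partial>lborel)"
  by (rule nn_integral_lborel_prod) measurable
 also have "\<dots> < \<infinity>" using nn_integral_japanese_real[OF c] by (simp add: power_less_top_ennreal)
 finally show ?thesis .
qed

lemma integrable_decay:
 fixes g :: "real^'n::finite \<Rightarrow> 'b::{banach, second_countable_topology}"
 assumes g[measurable]: "g \<in> \<B>" and le: "\<And>x. (1 + norm x) ^ (CARD('n) + 1) * norm (g x) \<le> C"
 shows "L1 g"
proof (rule int_bound)
 let ?b = "real CARD('n) + 1"
 show "L1 (\<lambda>x::real^'n. C * (1 + norm x) powr (- ?b))"
 proof (intro integrable_mult_right integrableI_bounded)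
  show "nnint (\<lambda>x. norm ((1 + norm (x :: real^'n)) powr (- ?b))) < \<infinity>"
   using nn_integral_japanese[where 'n = 'n, of ?b] by simp
 qed measurable
 show "AE x in lborel. norm (g x) \<le> norm (C * (1 + norm x) powr (- ?b))"
 proof (rule AE_I2)
  fix x :: "real^'n"
  have pos: "0 < 1 + norm x" by (rule add_pos_nonneg) auto
  have "(1 + norm x) powr ?b = (1 + norm x) ^ (CARD('n) + 1)"
   using powr_realpow[of "1 + norm x" "CARD('n) + 1"] pos by (simp add: add.commute)
  then have "(1 + norm x) powr ?b * norm (g x) \<le> C" using le[of x] by simp
  moreover have "0 < (1 + norm x) powr ?b" using pos by simp
  ultimately have "norm (g x) \<le> C * (1 + norm x) powr (- ?b)"
   unfolding powr_minus by (simp only: divide_inverse[symmetric] pos_le_divide_eq mult.commute)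
  then show "norm (g x) \<le> norm (C * (1 + norm x) powr (- ?b))" by simp
 qed
qed simp

section \<open>Low and high frequency multipliers\<close>

text \<open>(1 + y)^N \<le> 2^N (2 + y^(2N)), and y^(2N) exp(-c y^2) \<le> N!/c^N by one term of the
  exponential series.\<close>

lemma polynomial_gaussian_bounded:
 fixes c :: real
 assumes c: "0 < c"
 obtains D where "0 < D" "\<And>y. 0 \<le> y \<Longrightarrow> (1 + y) ^ N * exp (- (c * y^2)) \<le> D"
proof (rule that[of "2 ^ N * (2 + fact N / c ^ N)"])
 show "0 < 2 ^ N * (2 + fact N / c ^ N)" using c by (simp add: add_pos_pos)
 fix y :: real assume y: "0 \<le> y"
 have "(1 + y) ^ N \<le> (2 * max 1 y) ^ N" using y by (intro power_mono) auto
 also have "\<dots> = 2 ^ N * max 1 y ^ N" by (simp add: power_mult_distrib)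
 also have "max 1 y ^ N \<le> 1 + y ^ N" using y by (auto simp: max_def)
 also have "y ^ N \<le> 1 + (y^2) ^ N"
 proof (cases "y \<le> 1")
  case True
  then have "y ^ N \<le> 1" using y by (intro power_le_one) auto
  moreover have "0 \<le> (y^2) ^ N" by simp
  ultimately show ?thesis by linarith
 next
  case False
  then have "y ^ N \<le> (y^2) ^ N" using y by (intro power_mono) (auto simp: power2_eq_square)
  then show ?thesis by simp
 qed
 finally have "(1 + y) ^ N * exp (- (c * y^2)) \<le> 2 ^ N * (1 + (1 + (y^2) ^ N)) * exp (- (c * y^2))"
  by (intro mult_right_mono) auto
 also have "\<dots> = 2 ^ N * (2 * exp (- (c * y^2)) + (y^2) ^ N * exp (- (c * y^2)))" by (simp add: algebra_simps)
 also have "\<dots> \<le> 2 ^ N * (2 + fact N / c ^ N)"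
 proof (intro mult_left_mono add_mono)
  show "2 * exp (- (c * y^2)) \<le> 2" using c by simp
  have "(c * y^2) ^ N / fact N \<le> exp (c * y^2)" using c by (intro power_div_fact_le_exp) simp
  then show "(y^2) ^ N * exp (- (c * y^2)) \<le> fact N / c ^ N" using c by (simp add: exp_minus power_mult_distrib field_simps)
 qed simp
 finally show "(1 + y) ^ N * exp (- (c * y^2)) \<le> 2 ^ N * (2 + fact N / c ^ N)" .
qed

text \<open>Dilation by \<tau> yields the power \<tau>^(-n a), which is the source of the time rates
  once \<tau> is the square root of 1 + t or its inverse. The condition n a < b is integrability of
  (1 + |\<xi>|)^(-b/a); the alternative a = b = 0 is the bounded constant multiplier.\<close>

lemma Lb_japanese_scaled:
 assumes a: "0 \<le> a" and b: "real CARD('n::finite) * a < b \<or> (a = 0 \<and> b = 0)"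
 obtains V where "0 < V" "\<And>\<tau>. 0 < \<tau> \<Longrightarrow> Lb a (V * \<tau> powr (- (real CARD('n) * a))) (\<lambda>\<xi>::real^'n. (1 + \<tau> * norm \<xi>) powr (- b))"
proof -
 have "0 \<le> real CARD('n) * a" using a by simp
 then have b0: "0 \<le> b" using b by linarith
 show ?thesis
 proof (cases "a = 0")
  case True
  show ?thesis
  proof (rule that[of 1])
   fix \<tau> :: real assume \<tau>: "0 < \<tau>"
   have "(1 + \<tau> * norm \<xi>) powr (- b) \<le> 1 powr (- b)" for \<xi> :: "real^'n"
    using \<tau> b0 by (intro powr_mono2') auto
   then show "Lb a (1 * \<tau> powr (- (real CARD('n) * a))) (\<lambda>\<xi>::real^'n. (1 + \<tau> * norm \<xi>) powr (- b))"
    using True \<tau> by (simp add: Lb_def)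
  qed simp
 next
  case False
  then have a0: "0 < a" using a by simp
  define J where "J = enn2real (nnint (\<lambda>x. (1 + norm (x :: real^'n)) powr (- (b / a))))"
  have "real CARD('n) < b / a" using b a0 by (simp add: field_simps)
  from nn_integral_japanese[OF this]
  have J: "nnint (\<lambda>x. (1 + norm (x :: real^'n)) powr (- (b / a))) = ennreal J" by (simp add: J_def)
  have J0: "0 \<le> J" by (simp add: J_def)
  show ?thesis
  proof (rule that[of "(J + 1) powr a"])
   show "0 < (J + 1) powr a" using J0 by simp
   fix \<tau> :: real assume \<tau>: "0 < \<tau>"
   have "nn (\<lambda>\<xi>. ennreal (norm ((1 + \<tau> * norm (\<xi> :: real^'n)) powr (- b)) powr (1 / a)))
    = nn (\<lambda>\<xi>. ennreal ((1 + norm (0 + \<tau> *\<^sub>R (\<xi> :: real^'n))) powr (- (b / a))))"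
    using \<tau> by (simp add: powr_powr)
   also have "\<dots> = ennreal ((1 / \<tau>) ^ CARD('n)) * (ennreal (\<tau> ^ CARD('n)) * nn (\<lambda>\<xi>. ennreal ((1 + norm (0 + \<tau> *\<^sub>R (\<xi> :: real^'n))) powr (- (b / a)))))"
    using \<tau> by (simp add: mult.assoc[symmetric] ennreal_mult[symmetric] power_mult_distrib[symmetric])
   also have "ennreal (\<tau> ^ CARD('n)) * nn (\<lambda>\<xi>. ennreal ((1 + norm (0 + \<tau> *\<^sub>R (\<xi> :: real^'n))) powr (- (b / a)))) = ennreal J"
    using \<tau> nn_integral_lborel_affine[of "\<lambda>x::real^'n. ennreal ((1 + norm x) powr (- (b / a)))" \<tau> 0] J by simp
   also have "ennreal ((1 / \<tau>) ^ CARD('n)) * ennreal J \<le> ennreal ((1 / \<tau>) ^ CARD('n) * (J + 1))"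
    using \<tau> J0 by (simp flip: ennreal_mult)
   also have "(1 / \<tau>) ^ CARD('n) * (J + 1) = ((J + 1) powr a * \<tau> powr (- (real CARD('n) * a))) powr (1 / a)"
   proof -
    have e: "- (real CARD('n) * a) * (1 / a) = - real CARD('n)" "a * (1 / a) = 1" using a0 by auto
    have "((J + 1) powr a * \<tau> powr (- (real CARD('n) * a))) powr (1 / a) = (J + 1) powr 1 * \<tau> powr (- real CARD('n))"
     using \<tau> J0 by (simp only: powr_mult powr_powr e powr_ge_zero)
    then show ?thesis using \<tau> J0 by (simp add: powr_minus powr_realpow power_inverse divide_inverse mult.commute)
   qed
   finally show "Lb a ((J + 1) powr a * \<tau> powr (- (real CARD('n) * a))) (\<lambda>\<xi>::real^'n. (1 + \<tau> * norm \<xi>) powr (- b))"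
    using a0 by (simp add: Lb_def)
  qed
 qed
qed

text \<open>With \<tau> = sqrt(1 + t) and y = \<tau>|\<xi>|, the factor |\<xi>|^k is \<tau>^(-k)
  y^k, and the Gaussian in y absorbs every power of 1 + y. What remains is \<tau>^(-k) (1 +
  y)^(-(n+1)) up to a constant, and n + 1 > n a because a \<le> 1. The constant exp c pays for
  replacing t by 1 + t where |\<xi>| \<le> 1.\<close>

lemma low_frequency_multiplier:
 assumes c: "0 < c" and a: "0 \<le> a" "a \<le> 1"
 obtains C where "0 < C" "\<And>t. 0 \<le> t \<Longrightarrow>
  Lb a (C * (1 + t) powr (- (real CARD('n) * a / 2) - real k / 2))
   (\<lambda>\<xi>::real^'n::finite. indicator (cball 0 1) \<xi> * (norm \<xi> ^ k * exp (- (c * (norm \<xi>)^2 * t))))"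
proof -
 let ?b = "real (CARD('n) + 1)"
 have "real CARD('n) * a \<le> real CARD('n) * 1" using a by (intro mult_left_mono) auto
 also have "\<dots> < ?b" by simp
 finally obtain V where V: "0 < V" "\<And>\<tau>. 0 < \<tau> \<Longrightarrow> Lb a (V * \<tau> powr (- (real CARD('n) * a))) (\<lambda>\<xi>::real^'n. (1 + \<tau> * norm \<xi>) powr (- ?b))"
  using Lb_japanese_scaled[OF a(1), of ?b] by metis
 obtain D where D: "0 < D" "\<And>y. 0 \<le> y \<Longrightarrow> (1 + y) ^ (CARD('n) + 1 + k) * exp (- (c * y^2)) \<le> D"
  using polynomial_gaussian_bounded[OF c] by metis
 show ?thesis
 proof (rule that[of "exp c * D * V"])
  fix t :: real assume t: "0 \<le> t"
  define \<tau> where "\<tau> = sqrt (1 + t)"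
  let ?f = "\<lambda>\<xi>. indicator (cball 0 1) \<xi> * (norm \<xi> ^ k * exp (- (c * (norm \<xi>)^2 * t)))"
  let ?e = "- (real CARD('n) * a / 2) - real k / 2"
  have \<tau>: "0 < \<tau>" "\<tau>^2 = 1 + t" using t by (auto simp: \<tau>_def)
  have "Lb a (\<bar>exp c * D * \<tau> powr (- real k)\<bar> * (V * \<tau> powr (- (real CARD('n) * a)))) (\<lambda>\<xi>::real^'n. (exp c * D * \<tau> powr (- real k)) *\<^sub>R ((1 + \<tau> * norm \<xi>) powr (- ?b)))"
   using V(2)[OF \<tau>(1)] a(1) by (rule Lb_scaleR)
  also have "\<bar>exp c * D * \<tau> powr (- real k)\<bar> * (V * \<tau> powr (- (real CARD('n) * a))) = exp c * D * V * (1 + t) powr ?e"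
  proof -
   have "\<tau> powr (- real k) * \<tau> powr (- (real CARD('n) * a)) = (1 + t) powr ?e"
   proof -
    have "\<tau> powr (- real k) * \<tau> powr (- (real CARD('n) * a)) = ((1 + t) powr (1 / 2)) powr (- real k + - (real CARD('n) * a))"
     using t by (simp only: powr_add[symmetric]) (simp add: \<tau>_def powr_half_sqrt)
    also have "\<dots> = (1 + t) powr ?e"
     unfolding powr_powr by (rule arg_cong[where f = "\<lambda>e. (1 + t) powr e"]) (simp add: field_simps)
    finally show ?thesis .
   qed
   then show ?thesis using D by (simp add: abs_mult)
  qed
  finally show "Lb a (exp c * D * V * (1 + t) powr ?e)
   (\<lambda>\<xi>::real^'n. (?f \<xi>))"
  proof (rule Lb_cong_norm[OF _ _ _ a(1)])
   have [measurable]: "cball (0 :: real^'n) 1 \<in> sets borel" by simp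
   show "(\<lambda>\<xi>::real^'n. (?f \<xi>)) \<in> \<B>" by measurable
   fix \<xi> :: "real^'n"
   show "norm (?f \<xi>) \<le> norm ((exp c * D * \<tau> powr (- real k)) *\<^sub>R ((1 + \<tau> * norm \<xi>) powr (- ?b)))"
   proof (cases "norm \<xi> \<le> 1")
    case True
    let ?y = "\<tau> * norm \<xi>"
    have y: "0 \<le> ?y" "0 < 1 + ?y" using \<tau> by (auto intro: add_pos_nonneg)
    have "exp (- (c * (norm \<xi>)^2 * t)) = exp (c * (norm \<xi>)^2) * exp (- (c * ?y\<^sup>2))"
     by (simp add: mult_exp_exp power_mult_distrib \<tau>(2) algebra_simps)
    also have "\<dots> \<le> exp c * exp (- (c * ?y\<^sup>2))" using True c by (intro mult_right_mono) (auto simp: power_le_one)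
    finally have "norm \<xi> ^ k * exp (- (c * (norm \<xi>)^2 * t)) \<le> norm \<xi> ^ k * (exp c * exp (- (c * ?y\<^sup>2)))"
     by (intro mult_left_mono) auto
    also have "\<dots> = exp c * \<tau> powr (- real k) * (?y ^ k * exp (- (c * ?y\<^sup>2)))"
     using \<tau> by (simp add: power_mult_distrib powr_minus powr_realpow)
    also have "\<dots> \<le> exp c * \<tau> powr (- real k) * (D * (1 + ?y) powr (- ?b))"
    proof (intro mult_left_mono)
     have "?y ^ k * exp (- (c * ?y\<^sup>2)) * (1 + ?y) ^ (CARD('n) + 1) \<le> (1 + ?y) ^ k * exp (- (c * ?y\<^sup>2)) * (1 + ?y) ^ (CARD('n) + 1)"
      using y by (intro mult_right_mono power_mono) auto
     also have "\<dots> \<le> D" using D(2)[OF y(1)] by (simp add: power_add mult_ac)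
     finally have "?y ^ k * exp (- (c * ?y\<^sup>2)) * (1 + ?y) powr ?b \<le> D" using y by (simp only: powr_realpow)
     then show "?y ^ k * exp (- (c * ?y\<^sup>2)) \<le> D * (1 + ?y) powr (- ?b)"
      using y unfolding powr_minus divide_inverse[symmetric] by (subst pos_le_divide_eq) auto
    qed auto
    finally show ?thesis using True D by (simp add: mult_ac)
   qed simp
  qed
 qed (use V D in simp)
qed

text \<open>With \<tau> = sqrt(1 + t) and y = \<tau>/|\<xi>|, the factor |\<xi>|^(-ell) is
  \<tau>^(-ell) y^ell, and the Gaussian in y gains (1 + y)^(-ell). Since y/(1 + y) = 1/(1 +
  |\<xi>|/\<tau>), the multiplier is at most a constant times \<tau>^(-ell) (1 +
  |\<xi>|/\<tau>)^(-ell). Its norm is finite exactly under the stated condition on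
  \<open>ell\<close>, which becomes the one relating \<open>ell\<close>, r and p in the
  theorem.\<close>

lemma high_frequency_multiplier:
 assumes c: "0 < c" and a: "0 \<le> a" and ell: "real CARD('n) * a < real ell \<or> a = 0"
 obtains C where "0 < C" "\<And>t. 0 \<le> t \<Longrightarrow>
  Lb a (C * (1 + t) powr (- (real ell / 2) + real CARD('n) * a / 2))
   (\<lambda>\<xi>::real^'n::finite. indicator (- cball 0 1) \<xi> * (exp (- (c * t / (norm \<xi>)^2)) / norm \<xi> ^ ell))"
proof -
 have "real CARD('n) * a < real ell \<or> (a = 0 \<and> real ell = 0)" using ell by auto
 then obtain V where V: "0 < V" "\<And>\<tau>. 0 < \<tau> \<Longrightarrow> Lb a (V * \<tau> powr (- (real CARD('n) * a))) (\<lambda>\<xi>::real^'n. (1 + \<tau> * norm \<xi>) powr (- real ell))"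
  using Lb_japanese_scaled[OF a(1), of "real ell"] by metis
 obtain D where D: "0 < D" "\<And>y. 0 \<le> y \<Longrightarrow> (1 + y) ^ ell * exp (- (c * y^2)) \<le> D"
  using polynomial_gaussian_bounded[OF c] by metis
 show ?thesis
 proof (rule that[of "exp c * D * V"])
  fix t :: real assume t: "0 \<le> t"
  define \<tau> where "\<tau> = sqrt (1 + t)"
  let ?f = "\<lambda>\<xi>. indicator (- cball 0 1) \<xi> * (exp (- (c * t / (norm \<xi>)^2)) / norm \<xi> ^ ell)"
  let ?e = "- (real ell / 2) + real CARD('n) * a / 2"
  have \<tau>: "0 < \<tau>" "\<tau>^2 = 1 + t" using t by (auto simp: \<tau>_def)
  have "Lb a (\<bar>exp c * D * \<tau> powr (- real ell)\<bar> * (V * (1 / \<tau>) powr (- (real CARD('n) * a)))) (\<lambda>\<xi>::real^'n. (exp c * D * \<tau> powr (- real ell)) *\<^sub>R ((1 + (1 / \<tau>) * norm \<xi>) powr (- real ell)))"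
   using \<tau>(1) a by (intro Lb_scaleR V(2)) auto
  also have "\<bar>exp c * D * \<tau> powr (- real ell)\<bar> * (V * (1 / \<tau>) powr (- (real CARD('n) * a))) = exp c * D * V * (1 + t) powr ?e"
  proof -
   have "\<tau> powr (- real ell) * (1 / \<tau>) powr (- (real CARD('n) * a)) = \<tau> powr (- real ell) * \<tau> powr (real CARD('n) * a)"
    using \<tau> by (simp add: inverse_powr powr_minus divide_inverse)
   also have "\<dots> = (1 + t) powr ?e"
   proof -
    have "\<tau> powr (- real ell) * \<tau> powr (real CARD('n) * a) = ((1 + t) powr (1 / 2)) powr (- real ell + real CARD('n) * a)"
     using t by (simp only: powr_add[symmetric]) (simp add: \<tau>_def powr_half_sqrt)
    also have "\<dots> = (1 + t) powr ?e"
     unfolding powr_powr by (rule arg_cong[where f = "\<lambda>e. (1 + t) powr e"]) (simp add: field_simps)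
    finally show ?thesis .
   qed
   finally show ?thesis using D by (simp add: abs_mult)
  qed
  finally show "Lb a (exp c * D * V * (1 + t) powr ?e)
   (\<lambda>\<xi>::real^'n. (?f \<xi>))"
  proof (rule Lb_cong_norm[OF _ _ _ a])
   have [measurable]: "cball (0 :: real^'n) 1 \<in> sets borel" by simp
   show "(\<lambda>\<xi>::real^'n. (?f \<xi>)) \<in> \<B>" by measurable
   fix \<xi> :: "real^'n"
   show "norm (?f \<xi>) \<le> norm ((exp c * D * \<tau> powr (- real ell)) *\<^sub>R ((1 + (1 / \<tau>) * norm \<xi>) powr (- real ell)))"
   proof (cases "norm \<xi> > 1")
    case True
    define y where "y = \<tau> / norm \<xi>"
    have y: "0 < y" using \<tau>(1) True unfolding y_def by (intro divide_pos_pos) linarith+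
    have \<xi>0: "\<xi> \<noteq> 0" using True by auto
    have "exp (- (c * t / (norm \<xi>)^2)) = exp (c / (norm \<xi>)^2) * exp (- (c * y^2))"
     by (simp add: mult_exp_exp y_def power_divide \<tau>(2) add_divide_distrib algebra_simps)
    also have "\<dots> \<le> exp c * exp (- (c * y^2))"
     using True c by (intro mult_right_mono) (auto simp: divide_le_eq intro: one_le_power)
    finally have "exp (- (c * t / (norm \<xi>)^2)) / norm \<xi> ^ ell \<le> (exp c * exp (- (c * y^2))) / norm \<xi> ^ ell"
     by (intro divide_right_mono) auto
    also have "\<dots> = exp c * \<tau> powr (- real ell) * (y ^ ell * exp (- (c * y^2)))"
     using \<tau> \<xi>0 by (simp add: y_def power_divide powr_minus powr_realpow)
    also have "\<dots> \<le> exp c * \<tau> powr (- real ell) * (D * (1 + (1 / \<tau>) * norm \<xi>) powr (- real ell))"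
    proof (intro mult_left_mono)
     have z: "1 + (1 / \<tau>) * norm \<xi> = (1 + y) / y" using \<tau> \<xi>0 by (simp add: y_def field_simps)
     have "((1 + y) / y) powr (- real ell) = y ^ ell / (1 + y) ^ ell" using y by (simp add: powr_minus powr_realpow power_divide)
     moreover have "y ^ ell * exp (- (c * y^2)) \<le> D * (y ^ ell / (1 + y) ^ ell)"
      using y mult_left_mono[OF D(2)[of y], of "y ^ ell / (1 + y) ^ ell"] by (simp add: field_simps)
     ultimately show "y ^ ell * exp (- (c * y^2)) \<le> D * (1 + (1 / \<tau>) * norm \<xi>) powr (- real ell)" by (simp only: z)
    qed auto
    finally show ?thesis using True D by (simp add: mult_ac)
   qed simp
  qed
 qed (use V D in simp)
qed

section \<open>The Lyapunov function in Fourier space\<close>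

text \<open>\<open>complex^'m\<close> carries the real inner product Re <u, v>
  (\<open>Re_hinner\<close>). For it the transpose of a real matrix is the adjoint and
  multiplication by \<i> is skew (\<open>inner_cm\<close>, \<open>inner_ii\<close>); all quadratic
  forms below are taken in it.\<close>

definition cm :: "real^'m^'m \<Rightarrow> complex^'m \<Rightarrow> complex^'m" where
 "cm X u = cmat X *v u"

lemma cm_nth: "cm X u $ i = (\<Sum>j\<in>UNIV. cplx (X $ i $ j) * u $ j)"
 by (simp add: cm_def matrix_vector_mult_def map_matrix_def)

lemma cm_add: "cm X (u + v) = cm X u + cm X v"
 and cm_diff: "cm X (u - v) = cm X u - cm X v"
 and cm_minus: "cm X (- u) = - cm X u"
 and cm_ii: "cm X (\<i> *s u) = \<i> *s cm X u"
 and cm_0: "cm X 0 = 0"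
 and cm_add_left: "cm (X + Y) u = cm X u + cm Y u"
 and cm_minus_left: "cm (- X) u = - cm X u"
 by (simp_all add: vec_eq_iff cm_nth algebra_simps sum.distrib sum_subtractf sum_negf sum_distrib_left)

lemma cm_scaleR: "cm X (r *\<^sub>R u) = r *\<^sub>R cm X u"
 by (simp add: vec_eq_iff cm_nth scaleR_sum_right)

lemma cm_scaleR_left: "cm (r *\<^sub>R X) u = r *\<^sub>R cm X u"
 by (simp add: vec_eq_iff cm_nth scaleR_sum_right scaleR_conv_of_real[where 'a = complex] mult.assoc sum_distrib_left)

lemma cm_sum_left: "cm (\<Sum>j\<in>J. X j) u = (\<Sum>j\<in>J. cm (X j) u)"
proof (induction J rule: infinite_finite_induct)
 case empty show ?case by (simp add: vec_eq_iff cm_nth)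
qed (simp_all add: cm_add_left, simp add: vec_eq_iff cm_nth)

lemma cm_mult: "cm (X ** Y) u = cm X (cm Y u)"
proof -
 have "(\<Sum>j\<in>UNIV. \<Sum>k\<in>UNIV. cplx (X $ i $ k) * cplx (Y $ k $ j) * u $ j)
   = (\<Sum>k\<in>UNIV. \<Sum>j\<in>UNIV. cplx (X $ i $ k) * cplx (Y $ k $ j) * u $ j)" for i by (rule sum.swap)
 then show ?thesis by (simp add: vec_eq_iff cm_nth matrix_matrix_mult_def sum_distrib_left sum_distrib_right mult.assoc)
qed

lemma inner_cm: "cm X u \<bullet> v = u \<bullet> cm (transpose X) v"
proof -
 have of_real: "(cplx a * w) \<bullet> z = a * (w \<bullet> z)" "w \<bullet> (cplx a * z) = a * (w \<bullet> z)" for a w z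
  by (simp_all add: inner_complex_def algebra_simps)
 have "cm X u \<bullet> v = (\<Sum>i\<in>UNIV. \<Sum>j\<in>UNIV. (X $ i $ j) * (u $ j \<bullet> v $ i))"
  by (simp add: inner_vec_def cm_nth inner_sum_left of_real)
 also have "\<dots> = (\<Sum>j\<in>UNIV. \<Sum>i\<in>UNIV. (X $ i $ j) * (u $ j \<bullet> v $ i))" by (rule sum.swap)
 also have "\<dots> = u \<bullet> cm (transpose X) v" by (simp add: inner_vec_def cm_nth inner_sum_right transpose_def of_real)
 finally show ?thesis .
qed

lemma inner_ii: "(\<i> *s u) \<bullet> v = - (u \<bullet> (\<i> *s v))" for u v :: "complex^'m"
 by (simp add: inner_vec_def inner_complex_def sum_negf[symmetric] algebra_simps)

lemma ii_ii: "\<i> *s (\<i> *s u) = - u" for u :: "complex^'m"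
 by (simp add: vec_eq_iff)

lemma ii_linear: "\<i> *s (u + v) = \<i> *s u + \<i> *s v" "\<i> *s (r *\<^sub>R u) = r *\<^sub>R (\<i> *s u)" "\<i> *s (- u) = - (\<i> *s u)" "\<i> *s (u - v) = \<i> *s u - \<i> *s v" for u v :: "complex^'m"
 by (simp_all add: vec_eq_iff algebra_simps)

lemma norm_ii: "norm (\<i> *s u) = norm u" for u :: "complex^'m"
 by (simp add: norm_vec_def norm_mult)

lemma Re_hinner: "Re (hinner u v) = u \<bullet> v"
 by (simp add: hinner_def inner_vec_def inner_complex_def Re_sum)

lemma inner_ii_symmetric:
 assumes "transpose X = X" shows "(\<i> *s cm X u) \<bullet> u = 0"
proof -
 have "(\<i> *s cm X u) \<bullet> u = - (u \<bullet> cm X (\<i> *s u))"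
  using inner_cm[of X u "\<i> *s u"] assms by (simp add: inner_ii)
 also have "\<dots> = - ((\<i> *s cm X u) \<bullet> u)" by (simp add: cm_ii inner_commute)
 finally show ?thesis by simp
qed

lemma inner_sym_part: "cm (sym_part X) u \<bullet> u = cm X u \<bullet> u"
 using inner_cm[of "transpose X" u u]
 by (simp add: sym_part_def cm_add_left cm_scaleR_left inner_add_left inner_add_right inner_commute)

lemma transpose_add: "transpose (X + Y) = transpose X + transpose Y"
 and transpose_scaleR: "transpose (r *\<^sub>R X) = r *\<^sub>R transpose X" for X Y :: "real^'m^'n"
 by (simp_all add: transpose_def vec_eq_iff)

lemma transpose_sym_part: "transpose (sym_part X) = sym_part X"
 by (simp add: sym_part_def transpose_add transpose_scaleR add.commute)

lemma bounded_linear_cm: "bounded_linear (cm X)"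
 by (intro linear_conv_bounded_linear[THEN iffD1] linearI) (simp_all add: cm_add cm_scaleR)

lemma bounded_linear_ii: "bounded_linear (\<lambda>u :: complex^'m. \<i> *s u)"
 by (intro linear_conv_bounded_linear[THEN iffD1] linearI) (simp_all add: ii_linear)

lemma cm_bound: obtains C where "0 < C" "\<And>u. norm (cm X u) \<le> C * norm u"
 using bounded_linear.pos_bounded[OF bounded_linear_cm[of X]] by (auto simp: mult.commute)

lemma continuous_cm: "continuous_on S f \<Longrightarrow> continuous_on S g \<Longrightarrow> continuous_on S (\<lambda>x. cm (f x) (g x))"
 for f :: "'a::topological_space \<Rightarrow> real^'m^'m"
proof -
 assume fg: "continuous_on S f" "continuous_on S g"
 have "cm (f x) (g x) = (\<chi> i. \<Sum>j\<in>UNIV. cplx (f x $ i $ j) * g x $ j)" for x by (simp add: vec_eq_iff cm_nth)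
 then show ?thesis using fg by (simp only:) (intro continuous_intros)
qed

section \<open>Semidefinite forms and compactness\<close>

text \<open>At a zero of a semidefinite form the gradient vanishes: a short step from
  \<open>q\<close> against \<open>T q\<close> would otherwise make the form negative.\<close>

lemma psd_zero:
 fixes T :: "'a::real_inner \<Rightarrow> 'a"
 assumes T: "linear T" "\<And>u v. T u \<bullet> v = u \<bullet> T v" "\<And>u. 0 \<le> T u \<bullet> u" and q: "T q \<bullet> q = 0"
 shows "T q = 0"
proof (rule ccontr)
 assume nz: "T q \<noteq> 0"
 define v where "v = T q"
 define m where "m = T v \<bullet> v"
 have m: "0 \<le> m" unfolding m_def by (rule T(3))
 \<comment> \<open>This step length keeps the quadratic term \<open>s * m\<close> below |v|^2, hence
   below the linear gain 2 |v|^2; the 1 guards against m = 0.\<close>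
 define s where "s = (v \<bullet> v) / (m + 1)"
 have vv: "0 < v \<bullet> v" using nz by (simp add: v_def)
 have s: "0 < s" using vv m by (simp add: s_def)
 have "0 \<le> T (q - s *\<^sub>R v) \<bullet> (q - s *\<^sub>R v)" by (rule T(3))
 also have "\<dots> = T q \<bullet> q - 2 * s * (v \<bullet> v) + s * s * m"
  using T(2)[of v q] by (simp add: linear_diff[OF T(1)] linear_scale[OF T(1)] inner_diff_left inner_diff_right m_def v_def algebra_simps inner_commute)
 also have "\<dots> = s * (s * m - 2 * (v \<bullet> v))" using q by (simp add: algebra_simps)
 finally have "2 * (v \<bullet> v) \<le> s * m" using s by (simp add: zero_le_mult_iff)
 moreover have "s * m \<le> s * (m + 1)" using s by simp
 moreover have "s * (m + 1) = v \<bullet> v" using m by (simp add: s_def)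
 ultimately show False using vv by linarith
qed

text \<open>\<open>p\<close> is the orthogonal projection onto the kernel. On the unit sphere of the
  complement the form is positive by \<open>psd_zero\<close>, so its minimum there is the constant;
  that sphere is empty when T = 0.\<close>

lemma psd_decomposition:
 fixes T :: "'a::euclidean_space \<Rightarrow> 'a"
 assumes T: "linear T" "\<And>u v. T u \<bullet> v = u \<bullet> T v" "\<And>u. 0 \<le> T u \<bullet> u"
 obtains c where "0 < c" "\<And>u. \<exists>p q. u = p + q \<and> T p = 0 \<and> norm p \<le> norm u \<and> norm q \<le> norm u \<and> c * (norm q)^2 \<le> T u \<bullet> u"
proof -
 define N where "N = {u. T u = 0}"
 have N: "subspace N" unfolding N_def using T(1) by (rule linear_subspace_kernel)
 define X where "X = {u. norm u = 1 \<and> (\<forall>y\<in>N. orthogonal u y)}"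
 have "closed {u. \<forall>y\<in>N. orthogonal u y}" unfolding orthogonal_def Ball_def imp_conv_disj Collect_all_eq
  by (intro closed_INT ballI closed_Collect_disj closed_Collect_const closed_Collect_eq continuous_intros)
 then have "compact (sphere 0 1 \<inter> {u. \<forall>y\<in>N. orthogonal u y})" by (intro compact_Int_closed compact_sphere)
 moreover have "sphere 0 1 \<inter> {u. \<forall>y\<in>N. orthogonal u y} = X" by (auto simp: X_def)
 ultimately have X: "compact X" by simp
 have Tc: "continuous_on X (\<lambda>u. T u \<bullet> u)"
  using T(1) by (intro continuous_intros linear_continuous_on) (simp add: linear_conv_bounded_linear)
 have pos: "0 < T u \<bullet> u" if "u \<in> X" for u
 proof (rule ccontr)
  assume "\<not> 0 < T u \<bullet> u"
  then have "T u \<bullet> u = 0" using T(3)[of u] by simp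
  then have "u \<in> N" unfolding N_def using psd_zero[OF T] by simp
  then have "orthogonal u u" using that by (simp add: X_def)
  then show False using that by (simp add: X_def orthogonal_self)
 qed
 obtain c where c: "0 < c" "\<And>u. u \<in> X \<Longrightarrow> c \<le> T u \<bullet> u"
 proof (cases "X = {}")
  case False
  obtain u0 where "u0 \<in> X" "\<And>u. u \<in> X \<Longrightarrow> T u0 \<bullet> u0 \<le> T u \<bullet> u"
   using continuous_attains_inf[OF X False Tc] by blast
  then show ?thesis using that pos by blast
 qed (use that[of 1] in auto)
 show ?thesis
 proof (rule that[OF c(1)])
  fix u
  obtain p q where pq: "p \<in> span N" "\<And>w. w \<in> span N \<Longrightarrow> orthogonal q w" "u = p + q"
   using orthogonal_subspace_decomp_exists[of N u] by blast
  have pN: "T p = 0" using pq(1) N by (simp add: N_def span_eq_iff[THEN iffD2] )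
  have pyth: "(norm u)^2 = (norm p)^2 + (norm q)^2"
   using pq(2)[OF pq(1)] unfolding pq(3) by (simp add: norm_add_Pythagorean orthogonal_commute)
  have n: "norm p \<le> norm u" "norm q \<le> norm u" by (rule power2_le_imp_le; use pyth in simp)+
  have "T u \<bullet> u = T q \<bullet> (p + q)" unfolding pq(3) by (simp add: linear_add[OF T(1)] pN)
  also have "\<dots> = T q \<bullet> q" using T(2)[of q p] pN by (simp add: inner_add_right)
  finally have Tu: "T u \<bullet> u = T q \<bullet> q" .
  have "c * (norm q)^2 \<le> T q \<bullet> q"
  proof (cases "q = 0")
   case False
   define v where "v = (1 / norm q) *\<^sub>R q"
   have "v \<in> X" using False pq(2) span_base[of _ N] by (auto simp: X_def v_def orthogonal_def)
   then have "c \<le> T v \<bullet> v" by (rule c(2))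
   also have "T v \<bullet> v = (T q \<bullet> q) / (norm q)^2" by (simp add: v_def linear_scale[OF T(1)] power2_eq_square)
   finally show ?thesis using False by (simp add: field_simps)
  qed (simp add: linear_0[OF T(1)])
  then show "\<exists>p q. u = p + q \<and> T p = 0 \<and> norm p \<le> norm u \<and> norm q \<le> norm u \<and> c * (norm q)^2 \<le> T u \<bullet> u"
   using pq(3) pN n Tu by auto
 qed
qed

text \<open>If no multiple of \<open>g\<close> sufficed, points with f + N g \<le> 0 would
  accumulate at a point where f \<le> 0 and, because g \<le> -f/N with f convergent along the
  subsequence, also g = 0.\<close>

lemma compact_combination_pos:
 fixes f g :: "'a::metric_space \<Rightarrow> real"
 assumes X: "compact X" and f: "continuous_on X f" and g: "continuous_on X g"
  and g0: "\<And>x. x \<in> X \<Longrightarrow> 0 \<le> g x" and pos: "\<And>x. x \<in> X \<Longrightarrow> g x = 0 \<Longrightarrow> 0 < f x"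
 obtains c C where "0 < c" "0 < C" "\<And>x. x \<in> X \<Longrightarrow> c \<le> f x + C * g x"
proof -
 have "\<exists>N. \<forall>x\<in>X. 0 < f x + real (Suc N) * g x"
 proof (rule ccontr)
  assume "\<not> ?thesis"
  then have "\<forall>N. \<exists>x\<in>X. f x + real (Suc N) * g x \<le> 0" by (simp add: not_less)
  then obtain x where x: "\<And>N. x N \<in> X" "\<And>N. f (x N) + real (Suc N) * g (x N) \<le> 0" by metis
  obtain l r where l: "l \<in> X" "strict_mono r" "(x \<circ> r) \<longlonglongrightarrow> l"
   using X x(1) unfolding compact_def by metis
  have fl: "(\<lambda>n. f (x (r n))) \<longlonglongrightarrow> f l" and gl: "(\<lambda>n. g (x (r n))) \<longlonglongrightarrow> g l"
   using continuous_on_tendsto_compose[OF f l(3)] continuous_on_tendsto_compose[OF g l(3)] l(1) x(1) by (auto simp: comp_def)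
  have "f l \<le> 0"
  proof (rule LIMSEQ_le_const2[OF fl])
   have "f (x (r n)) \<le> 0" for n
    using x(2)[of "r n"] mult_nonneg_nonneg[OF of_nat_0_le_iff[of "Suc (r n)"] g0[OF x(1)[of "r n"]]] by linarith
   then show "\<exists>N. \<forall>n\<ge>N. f (x (r n)) \<le> 0" by blast
  qed
  moreover have "g l \<le> 0"
  proof (rule LIMSEQ_le[OF gl])
   have "(\<lambda>n. inverse (real (Suc (r n)))) \<longlonglongrightarrow> 0"
    using LIMSEQ_subseq_LIMSEQ[OF LIMSEQ_inverse_real_of_nat l(2)] by (simp add: comp_def)
   from tendsto_mult[OF tendsto_minus[OF fl] this]
   show "(\<lambda>n. - f (x (r n)) * inverse (real (Suc (r n)))) \<longlonglongrightarrow> 0" by simp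
   have "g (x (r n)) \<le> - f (x (r n)) * inverse (real (Suc (r n)))" for n using x(2)[of "r n"] by (simp add: field_simps)
   then show "\<exists>N. \<forall>n\<ge>N. g (x (r n)) \<le> - f (x (r n)) * inverse (real (Suc (r n)))" by blast
  qed
  ultimately show False using g0[OF l(1)] pos[OF l(1)] by simp
 qed
 then obtain N where N: "\<And>x. x \<in> X \<Longrightarrow> 0 < f x + real (Suc N) * g x" by blast
 show ?thesis
 proof (cases "X = {}")
  case False
  have "continuous_on X (\<lambda>x. f x + real (Suc N) * g x)" using f g by (intro continuous_intros)
  then obtain x0 where "x0 \<in> X" "\<forall>x\<in>X. f x0 + real (Suc N) * g x0 \<le> f x + real (Suc N) * g x"
   by (rule bexE[OF continuous_attains_inf[OF X False]])
  then show ?thesis using that[of "f x0 + real (Suc N) * g x0" "real (Suc N)"] N by simp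
 qed (use that[of 1 1] in auto)
qed

text \<open>The combination of the three energy estimates: \<open>x\<^sup>2\<close>, \<open>z\<^sup>2\<close> and \<open>y\<^sup>2\<close> stand for the
 dissipation due to \<open>L\<close>, the one due to \<open>S\<close>, and \<open>|u|\<^sup>2\<close>. The weights \<open>\<epsilon>\<^sup>2/(1+r\<^sup>2)\<close> and
 \<open>\<epsilon>\<^sup>3/(1+r\<^sup>2)\<^sup>2\<close> are forced by the unsigned term \<open>h\<close>, which only the \<open>L\<close> dissipation
 controls.\<close>

lemma dissipation_bound:
 fixes x y z r \<epsilon> :: real
 assumes nn: "0 \<le> x" "0 \<le> y" "0 \<le> z" "0 \<le> r" "0 < \<epsilon>" "0 < kk" "0 \<le> ch" "0 \<le> ce" "0 \<le> ck"
  and small: "\<epsilon> * ch^2 \<le> kk" "\<epsilon> * ce^2 \<le> kk" "\<epsilon> * ck \<le> 1 / 2"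
  and b: "b = \<epsilon>^2 / (1 + r^2)" and a: "a = \<epsilon> ^ 3 / (1 + r^2)^2"
  and h: "\<bar>h\<bar> \<le> ch * x * y" and e: "\<bar>e\<bar> \<le> ce * z * y" and k: "kk * y^2 - ck * z^2 \<le> k"
 shows "a * r^2 * (kk / 4) * y^2 \<le> x^2 + b * z^2 + a * r^2 * k + b * r * h - a * r * e"
proof -
 have D: "0 < 1 + r^2" by (rule add_pos_nonneg) auto
 have pos: "0 < b" "0 < a" using D nn by (auto simp: a b)
 \<comment> \<open>The relations that the weights are built for. The last one lets the cross term
   \<open>b * r * h\<close> be split between x^2, which has weight 1, and a r^2 y^2.\<close>
 have ab: "a * r^2 \<le> \<epsilon> * b" "a \<le> \<epsilon> * b" "(b * r)^2 = \<epsilon> * (a * r^2)"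
 proof -
  have "\<epsilon> * b = a * (1 + r^2)" using D by (simp add: a b power2_eq_square power3_eq_cube)
  then show "a * r^2 \<le> \<epsilon> * b" "a \<le> \<epsilon> * b" using pos by (simp_all add: algebra_simps)
  show "(b * r)^2 = \<epsilon> * (a * r^2)" by (simp add: a b power_mult_distrib power_divide power2_eq_square power3_eq_cube)
 qed
 have h': "- (x^2) - a * r^2 * (kk / 4) * y^2 \<le> b * r * h"
 proof -
  have "b * r * \<bar>h\<bar> \<le> b * r * (ch * x * y)" using h pos nn by (intro mult_left_mono) auto
  also have "\<dots> = x * (b * r * ch * y)" by simp
  also have "\<dots> \<le> x^2 + (b * r * ch * y)^2 / 4"
   using sum_squares_bound[of x "b * r * ch * y / 2"] by (simp add: power_divide)
  also have "(b * r * ch * y)^2 = (b * r)^2 * ch^2 * y^2" by (simp add: power_mult_distrib)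
  also have "\<dots> = a * r^2 * (\<epsilon> * ch^2) * y^2" unfolding ab(3) by simp
  also have "\<dots> \<le> a * r^2 * kk * y^2" using small(1) pos by (intro mult_right_mono mult_left_mono) auto
  finally have "b * r * \<bar>h\<bar> \<le> x^2 + a * r^2 * (kk / 4) * y^2" by simp
  moreover have "- (b * r * \<bar>h\<bar>) \<le> b * r * h" using pos nn
   mult_left_mono[of "- \<bar>h\<bar>" h "b * r"] by simp
  ultimately show ?thesis by linarith
 qed
 have e': "a * r * e \<le> a * r^2 * (kk / 2) * y^2 + (b / 2) * z^2"
 proof -
  have "a * r * e \<le> a * r * (ce * z * y)" using e pos nn by (intro mult_left_mono) auto
  also have "\<dots> = a * ((r * y) * (ce * z))" by simp
  also have "\<dots> \<le> a * (kk / 2 * (r * y)^2 + (ce * z)^2 / (2 * kk))"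
  proof (intro mult_left_mono)
   have "2 * (kk * (r * y)) * (ce * z) \<le> (kk * (r * y))^2 + (ce * z)^2" by (rule sum_squares_bound)
   then have "2 * (kk * (r * y)) * (ce * z) / (2 * kk) \<le> ((kk * (r * y))^2 + (ce * z)^2) / (2 * kk)"
    using nn by (intro divide_right_mono) auto
   then show "(r * y) * (ce * z) \<le> kk / 2 * (r * y)^2 + (ce * z)^2 / (2 * kk)"
    using nn by (simp add: add_divide_distrib power2_eq_square mult_ac)
  qed (use pos in simp)
  also have "\<dots> = a * r^2 * (kk / 2) * y^2 + a * (ce^2 / kk) / 2 * z^2" by (simp add: power_mult_distrib algebra_simps)
  also have "a * (ce^2 / kk) \<le> b"
  proof -
   have "a * (ce^2 / kk) \<le> \<epsilon> * b * (ce^2 / kk)" using ab(2) nn by (intro mult_right_mono) auto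
   also have "\<dots> = b * ((\<epsilon> * ce^2) / kk)" by simp
   also have "\<dots> \<le> b * 1" using small(2) pos nn by (intro mult_left_mono) auto
   finally show ?thesis by simp
  qed
  finally show ?thesis by (simp add: mult_right_mono divide_right_mono)
 qed
 have k': "a * r^2 * kk * y^2 - (b / 2) * z^2 \<le> a * r^2 * k"
 proof -
  have "a * r^2 * ck \<le> \<epsilon> * b * ck" using ab(1) nn by (intro mult_right_mono) auto
  also have "\<dots> = b * (\<epsilon> * ck)" by simp
  also have "\<dots> \<le> b * (1 / 2)" using small(3) pos by (intro mult_left_mono) auto
  finally have "a * r^2 * ck * z^2 \<le> (b / 2) * z^2" by (intro mult_right_mono) auto
  moreover have "a * r^2 * (kk * y^2 - ck * z^2) \<le> a * r^2 * k" using k pos by (intro mult_left_mono) auto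
  ultimately show ?thesis by (simp add: algebra_simps)
 qed
 \<comment> \<open>The budget: \<open>h\<close> consumes the whole x-term and a quarter of the
   y-term, \<open>e\<close> consumes half of the y-term and half of the z-term, and the deficit in
   \<open>k\<close> takes the other half of the z-term. A quarter of the y-term remains.\<close>
 show ?thesis using h' e' k' by (simp add: algebra_simps)
qed

section \<open>The structural conditions as inequalities\<close>

lemma condition_A_D:
 assumes "condition_A A0 A L"
 shows "transpose A0 = A0" "transpose (A j) = A j" "\<And>u. u \<noteq> 0 \<Longrightarrow> 0 < cm A0 u \<bullet> u" "\<And>u. 0 \<le> cm L u \<bullet> u"
 using assms by (auto simp: condition_A_def pos_on_def nonneg_on_def Re_hinner cm_def)

lemma transpose_symbol: "condition_A A0 A L \<Longrightarrow> transpose (symbol A \<omega>) = symbol A \<omega>"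
 by (simp add: condition_A_def symbol_def transpose_def vec_eq_iff)

lemma cm_symbol: "cm (symbol A \<omega>) u = (\<Sum>j\<in>UNIV. (\<omega> $ j) *\<^sub>R cm (A j) u)"
 by (simp add: symbol_def cm_sum_left cm_scaleR_left)

lemma symbol_scaleR: "symbol A (r *\<^sub>R \<omega>) = r *\<^sub>R symbol A \<omega>"
 by (simp add: symbol_def scaleR_sum_right)

lemma continuous_symbol [continuous_intros]: "continuous_on T f \<Longrightarrow> continuous_on T (\<lambda>x. symbol A (f x))"
 unfolding symbol_def by (intro continuous_intros)

lemma symbol_bound:
 obtains C where "0 < C" "\<And>\<omega> u. norm (cm X (cm (symbol A \<omega>) u)) \<le> C * norm \<omega> * norm u"
proof -
 have "\<exists>C. 0 < C \<and> (\<forall>u. norm (cm (X ** A j) u) \<le> C * norm u)" for j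
  using cm_bound[of "X ** A j"] by metis
 then obtain C where C: "\<And>j. 0 < C j" "\<And>j u. norm (cm (X ** A j) u) \<le> C j * norm u" by metis
 show ?thesis
 proof (rule that[of "\<Sum>j\<in>UNIV. C j"])
  show "0 < (\<Sum>j\<in>UNIV. C j)" using C(1) by (intro sum_pos) auto
  fix \<omega> u
  have "cm X (cm (symbol A \<omega>) u) = (\<Sum>j\<in>UNIV. (\<omega> $ j) *\<^sub>R cm (X ** A j) u)"
   unfolding cm_symbol cm_mult by (simp add: linear_sum[OF bounded_linear.linear[OF bounded_linear_cm]] cm_scaleR)
  also have "norm \<dots> \<le> (\<Sum>j\<in>UNIV. norm \<omega> * (C j * norm u))"
  proof (rule order_trans[OF norm_sum sum_mono])
   show "norm ((\<omega> $ j) *\<^sub>R cm (X ** A j) u) \<le> norm \<omega> * (C j * norm u)" for j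
    using component_le_norm_cart[of \<omega> j] C(2)[of j u] by (auto intro: mult_mono)
  qed
  also have "\<dots> = (\<Sum>j\<in>UNIV. C j) * norm \<omega> * norm u" by (simp add: sum_distrib_left sum_distrib_right mult_ac)
  finally show "norm (cm X (cm (symbol A \<omega>) u)) \<le> (\<Sum>j\<in>UNIV. C j) * norm \<omega> * norm u" .
 qed
qed

text \<open>The symmetric part of S A(\<omega>) contributes nothing to the form of i S A(\<omega>),
  so the condition gives a sign. The form is odd in \<omega>; the sign at \<omega> and at -\<omega>
  makes it zero.\<close>

lemma condition_S1_form:
 fixes L S :: "real^'m^'m" and A :: "'n::finite \<Rightarrow> real^'m^'m"
 assumes S1: "condition_S1 A L S" and \<omega>: "norm \<omega> = 1" and p: "cm (sym_part L) p = 0"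
 shows "(\<i> *s cm (S ** symbol A \<omega>) p) \<bullet> p = 0"
proof -
 have form: "Re (hinner (map_matrix (\<lambda>a. \<i> * cplx a) (skew_part X) *v p) p) = (\<i> *s cm X p) \<bullet> p" for X :: "real^'m^'m"
 proof -
  have "map_matrix (\<lambda>a. \<i> * cplx a) Y *v p = \<i> *s cm Y p" for Y :: "real^'m^'m"
   by (simp add: vec_eq_iff cm_nth matrix_vector_mult_def map_matrix_def sum_distrib_left mult.assoc)
  moreover have "X = skew_part X + sym_part X" by (simp add: skew_part_def sym_part_def algebra_simps flip: scaleR_add_left)
  then have "cm X p = cm (skew_part X) p + cm (sym_part X) p" using cm_add_left by metis
  ultimately show ?thesis
   using inner_ii_symmetric[OF transpose_sym_part, of X p] by (simp add: Re_hinner ii_linear inner_add_left)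
 qed
 have ge: "0 \<le> (\<i> *s cm (S ** symbol A \<omega>) p) \<bullet> p" if "norm \<omega> = 1" for \<omega>
 proof -
  have "0 \<le> Re (hinner (map_matrix (\<lambda>a. \<i> * cplx a) (skew_part (S ** symbol A \<omega>)) *v p) p)"
   using S1 that p unfolding condition_S1_def nonneg_on_def Ker_def by (auto simp: cm_def)
  then show ?thesis by (simp only: form)
 qed
 have "S ** symbol A (- \<omega>) = - (S ** symbol A \<omega>)"
  by (simp add: symbol_def vec_eq_iff matrix_matrix_mult_def sum_negf)
 then show ?thesis using ge[OF \<omega>] ge[of "- \<omega>"] \<omega> by (simp add: cm_minus_left ii_linear)
qed

text \<open>Once the term in \<open>p\<close> alone is gone, every remaining term of the expansion
  has a factor \<open>q\<close>. Only the diagonal value at \<open>p\<close> has to vanish, not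
  \<open>T p\<close> itself.\<close>

lemma form_bound_of_kernel:
 fixes T :: "'a::real_inner \<Rightarrow> 'a"
 assumes T: "linear T" and bound: "\<And>u. norm (T u) \<le> C * norm u" and C: "0 \<le> C"
  and p: "T p \<bullet> p = 0" "norm p \<le> norm (p + q)" "norm q \<le> norm (p + q)"
 shows "\<bar>T (p + q) \<bullet> (p + q)\<bar> \<le> 3 * C * norm q * norm (p + q)"
proof -
 have "T (p + q) \<bullet> (p + q) = T p \<bullet> q + T q \<bullet> p + T q \<bullet> q"
  using p(1) by (simp add: linear_add[OF T] inner_add_left inner_add_right)
 moreover have "\<bar>T x \<bullet> y\<bar> \<le> C * norm x * norm y" for x y
  by (rule order_trans[OF Cauchy_Schwarz_ineq2]) (intro mult_right_mono bound norm_ge_zero)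
 then have "\<bar>T p \<bullet> q\<bar> \<le> C * norm p * norm q" "\<bar>T q \<bullet> p\<bar> \<le> C * norm q * norm p" "\<bar>T q \<bullet> q\<bar> \<le> C * norm q * norm q"
  by blast+
 moreover have "C * norm p * norm q \<le> C * norm q * norm (p + q)" "C * norm q * norm p \<le> C * norm q * norm (p + q)" "C * norm q * norm q \<le> C * norm q * norm (p + q)"
  using mult_left_mono[OF p(2), of "C * norm q"] mult_left_mono[OF p(3), of "C * norm q"] C by (simp_all add: mult_ac)
 ultimately show ?thesis by linarith
qed

text \<open>The bounds are uniform in \<omega>. The \<open>S A\<close> form is controlled by the
  dissipation of \<open>L\<close>, because it vanishes on the kernel of the symmetric part. The
  \<open>K L\<close> form is controlled by the dissipation of \<open>S\<close>, because that has the
  kernel of \<open>L\<close>. The \<open>K A\<close> form is coercive up to the latter dissipation,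
  by compactness of the product of two unit spheres.\<close>

lemma structural_estimates:
 fixes A0 L S :: "real^'m^'m" and A :: "'n::finite \<Rightarrow> real^'m^'m"
 assumes A: "condition_A A0 A L" and K: "condition_K A0 A L" and S: "condition_S A0 L S" and S1: "condition_S1 A L S"
 obtains K c3 C1 C2 C3 C4 where "0 < c3" "0 < C1" "0 < C2" "0 < C3" "0 < C4"
  "\<And>\<omega>. norm \<omega> = 1 \<Longrightarrow> transpose (K \<omega> ** A0) = - (K \<omega> ** A0)"
  "\<And>u. 0 \<le> cm L u \<bullet> u" "\<And>u. 0 \<le> cm (S ** L) u \<bullet> u + cm L u \<bullet> u"
  "\<And>\<omega> u. norm \<omega> = 1 \<Longrightarrow> \<bar>(\<i> *s cm (S ** symbol A \<omega>) u) \<bullet> u\<bar> \<le> C1 * sqrt (cm L u \<bullet> u) * norm u"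
  "\<And>\<omega> u. norm \<omega> = 1 \<Longrightarrow> \<bar>(\<i> *s cm (K \<omega>) (cm L u)) \<bullet> u\<bar> \<le> C2 * sqrt (cm (S ** L) u \<bullet> u + cm L u \<bullet> u) * norm u"
  "\<And>\<omega> u. norm \<omega> = 1 \<Longrightarrow> c3 * (norm u)^2 - C3 * (cm (S ** L) u \<bullet> u + cm L u \<bullet> u) \<le> cm (K \<omega> ** symbol A \<omega>) u \<bullet> u"
  "\<And>\<omega> u. norm \<omega> = 1 \<Longrightarrow> \<bar>(\<i> *s cm (K \<omega>) (cm A0 u)) \<bullet> u\<bar> \<le> C4 * (norm u)^2"
proof -
 obtain K0 where K0: "smooth_on_sphere K0" and Kskew: "\<And>\<omega>. norm \<omega> = 1 \<Longrightarrow> transpose (K0 \<omega> ** A0) = - (K0 \<omega> ** A0)"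
  and Kpos0: "\<And>\<omega>. norm \<omega> = 1 \<Longrightarrow> pos_on (Ker L) (cmat (sym_part (K0 \<omega> ** symbol A \<omega>)))"
  using K unfolding condition_K_def by auto
 have Kpos: "0 < cm (K0 \<omega> ** symbol A \<omega>) u \<bullet> u" if "norm \<omega> = 1" "cm L u = 0" "u \<noteq> 0" for \<omega> u
  using Kpos0[OF that(1)] that(2,3) by (auto simp: pos_on_def Ker_def cm_def[symmetric] Re_hinner inner_sym_part)
 have Kcont: "continuous_on (sphere 0 1) K0"
 proof -
  obtain U F where U: "open U" "sphere 0 1 \<subseteq> U" "smooth_on U F" "\<And>\<omega>. \<omega> \<in> sphere 0 1 \<Longrightarrow> F \<omega> = K0 \<omega>"
   using K0 unfolding smooth_on_sphere_def by blast
  have "F differentiable (at x)" if "x \<in> U" for x using U(3) that unfolding smooth_on_def by (metis partial_derivs.simps(1))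
  then have "continuous_on (sphere 0 1) F"
   using U(2) by (intro continuous_at_imp_continuous_on) (auto intro: differentiable_imp_continuous_within)
  then show ?thesis using U(4) by (rule continuous_on_eq)
 qed
 define l where "l u = cm L u \<bullet> u" for u
 define D where "D = sym_part (S ** L) + sym_part L"
 define d where "d u = cm (S ** L) u \<bullet> u + cm L u \<bullet> u" for u
 have dD: "d u = cm D u \<bullet> u" for u by (simp add: d_def D_def cm_add_left inner_add_left inner_sym_part)
 have l0: "0 \<le> l u" for u using condition_A_D(4)[OF A] by (simp add: l_def)
 have d0: "0 \<le> d u" for u using S unfolding condition_S_def nonneg_on_def dD by (simp add: Re_hinner cm_def D_def)
 have kerD: "cm D u = 0 \<longleftrightarrow> cm L u = 0" for u
  using S unfolding condition_S_def Ker_def by (auto simp: cm_def D_def)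
 have lin: "linear (cm X)" for X :: "real^'m^'m" by (rule bounded_linear.linear[OF bounded_linear_cm])
 have symD: "transpose D = D" by (simp add: D_def transpose_add transpose_sym_part)
 obtain cL where cL: "0 < cL" "\<And>u. \<exists>p q. u = p + q \<and> cm (sym_part L) p = 0 \<and> norm p \<le> norm u \<and> norm q \<le> norm u \<and> cL * (norm q)^2 \<le> cm (sym_part L) u \<bullet> u"
 proof (rule psd_decomposition[OF lin[of "sym_part L"]])
  show "cm (sym_part L) u \<bullet> v = u \<bullet> cm (sym_part L) v" for u v by (simp add: inner_cm transpose_sym_part)
  show "0 \<le> cm (sym_part L) u \<bullet> u" for u using l0 by (simp add: inner_sym_part l_def)
 qed blast
 obtain cD where cD: "0 < cD" "\<And>u. \<exists>p q. u = p + q \<and> cm D p = 0 \<and> norm p \<le> norm u \<and> norm q \<le> norm u \<and> cD * (norm q)^2 \<le> cm D u \<bullet> u"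
 proof (rule psd_decomposition[OF lin[of D]])
  show "cm D u \<bullet> v = u \<bullet> cm D v" for u v by (simp add: inner_cm symD)
  show "0 \<le> cm D u \<bullet> u" for u using d0 by (simp add: dD)
 qed blast
 have sq: "norm q \<le> sqrt x / sqrt c" if "c * (norm q)^2 \<le> x" "0 < c" for c x :: real and q :: "complex^'m"
 proof -
  have "(norm q)^2 \<le> x / c" using that by (simp add: field_simps)
  then have "norm q \<le> sqrt (x / c)" by (rule real_le_rsqrt)
  then show ?thesis by (simp add: real_sqrt_divide)
 qed
 obtain CS where CS: "0 < CS" "\<And>\<omega> u. norm (cm S (cm (symbol A \<omega>) u)) \<le> CS * norm \<omega> * norm u"
  using symbol_bound[of S A] by metis
 have h: "\<bar>(\<i> *s cm (S ** symbol A \<omega>) u) \<bullet> u\<bar> \<le> (3 * CS / sqrt cL) * sqrt (l u) * norm u" if \<omega>: "norm \<omega> = 1" for \<omega> u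
 proof -
  obtain p q where pq: "u = p + q" "cm (sym_part L) p = 0" "norm p \<le> norm u" "norm q \<le> norm u" "cL * (norm q)^2 \<le> l u"
   using cL(2)[of u] by (auto simp: inner_sym_part l_def)
  have "\<bar>(\<i> *s cm (S ** symbol A \<omega>) (p + q)) \<bullet> (p + q)\<bar> \<le> 3 * CS * norm q * norm (p + q)"
  proof (rule form_bound_of_kernel)
   show "linear (\<lambda>u. \<i> *s cm (S ** symbol A \<omega>) u)" by (intro linearI) (simp_all add: cm_add cm_scaleR ii_linear)
   show "norm (\<i> *s cm (S ** symbol A \<omega>) u) \<le> CS * norm u" for u
    using CS(2)[of \<omega> u] \<omega> by (simp add: norm_ii cm_mult)
   show "(\<i> *s cm (S ** symbol A \<omega>) p) \<bullet> p = 0" by (rule condition_S1_form[OF S1 \<omega> pq(2)])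
  qed (use CS pq in auto)
  also have "\<dots> \<le> 3 * CS * (sqrt (l u) / sqrt cL) * norm (p + q)"
   using sq[OF pq(5) cL(1)] CS(1) by (intro mult_right_mono mult_left_mono) auto
  finally show ?thesis using pq(1) by simp
 qed
 have kcont: "continuous_on (sphere 0 1 \<times> sphere 0 1) (\<lambda>x. cm (K0 (fst x)) (f x))"
  if "continuous_on (sphere 0 1 \<times> sphere 0 1) f" for f :: "(real^'n) \<times> (complex^'m) \<Rightarrow> complex^'m"
  by (intro continuous_cm continuous_on_compose2[OF Kcont] continuous_intros that) auto
 have unit: "\<exists>v. norm v = 1 \<and> u = norm u *\<^sub>R v" if "u \<noteq> 0" for u :: "complex^'m"
  using that by (intro exI[of _ "(1 / norm u) *\<^sub>R u"]) simp
 have cmpt: "compact (sphere (0::real^'n) 1 \<times> sphere (0::complex^'m) 1)" by (intro compact_Times compact_sphere)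
 obtain CK where CK: "0 < CK" "\<And>\<omega> u. norm \<omega> = 1 \<Longrightarrow> norm (cm (K0 \<omega>) u) \<le> CK * norm u"
 proof -
  have "continuous_on (sphere 0 1 \<times> sphere 0 1) (\<lambda>x. cm (K0 (fst x)) (snd x))" by (intro kcont continuous_intros)
  from compact_imp_bounded[OF compact_continuous_image[OF this cmpt]]
  obtain b where b0: "\<forall>y\<in>(\<lambda>x. cm (K0 (fst x)) (snd x)) ` (sphere 0 1 \<times> sphere 0 1). norm y \<le> b"
   unfolding bounded_iff by (rule exE)
  have b: "norm (cm (K0 \<omega>) v) \<le> b" if "norm \<omega> = 1" "norm v = 1" for \<omega> v
   using bspec[OF b0 imageI[of "(\<omega>, v)"]] that by simp
  show ?thesis
  proof (rule that[of "\<bar>b\<bar> + 1"])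
   fix \<omega> :: "real^'n" and u :: "complex^'m" assume \<omega>: "norm \<omega> = 1"
   show "norm (cm (K0 \<omega>) u) \<le> (\<bar>b\<bar> + 1) * norm u"
   proof (cases "u = 0")
    case False
    then obtain v where v: "norm v = 1" "u = norm u *\<^sub>R v" using unit by blast
    have "norm (cm (K0 \<omega>) u) = norm u * norm (cm (K0 \<omega>) v)" by (subst v(2)) (simp add: cm_scaleR)
    also have "\<dots> \<le> norm u * (\<bar>b\<bar> + 1)" using b[OF \<omega> v(1)] by (intro mult_left_mono) auto
    finally show ?thesis by (simp add: mult.commute)
   qed (simp add: cm_0)
  qed simp
 qed
 obtain CL where CL: "0 < CL" "\<And>u. norm (cm L u) \<le> CL * norm u" using cm_bound[of L] by metis
 have e: "\<bar>(\<i> *s cm (K0 \<omega>) (cm L u)) \<bullet> u\<bar> \<le> (CK * CL / sqrt cD) * sqrt (d u) * norm u" if \<omega>: "norm \<omega> = 1" for \<omega> u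
 proof -
  \<comment> \<open>Here the equality of kernels in condition (S) acts: \<open>p\<close> is
    annihilated by \<open>L\<close>, so \<open>cm L u\<close> depends on \<open>q\<close>
    alone.\<close>
  obtain p q where pq: "u = p + q" "cm L p = 0" "cD * (norm q)^2 \<le> d u" using cD(2)[of u] by (auto simp: kerD dD)
  have "\<bar>(\<i> *s cm (K0 \<omega>) (cm L u)) \<bullet> u\<bar> \<le> norm (cm (K0 \<omega>) (cm L q)) * norm u"
   using Cauchy_Schwarz_ineq2[of "\<i> *s cm (K0 \<omega>) (cm L u)" u] pq by (simp add: norm_ii cm_add)
  also have "\<dots> \<le> (CK * (CL * (sqrt (d u) / sqrt cD))) * norm u"
  proof (intro mult_right_mono)
   have "norm (cm (K0 \<omega>) (cm L q)) \<le> CK * norm (cm L q)" by (rule CK(2)[OF \<omega>])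
   also have "\<dots> \<le> CK * (CL * norm q)" using CK(1) by (intro mult_left_mono CL) auto
   also have "\<dots> \<le> CK * (CL * (sqrt (d u) / sqrt cD))" using CK(1) CL(1) sq[OF pq(3) cD(1)] by (intro mult_left_mono) auto
   finally show "norm (cm (K0 \<omega>) (cm L q)) \<le> CK * (CL * (sqrt (d u) / sqrt cD))" .
  qed simp
  finally show ?thesis by simp
 qed
 obtain c3 C3 where c3: "0 < c3" "0 < C3" "\<And>x. x \<in> sphere (0::real^'n) 1 \<times> sphere (0::complex^'m) 1 \<Longrightarrow>
   c3 \<le> cm (K0 (fst x)) (cm (symbol A (fst x)) (snd x)) \<bullet> snd x + C3 * d (snd x)"
 proof (rule compact_combination_pos[OF cmpt])
  show "continuous_on (sphere (0::real^'n) 1 \<times> sphere (0::complex^'m) 1) (\<lambda>x. cm (K0 (fst x)) (cm (symbol A (fst x)) (snd x)) \<bullet> snd x)"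
   by (intro continuous_intros kcont continuous_cm)
  show "continuous_on (sphere (0::real^'n) 1 \<times> sphere (0::complex^'m) 1) (\<lambda>x. d (snd x))"
   unfolding d_def by (intro continuous_intros continuous_cm)
  show "0 < cm (K0 (fst x)) (cm (symbol A (fst x)) (snd x)) \<bullet> snd x"
   \<comment> \<open>A zero of the semidefinite form \<open>d\<close> lies in the kernel of
     \<open>D\<close>, hence in \<open>Ker L\<close>, where condition (K) gives positivity.\<close>
   if "x \<in> sphere (0::real^'n) 1 \<times> sphere (0::complex^'m) 1" "d (snd x) = 0" for x
  proof -
   have "cm D (snd x) = 0"
   proof (rule psd_zero[OF lin[of D]])
    show "cm D u \<bullet> v = u \<bullet> cm D v" for u v by (simp add: inner_cm symD)
    show "0 \<le> cm D u \<bullet> u" for u using d0 by (simp add: dD)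
    show "cm D (snd x) \<bullet> snd x = 0" using that by (simp add: dD)
   qed
   then have "0 < cm (K0 (fst x) ** symbol A (fst x)) (snd x) \<bullet> snd x" using that by (intro Kpos) (auto simp: kerD)
   then show ?thesis by (simp add: cm_mult)
  qed
 qed (use d0 in auto)
 have k: "c3 * (norm u)^2 - C3 * d u \<le> cm (K0 \<omega> ** symbol A \<omega>) u \<bullet> u" if \<omega>: "norm \<omega> = 1" for \<omega> u
 proof (cases "u = 0")
  case False
  then obtain v where v: "norm v = 1" "u = norm u *\<^sub>R v" using unit by blast
  have "d u = (norm u)^2 * d v" unfolding d_def by (subst (1 2 3 4) v(2)) (simp add: cm_scaleR power2_eq_square distrib_left)
  moreover have "cm (K0 \<omega> ** symbol A \<omega>) u \<bullet> u = (norm u)^2 * (cm (K0 \<omega> ** symbol A \<omega>) v \<bullet> v)"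
   by (subst (1 2) v(2)) (simp add: cm_scaleR power2_eq_square)
  moreover have "c3 \<le> cm (K0 \<omega> ** symbol A \<omega>) v \<bullet> v + C3 * d v" using c3(3)[of "(\<omega>, v)"] \<omega> v(1) by (simp add: cm_mult)
  then have "(norm u)^2 * c3 \<le> (norm u)^2 * (cm (K0 \<omega> ** symbol A \<omega>) v \<bullet> v + C3 * d v)" by (intro mult_left_mono) auto
  ultimately show ?thesis by (simp add: algebra_simps)
 qed (simp add: cm_0 d_def)
 obtain CA where CA: "0 < CA" "\<And>u. norm (cm A0 u) \<le> CA * norm u" using cm_bound[of A0] by metis
 have k0: "\<bar>(\<i> *s cm (K0 \<omega>) (cm A0 u)) \<bullet> u\<bar> \<le> (CK * CA) * (norm u)^2" if \<omega>: "norm \<omega> = 1" for \<omega> u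
 proof -
  have "norm (cm (K0 \<omega>) (cm A0 u)) \<le> CK * (CA * norm u)"
   by (rule order_trans[OF CK(2)[OF \<omega>]]) (use CK(1) CA in \<open>auto intro: mult_left_mono\<close>)
  then have "norm (\<i> *s cm (K0 \<omega>) (cm A0 u)) * norm u \<le> CK * (CA * norm u) * norm u"
   unfolding norm_ii by (intro mult_right_mono) auto
  then show ?thesis using Cauchy_Schwarz_ineq2[of "\<i> *s cm (K0 \<omega>) (cm A0 u)" u] by (simp add: power2_eq_square mult_ac)
 qed
 show ?thesis
 proof (rule that[of c3 "3 * CS / sqrt cL" "CK * CL / sqrt cD" C3 "CK * CA" K0])
  show "0 < c3" "0 < C3" by (fact c3)+
  show "0 < 3 * CS / sqrt cL" "0 < CK * CL / sqrt cD" "0 < CK * CA" using CS cL CK CL cD CA by simp_all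
 qed (fact Kskew l0[unfolded l_def] d0[unfolded d_def] h[unfolded l_def] e[unfolded d_def] k[unfolded d_def] k0)+
qed

section \<open>Exponential decay at each frequency\<close>

lemma has_vector_derivative_quadratic:
 fixes T :: "'a::real_inner \<Rightarrow> 'a"
 assumes T: "bounded_linear T" "\<And>u v. T u \<bullet> v = u \<bullet> T v" and u: "(u has_vector_derivative u') (at t)"
 shows "((\<lambda>t. T (u t) \<bullet> u t) has_real_derivative 2 * (T u' \<bullet> u t)) (at t)"
proof -
 have "((\<lambda>t. T (u t)) has_vector_derivative T u') (at t)" by (rule bounded_linear.has_vector_derivative[OF T(1) u])
 from bounded_bilinear.has_vector_derivative[OF bounded_bilinear_inner this u]
 have "((\<lambda>t. T (u t) \<bullet> u t) has_vector_derivative (T (u t) \<bullet> u' + T u' \<bullet> u t)) (at t)" .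
 moreover have "T (u t) \<bullet> u' = T u' \<bullet> u t" using T(2)[of "u t" u'] by (simp add: inner_commute)
 ultimately show ?thesis by (simp add: has_real_derivative_iff_has_vector_derivative)
qed

lemma gronwall_decay:
 fixes F :: "real \<Rightarrow> real"
 assumes F: "\<And>t. 0 \<le> t \<Longrightarrow> (F has_real_derivative F' t) (at t)" "\<And>t. 0 \<le> t \<Longrightarrow> F' t \<le> - r * F t" and t: "0 \<le> t"
 shows "F t \<le> exp (- r * t) * F 0"
proof -
 have "exp (r * t) * F t \<le> exp (r * 0) * F 0"
 proof (rule DERIV_nonpos_imp_nonincreasing[OF t])
  fix s assume s: "0 \<le> s" "s \<le> t"
  have "((\<lambda>s. exp (r * s) * F s) has_real_derivative exp (r * s) * (r * F s + F' s)) (at s)"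
   using F(1)[OF s(1)] by (auto intro!: derivative_eq_intros simp: algebra_simps)
  moreover have "exp (r * s) * (r * F s + F' s) \<le> 0" using F(2)[OF s(1)] by (simp add: mult_le_0_iff)
  ultimately show "\<exists>y. ((\<lambda>s. exp (r * s) * F s) has_real_derivative y) (at s) \<and> y \<le> 0" by blast
 qed
 then have "exp (- r * t) * (exp (r * t) * F t) \<le> exp (- r * t) * F 0" by (intro mult_left_mono) auto
 then show ?thesis by (simp add: mult.assoc[symmetric] mult_exp_exp)
qed

text \<open>The Lyapunov function is the form of a symmetric operator \<open>T\<close>:
  \<open>S A0\<close> is symmetric, and \<open>\<i> K A0\<close> is symmetric because
  \<open>K A0\<close> is skew. Its derivative is minus twice the combination in
  \<open>dissipation_bound\<close>. The constants are chosen before \<xi>, as the multiplier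
  estimates require.\<close>

lemma pointwise_decay:
 fixes A0 L S :: "real^'m^'m" and A :: "'n::finite \<Rightarrow> real^'m^'m"
 assumes A: "condition_A A0 A L" and K: "condition_K A0 A L" and S: "condition_S A0 L S" and S1: "condition_S1 A L S"
 shows "\<exists>c>0. \<exists>C>0. \<forall>(\<xi>::real^'n) u u'.
  (\<forall>t\<ge>0. (u has_vector_derivative u' t) (at t) \<and> cm A0 (u' t) = - (\<i> *s cm (symbol A \<xi>) (u t)) - cm L (u t)) \<longrightarrow>
  (\<forall>t\<ge>0. (norm (u t))\<^sup>2 \<le> C * exp (- (c * rate \<xi>) * t) * (norm (u 0))^2)"
proof -
 obtain K c3 C1 C2 C3 C4 where pos: "0 < c3" "0 < C1" "0 < C2" "0 < C3" "0 < C4"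
  and Kskew: "\<And>\<omega>. norm \<omega> = 1 \<Longrightarrow> transpose (K \<omega> ** A0) = - (K \<omega> ** A0)"
  and l0: "\<And>u. 0 \<le> cm L u \<bullet> u" and d0: "\<And>u. 0 \<le> cm (S ** L) u \<bullet> u + cm L u \<bullet> u"
  and h: "\<And>\<omega> u. norm \<omega> = 1 \<Longrightarrow> \<bar>(\<i> *s cm (S ** symbol A \<omega>) u) \<bullet> u\<bar> \<le> C1 * sqrt (cm L u \<bullet> u) * norm u"
  and e: "\<And>\<omega> u. norm \<omega> = 1 \<Longrightarrow> \<bar>(\<i> *s cm (K \<omega>) (cm L u)) \<bullet> u\<bar> \<le> C2 * sqrt (cm (S ** L) u \<bullet> u + cm L u \<bullet> u) * norm u"
  and k: "\<And>\<omega> u. norm \<omega> = 1 \<Longrightarrow> c3 * (norm u)^2 - C3 * (cm (S ** L) u \<bullet> u + cm L u \<bullet> u) \<le> cm (K \<omega> ** symbol A \<omega>) u \<bullet> u"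
  and k0: "\<And>\<omega> u. norm \<omega> = 1 \<Longrightarrow> \<bar>(\<i> *s cm (K \<omega>) (cm A0 u)) \<bullet> u\<bar> \<le> C4 * (norm u)^2"
  by (rule structural_estimates[OF A K S S1]) (rule that)
 have A0t: "transpose A0 = A0" by (rule condition_A_D(1)[OF A])
 have SA0t: "transpose (S ** A0) = S ** A0" using S by (simp add: condition_S_def)
 have lin: "linear (cm X)" for X :: "real^'m^'m" by (rule bounded_linear.linear[OF bounded_linear_cm])
 obtain a0 where a0: "0 < a0" "\<And>u. a0 * (norm u)^2 \<le> cm A0 u \<bullet> u"
 proof -
  obtain c where c: "0 < c" "\<And>u. \<exists>p q. u = p + q \<and> cm A0 p = 0 \<and> norm p \<le> norm u \<and> norm q \<le> norm u \<and> c * (norm q)^2 \<le> cm A0 u \<bullet> u"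
  proof (rule psd_decomposition[OF lin[of A0]])
   show "cm A0 u \<bullet> v = u \<bullet> cm A0 v" for u v by (simp add: inner_cm A0t)
   show "0 \<le> cm A0 u \<bullet> u" for u using condition_A_D(3)[OF A, of u] by (cases "u = 0") (auto simp: cm_0)
  qed blast
  show ?thesis
  proof (rule that[OF c(1)])
   fix u
   obtain p q where pq: "u = p + q" "cm A0 p = 0" "c * (norm q)^2 \<le> cm A0 u \<bullet> u" using c(2)[of u] by blast
   then have "p = 0" using condition_A_D(3)[OF A, of p] by fastforce
   then show "c * (norm u)^2 \<le> cm A0 u \<bullet> u" using pq by simp
  qed
 qed
 obtain a1 where a1: "0 < a1" "\<And>u. norm (cm A0 u) \<le> a1 * norm u" using cm_bound[of A0] by blast
 obtain a2 where a2: "0 < a2" "\<And>u. norm (cm (S ** A0) u) \<le> a2 * norm u" using cm_bound[of "S ** A0"] by blast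
 have form_le: "\<bar>v \<bullet> u\<bar> \<le> m * (norm u)^2" if "norm v \<le> m * norm u" for v u :: "complex^'m" and m
  using Cauchy_Schwarz_ineq2[of v u] mult_right_mono[OF that norm_ge_zero[of u]] by (simp add: power2_eq_square mult_ac)
 \<comment> \<open>Every smallness requirement on \<epsilon> = 1/M is a summand of \<open>M\<close>:
   three for \<open>dissipation_bound\<close>, and a last one so that the parts with
   \<open>S\<close> and \<open>K\<close> use at most half of the \<open>A0\<close> form.\<close>
 define M where "M = C1^2 / c3 + C2^2 / c3 + 2 * C3 + 1 + 2 * (a2 + C4) / a0"
 have M: "1 \<le> M" "0 < M" using pos a0 a2 by (auto simp: M_def intro: add_nonneg_nonneg add_nonneg_pos)
 define \<epsilon> where "\<epsilon> = 1 / M"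
 have \<epsilon>: "0 < \<epsilon>" "\<epsilon> \<le> 1" using M by (auto simp: \<epsilon>_def)
 have \<epsilon>M: "\<epsilon> * x \<le> y" if "x \<le> y * M" for x y using that M by (simp add: \<epsilon>_def field_simps)
 have sm1: "\<epsilon> * C1^2 \<le> c3"
 proof (rule \<epsilon>M)
  have "c3 * (C1^2 / c3) \<le> c3 * M" using pos a0 a2 by (intro mult_left_mono) (auto simp: M_def)
  then show "C1^2 \<le> c3 * M" using pos by simp
 qed
 have sm2: "\<epsilon> * C2^2 \<le> c3"
 proof (rule \<epsilon>M)
  have "c3 * (C2^2 / c3) \<le> c3 * M" using pos a0 a2 by (intro mult_left_mono) (auto simp: M_def)
  then show "C2^2 \<le> c3 * M" using pos by simp
 qed
 have sm3: "\<epsilon> * C3 \<le> 1 / 2"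
 proof (rule \<epsilon>M)
  have "2 * C3 \<le> M" using pos a0 a2 by (auto simp: M_def)
  then show "C3 \<le> 1 / 2 * M" by simp
 qed
 have sm4: "\<epsilon> * (a2 + C4) \<le> a0 / 2"
 proof (rule \<epsilon>M)
  have "a0 / 2 * (2 * (a2 + C4) / a0) \<le> a0 / 2 * M" using pos a0 a2 by (intro mult_left_mono) (auto simp: M_def)
  then show "a2 + C4 \<le> a0 / 2 * M" using a0 by simp
 qed
 define CF where "CF = 2 * a1 + a2 + C4"
 have CF: "0 < CF" using a1 a2 pos by (simp add: CF_def)
 \<comment> \<open>The rate is the coefficient of the dissipation, without its dependence on \<xi>,
   divided by the upper bound \<open>CF\<close> of the Lyapunov function.\<close>
 define \<delta> where "\<delta> = \<epsilon> ^ 3 * (c3 / 2) / CF"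
 have \<delta>: "0 < \<delta>" using \<epsilon> pos CF by (simp add: \<delta>_def)
 show ?thesis
 proof (intro exI conjI allI impI)
  show "0 < \<delta>" "0 < 2 * CF / a0" using \<delta> CF a0 by simp_all
  fix \<xi> :: "real^'n" and u u' and t :: real
  assume der_ode: "\<forall>t\<ge>0. (u has_vector_derivative u' t) (at t) \<and> cm A0 (u' t) = - (\<i> *s cm (symbol A \<xi>) (u t)) - cm L (u t)"
   and t: "0 \<le> t"
  have der: "(u has_vector_derivative u' t) (at t)"
   and ode: "cm A0 (u' t) = - (\<i> *s cm (symbol A \<xi>) (u t)) - cm L (u t)" if "0 \<le> t" for t
   using der_ode that by simp_all
  define r where "r = norm \<xi>"
  have r0: "0 \<le> r" by (simp add: r_def)
  \<comment> \<open>At \<xi> = 0 the direction is arbitrary; it is multiplied by r = 0.\<close>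
  obtain \<omega> where \<omega>: "norm \<omega> = 1" "\<xi> = r *\<^sub>R \<omega>"
  proof (cases "\<xi> = 0")
   case True
   obtain w :: "real^'n" where "norm w = 1" using vector_choose_size[of 1] by auto
   then show ?thesis using True that by (simp add: r_def)
  next
   case False
   then show ?thesis using that[of "(1 / r) *\<^sub>R \<xi>"] by (simp add: r_def)
  qed
  define b where "b = \<epsilon>^2 / (1 + r^2)"
  define a where "a = \<epsilon> ^ 3 / (1 + r^2)^2"
  let ?k = "\<lambda>s. (\<i> *s cm (K \<omega>) (cm A0 (u s))) \<bullet> u s" and ?s = "\<lambda>s. cm (S ** A0) (u s) \<bullet> u s"
  have D: "1 \<le> 1 + r^2" "0 < 1 + r^2" by (auto intro: add_pos_nonneg)
  have b: "0 \<le> b" "b \<le> \<epsilon>" "b \<le> 1"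
  proof -
   have "\<epsilon>^2 / (1 + r^2) \<le> \<epsilon>^2 / 1" using D by (intro divide_left_mono) auto
   also have "\<dots> \<le> \<epsilon>" using \<epsilon> by (simp add: power2_eq_square mult_left_le)
   finally show "b \<le> \<epsilon>" by (simp add: b_def)
   then show "b \<le> 1" using \<epsilon> by simp
  qed (simp add: b_def)
  have a: "0 \<le> a * r" "a * r \<le> \<epsilon>" "0 \<le> a"
  proof -
   show a0: "0 \<le> a" using \<epsilon> by (simp add: a_def)
   then show "0 \<le> a * r" using r0 by simp
   have "2 * r \<le> 1 + r^2" using sum_squares_bound[of r 1] by simp
   then have "r \<le> 1 + r^2" using r0 by linarith
   also have "\<dots> \<le> (1 + r^2)^2" using D by (simp add: power2_eq_square)
   finally have "r / (1 + r^2)^2 \<le> 1" using D by simp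
   then have "\<epsilon> ^ 3 * (r / (1 + r^2)^2) \<le> \<epsilon> ^ 3 * 1" using \<epsilon> by (intro mult_left_mono) auto
   also have "\<epsilon> ^ 3 * 1 \<le> \<epsilon>" using \<epsilon> power_decreasing[of 1 3 \<epsilon>] by simp
   finally show "a * r \<le> \<epsilon>" by (simp add: a_def)
  qed
  \<comment> \<open>The extra \<open>b\<close> on \<open>A0\<close> joins the dissipation of
    \<open>L\<close> to that of \<open>S L\<close>: together they are b times the form that
    condition (S) makes semidefinite.\<close>
  define T where "T v = (1 + b) *\<^sub>R cm A0 v + b *\<^sub>R cm (S ** A0) v - (a * r) *\<^sub>R (\<i> *s cm (K \<omega>) (cm A0 v))" for v
  have Tlin: "bounded_linear T"
   unfolding T_def by (intro bounded_linear_intros bounded_linear_compose[OF bounded_linear_ii] bounded_linear_compose[OF bounded_linear_cm] bounded_linear_cm)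
  have Tsym: "T x \<bullet> y = x \<bullet> T y" for x y
  proof -
   have "(\<i> *s cm (K \<omega>) (cm A0 x)) \<bullet> y = x \<bullet> (\<i> *s cm (K \<omega>) (cm A0 y))"
    using inner_cm[of "K \<omega> ** A0" x "\<i> *s y"] Kskew[OF \<omega>(1)]
    by (simp add: inner_ii cm_mult[symmetric] cm_minus_left cm_ii)
   then show ?thesis by (simp add: T_def inner_add_left inner_add_right inner_diff_left inner_diff_right inner_cm A0t SA0t)
  qed
  define F where "F s = T (u s) \<bullet> u s" for s
  have Fder: "(F has_real_derivative 2 * (T (u' s) \<bullet> u s)) (at s)" if "0 \<le> s" for s
   unfolding F_def by (rule has_vector_derivative_quadratic[OF Tlin Tsym der[OF that]])
  have Fval: "F s = (1 + b) * (cm A0 (u s) \<bullet> u s) + b * ?s s - a * r * ?k s" for s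
   by (simp add: F_def T_def inner_add_left inner_diff_left)
  have Flow: "a0 / 2 * (norm (u s))^2 \<le> F s" for s
  proof -
   let ?U = "(norm (u s))^2"
   have 1: "a0 * ?U \<le> (1 + b) * (cm A0 (u s) \<bullet> u s)"
    using a0(2)[of "u s"] b(1) mult_nonneg_nonneg[OF b(1), of "cm A0 (u s) \<bullet> u s"] a0(1)
    by (simp add: distrib_right) (meson add_increasing2 mult_nonneg_nonneg order_trans zero_le_power2 less_imp_le)
   have 2: "- (\<epsilon> * (a2 * ?U)) \<le> b * ?s s"
    using mult_mono[OF b(2) form_le[OF a2(2)[of "u s"]]] \<epsilon> b(1) abs_ge_minus_self[of "b * ?s s"] by (simp add: abs_mult)
   have 3: "a * r * ?k s \<le> \<epsilon> * (C4 * ?U)"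
    using mult_mono[OF a(2) k0[OF \<omega>(1), of "u s"]] \<epsilon> a(1) abs_ge_self[of "a * r * ?k s"] by (simp add: abs_mult r0 a(3))
   have "\<epsilon> * (a2 * ?U) + \<epsilon> * (C4 * ?U) = \<epsilon> * (a2 + C4) * ?U" by (simp add: algebra_simps)
   also have "\<dots> \<le> a0 / 2 * ?U" using sm4 by (intro mult_right_mono) auto
   finally show ?thesis using 1 2 3 by (simp add: Fval)
  qed
  have Fup: "F s \<le> CF * (norm (u s))^2" for s
  proof -
   let ?U = "(norm (u s))^2"
   have 1: "(1 + b) * (cm A0 (u s) \<bullet> u s) \<le> 2 * (a1 * ?U)"
    using b form_le[OF a1(2)[of "u s"]] a1(1) by (intro mult_mono') (auto intro: order_trans[OF mult_nonneg_nonneg a0(2)] less_imp_le[OF a0(1)])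
   have 2: "b * ?s s \<le> 1 * (a2 * ?U)"
    using mult_mono[OF b(3) form_le[OF a2(2)[of "u s"]]] b(1) abs_ge_self[of "b * ?s s"] by (simp add: abs_mult)
   have 3: "- (a * r * ?k s) \<le> 1 * (C4 * ?U)"
    using mult_mono[OF order_trans[OF a(2) \<epsilon>(2)] k0[OF \<omega>(1), of "u s"]] a(1) abs_ge_minus_self[of "a * r * ?k s"] by (simp add: abs_mult r0 a(3))
   show ?thesis using 1 2 3 by (simp add: Fval CF_def algebra_simps)
  qed
  have diss: "2 * (T (u' s) \<bullet> u s) \<le> - (a * r^2 * (c3 / 2)) * (norm (u s))^2" if s: "0 \<le> s" for s
  proof -
   let ?u = "u s"
   let ?B = "symbol A \<omega>"
   let ?l = "cm L ?u \<bullet> ?u" and ?d = "cm (S ** L) ?u \<bullet> ?u + cm L ?u \<bullet> ?u" and ?m = "cm (K \<omega> ** ?B) ?u \<bullet> ?u"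
    and ?h = "(\<i> *s cm (S ** ?B) ?u) \<bullet> ?u" and ?e = "(\<i> *s cm (K \<omega>) (cm L ?u)) \<bullet> ?u"
   let ?Q = "(sqrt ?l)^2 + b * (sqrt ?d)^2 + a * r^2 * ?m + b * r * ?h - a * r * ?e"
   have u': "cm A0 (u' s) = - (r *\<^sub>R (\<i> *s cm ?B ?u)) - cm L ?u"
    using ode[OF s] by (simp add: \<omega>(2) symbol_scaleR cm_scaleR_left ii_linear)
   have Bz: "(\<i> *s cm ?B ?u) \<bullet> ?u = 0" by (rule inner_ii_symmetric[OF transpose_symbol[OF A]])
   have "T (u' s) \<bullet> ?u = (1 + b) * (cm A0 (u' s) \<bullet> ?u) + b * (cm S (cm A0 (u' s)) \<bullet> ?u) - a * r * ((\<i> *s cm (K \<omega>) (cm A0 (u' s))) \<bullet> ?u)"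
    by (simp add: T_def inner_add_left inner_diff_left cm_mult)
   also have "\<dots> = - (?l + b * ?d + a * r^2 * ?m
     + b * r * ?h - a * r * ?e)" unfolding u' cm_mult
    by (simp add: cm_diff cm_minus cm_scaleR cm_ii ii_linear ii_ii inner_diff_left inner_minus_left Bz algebra_simps power2_eq_square)
   finally have eq: "T (u' s) \<bullet> ?u = - ?Q" using l0[of ?u] d0[of ?u] by simp
   have "a * r^2 * (c3 / 4) * (norm ?u)^2 \<le> ?Q"
   proof (rule dissipation_bound[where \<epsilon> = \<epsilon> and ch = C1 and ce = C2 and ck = C3 and kk = c3])
    show "c3 * (norm ?u)^2 - C3 * (sqrt ?d)^2 \<le> ?m" using k[OF \<omega>(1), of ?u] d0[of ?u] by simp
   qed (use l0 d0 r0 \<epsilon> pos sm1 sm2 sm3 h[OF \<omega>(1)] e[OF \<omega>(1)] b_def a_def in auto)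
   then show ?thesis unfolding eq by simp
  qed
  let ?r = "\<delta> * (r^2 / (1 + r^2)^2)"
  have rate: "a * r^2 * (c3 / 2) = ?r * CF" using CF by (simp add: a_def \<delta>_def mult_ac)
  have "F t \<le> exp (- ?r * t) * F 0"
  proof (rule gronwall_decay[OF Fder _ t])
   fix s :: real assume s: "0 \<le> s"
   have "?r * F s \<le> ?r * (CF * (norm (u s))^2)" using \<delta> by (intro mult_left_mono Fup) auto
   also have "\<dots> = a * r^2 * (c3 / 2) * (norm (u s))^2" unfolding rate by simp
   finally show "2 * (T (u' s) \<bullet> u s) \<le> - ?r * F s"
    by (intro order_trans[OF diss[OF s]]) (simp only: mult_minus_left neg_le_iff_le)
  qed
  also have "\<dots> \<le> exp (- ?r * t) * (CF * (norm (u 0))^2)" by (intro mult_left_mono Fup) auto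
  finally have "a0 / 2 * (norm (u t))^2 \<le> exp (- ?r * t) * (CF * (norm (u 0))^2)" using Flow[of t] by linarith
  then show "(norm (u t))^2 \<le> 2 * CF / a0 * exp (- (\<delta> * rate \<xi>) * t) * (norm (u 0))^2"
   using a0(1) by (simp add: r_def field_simps)
 qed
qed

section \<open>The propagator\<close>

primrec mpow :: "complex^'m^'m \<Rightarrow> nat \<Rightarrow> complex^'m^'m" where
 "mpow M 0 = mat 1"
| "mpow M (Suc k) = M ** mpow M k"

lemma mpow_Suc_nth: "mpow M (Suc k) $ i $ j = (\<Sum>l\<in>UNIV. M $ i $ l * mpow M k $ l $ j)"
 by (simp add: matrix_matrix_mult_def)

lemma mpow_bound:
 fixes M :: "complex^'m^'m"
 assumes "\<And>i j. norm (M $ i $ j) \<le> b"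
 shows "norm (mpow M k $ i $ j) \<le> (real CARD('m) * b) ^ k"
proof (induction k arbitrary: i j)
 case 0 show ?case by (simp add: mat_def)
next
 case (Suc k)
 have "norm (mpow M (Suc k) $ i $ j) \<le> (\<Sum>l\<in>(UNIV::'m set). b * (real CARD('m) * b) ^ k)" unfolding mpow_Suc_nth
 proof (rule order_trans[OF norm_sum sum_mono])
  show "norm (M $ i $ l * mpow M k $ l $ j) \<le> b * (real CARD('m) * b) ^ k" for l
   unfolding norm_mult using assms[of i l] order_trans[OF norm_ge_zero assms] by (intro mult_mono Suc.IH) auto
 qed
 then show ?case by simp
qed

text \<open>The matrix exponential by entries, so that its derivative, and its measurability in a
  parameter of the matrix, are statements about scalar power series.\<close>

definition mexp :: "complex^'m^'m \<Rightarrow> real \<Rightarrow> complex^'m^'m" where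
 "mexp M t = (\<chi> i j. \<Sum>k. mpow M k $ i $ j / fact k * cplx t ^ k)"

lemma mexp_summable: "summable (\<lambda>k. mpow M k $ i $ j / fact k * z ^ k)" for M :: "complex^'m^'m"
proof -
 define b where "b = Max (range (\<lambda>(i, j). norm (M $ i $ j)))"
 have b: "norm (M $ i $ j) \<le> b" for i j unfolding b_def by (rule Max_ge) (auto intro!: image_eqI[of _ _ "(i, j)"])
 show ?thesis
 proof (rule summable_comparison_test'[where N = 0])
  show "summable (\<lambda>k. inverse (fact k) * (real CARD('m) * b * norm z) ^ k)" by (rule summable_exp)
  fix k
  have "norm (mpow M k $ i $ j / fact k * z ^ k) = norm (mpow M k $ i $ j) * (inverse (fact k) * norm z ^ k)"
   by (simp add: norm_mult norm_divide norm_power divide_inverse norm_inverse norm_fact)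
  also have "\<dots> \<le> (real CARD('m) * b) ^ k * (inverse (fact k) * norm z ^ k)" by (intro mult_right_mono mpow_bound b) auto
  finally show "norm (mpow M k $ i $ j / fact k * z ^ k) \<le> inverse (fact k) * (real CARD('m) * b * norm z) ^ k"
   by (simp add: power_mult_distrib mult_ac)
 qed
qed

lemma mexp_0: "mexp M 0 $ i $ j = (if i = j then 1 else 0)"
proof -
 have "(\<Sum>k. mpow M k $ i $ j / fact k * cplx 0 ^ k) = mpow M 0 $ i $ j / fact 0"
  using powser_zero[of "\<lambda>k. mpow M k $ i $ j / fact k"] by simp
 then show ?thesis by (simp add: mexp_def mat_def)
qed

lemma mexp_derivative:
 "((\<lambda>t. mexp M t $ i $ j) has_vector_derivative (\<Sum>l\<in>UNIV. M $ i $ l * mexp M t $ l $ j)) (at t)"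
proof -
 define c where "c k = mpow M k $ i $ j / fact k" for k
 have "((\<lambda>z. \<Sum>k. c k * z ^ k) has_field_derivative (\<Sum>k. diffs c k * cplx t ^ k)) (at (cplx t))"
  unfolding c_def by (rule termdiffs_strong_converges_everywhere) (rule mexp_summable)
 from has_vector_derivative_real_field[OF this]
 have "((\<lambda>t. mexp M t $ i $ j) has_vector_derivative (\<Sum>k. diffs c k * cplx t ^ k)) (at t)"
  by (simp add: mexp_def c_def)
 moreover have "diffs c k * cplx t ^ k = (\<Sum>l\<in>UNIV. M $ i $ l * (mpow M k $ l $ j / fact k * cplx t ^ k))" for k
 proof -
  have "diffs c k = mpow M (Suc k) $ i $ j / fact k" by (simp add: diffs_def c_def fact_Suc del: mpow.simps of_nat_Suc)
  then show ?thesis unfolding mpow_Suc_nth by (simp add: sum_divide_distrib sum_distrib_right mult.assoc)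
 qed
 moreover have "(\<Sum>k. \<Sum>l\<in>UNIV. M $ i $ l * (mpow M k $ l $ j / fact k * cplx t ^ k)) = (\<Sum>l\<in>UNIV. M $ i $ l * mexp M t $ l $ j)"
 proof (rule sums_unique[symmetric], rule sums_sum)
  show "(\<lambda>k. M $ i $ l * (mpow M k $ l $ j / fact k * cplx t ^ k)) sums (M $ i $ l * mexp M t $ l $ j)" for l
   using sums_mult[OF summable_sums[OF mexp_summable]] by (simp add: mexp_def)
 qed
 ultimately show ?thesis by simp
qed

lemma mexp_measurable:
 fixes M :: "'a::euclidean_space \<Rightarrow> complex^'m^'m"
 assumes M: "\<And>i j. (\<lambda>x. M x $ i $ j) \<in> \<B>"
 shows "(\<lambda>x. mexp (M x) t $ i $ j) \<in> \<B>"
proof -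
 have pm[measurable]: "(\<lambda>x. mpow (M x) k $ i $ j) \<in> \<B>" for k i j
 proof (induction k arbitrary: i j)
  case (Suc k)
  show ?case unfolding mpow_Suc_nth by (rule borel_measurable_sum, rule borel_measurable_times, rule M, rule Suc)
 qed simp
 show ?thesis
 proof (rule borel_measurable_LIMSEQ_metric)
  show "(\<lambda>n. \<Sum>k<n. mpow (M x) k $ i $ j / fact k * cplx t ^ k) \<longlonglongrightarrow> mexp (M x) t $ i $ j" for x
   using summable_LIMSEQ[OF mexp_summable] by (simp add: mexp_def)
 qed measurable
qed

lemma has_vector_derivative_vec_lambda:
 fixes f :: "real \<Rightarrow> 'm::finite \<Rightarrow> 'b::euclidean_space"
 assumes "\<And>i. ((\<lambda>t. f t i) has_vector_derivative f' i) (at t)"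
 shows "((\<lambda>t. \<chi> i. f t i) has_vector_derivative (\<chi> i. f' i)) (at t)"
proof -
 have ax: "(\<chi> i. g i) = (\<Sum>i\<in>UNIV. axis i (g i))" for g :: "'m \<Rightarrow> 'b"
  by (simp add: vec_eq_iff axis_def if_distrib cong: if_cong)
 have "bounded_linear (axis i :: 'b \<Rightarrow> 'b^'m)" for i
  by (intro linear_conv_bounded_linear[THEN iffD1] linearI) (auto simp: vec_eq_iff axis_def)
 then have "((\<lambda>t. axis i (f t i)) has_vector_derivative axis i (f' i)) (at t)" for i
  by (rule bounded_linear.has_vector_derivative) (rule assms)
 then show ?thesis unfolding ax by (rule has_vector_derivative_sum)
qed

text \<open>Positivity is known on complex vectors and is transferred to real ones by embedding; a
  matrix with trivial kernel is invertible on both sides.\<close>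

lemma pos_invertible:
 fixes A0 :: "real^'m^'m"
 assumes pos: "\<And>u. u \<noteq> 0 \<Longrightarrow> 0 < cm A0 u \<bullet> u"
 obtains B where "B ** A0 = mat 1" "A0 ** B = mat 1"
proof -
 have "x = 0" if "A0 *v x = 0" for x
 proof (rule ccontr)
  assume "x \<noteq> 0"
  define u where "u = (\<chi> i. cplx (x $ i))"
  have "u \<noteq> 0" using \<open>x \<noteq> 0\<close> by (auto simp: u_def vec_eq_iff)
  moreover have "cm A0 u $ i = cplx ((A0 *v x) $ i)" for i by (simp add: cm_nth u_def matrix_vector_mult_def)
  then have "cm A0 u = 0" using that by (simp add: vec_eq_iff)
  ultimately show False using pos[of u] by simp
 qed
 then obtain B where "B ** A0 = mat 1" using matrix_left_invertible_ker[of A0] by blast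
 then show ?thesis using that matrix_left_right_inverse by blast
qed

text \<open>What the solution operator needs to know about the exponential of each frequency:
  \<open>E'\<close> is its time derivative and may grow by one power of |\<xi>|, while
  \<open>E\<close> decays at the rate of the Lyapunov function. One constant \<open>C\<close> serves
  for all bounds.\<close>

locale propagation =
 fixes A0 L :: "real^'m^'m" and A :: "'n::finite \<Rightarrow> real^'m^'m"
  and E E' :: "real \<Rightarrow> real^'n \<Rightarrow> 'm \<Rightarrow> 'm \<Rightarrow> complex" and c C :: real
 assumes cC: "0 < c" "0 < C"
  and E_measurable [measurable]: "\<And>t i j. (\<lambda>\<xi>. E t \<xi> i j) \<in> \<B>"
  and E'_measurable [measurable]: "\<And>t i j. (\<lambda>\<xi>. E' t \<xi> i j) \<in> \<B>"
  and E_0: "\<And>\<xi> i j. E 0 \<xi> i j = (if i = j then 1 else 0)"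
  and E_derivative: "\<And>t \<xi> i j. ((\<lambda>t. E t \<xi> i j) has_vector_derivative E' t \<xi> i j) (at t)"
  and E_ode: "\<And>t \<xi> i j. (\<Sum>l\<in>UNIV. of_real (A0 $ i $ l) * E' t \<xi> l j) =
   - (\<i> * (\<Sum>l\<in>UNIV. of_real (symbol A \<xi> $ i $ l) * E t \<xi> l j)) - (\<Sum>l\<in>UNIV. of_real (L $ i $ l) * E t \<xi> l j)"
  and E_decay: "\<And>t \<xi> z. 0 \<le> t \<Longrightarrow> norm (\<chi> i. \<Sum>j\<in>UNIV. E t \<xi> i j * z $ j) \<le>
   C * exp (- (c * rate \<xi>) * t) * norm z"
  and E_bound: "\<And>t \<xi> i j. 0 \<le> t \<Longrightarrow> norm (E t \<xi> i j) \<le> C"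
  and E'_bound: "\<And>t \<xi> i j. 0 \<le> t \<Longrightarrow> norm (E' t \<xi> i j) \<le> C * (1 + norm \<xi>)"

text \<open>\<open>E\<close> is the exponential of t G(\<xi>) with G(\<xi>) = -B (i A(\<xi>) + L),
  where \<open>B\<close> is the inverse of \<open>A0\<close>. Its columns solve the equation of
  \<open>pointwise_decay\<close>, and entries of \<open>E\<close> are read off from unit
  vectors.\<close>

lemma propagator:
 fixes A0 L S :: "real^'m^'m" and A :: "'n::finite \<Rightarrow> real^'m^'m"
 assumes A: "condition_A A0 A L" and K: "condition_K A0 A L" and S: "condition_S A0 L S" and S1: "condition_S1 A L S"
 obtains E E' :: "real \<Rightarrow> real^'n \<Rightarrow> 'm \<Rightarrow> 'm \<Rightarrow> complex" and c C :: real where "propagation A0 L A E E' c C"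
proof -
 from pointwise_decay[OF A K S S1] obtain c C where cC: "0 < c" "0 < C" and dec0: "\<forall>(\<xi>::real^'n) u u'.
  (\<forall>t\<ge>0. (u has_vector_derivative u' t) (at t) \<and> cm A0 (u' t) = - (\<i> *s cm (symbol A \<xi>) (u t)) - cm L (u t)) \<longrightarrow>
  (\<forall>t\<ge>0. (norm (u t))\<^sup>2 \<le> C * exp (- (c * rate \<xi>) * t) * (norm (u 0))^2)" by (elim exE conjE)
 note dec = dec0[rule_format]
 obtain B where B: "B ** A0 = mat 1" "A0 ** B = mat 1" by (rule pos_invertible, erule condition_A_D(3)[OF A]) (rule that)
 define G where "G \<xi> = (\<chi> i j. - (\<i> * of_real ((B ** symbol A \<xi>) $ i $ j) + of_real ((B ** L) $ i $ j)))" for \<xi>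
 have Gv: "G \<xi> *v u = - (\<i> *s cm (B ** symbol A \<xi>) u) - cm (B ** L) u" for \<xi> u
  by (simp add: vec_eq_iff G_def cm_nth matrix_vector_mult_def algebra_simps sum.distrib sum_negf sum_subtractf sum_distrib_left)
 have AG: "cm A0 (G \<xi> *v u) = - (\<i> *s cm (symbol A \<xi>) u) - cm L u" for \<xi> u
  unfolding Gv by (simp add: cm_diff cm_minus cm_ii cm_mult[symmetric] matrix_mul_assoc B(2) matrix_mul_lid)
 define E where "E t \<xi> i j = mexp (G \<xi>) t $ i $ j" for t \<xi> i j
 define E' where "E' t \<xi> i j = (\<Sum>l\<in>UNIV. G \<xi> $ i $ l * E t \<xi> l j)" for t \<xi> i j
 have Gm: "(\<lambda>\<xi>. G \<xi> $ i $ j) \<in> \<B>" for i j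
 proof -
  have "continuous_on UNIV (\<lambda>\<xi>. - (\<i> * cplx (\<Sum>k\<in>UNIV. B $ i $ k * symbol A \<xi> $ k $ j) + cplx ((B ** L) $ i $ j)))"
   by (intro continuous_intros)
  then show ?thesis by (intro borel_measurable_continuous_onI) (simp add: G_def matrix_matrix_mult_def)
 qed
 have Em: "(\<lambda>\<xi>. E t \<xi> i j) \<in> \<B>" for t i j unfolding E_def by (rule mexp_measurable[OF Gm])
 have E'm: "(\<lambda>\<xi>. E' t \<xi> i j) \<in> \<B>" for t i j
  unfolding E'_def by (intro borel_measurable_sum borel_measurable_times Gm Em)
 have Ed: "((\<lambda>t. E t \<xi> i j) has_vector_derivative E' t \<xi> i j) (at t)" for t \<xi> i j
  unfolding E_def E'_def by (rule mexp_derivative)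
 have E0: "E 0 \<xi> i j = (if i = j then 1 else 0)" for \<xi> i j by (simp add: E_def mexp_0)
 have ode: "(\<Sum>l\<in>UNIV. of_real (A0 $ i $ l) * E' t \<xi> l j) = - (\<i> * (\<Sum>l\<in>UNIV. of_real (symbol A \<xi> $ i $ l) * E t \<xi> l j)) - (\<Sum>l\<in>UNIV. of_real (L $ i $ l) * E t \<xi> l j)" for t \<xi> i j
  using arg_cong[OF AG[of \<xi> "\<chi> l. E t \<xi> l j"], of "\<lambda>v. v $ i"]
  by (simp add: cm_nth matrix_vector_mult_def E'_def)
 \<comment> \<open>The Lyapunov estimate bounds the square of the norm; its root halves the rate and
   replaces \<open>C\<close> by \<open>sqrt C\<close>.\<close>
 have decay: "norm (\<chi> i. \<Sum>j\<in>UNIV. E t \<xi> i j * z $ j) \<le> sqrt C * exp (- (c / 2 * rate \<xi>) * t) * norm z" if t: "0 \<le> t" for t \<xi> z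
 proof -
  define u where "u t = (\<chi> i. \<Sum>j\<in>UNIV. E t \<xi> i j * z $ j)" for t
  define u' where "u' t = (\<chi> i. \<Sum>j\<in>UNIV. E' t \<xi> i j * z $ j)" for t
  have "(u has_vector_derivative u' t) (at t)" for t
  proof -
   have "((\<lambda>t. \<Sum>j\<in>UNIV. E t \<xi> i j * z $ j) has_vector_derivative (\<Sum>j\<in>UNIV. E' t \<xi> i j * z $ j)) (at t)" for i
    by (intro has_vector_derivative_sum has_vector_derivative_mult_left Ed)
   then show ?thesis unfolding u_def u'_def by (rule has_vector_derivative_vec_lambda)
  qed
  moreover have "cm A0 (u' t) = - (\<i> *s cm (symbol A \<xi>) (u t)) - cm L (u t)" for t
  proof -
   have "u' t = G \<xi> *v u t"
    unfolding u'_def u_def E'_def by (simp add: vec_eq_iff matrix_vector_mult_def sum_distrib_left sum_distrib_right mult.assoc, subst sum.swap, simp)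
   then show ?thesis by (simp add: AG)
  qed
  ultimately have "(norm (u t))^2 \<le> C * exp (- (c * rate \<xi>) * t) * (norm (u 0))^2"
   using t by (intro dec[of u u']) simp_all
  also have "u 0 = z" by (simp add: u_def E0 vec_eq_iff if_distrib if_distribR cong: if_cong)
  also have "exp (- (c * rate \<xi>) * t) = (exp (- (c / 2 * rate \<xi>) * t))^2" by (simp add: power2_eq_square mult_exp_exp)
  also have "C * (exp (- (c / 2 * rate \<xi>) * t))^2 * (norm z)^2 = (sqrt C * exp (- (c / 2 * rate \<xi>) * t) * norm z)^2"
   using cC by (simp add: power_mult_distrib)
  finally show ?thesis unfolding u_def[symmetric] by (rule power2_le_imp_le) (use cC in auto)
 qed
 have Eb: "norm (E t \<xi> i j) \<le> sqrt C" if t: "0 \<le> t" for t \<xi> i j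
 proof -
  have "E t \<xi> i j = (\<chi> i. \<Sum>k\<in>UNIV. E t \<xi> i k * axis j 1 $ k) $ i"
   by (simp add: axis_def if_distrib if_distribR cong: if_cong)
  then have "norm (E t \<xi> i j) \<le> norm (\<chi> i. \<Sum>k\<in>UNIV. E t \<xi> i k * axis j 1 $ k)"
   by (simp only: Finite_Cartesian_Product.norm_nth_le)
  also have "\<dots> \<le> sqrt C * exp (- (c / 2 * rate \<xi>) * t) * norm (axis j 1 :: complex^'m)" by (rule decay[OF t])
  also have "\<dots> \<le> sqrt C * 1 * 1" using cC t by (intro mult_mono) (auto simp: norm_axis_1)
  finally show ?thesis by simp
 qed
 obtain b where b: "0 < b" "\<And>\<xi> i j. norm (G \<xi> $ i $ j) \<le> b * (1 + norm \<xi>)"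
 proof -
  obtain b1 where b1: "0 < b1" "\<And>\<omega> u. norm (cm B (cm (symbol A \<omega>) u)) \<le> b1 * norm \<omega> * norm u"
   by (rule symbol_bound[of B A]) (rule that)
  obtain b2 where b2: "0 < b2" "\<And>u. norm (cm (B ** L) u) \<le> b2 * norm u" by (rule cm_bound[of "B ** L"]) (rule that)
  show ?thesis
  proof (rule that[of "b1 + b2"])
   fix \<xi> i j
   have "G \<xi> $ i $ j = (G \<xi> *v axis j 1) $ i"
    by (simp add: matrix_vector_mult_def axis_def if_distrib if_distribR cong: if_cong)
   then have "norm (G \<xi> $ i $ j) \<le> norm (G \<xi> *v axis j 1)" by (simp add: Finite_Cartesian_Product.norm_nth_le)
   also have "\<dots> \<le> norm (cm B (cm (symbol A \<xi>) (axis j 1))) + norm (cm (B ** L) (axis j 1))"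
    unfolding Gv by (rule order_trans[OF norm_triangle_ineq4]) (simp add: norm_ii cm_mult)
   also have "\<dots> \<le> b1 * norm \<xi> * 1 + b2 * 1"
    using b1(2)[of \<xi> "axis j 1"] b2(2)[of "axis j 1"] by (intro add_mono) (auto simp: norm_axis_1)
   also have "\<dots> \<le> (b1 + b2) * (1 + norm \<xi>)" using b1(1) b2(1) by (simp add: algebra_simps)
   finally show "norm (G \<xi> $ i $ j) \<le> (b1 + b2) * (1 + norm \<xi>)" .
  qed (use b1 b2 in simp)
 qed
 have E'b: "norm (E' t \<xi> i j) \<le> (real CARD('m) * b * sqrt C) * (1 + norm \<xi>)" if t: "0 \<le> t" for t \<xi> i j
 proof -
  have "norm (E' t \<xi> i j) \<le> (\<Sum>l\<in>(UNIV::'m set). b * (1 + norm \<xi>) * sqrt C)" unfolding E'_def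
  proof (rule order_trans[OF norm_sum sum_mono])
   show "norm (G \<xi> $ i $ l * E t \<xi> l j) \<le> b * (1 + norm \<xi>) * sqrt C" for l
    unfolding norm_mult using b Eb[OF t] by (intro mult_mono) auto
  qed
  then show ?thesis by (simp add: mult_ac)
 qed
 define C' where "C' = max (sqrt C) (real CARD('m) * b * sqrt C)"
 have C': "sqrt C \<le> C'" "real CARD('m) * b * sqrt C \<le> C'" "0 < C'" using cC by (auto simp: C'_def less_max_iff_disj)
 show ?thesis
 proof (rule that[of E E' "c / 2" C'], unfold_locales)
  show "norm (\<chi> i. \<Sum>j\<in>UNIV. E t \<xi> i j * z $ j) \<le> C' * exp (- (c / 2 * rate \<xi>) * t) * norm z" if "0 \<le> t" for t \<xi> z
   by (rule order_trans[OF decay[OF that]]) (intro mult_right_mono C' exp_ge_zero norm_ge_zero)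
  show "norm (E t \<xi> i j) \<le> C'" if "0 \<le> t" for t \<xi> i j using Eb[OF that] C'(1) by (rule order_trans)
  show "norm (E' t \<xi> i j) \<le> C' * (1 + norm \<xi>)" if "0 \<le> t" for t \<xi> i j
   by (rule order_trans[OF E'b[OF that]]) (intro mult_right_mono C', simp)
 qed (use cC C' Em E'm E0 Ed ode in auto)
qed

section \<open>The solution operator on smooth data\<close>

lemma FT_diff: "L1 f \<Longrightarrow> L1 g \<Longrightarrow> FT (\<lambda>x. f x - g x) \<xi> = FT f \<xi> - FT g \<xi>"
 unfolding FT_def by (simp add: right_diff_distrib FT_integrable)

lemma Lb_norm: "Lb a B f \<Longrightarrow> Lb a B (\<lambda>x. norm (f x))"
 by (auto simp: Lb_def intro: measurable_compose[OF _ borel_measurable_norm])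

context propagation
begin

definition cf :: "(real^'n \<Rightarrow> real^'m) \<Rightarrow> 'm \<Rightarrow> real^'n \<Rightarrow> complex" where
 "cf f j x = cplx (f x $ j)"

abbreviation ftsum where "ftsum f \<xi> \<equiv> \<Sum>j\<in>UNIV. norm (FT (cf f j) \<xi>)"

definition usym :: "real \<Rightarrow> (real^'n \<Rightarrow> real^'m) \<Rightarrow> 'm \<Rightarrow> real^'n \<Rightarrow> complex" where
 "usym t f i \<xi> = (\<Sum>j\<in>UNIV. E t \<xi> i j * FT (cf f j) \<xi>)"

definition usym' :: "real \<Rightarrow> (real^'n \<Rightarrow> real^'m) \<Rightarrow> 'm \<Rightarrow> real^'n \<Rightarrow> complex" where
 "usym' t f i \<xi> = (\<Sum>j\<in>UNIV. E' t \<xi> i j * FT (cf f j) \<xi>)"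

text \<open>Taking the real part is harmless because the system has real coefficients: real parts of
  solutions are solutions. No conjugation symmetry of the transforms has to be established.\<close>

definition invFT :: "('m \<Rightarrow> real^'n \<Rightarrow> complex) \<Rightarrow> real^'n \<Rightarrow> real^'m" where
 "invFT G x = (\<chi> i. Re (FT (G i) (- x)) / \<kappa> TYPE('n))"

text \<open>\<open>js = []\<close> is the solution with data \<open>f\<close>; other lists give its
  space derivatives, defined by the symbol and related to the solution afterwards.\<close>

definition dsol :: "'n list \<Rightarrow> real \<Rightarrow> (real^'n \<Rightarrow> real^'m) \<Rightarrow> real^'n \<Rightarrow> real^'m" where
 "dsol js t f = invFT (\<lambda>i \<xi>. mon js \<xi> * usym t f i \<xi>)"

definition tsol :: "real \<Rightarrow> (real^'n \<Rightarrow> real^'m) \<Rightarrow> real^'n \<Rightarrow> real^'m" where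
 "tsol t f = invFT (\<lambda>i. usym' t f i)"

lemma bounded_linear_component: "bounded_linear (\<lambda>v :: real^'m. cplx (v $ j))"
 by (intro bounded_linear_compose[OF bounded_linear_of_real] bounded_linear_vec_nth)

lemma cf_smooth: "smooth_csupp f \<Longrightarrow> smooth_csupp (cf f j)"
 unfolding cf_def[abs_def] smooth_csupp_def using smooth_linear[OF bounded_linear_component] by fastforce

lemma cf_partial_derivs: "smooth_csupp f \<Longrightarrow> pds js (cf f j) = cf (pds js f) j"
 unfolding cf_def[abs_def] smooth_csupp_def by (intro partial_derivs_linear[OF bounded_linear_component]) simp

lemma cf_norm_le: "norm (cf f j x) \<le> norm (f x)"
 by (simp add: cf_def component_le_norm_cart)

lemma FT_cf_measurable: "smooth_csupp f \<Longrightarrow> FT (cf f j) \<in> \<B>"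
 using cf_smooth[of f j] smooth_borel_measurable by (intro FT_measurable) (auto simp: smooth_csupp_def)

lemma usym_measurable:
 assumes "smooth_csupp f" shows "usym t f i \<in> \<B>" "usym' t f i \<in> \<B>"
 using FT_cf_measurable[OF assms] unfolding usym_def[abs_def] usym'_def[abs_def]
 by (intro borel_measurable_sum borel_measurable_times E_measurable E'_measurable; simp)+

lemma FT_cf_decay:
 assumes f: "smooth_csupp f"
 obtains D where "0 \<le> D" "\<And>\<xi>. (1 + norm \<xi>) ^ N * ftsum f \<xi> \<le> D"
proof -
 have "\<exists>D. \<forall>\<xi>. (1 + norm \<xi>) ^ N * norm (FT (cf f j) \<xi>) \<le> D" for j
  by (rule FT_decay[OF cf_smooth[OF f]]) auto
 then obtain D where D: "\<And>j \<xi>. (1 + norm \<xi>) ^ N * norm (FT (cf f j) \<xi>) \<le> D j" by metis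
 have le: "(1 + norm \<xi>) ^ N * ftsum f \<xi> \<le> (\<Sum>j\<in>UNIV. D j)" for \<xi>
  unfolding sum_distrib_left by (intro sum_mono D)
 have "0 \<le> (1 + norm (0::real^'n)) ^ N * (\<Sum>j\<in>UNIV. norm (FT (cf f j) 0))" by (simp add: sum_nonneg)
 also have "\<dots> \<le> (\<Sum>j\<in>UNIV. D j)" by (rule le)
 finally show ?thesis by (rule that[OF _ le])
qed

lemma usym_le: "0 \<le> t \<Longrightarrow> norm (usym t f i \<xi>) \<le> C * ftsum f \<xi>"
 unfolding usym_def sum_distrib_left
 by (rule order_trans[OF norm_sum sum_mono]) (auto simp: norm_mult intro!: mult_right_mono E_bound)

lemma usym'_le: "0 \<le> t \<Longrightarrow> norm (usym' t f i \<xi>) \<le> C * (1 + norm \<xi>) * ftsum f \<xi>"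
 unfolding usym'_def sum_distrib_left
 by (rule order_trans[OF norm_sum sum_mono]) (auto simp: norm_mult intro!: mult_right_mono E'_bound)

text \<open>The transform of smooth compactly supported data decays faster than any power, so
  polynomial weights cost nothing; n + 1 further powers ensure integrability.\<close>

lemma weighted_integrable:
 assumes f: "smooth_csupp f" and g: "g \<in> \<B>"
  and le: "\<And>\<xi>. norm (g \<xi>) \<le> K * (1 + norm \<xi>) ^ N * ftsum f \<xi>" and K: "0 \<le> K"
 shows "L1 (g :: real^'n \<Rightarrow> 'b::{banach, second_countable_topology})"
proof -
 obtain D where D: "\<And>\<xi>. (1 + norm \<xi>) ^ (CARD('n) + 1 + N) * ftsum f \<xi> \<le> D"
  by (rule FT_cf_decay[OF f, where N = "CARD('n) + 1 + N"]) (rule that)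
 show ?thesis
 proof (rule integrable_decay[OF g])
  fix \<xi>
  have "(1 + norm \<xi>) ^ (CARD('n) + 1) * norm (g \<xi>) \<le> (1 + norm \<xi>) ^ (CARD('n) + 1) * (K * (1 + norm \<xi>) ^ N * ftsum f \<xi>)"
   by (intro mult_left_mono le) auto
  also have "\<dots> = K * ((1 + norm \<xi>) ^ (CARD('n) + 1 + N) * ftsum f \<xi>)" by (simp add: power_add mult_ac)
  also have "\<dots> \<le> K * D" by (intro mult_left_mono D K)
  finally show "(1 + norm \<xi>) ^ (CARD('n) + 1) * norm (g \<xi>) \<le> K * D" .
 qed
qed

lemma mon_usym_le:
 assumes t: "0 \<le> t"
 shows "norm (mon js \<xi> * usym t f i \<xi>) \<le> C * (1 + norm \<xi>) ^ length js * ftsum f \<xi>"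
proof -
 have "norm (mon js \<xi>) \<le> (1 + norm \<xi>) ^ length js" by (rule order_trans[OF mon_norm_le]) (intro power_mono, auto)
 then have "norm (mon js \<xi> * usym t f i \<xi>) \<le> (1 + norm \<xi>) ^ length js * (C * ftsum f \<xi>)"
  unfolding norm_mult by (intro mult_mono usym_le t) auto
 then show ?thesis by (simp add: mult_ac)
qed

lemma mon_usym_integrable:
 assumes f: "smooth_csupp f" and t: "0 \<le> t"
 shows "L1 (\<lambda>\<xi>. mon js \<xi> * usym t f i \<xi>)"
 using usym_measurable(1)[OF f] cC by (intro weighted_integrable[OF f _ mon_usym_le[OF t]]) auto

lemma usym'_integrable:
 assumes f: "smooth_csupp f" and t: "0 \<le> t"
 shows "L1 (usym' t f i)"
 by (rule weighted_integrable[OF f usym_measurable(2)[OF f], where K = C and N = 1]) (use usym'_le[OF t] cC in simp_all)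

lemma borel_measurable_vec_lambda:
 fixes g :: "'a \<Rightarrow> 'm \<Rightarrow> real"
 assumes "\<And>i. (\<lambda>x. g x i) \<in> borel_measurable M"
 shows "(\<lambda>x. \<chi> i. g x i) \<in> borel_measurable M"
proof -
 have "(\<chi> i. g x i) = (\<Sum>i\<in>UNIV. g x i *\<^sub>R axis i 1)" for x
  by (simp add: vec_eq_iff axis_def if_distrib cong: if_cong)
 then show ?thesis using assms by simp
qed

lemma invFT_measurable:
 assumes "\<And>i. G i \<in> \<B>" shows "invFT G \<in> \<B>"
proof -
 have "(\<lambda>x. FT (G i) (- x)) \<in> \<B>" for i using measurable_compose[OF _ FT_measurable[OF assms], of uminus] by simp
 then have "(\<lambda>x. Re (FT (G i) (- x)) / \<kappa> TYPE('n)) \<in> \<B>" for i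
  using measurable_compose[OF _ borel_measurable_Re] by (intro borel_measurable_divide borel_measurable_const) simp
 then show ?thesis unfolding invFT_def[abs_def] by (rule borel_measurable_vec_lambda)
qed

lemma invFT_norm_le: "norm (invFT G x) \<le> (\<Sum>i\<in>UNIV. norm (FT (G i) (- x)) / \<kappa> TYPE('n))"
proof (rule order_trans[OF norm_le_l1_cart sum_mono])
 show "\<bar>invFT G x $ i\<bar> \<le> norm (FT (G i) (- x)) / \<kappa> TYPE('n)" for i
  using \<kappa>_pos[where 'n = 'n] abs_Re_le_cmod by (simp add: invFT_def divide_right_mono)
qed

lemma dsol_measurable: "smooth_csupp f \<Longrightarrow> dsol js t f \<in> \<B>"
 unfolding dsol_def using usym_measurable(1) by (intro invFT_measurable) auto

lemma tsol_measurable: "smooth_csupp f \<Longrightarrow> tsol t f \<in> \<B>"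
 unfolding tsol_def using usym_measurable(2) by (intro invFT_measurable) auto

lemma invFT_bounded:
 assumes f: "smooth_csupp f"
  and G: "\<And>t i. t \<in> T \<Longrightarrow> G t i \<in> \<B>"
  and le: "\<And>t i \<xi>. t \<in> T \<Longrightarrow> norm (G t i \<xi>) \<le> C * (1 + norm \<xi>) ^ N * ftsum f \<xi>"
 obtains M where "\<And>t x. t \<in> T \<Longrightarrow> norm (invFT (G t) x) \<le> M"
proof -
 let ?w = "\<lambda>\<xi>. C * (1 + norm \<xi>) ^ N * ftsum f \<xi>"
 have wm: "?w \<in> \<B>" using FT_cf_measurable[OF f] by measurable
 have w: "L1 ?w" by (rule weighted_integrable[OF f wm, of C N]) (use cC in \<open>auto simp: abs_mult sum_nonneg\<close>)
 show ?thesis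
 proof (rule that[of "\<Sum>i\<in>(UNIV::'m set). (LBINT \<xi>. ?w \<xi>) / \<kappa> TYPE('n)"])
  fix t x assume t: "t \<in> T"
  show "norm (invFT (G t) x) \<le> (\<Sum>i\<in>(UNIV::'m set). (LBINT \<xi>. ?w \<xi>) / \<kappa> TYPE('n))"
  proof (rule order_trans[OF invFT_norm_le sum_mono])
   fix i
   have Gi: "L1 (G t i)" by (rule int_bound[OF w]) (use G[OF t] order_trans[OF le[OF t] abs_ge_self] in simp_all)
   have "norm (FT (G t i) (- x)) \<le> (LBINT \<xi>. norm (G t i \<xi>))" by (rule FT_norm_le[OF Gi])
   also have "\<dots> \<le> (LBINT \<xi>. ?w \<xi>)" by (intro integral_mono integrable_norm Gi w le t)
   finally show "norm (FT (G t i) (- x)) / \<kappa> TYPE('n) \<le> (LBINT \<xi>. ?w \<xi>) / \<kappa> TYPE('n)"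
    using \<kappa>_pos[where 'n = 'n] by (simp add: divide_right_mono)
  qed
 qed
qed

lemma dsol_bounded:
 assumes f: "smooth_csupp f" obtains M where "\<And>t x. 0 \<le> t \<Longrightarrow> norm (dsol js t f x) \<le> M"
proof (rule invFT_bounded[OF f, of "{0..}" "\<lambda>t i \<xi>. mon js \<xi> * usym t f i \<xi>"])
 show "(\<lambda>\<xi>. mon js \<xi> * usym t f i \<xi>) \<in> \<B>" for t i using usym_measurable(1)[OF f] by measurable
qed (use mon_usym_le that in \<open>auto simp: dsol_def\<close>)

lemma tsol_bounded:
 assumes f: "smooth_csupp f" obtains M where "\<And>t x. 0 \<le> t \<Longrightarrow> norm (tsol t f x) \<le> M"
proof (rule invFT_bounded[OF f, of "{0..}" "\<lambda>t. usym' t f" 1])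
 show "usym' t f i \<in> \<B>" for t i by (rule usym_measurable(2)[OF f])
qed (use usym'_le that in \<open>auto simp: tsol_def\<close>)

lemma dsol_0:
 assumes f: "smooth_csupp f" shows "dsol [] 0 f = f"
proof
 fix x
 have "FT (\<lambda>\<xi>. mon [] \<xi> * usym 0 f i \<xi>) (- x) = cplx (\<kappa> TYPE('n)) * cf f i x" for i
 proof -
  have eq: "(\<lambda>\<xi>. mon [] \<xi> * usym 0 f i \<xi>) = FT (cf f i)"
   by (simp add: usym_def E_0 if_distrib if_distribR cong: if_cong)
  obtain B where "B > 0" and B: "\<And>x. norm (cf f i x) \<le> B" by (rule smooth_csupp_bounded[OF cf_smooth[OF f]]) auto
  show ?thesis unfolding eq
  proof (rule fourier_inversion[OF _ B])
   show "L1 (cf f i)" by (rule smooth_csupp_integrable[OF cf_smooth[OF f]])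
   show "continuous_on UNIV (cf f i)" using cf_smooth[OF f, of i] by (intro smooth_continuous) (simp add: smooth_csupp_def)
   show "L1 (FT (cf f i))" using mon_usym_integrable[OF f, of 0 "[]" i] by (simp only: eq)
  qed
 qed
 then show "dsol [] 0 f x = f x" using \<kappa>_pos[where 'n = 'n] by (simp add: dsol_def invFT_def cf_def vec_eq_iff)
qed

lemma invFT_has_vector_derivative:
 assumes f: "smooth_csupp f" and t: "t \<in> {a<..<b}"
  and G: "\<And>s i. s \<in> {a<..<b} \<Longrightarrow> L1 (G s i)"
  and G': "\<And>i. G' t i \<in> \<B>"
  and der: "\<And>s i \<xi>. s \<in> {a<..<b} \<Longrightarrow> ((\<lambda>s. G s i \<xi>) has_vector_derivative G' s i \<xi>) (at s)"
  and le: "\<And>s i \<xi>. s \<in> {a<..<b} \<Longrightarrow> norm (G' s i \<xi>) \<le> C * (1 + norm \<xi>) ^ N * ftsum f \<xi>"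
 shows "((\<lambda>s. invFT (G s) x) has_vector_derivative invFT (G' t) x) (at t)"
proof -
 let ?w = "\<lambda>\<xi>. C * (1 + norm \<xi>) ^ N * ftsum f \<xi>"
 have wm: "?w \<in> \<B>" using FT_cf_measurable[OF f] by measurable
 have w: "L1 ?w" by (rule weighted_integrable[OF f wm, of C N]) (use cC in \<open>auto simp: abs_mult sum_nonneg\<close>)
 have "((\<lambda>s. FT (G s i) (- x)) has_vector_derivative FT (G' t i) (- x)) (at t)" for i unfolding FT_def
 proof (rule has_vector_derivative_lebesgue_integral[OF t, where g = ?w])
  show "L1 (\<lambda>xa. cis (- (xa \<bullet> - x)) * G s i xa)" if "s \<in> {a<..<b}" for s
   by (rule FT_integrable[OF G[OF that]])
  show "((\<lambda>s. cis (- (y \<bullet> - x)) * G s i y) has_vector_derivative cis (- (y \<bullet> - x)) * G' s i y) (at s)" if "s \<in> {a<..<b}" for s y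
   by (intro has_vector_derivative_mult_right der that)
  show "norm (cis (- (y \<bullet> - x)) * G' s i y) \<le> ?w y" if "s \<in> {a<..<b}" for s y
   using le[OF that, of i y] by (simp add: norm_mult)
  show "(\<lambda>xa. cis (- (xa \<bullet> - x)) * G' t i xa) \<in> borel_measurable lborel" using G'[of i] by measurable
 qed (rule w)
 then have "((\<lambda>s. Re (FT (G s i) (- x)) / \<kappa> TYPE('n)) has_vector_derivative Re (FT (G' t i) (- x)) / \<kappa> TYPE('n)) (at t)" for i
  using bounded_linear.has_vector_derivative[OF bounded_linear_compose[OF bounded_linear_divide[of "\<kappa> TYPE('n)"] bounded_linear_Re]] by fastforce
 then show ?thesis unfolding invFT_def by (rule has_vector_derivative_vec_lambda)
qed

lemma usym_derivative: "((\<lambda>s. usym s f i \<xi>) has_vector_derivative usym' t f i \<xi>) (at t)"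
 unfolding usym_def usym'_def by (intro has_vector_derivative_sum has_vector_derivative_mult_left E_derivative)

lemma dsol_time_derivative:
 assumes f: "smooth_csupp f" and t: "0 < t"
 shows "((\<lambda>s. dsol [] s f x) has_vector_derivative tsol t f x) (at t)"
 unfolding dsol_def tsol_def
proof (rule invFT_has_vector_derivative[OF f, where a = 0 and b = "t + 1" and N = 1])
 show "L1 (\<lambda>\<xi>. mon [] \<xi> * usym s f i \<xi>)" if "s \<in> {0<..<t + 1}" for s i
  using mon_usym_integrable[OF f, of s "[]" i] that by simp
 show "((\<lambda>s. mon [] \<xi> * usym s f i \<xi>) has_vector_derivative usym' s f i \<xi>) (at s)" for s i \<xi>
  using usym_derivative by simp
 show "norm (usym' s f i \<xi>) \<le> C * (1 + norm \<xi>) ^ 1 * ftsum f \<xi>" if "s \<in> {0<..<t + 1}" for s i \<xi>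
  using usym'_le[of s f i \<xi>] that by simp
qed (use t usym_measurable(2)[OF f] in auto)

lemma dsol_space_derivative:
 assumes f: "smooth_csupp f" and t: "0 \<le> t"
 shows "((\<lambda>s. dsol [] t f (x + s *\<^sub>R axis k 1)) has_vector_derivative dsol [k] t f x) (at 0)"
proof -
 \<comment> \<open>Translation by s along the axis is the factor \<open>cis (s * \<xi> $ k)\<close>
   under the inverse transform, so the space derivative becomes a derivative in a parameter.\<close>
 define G where "G s i \<xi> = cis (0 + s * (\<xi> $ k)) * usym t f i \<xi>" for s i \<xi>
 define G' where "G' s i \<xi> = \<i> * of_real (\<xi> $ k) * cis (0 + s * (\<xi> $ k)) * usym t f i \<xi>" for s i \<xi>
 have um[measurable]: "usym t f i \<in> \<B>" for i by (rule usym_measurable(1)[OF f])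
 have cm[measurable]: "(\<lambda>\<xi>::real^'n. \<xi> $ k) \<in> \<B>"
  by (intro borel_measurable_continuous_onI continuous_intros)
 have "((\<lambda>s. invFT (G s) x) has_vector_derivative invFT (G' 0) x) (at 0)"
 proof (rule invFT_has_vector_derivative[OF f, where a = "-1" and b = 1 and N = 1])
  show "L1 (G s i)" for s i
  proof (rule int_bound[OF mon_usym_integrable[OF f t, of "[]" i]])
   show "G s i \<in> borel_measurable lborel" unfolding G_def[abs_def] by measurable
  qed (simp add: G_def norm_mult)
  show "((\<lambda>s. G s i \<xi>) has_vector_derivative G' s i \<xi>) (at s)" for s i \<xi>
   unfolding G_def G'_def by (intro has_vector_derivative_mult_left has_vector_derivative_cis)
  show "norm (G' s i \<xi>) \<le> C * (1 + norm \<xi>) ^ 1 * ftsum f \<xi>" for s i \<xi>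
   using mon_usym_le[OF t, of "[k]" \<xi> f i] by (simp add: G'_def norm_mult)
  show "G' 0 i \<in> \<B>" for i unfolding G'_def[abs_def] by measurable
 qed simp
 moreover have "invFT (G s) x = dsol [] t f (x + s *\<^sub>R axis k 1)" for s
 proof -
  have "FT (G s i) (- x) = FT (\<lambda>\<xi>. mon [] \<xi> * usym t f i \<xi>) (- (x + s *\<^sub>R axis k 1))" for i
   unfolding FT_def G_def by (simp add: mult.assoc[symmetric] cis_mult inner_add_right inner_axis algebra_simps)
  then show ?thesis by (simp add: dsol_def invFT_def)
 qed
 moreover have "invFT (G' 0) x = dsol [k] t f x" by (simp add: dsol_def invFT_def G'_def[abs_def] mult.assoc)
 ultimately show ?thesis by simp
qed

text \<open>Uniform in space and valid up to time 0, where the bound on \<open>E'\<close> still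
  holds; it yields the attainment of the initial data.\<close>

lemma dsol_lipschitz:
 assumes f: "smooth_csupp f"
 obtains M where "\<And>s t x. 0 \<le> s \<Longrightarrow> 0 \<le> t \<Longrightarrow> norm (dsol [] t f x - dsol [] s f x) \<le> M * \<bar>t - s\<bar>"
proof -
 let ?w = "\<lambda>\<xi>. C * (1 + norm \<xi>) * ftsum f \<xi>"
 have wm: "?w \<in> \<B>" using FT_cf_measurable[OF f] by measurable
 have w: "L1 ?w"
  by (rule weighted_integrable[OF f wm, where K = C and N = 1]) (use cC in \<open>auto simp: abs_mult sum_nonneg\<close>)
 have lip: "norm (usym t f i \<xi> - usym s f i \<xi>) \<le> ?w \<xi> * \<bar>t - s\<bar>" if "0 \<le> s" "0 \<le> t" for s t i \<xi>
 proof -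
  have w0: "0 \<le> ?w \<xi>" using cC by (simp add: sum_nonneg)
  have "norm (usym t f i \<xi> - usym s f i \<xi>) \<le> ?w \<xi> * norm (t - s)"
  proof (rule differentiable_bound[of "{0..}"])
   show "((\<lambda>s. usym s f i \<xi>) has_derivative (\<lambda>h. h *\<^sub>R usym' r f i \<xi>)) (at r within {0..})" for r
    using usym_derivative[unfolded has_vector_derivative_def] by (rule has_derivative_at_withinI)
   show "onorm (\<lambda>h. h *\<^sub>R usym' r f i \<xi>) \<le> ?w \<xi>" if "r \<in> {0..}" for r
    using usym'_le[of r f i \<xi>] that w0
    by (intro onorm_bound) (auto simp: mult.commute[of _ "\<bar>_\<bar>"] intro: mult_left_mono)
  qed (use that in auto)
  then show ?thesis by simp
 qed
 show ?thesis
 proof (rule that[of "\<Sum>i\<in>(UNIV::'m set). (LBINT \<xi>. ?w \<xi>) / \<kappa> TYPE('n)"])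
  fix s t :: real and x assume st: "0 \<le> s" "0 \<le> t"
  have int: "L1 (\<lambda>\<xi>. mon [] \<xi> * usym t f i \<xi>)" if "0 \<le> t" for t i by (rule mon_usym_integrable[OF f that])
  have "dsol [] t f x - dsol [] s f x = invFT (\<lambda>i \<xi>. usym t f i \<xi> - usym s f i \<xi>) x"
   using int[OF st(1)] int[OF st(2)] by (simp add: dsol_def invFT_def vec_eq_iff FT_diff diff_divide_distrib)
  also have "norm \<dots> \<le> (\<Sum>i\<in>(UNIV::'m set). (LBINT \<xi>. ?w \<xi>) / \<kappa> TYPE('n) * \<bar>t - s\<bar>)"
  proof (rule order_trans[OF invFT_norm_le sum_mono])
   fix i
   have d: "L1 (\<lambda>\<xi>. usym t f i \<xi> - usym s f i \<xi>)" using int[OF st(1), of i] int[OF st(2), of i] by simp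
   have "norm (FT (\<lambda>\<xi>. usym t f i \<xi> - usym s f i \<xi>) (- x)) \<le> (LBINT \<xi>. norm (usym t f i \<xi> - usym s f i \<xi>))"
    by (rule FT_norm_le[OF d])
   also have "\<dots> \<le> (LBINT \<xi>. ?w \<xi> * \<bar>t - s\<bar>)"
    by (intro integral_mono integrable_norm d integrable_mult_left w lip st)
   also have "\<dots> = (LBINT \<xi>. ?w \<xi>) * \<bar>t - s\<bar>" by (rule integral_mult_left_zero)
   finally show "norm (FT (\<lambda>\<xi>. usym t f i \<xi> - usym s f i \<xi>) (- x)) / \<kappa> TYPE('n) \<le> (LBINT \<xi>. ?w \<xi>) / \<kappa> TYPE('n) * \<bar>t - s\<bar>"
    using \<kappa>_pos[where 'n = 'n] by (simp add: divide_right_mono)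
  qed
  finally show "norm (dsol [] t f x - dsol [] s f x) \<le> (\<Sum>i\<in>(UNIV::'m set). (LBINT \<xi>. ?w \<xi>) / \<kappa> TYPE('n)) * \<bar>t - s\<bar>"
   by (simp add: sum_distrib_right)
 qed
qed

lemma dsol_pde:
 assumes f: "smooth_csupp f" and t: "0 \<le> t"
 shows "A0 *v tsol t f x + (\<Sum>k\<in>UNIV. A k *v dsol [k] t f x) + L *v dsol [] t f x = 0"
proof -
 have "(A0 *v tsol t f x + (\<Sum>k\<in>UNIV. A k *v dsol [k] t f x) + L *v dsol [] t f x) $ i = 0" for i
 proof -
  let ?D = "\<lambda>k l \<xi>. mon [k] \<xi> * usym t f l \<xi>" and ?U = "\<lambda>l \<xi>. mon [] \<xi> * usym t f l \<xi>"
  let ?H = "\<lambda>\<xi>. (\<Sum>l\<in>UNIV. of_real (A0 $ i $ l) * usym' t f l \<xi>) + (\<Sum>k\<in>UNIV. \<Sum>l\<in>UNIV. of_real (A k $ i $ l) * ?D k l \<xi>) + (\<Sum>l\<in>UNIV. of_real (L $ i $ l) * ?U l \<xi>)"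
  have int: "L1 (\<lambda>\<xi>. of_real (A0 $ i $ l) * usym' t f l \<xi>)" "L1 (\<lambda>\<xi>. of_real (A k $ i $ l) * ?D k l \<xi>)" "L1 (\<lambda>\<xi>. of_real (L $ i $ l) * ?U l \<xi>)" for k l
   by (intro integrable_mult_right usym'_integrable mon_usym_integrable f t)+
  have "?H \<xi> = 0" for \<xi>
  proof -
   have sy: "symbol A \<xi> $ i $ l = (\<Sum>k\<in>UNIV. \<xi> $ k * A k $ i $ l)" for l by (simp add: symbol_def)
   have "(\<Sum>k\<in>UNIV. \<Sum>l\<in>UNIV. of_real (A k $ i $ l) * ?D k l \<xi>) = (\<Sum>l\<in>UNIV. \<i> * of_real (symbol A \<xi> $ i $ l) * usym t f l \<xi>)"
    by (subst sum.swap) (simp add: sy sum_distrib_left sum_distrib_right mult_ac)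
   moreover have "(\<Sum>l\<in>UNIV. of_real (A0 $ i $ l) * usym' t f l \<xi>) = (\<Sum>j\<in>UNIV. (\<Sum>l\<in>UNIV. of_real (A0 $ i $ l) * E' t \<xi> l j) * FT (cf f j) \<xi>)"
    unfolding usym'_def sum_distrib_left sum_distrib_right by (subst sum.swap) (simp add: mult.assoc)
   moreover have "(\<Sum>l\<in>UNIV. \<i> * of_real (symbol A \<xi> $ i $ l) * usym t f l \<xi>) = (\<Sum>j\<in>UNIV. (\<i> * (\<Sum>l\<in>UNIV. of_real (symbol A \<xi> $ i $ l) * E t \<xi> l j)) * FT (cf f j) \<xi>)"
    unfolding usym_def sum_distrib_left sum_distrib_right by (subst sum.swap) (simp add: mult.assoc)
   moreover have "(\<Sum>l\<in>UNIV. of_real (L $ i $ l) * ?U l \<xi>) = (\<Sum>j\<in>UNIV. (\<Sum>l\<in>UNIV. of_real (L $ i $ l) * E t \<xi> l j) * FT (cf f j) \<xi>)"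
    unfolding usym_def sum_distrib_left sum_distrib_right by (subst sum.swap) (simp add: mult.assoc)
   ultimately show ?thesis by (simp only: E_ode left_diff_distrib) (simp add: sum_subtractf sum_negf)
  qed
  then have "FT ?H (- x) = 0" unfolding FT_def by simp
  also have "FT ?H (- x) = (\<Sum>l\<in>UNIV. of_real (A0 $ i $ l) * FT (usym' t f l) (- x)) + (\<Sum>k\<in>UNIV. \<Sum>l\<in>UNIV. of_real (A k $ i $ l) * FT (?D k l) (- x)) + (\<Sum>l\<in>UNIV. of_real (L $ i $ l) * FT (?U l) (- x))"
   using int by (simp only: FT_add FT_sum FT_cmult Bochner_Integration.integrable_sum Bochner_Integration.integrable_add)
  finally have "Re ((\<Sum>l\<in>UNIV. of_real (A0 $ i $ l) * FT (usym' t f l) (- x)) + (\<Sum>k\<in>UNIV. \<Sum>l\<in>UNIV. of_real (A k $ i $ l) * FT (?D k l) (- x)) + (\<Sum>l\<in>UNIV. of_real (L $ i $ l) * FT (?U l) (- x))) / \<kappa> TYPE('n) = 0"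
   by simp
  then show ?thesis
   by (simp add: matrix_vector_mult_def tsol_def dsol_def invFT_def add_divide_distrib sum_divide_distrib del: mon_simps)
 qed
 then show ?thesis by (simp add: vec_eq_iff)
qed

section \<open>The decay estimate for smooth data\<close>

lemma rate_low: "norm \<xi> \<le> 1 \<Longrightarrow> (norm \<xi>)\<^sup>2 / 4 \<le> rate \<xi>" for \<xi> :: "real^'n"
proof -
 assume "norm \<xi> \<le> 1"
 then have "(norm \<xi>)^2 \<le> 1" by (simp add: power_le_one)
 then have "(1 + (norm \<xi>)^2)^2 \<le> 2^2" by (intro power_mono) auto
 moreover have "0 < (1 + (norm \<xi>)^2)^2" by (intro zero_less_power add_pos_nonneg) auto
 ultimately show ?thesis by (intro divide_left_mono) auto
qed

lemma rate_high: "norm \<xi> > 1 \<Longrightarrow> 1 / (4 * (norm \<xi>)^2) \<le> rate \<xi>" for \<xi> :: "real^'n"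
proof -
 assume x: "norm \<xi> > 1"
 then have 1: "1 \<le> (norm \<xi>)^2" by simp
 have "(1 + (norm \<xi>)^2)^2 \<le> (2 * (norm \<xi>)^2)^2" using 1 by (intro power_mono) auto
 then have "(norm \<xi>)^2 / (2 * (norm \<xi>)^2)^2 \<le> rate \<xi>"
  using 1 by (intro divide_left_mono mult_pos_pos zero_less_power) (auto simp: add_pos_nonneg)
 moreover have "(norm \<xi>)^2 / (2 * (norm \<xi>)^2)^2 = 1 / (4 * (norm \<xi>)^2)" using 1 by (simp add: power2_eq_square)
 ultimately show ?thesis by simp
qed

lemma usym_decay:
 assumes t: "0 \<le> t"
 shows "norm (usym t f i \<xi>) \<le> C * exp (- (c * rate \<xi>) * t) * ftsum f \<xi>"
proof -
 have "norm (usym t f i \<xi>) = norm ((\<chi> i. \<Sum>j\<in>UNIV. E t \<xi> i j * (\<chi> j. FT (cf f j) \<xi>) $ j) $ i)" by (simp add: usym_def)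
 also have "\<dots> \<le> norm (\<chi> i. \<Sum>j\<in>UNIV. E t \<xi> i j * (\<chi> j. FT (cf f j) \<xi>) $ j)" by (rule Finite_Cartesian_Product.norm_nth_le)
 also have "\<dots> \<le> C * exp (- (c * rate \<xi>) * t) * norm (\<chi> j. FT (cf f j) \<xi>)" by (rule E_decay[OF t])
 also have "norm (\<chi> j. FT (cf f j) \<xi>) \<le> ftsum f \<xi>"
  unfolding norm_vec_def by (rule order_trans[OF L2_set_le_sum]) auto
 finally show ?thesis using cC by (simp add: mult_left_mono)
qed

text \<open>The finite family serves twice: with a one-point index for the data themselves, and with
  all lists of length k + ell for their derivatives.\<close>

lemma Lb_FT_data:
 assumes HY: "\<And>(g :: real^'n \<Rightarrow> complex) B. L1 g \<Longrightarrow> 0 < B \<Longrightarrow> Lb a B g \<Longrightarrow> Lb (1 - a) (H * B) (FT g)"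
  and a: "0 \<le> a" "a \<le> 1" and H: "0 < H" and J: "finite J" and f: "\<And>k. k \<in> J \<Longrightarrow> smooth_csupp (f k)" "\<And>k. k \<in> J \<Longrightarrow> Lb a B (f k)" and B: "0 < B"
 shows "Lb (1 - a) (real (card (J \<times> (UNIV :: 'm set))) ^ 2 * (H * B)) (\<lambda>\<xi>. \<Sum>(k, j)\<in>J \<times> UNIV. norm (FT (cf (f k) j) \<xi>))"
proof -
 have "Lb (1 - a) (real (card (J \<times> (UNIV :: 'm set))) ^ 2 * (H * B)) (\<lambda>\<xi>. \<Sum>kj\<in>J \<times> UNIV. norm (FT (cf (f (fst kj)) (snd kj)) \<xi>))"
 proof (rule Lb_sum)
  fix kj assume kj: "kj \<in> J \<times> (UNIV :: 'm set)"
  then have k: "fst kj \<in> J" by auto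
  have sm: "smooth_csupp (cf (f (fst kj)) (snd kj))" by (rule cf_smooth[OF f(1)[OF k]])
  have "Lb a B (cf (f (fst kj)) (snd kj))"
  proof (rule Lb_cong_norm[OF f(2)[OF k] _ _ a(1)])
   show "norm (cf (f (fst kj)) (snd kj) x) \<le> norm (f (fst kj) x)" for x by (rule cf_norm_le)
   show "cf (f (fst kj)) (snd kj) \<in> \<B>"
    by (rule smooth_borel_measurable) (use sm in \<open>simp add: smooth_csupp_def\<close>)
  qed
  then have "Lb (1 - a) (H * B) (FT (cf (f (fst kj)) (snd kj)))" using smooth_csupp_integrable[OF sm] B by (intro HY)
  then show "Lb (1 - a) (H * B) (\<lambda>\<xi>. norm (FT (cf (f (fst kj)) (snd kj)) \<xi>))"
   by (rule Lb_cong_norm) (use a FT_cf_measurable[OF f(1)[OF k]] in auto)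
 qed (use a H B J in auto)
 then show ?thesis by (simp add: case_prod_beta)
qed

text \<open>The Hausdorff--Young inequality is applied twice: to the data, and to the inverse
 transform of the low and high frequency parts.\<close>

lemma dsol_decay:
 assumes aq: "1 / 2 \<le> aq" "aq \<le> 1" and ar: "1 / 2 \<le> ar" "ar \<le> 1" and ap: "0 \<le> ap" "ap \<le> 1 / 2"
  and ell: "real CARD('n) * (ar - ap) < real ell \<or> ar - ap = 0"
 shows "\<exists>K>0. \<forall>f Bq Br t js. smooth_csupp f \<longrightarrow> 0 < Bq \<longrightarrow> 0 < Br \<longrightarrow> Lb aq Bq f \<longrightarrow>
  (\<forall>ks. length ks = k + ell \<longrightarrow> Lb ar Br (pds ks f)) \<longrightarrow> 0 \<le> t \<longrightarrow> length js = k \<longrightarrow>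
  Lb ap (K * ((1 + t) powr (- (real CARD('n) * (aq - ap) / 2) - real k / 2) * Bq + (1 + t) powr (- (real ell / 2) + real CARD('n) * (ar - ap) / 2) * Br)) (dsol js t f)"
proof -
 have c4: "0 < c / 4" using cC by simp
 obtain Hq where Hq: "0 < Hq" "\<And>(f :: real^'n \<Rightarrow> complex) B. L1 f \<Longrightarrow> 0 < B \<Longrightarrow> Lb aq B f \<Longrightarrow> Lb (1 - aq) (Hq * B) (FT f)"
  by (rule hausdorff_young[OF aq]) (rule that)
 obtain Hr where Hr: "0 < Hr" "\<And>(f :: real^'n \<Rightarrow> complex) B. L1 f \<Longrightarrow> 0 < B \<Longrightarrow> Lb ar B f \<Longrightarrow> Lb (1 - ar) (Hr * B) (FT f)"
  by (rule hausdorff_young[OF ar]) (rule that)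
 have ap': "1 / 2 \<le> 1 - ap" "1 - ap \<le> 1" using ap by auto
 obtain Hp where Hp: "0 < Hp" "\<And>(f :: real^'n \<Rightarrow> complex) B. L1 f \<Longrightarrow> 0 < B \<Longrightarrow> Lb (1 - ap) B f \<Longrightarrow> Lb (1 - (1 - ap)) (Hp * B) (FT f)"
  by (rule hausdorff_young[OF ap']) (rule that)
 have sq: "0 \<le> aq - ap" "aq - ap \<le> 1" and sr: "0 \<le> ar - ap" using aq ar ap by auto
 obtain Ml where Ml: "0 < Ml" "\<And>t. 0 \<le> t \<Longrightarrow> Lb (aq - ap) (Ml * (1 + t) powr (- (real CARD('n) * (aq - ap) / 2) - real k / 2))
   (\<lambda>\<xi>::real^'n. indicator (cball 0 1) \<xi> * (norm \<xi> ^ k * exp (- (c / 4 * (norm \<xi>)^2 * t))))"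
  by (rule low_frequency_multiplier[OF c4 sq, where 'n = 'n and k = k]) (rule that)
 obtain Mh where Mh: "0 < Mh" "\<And>t. 0 \<le> t \<Longrightarrow> Lb (ar - ap) (Mh * (1 + t) powr (- (real ell / 2) + real CARD('n) * (ar - ap) / 2))
   (\<lambda>\<xi>::real^'n. indicator (- cball 0 1) \<xi> * (exp (- (c / 4 * t / (norm \<xi>)^2)) / norm \<xi> ^ ell))"
  by (rule high_frequency_multiplier[OF c4 sr ell]) (rule that)
 define Jr where "Jr = {ks :: 'n list. length ks = k + ell}"
 have Jr: "finite Jr" unfolding Jr_def by (rule finite_lists)
 have Jr0: "Jr \<noteq> {}" unfolding Jr_def using Ex_list_of_length[of "k + ell"] by auto
 define nq where "nq = real (card ({()} \<times> (UNIV :: 'm set))) ^ 2"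
 define nr where "nr = real (card (Jr \<times> (UNIV :: 'm set))) ^ 2"
 have n: "0 < nq" "0 < nr" unfolding nq_def nr_def using Jr Jr0 by (auto simp: card_gt_0_iff)
 define Kl where "Kl = Ml * (C * (nq * Hq))"
 define Kh where "Kh = Mh * (C * (nr * Hr))"
 have Kp: "0 < Kl" "0 < Kh" using Ml Mh cC n Hq Hr by (auto simp: Kl_def Kh_def)
 define K where "K = (real CARD('m))^2 * (1 / \<kappa> TYPE('n) * (4 * (Hp * (Kl + Kh))))"
 have K: "0 < K" using Kp Hp \<kappa>_pos[where 'n = 'n] by (simp add: K_def)
 have [measurable]: "cball (0 :: real^'n) 1 \<in> sets borel" by simp
 show ?thesis
 proof (intro exI[of _ K] conjI K allI impI)
  fix f :: "real^'n \<Rightarrow> real^'m" and Bq Br t :: real and js :: "'n list"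
  assume f: "smooth_csupp f" and B: "0 < Bq" "0 < Br" and fq: "Lb aq Bq f"
   and fr0: "\<forall>ks. length ks = k + ell \<longrightarrow> Lb ar Br (pds ks f)" and t: "0 \<le> t" and js: "length js = k"
  note fr = fr0[rule_format]
  let ?F = "\<lambda>i. FT (\<lambda>\<xi>. mon js \<xi> * usym t f i \<xi>)"
  let ?W = "\<lambda>i x. (1 / \<kappa> TYPE('n)) *\<^sub>R (?F i) (0 + (-1) *\<^sub>R x)"
  define Rl where "Rl = (1 + t) powr (- (real CARD('n) * (aq - ap) / 2) - real k / 2)"
  define Rh where "Rh = (1 + t) powr (- (real ell / 2) + real CARD('n) * (ar - ap) / 2)"
  have R: "0 < Rl" "0 < Rh" using t by (auto simp: Rl_def Rh_def)
  define hl where "hl \<xi> = C * ftsum f \<xi>" for \<xi>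
  define hh where "hh \<xi> = C * (\<Sum>(ks, j)\<in>Jr \<times> UNIV. norm (FT (cf (pds ks f) j) \<xi>))" for \<xi>
  have hl: "Lb (1 - aq) (C * (nq * (Hq * Bq))) hl"
  proof -
   have "Lb (1 - aq) (nq * (Hq * Bq)) (\<lambda>\<xi>. \<Sum>(k, j)\<in>{()} \<times> UNIV. norm (FT (cf f j) \<xi>))"
    unfolding nq_def by (rule Lb_FT_data[OF Hq(2)]) (use aq Hq f fq B in auto)
   then have "Lb (1 - aq) (nq * (Hq * Bq)) (\<lambda>\<xi>. \<Sum>j\<in>UNIV. norm (FT (cf f j) \<xi>))"
    by (simp add: sum.cartesian_product[symmetric])
   from Lb_scaleR[OF this, of C] show ?thesis using aq cC unfolding hl_def[abs_def] by simp
  qed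
  have hh: "Lb (1 - ar) (C * (nr * (Hr * Br))) hh"
  proof -
   have "Lb (1 - ar) (nr * (Hr * Br)) (\<lambda>\<xi>. \<Sum>(ks, j)\<in>Jr \<times> UNIV. norm (FT (cf (pds ks f) j) \<xi>))"
    unfolding nr_def by (rule Lb_FT_data[OF Hr(2)]) (use ar Hr f fr B Jr smooth_csupp_partial_derivs in \<open>auto simp: Jr_def\<close>)
   from Lb_scaleR[OF this, of C] show ?thesis using ar cC unfolding hh_def[abs_def] by simp
  qed
  \<comment> \<open>At high frequency k + ell powers of |\<xi>| are moved onto the data: k of them
    belong to the derivative being estimated, and ell are the price of the degenerate rate.\<close>
  have high: "C * norm \<xi> ^ (k + ell) * ftsum f \<xi> \<le> hh \<xi>" for \<xi>
  proof -
   have "norm \<xi> ^ (k + ell) * ftsum f \<xi> \<le> (\<Sum>ks\<in>Jr. norm (mon ks \<xi>)) * ftsum f \<xi>"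
    unfolding Jr_def by (intro mult_right_mono norm_power_le_mon sum_nonneg) auto
   also have "\<dots> = (\<Sum>(ks, j)\<in>Jr \<times> UNIV. norm (FT (cf (pds ks f) j) \<xi>))"
    by (simp add: sum_product sum.cartesian_product cf_partial_derivs[OF f, symmetric] FT_partial_derivs[OF cf_smooth[OF f]] norm_mult)
   finally show ?thesis using cC unfolding hh_def mult.assoc by (intro mult_left_mono) auto
  qed
  have um[measurable]: "usym t f i \<in> \<B>" for i by (rule usym_measurable(1)[OF f])
  define Gl where "Gl i \<xi> = indicator (cball 0 1) \<xi> * (mon js \<xi> * usym t f i \<xi>)" for i \<xi>
  define Gh where "Gh i \<xi> = indicator (- cball 0 1) \<xi> * (mon js \<xi> * usym t f i \<xi>)" for i \<xi>
  have Gm[measurable]: "Gl i \<in> \<B>" "Gh i \<in> \<B>" for i unfolding Gl_def[abs_def] Gh_def[abs_def] by measurable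
  have Gi: "L1 (Gl i)" "L1 (Gh i)" for i
   by (rule int_bound[OF mon_usym_integrable[OF f t, of js i]]; simp add: Gl_def Gh_def indicator_def)+
  have Gl: "Lb (1 - ap) (Kl * (Rl * Bq)) (Gl i)" for i
  proof -
   \<comment> \<open>The exponents close up: (aq - ap) from the multiplier and (1 - aq) from the
     transform of the data give 1 - ap, the conjugate of p, from which Hausdorff--Young returns to
     p. The high-frequency part repeats this with ar.\<close>
   have "Lb ((aq - ap) + (1 - aq)) ((Ml * Rl) * (C * (nq * (Hq * Bq)))) (Gl i)"
   proof (rule Lb_holder[OF Ml(2)[OF t, folded Rl_def] hl])
    fix \<xi> :: "real^'n"
    show "norm (Gl i \<xi>) \<le> norm (indicator (cball 0 1) \<xi> * (norm \<xi> ^ k * exp (- (c / 4 * (norm \<xi>)^2 * t)))) * norm (hl \<xi>)"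
    proof (cases "norm \<xi> \<le> 1")
     case True
     have "exp (- (c * rate \<xi>) * t) \<le> exp (- (c / 4 * (norm \<xi>)^2 * t))"
      using mult_right_mono[OF mult_left_mono[OF rate_low[OF True], of c] t] cC by simp
     then have "norm (usym t f i \<xi>) \<le> C * exp (- (c / 4 * (norm \<xi>)^2 * t)) * ftsum f \<xi>"
      using cC by (intro order_trans[OF usym_decay[OF t]] mult_right_mono mult_left_mono sum_nonneg) auto
     then have "norm (mon js \<xi>) * norm (usym t f i \<xi>) \<le> norm \<xi> ^ k * (C * exp (- (c / 4 * (norm \<xi>)^2 * t)) * ftsum f \<xi>)"
      using mon_norm_le[of js \<xi>] by (intro mult_mono) (auto simp: js)
     then show ?thesis using True cC by (simp add: Gl_def norm_mult hl_def abs_mult sum_nonneg abs_of_nonneg mult_ac)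
    qed (simp add: Gl_def)
   qed (use aq ap Ml R cC n Hq B in auto)
   then show ?thesis by (simp add: Kl_def mult_ac)
  qed
  have Gh: "Lb (1 - ap) (Kh * (Rh * Br)) (Gh i)" for i
  proof -
   have "Lb ((ar - ap) + (1 - ar)) ((Mh * Rh) * (C * (nr * (Hr * Br)))) (Gh i)"
   proof (rule Lb_holder[OF Mh(2)[OF t, folded Rh_def] hh])
    fix \<xi> :: "real^'n"
    show "norm (Gh i \<xi>) \<le> norm (indicator (- cball 0 1) \<xi> * (exp (- (c / 4 * t / (norm \<xi>)^2)) / norm \<xi> ^ ell)) * norm (hh \<xi>)"
    proof (cases "norm \<xi> > 1")
     case True
     have \<xi>: "0 < norm \<xi>" using True by linarith
     have "c / 4 * t / (norm \<xi>)^2 = c * (1 / (4 * (norm \<xi>)^2)) * t" by simp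
     also have "\<dots> \<le> c * rate \<xi> * t" using rate_high[OF True] cC t by (intro mult_right_mono mult_left_mono) auto
     finally have "exp (- (c * rate \<xi>) * t) \<le> exp (- (c / 4 * t / (norm \<xi>)^2))" by simp
     then have "norm (usym t f i \<xi>) \<le> C * exp (- (c / 4 * t / (norm \<xi>)^2)) * ftsum f \<xi>"
      using cC by (intro order_trans[OF usym_decay[OF t]] mult_right_mono mult_left_mono sum_nonneg) auto
     then have "norm (mon js \<xi>) * norm (usym t f i \<xi>) \<le> norm \<xi> ^ k * (C * exp (- (c / 4 * t / (norm \<xi>)^2)) * ftsum f \<xi>)"
      using mon_norm_le[of js \<xi>] by (intro mult_mono) (auto simp: js)
     also have "\<dots> = exp (- (c / 4 * t / (norm \<xi>)^2)) / norm \<xi> ^ ell * (C * norm \<xi> ^ (k + ell) * ftsum f \<xi>)"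
      using \<xi> by (simp add: power_add)
     also have "\<dots> \<le> exp (- (c / 4 * t / (norm \<xi>)^2)) / norm \<xi> ^ ell * \<bar>hh \<xi>\<bar>"
      by (intro mult_left_mono order_trans[OF high abs_ge_self]) auto
     finally show ?thesis using True by (simp add: Gh_def norm_mult)
    qed (simp add: Gh_def)
   qed (use ar ap Mh R cC n Hr B in auto)
   then show ?thesis by (simp add: Kh_def mult_ac)
  qed
  define W where "W = Rl * Bq + Rh * Br"
  have W: "0 < W" using R B by (auto simp: W_def intro: add_pos_pos)
  have comp: "Lb ap (1 / \<kappa> TYPE('n) * (4 * (Hp * (Kl + Kh) * W))) (\<lambda>x. (?W i x))" for i
  proof -
   have l: "Lb ap (Hp * (Kl * (Rl * Bq))) (FT (Gl i))" using Hp(2)[OF Gi(1) _ Gl] Kp R B by simp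
   have h: "Lb ap (Hp * (Kh * (Rh * Br))) (FT (Gh i))" using Hp(2)[OF Gi(2) _ Gh] Kp R B by simp
   have "Lb ap (4 * (Hp * (Kl * (Rl * Bq)) + Hp * (Kh * (Rh * Br)))) (\<lambda>\<xi>. FT (Gl i) \<xi> + FT (Gh i) \<xi>)"
    using ap by (intro Lb_add l h) auto
   moreover have "FT (Gl i) x + FT (Gh i) x = (?F i) x" for x
   proof -
    have "(\<lambda>\<xi>. Gl i \<xi> + Gh i \<xi>) = (\<lambda>\<xi>. mon js \<xi> * usym t f i \<xi>)" by (auto simp: Gl_def Gh_def indicator_def)
    then show ?thesis using FT_add[OF Gi(1)[of i] Gi(2)[of i], of x] by simp
   qed
   ultimately have "Lb ap (4 * (Hp * (Kl * (Rl * Bq)) + Hp * (Kh * (Rh * Br)))) (?F i)" by simp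
   moreover have "4 * (Hp * (Kl * (Rl * Bq)) + Hp * (Kh * (Rh * Br))) \<le> 4 * (Hp * (Kl + Kh) * W)"
   proof -
    have "Hp * (Kl + Kh) * W = Hp * (Kl * (Rl * Bq)) + Hp * (Kh * (Rh * Br)) + Hp * (Kl * (Rh * Br)) + Hp * (Kh * (Rl * Bq))"
     by (simp add: W_def algebra_simps)
    moreover have "0 \<le> Hp * (Kl * (Rh * Br))" "0 \<le> Hp * (Kh * (Rl * Bq))" using Hp Kp R B by simp_all
    ultimately have "Hp * (Kl * (Rl * Bq)) + Hp * (Kh * (Rh * Br)) \<le> Hp * (Kl + Kh) * W" by simp
    then show ?thesis by (intro mult_left_mono) auto
   qed
   ultimately have "Lb ap (4 * (Hp * (Kl + Kh) * W)) (?F i)" using ap(1) by (rule Lb_weaken)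
   then have "Lb ap (4 * (Hp * (Kl + Kh) * W)) (\<lambda>x. (?F i) (0 + (-1) *\<^sub>R x))" by (rule Lb_affine) simp
   from Lb_scaleR[OF this ap(1), of "1 / \<kappa> TYPE('n)"] show ?thesis using \<kappa>_pos[where 'n = 'n] by simp
  qed
  have "Lb ap (real (card (UNIV :: 'm set)) ^ 2 * (1 / \<kappa> TYPE('n) * (4 * (Hp * (Kl + Kh) * W)))) (\<lambda>x. \<Sum>i\<in>(UNIV :: 'm set). norm (?W i x))"
  proof (rule Lb_sum)
   show "Lb ap (1 / \<kappa> TYPE('n) * (4 * (Hp * (Kl + Kh) * W))) (\<lambda>x. norm (?W i x))" for i by (rule Lb_norm[OF comp])
  qed (use ap W Hp Kp \<kappa>_pos[where 'n = 'n] in auto)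
  then have "Lb ap (real (card (UNIV :: 'm set)) ^ 2 * (1 / \<kappa> TYPE('n) * (4 * (Hp * (Kl + Kh) * W)))) (dsol js t f)"
  proof (rule Lb_cong_norm[OF _ dsol_measurable[OF f] _ ap(1)])
   fix x
   show "norm (dsol js t f x) \<le> norm (\<Sum>i\<in>(UNIV :: 'm set). norm (?W i x))"
    using invFT_norm_le[of "\<lambda>i \<xi>. mon js \<xi> * usym t f i \<xi>" x] \<kappa>_pos[where 'n = 'n]
    by (simp add: dsol_def sum_nonneg)
  qed
  then have "Lb ap (K * W) (dsol js t f)" unfolding K_def by (simp only: mult.assoc)
  then show "Lb ap (K * ((1 + t) powr (- (real CARD('n) * (aq - ap) / 2) - real k / 2) * Bq + (1 + t) powr (- (real ell / 2) + real CARD('n) * (ar - ap) / 2) * Br)) (dsol js t f)"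
   by (simp only: W_def Rl_def Rh_def)
 qed
qed

section \<open>Weak derivatives of the Fourier solution\<close>

text \<open>The multiplication formula moves the transform to the test function, the reflection in
  the inverse transform becoming a sign in its argument. Weak identities thus reduce to identities
  between symbols.\<close>

lemma invFT_pairing:
 assumes G: "\<And>i. L1 (G i)" and \<phi>: "L1 (\<phi> :: real^'n \<Rightarrow> real)"
 shows "(LBINT x. \<phi> x *\<^sub>R invFT G x) $ i = Re (LBINT \<xi>. FT (\<lambda>x. cplx (\<phi> x)) (- \<xi>) * G i \<xi>) / \<kappa> TYPE('n)"
proof -
 let ?c = "\<lambda>x. cplx (\<phi> x)"
 let ?P = "\<lambda>i x. cplx (\<phi> x) * FT (G i) (- x)"
 have h: "L1 ?c" using \<phi> by simp
 have FTm: "(\<lambda>x. FT (G i) (- x)) \<in> \<B>" for i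
  using measurable_compose[OF _ FT_measurable[of "G i"], of uminus] borel_measurable_integrable[OF G[of i]] by simp
 have int: "L1 (\<lambda>x. (?P i x))" for i
 proof (rule int_bound[OF integrable_mult_left[OF h, of "of_real (LBINT x. norm (G i x))"]])
  show "(\<lambda>x. (?P i x)) \<in> borel_measurable lborel" using borel_measurable_integrable[OF h] FTm[of i] by simp
  show "AE x in lborel. norm (?P i x) \<le> norm (cplx (\<phi> x) * of_real (LBINT x. norm (G i x)))"
   using FT_norm_le[OF G[of i]] by (simp add: norm_mult integral_nonneg_AE mult_left_mono)
 qed
 have "(\<phi> x *\<^sub>R invFT G x) $ i = Re (?P i x) / \<kappa> TYPE('n)" for x i by (simp add: invFT_def)
 moreover have "L1 (\<lambda>x. \<phi> x *\<^sub>R invFT G x)"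
 proof (rule int_bound[where f = "\<lambda>x. \<Sum>i\<in>UNIV. norm (?P i x) / \<kappa> TYPE('n)"])
  show "L1 (\<lambda>x. \<Sum>i\<in>UNIV. norm (?P i x) / \<kappa> TYPE('n))"
   by (intro Bochner_Integration.integrable_sum integrable_divide integrable_norm int)
  show "(\<lambda>x. \<phi> x *\<^sub>R invFT G x) \<in> borel_measurable lborel"
   using borel_measurable_integrable[OF \<phi>] invFT_measurable[of G] borel_measurable_integrable[OF G] by simp
  have "norm (\<phi> x *\<^sub>R invFT G x) \<le> \<bar>\<phi> x\<bar> * (\<Sum>i\<in>UNIV. norm (FT (G i) (- x)) / \<kappa> TYPE('n))" for x
   using invFT_norm_le[of G x] by (simp add: mult_left_mono)
  then show "AE x in lborel. norm (\<phi> x *\<^sub>R invFT G x) \<le> norm (\<Sum>i\<in>UNIV. norm (?P i x) / \<kappa> TYPE('n))"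
   using \<kappa>_pos[where 'n = 'n] by (intro AE_I2) (simp add: norm_mult sum_distrib_left sum_nonneg)
 qed
 ultimately have "(LBINT x. \<phi> x *\<^sub>R invFT G x) $ i = (LBINT x. Re (?P i x) / \<kappa> TYPE('n))"
  using integral_bounded_linear[OF bounded_linear_vec_nth[of i], of lborel "\<lambda>x. \<phi> x *\<^sub>R invFT G x"] by (simp del: vector_scaleR_component)
 also have "\<dots> = Re (LBINT x. (?P i x)) / \<kappa> TYPE('n)" using integral_Re[OF int[of i]] by simp
 also have "(LBINT x. (?P i x)) = (LBINT x. cplx (\<phi> (- x)) * FT (G i) x)"
  using integral_lborel_reflect[of "\<lambda>x. (?P i x)" 0] by simp
 also have "\<dots> = (LBINT x. FT (\<lambda>x. cplx (\<phi> (- x))) x * G i x)"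
  using integrable_lborel_affine[OF h, of "-1" 0] by (intro FT_multiplication[symmetric] G) simp
 also have "FT (\<lambda>x. cplx (\<phi> (- x))) = (\<lambda>\<xi>. FT ?c (- \<xi>))" unfolding FT_def
 proof
  fix \<xi>
  show "(LBINT x. cis (- (x \<bullet> \<xi>)) * cplx (\<phi> (- x))) = (LBINT x. cis (- (x \<bullet> - \<xi>)) * cplx (\<phi> x))"
   using integral_lborel_reflect[of "\<lambda>x. cis (- (x \<bullet> - \<xi>)) * cplx (\<phi> x)" 0] by simp
 qed
 finally show ?thesis .
qed

text \<open>On the Fourier side the derivative of the test function is the symbol
  \<open>mon js\<close> at -\<xi>, that is, the sign (-1)^|js| times the symbol carried by
  \<open>dsol js\<close>. Only integrability is used, so all orders are treated at once.\<close>

lemma dsol_weak_derivative: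
 assumes f: "smooth_csupp f" and t: "0 \<le> t" and \<phi>: "smooth_csupp (\<phi> :: real^'n \<Rightarrow> real)"
 shows "(LBINT x. pds js \<phi> x *\<^sub>R dsol [] t f x) = (-1) ^ length js *\<^sub>R (LBINT x. \<phi> x *\<^sub>R dsol js t f x)"
proof -
 let ?c = "\<lambda>x. cplx (\<phi> x)"
 have c\<phi>: "smooth_csupp ?c" using \<phi> smooth_linear[OF bounded_linear_of_real] unfolding smooth_csupp_def by fastforce
 have "pds js ?c = (\<lambda>x. cplx (pds js \<phi> x))"
  using \<phi> unfolding smooth_csupp_def by (intro partial_derivs_linear[OF bounded_linear_of_real]) simp
 then have FTd: "FT (\<lambda>x. cplx (pds js \<phi> x)) \<xi> = mon js \<xi> * FT ?c \<xi>" for \<xi>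
  using FT_partial_derivs[OF c\<phi>, of js \<xi>] by simp
 have i: "L1 \<phi>" "L1 (pds js \<phi>)" by (intro smooth_csupp_integrable smooth_csupp_partial_derivs \<phi>)+
 have "(LBINT x. pds js \<phi> x *\<^sub>R dsol [] t f x) $ i = ((-1) ^ length js *\<^sub>R (LBINT x. \<phi> x *\<^sub>R dsol js t f x)) $ i" for i
 proof -
  have "(LBINT \<xi>. FT (\<lambda>x. cplx (pds js \<phi> x)) (- \<xi>) * (mon [] \<xi> * usym t f i \<xi>))
   = (LBINT \<xi>. of_real ((-1) ^ length js) * (FT ?c (- \<xi>) * (mon js \<xi> * usym t f i \<xi>)))"
   by (simp add: FTd mon_minus mult_ac)
  also have "\<dots> = of_real ((-1) ^ length js) * (LBINT \<xi>. FT ?c (- \<xi>) * (mon js \<xi> * usym t f i \<xi>))"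
   by (rule integral_mult_right_zero)
  finally have eq: "(LBINT \<xi>. FT (\<lambda>x. cplx (pds js \<phi> x)) (- \<xi>) * (mon [] \<xi> * usym t f i \<xi>)) = \<dots>" .
  show ?thesis
   unfolding dsol_def vector_scaleR_component by (simp only: invFT_pairing[OF mon_usym_integrable[OF f t] i(1)] invFT_pairing[OF mon_usym_integrable[OF f t] i(2)] eq) simp
 qed
 then show ?thesis by (simp add: vec_eq_iff)
qed

lemma dsol_diff:
 assumes f: "smooth_csupp f" "smooth_csupp g" and t: "0 \<le> t"
 shows "dsol js t (\<lambda>x. f x - g x) x = dsol js t f x - dsol js t g x"
proof -
 have cfd: "cf (\<lambda>x. f x - g x) j = (\<lambda>x. cf f j x - cf g j x)" for j by (simp add: cf_def fun_eq_iff)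
 have "FT (cf (\<lambda>x. f x - g x) j) \<xi> = FT (cf f j) \<xi> - FT (cf g j) \<xi>" for j \<xi>
  unfolding cfd by (intro FT_diff smooth_csupp_integrable cf_smooth f)
 then have "mon js \<xi> * usym t (\<lambda>x. f x - g x) i \<xi> = mon js \<xi> * usym t f i \<xi> - mon js \<xi> * usym t g i \<xi>" for i \<xi>
  by (simp add: usym_def right_diff_distrib sum_subtractf)
 then show ?thesis using mon_usym_integrable[OF f(1) t] mon_usym_integrable[OF f(2) t]
  by (simp add: dsol_def invFT_def vec_eq_iff FT_diff diff_divide_distrib)
qed
end

section \<open>Finite speed of propagation\<close>

lemma condition_A_real:
 assumes "condition_A A0 A L"
 shows "v \<noteq> 0 \<Longrightarrow> 0 < (A0 *v v) \<bullet> v" "0 \<le> (L *v v) \<bullet> v"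
proof -
 define u where "u = (\<chi> i. cplx (v $ i))"
 have cm: "cm X u \<bullet> u = (X *v v) \<bullet> v" for X
  by (simp add: inner_vec_def cm_nth u_def matrix_vector_mult_def inner_complex_def)
 have "v \<noteq> 0 \<Longrightarrow> u \<noteq> 0" by (auto simp: u_def vec_eq_iff)
 then show "v \<noteq> 0 \<Longrightarrow> 0 < (A0 *v v) \<bullet> v" using condition_A_D(3)[OF assms, of u] by (simp add: cm)
 show "0 \<le> (L *v v) \<bullet> v" using condition_A_D(4)[OF assms, of u] by (simp add: cm)
qed

lemma inner_symmetric_matrix: "transpose X = X \<Longrightarrow> (X *v u) \<bullet> v = (X *v v) \<bullet> u" for X :: "real^'m^'m"
 by (metis dot_lmul_matrix inner_commute transpose_matrix_vector)

lemma matrix_form_bound: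
 fixes X :: "real^'m^'m"
 obtains K where "0 < K" "\<And>u v. \<bar>(X *v u) \<bullet> v\<bar> \<le> K * norm u * norm v"
proof -
 obtain K where K: "0 < K" "\<And>u. norm (X *v u) \<le> norm u * K"
  using bounded_linear.pos_bounded[OF matrix_vector_mul_bounded_linear[of X]] by auto
 have "\<bar>(X *v u) \<bullet> v\<bar> \<le> K * norm u * norm v" for u v
  using mult_right_mono[OF K(2)[of u] norm_ge_zero[of v]] Cauchy_Schwarz_ineq2[of "X *v u" v] by (simp add: mult.commute[of K])
 with K show ?thesis using that by blast
qed

text \<open>A crude bound for the characteristic speeds: the sum of the norms of the
  \<open>A j\<close> over the minimum of the \<open>A0\<close> form on the unit sphere.\<close>

lemma speed_exists:
 fixes A0 L :: "real^'m^'m" and A :: "'n::finite \<Rightarrow> real^'m^'m"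
 assumes A: "condition_A A0 A L"
 obtains sp where "0 < sp" "\<And>(e :: real^'n) v. norm e \<le> 1 \<Longrightarrow> (\<Sum>j\<in>UNIV. e $ j * ((A j *v v) \<bullet> v)) \<le> sp * ((A0 *v v) \<bullet> v)"
proof -
 have "\<exists>K>0. \<forall>v. \<bar>(A j *v v) \<bullet> v\<bar> \<le> K * norm v * norm v" for j
  by (rule matrix_form_bound[of "A j"]) auto
 then obtain K where K: "\<And>j. 0 < K j" "\<And>j v. \<bar>(A j *v v) \<bullet> v\<bar> \<le> K j * norm v * norm v" by metis
 have "continuous_on (sphere 0 1) (\<lambda>v. (A0 *v v) \<bullet> v)"
  by (intro continuous_intros linear_continuous_on matrix_vector_mul_bounded_linear)
 moreover have "sphere (0::real^'m) 1 \<noteq> {}" by (simp add: sphere_eq_empty)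
 ultimately obtain v0 where v0: "v0 \<in> sphere 0 1" "\<forall>v\<in>sphere 0 1. (A0 *v v0) \<bullet> v0 \<le> (A0 *v v) \<bullet> v"
  using continuous_attains_inf[OF compact_sphere] by blast
 define m where "m = (A0 *v v0) \<bullet> v0"
 have m: "0 < m" unfolding m_def using v0(1) by (intro condition_A_real(1)[OF A]) auto
 have low: "m * (norm v)^2 \<le> (A0 *v v) \<bullet> v" for v
 proof (cases "v = 0")
  case False
  have "m \<le> (A0 *v ((1 / norm v) *\<^sub>R v)) \<bullet> ((1 / norm v) *\<^sub>R v)"
   unfolding m_def by (rule v0(2)[rule_format]) (use False in simp)
  also have "\<dots> = ((A0 *v v) \<bullet> v) / (norm v)^2" by (simp add: matrix_vector_mult_scaleR power2_eq_square)
  finally show ?thesis using False by (simp add: le_divide_eq)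
 qed simp
 define S where "S = (\<Sum>j\<in>UNIV. K j)"
 have S: "0 < S" unfolding S_def using K by (intro sum_pos) auto
 show ?thesis
 proof (rule that[of "S / m"])
  fix e :: "real^'n" and v :: "real^'m" assume e: "norm e \<le> 1"
  have "(\<Sum>j\<in>UNIV. e $ j * ((A j *v v) \<bullet> v)) \<le> (\<Sum>j\<in>UNIV. 1 * (K j * norm v * norm v))"
  proof (rule sum_mono)
   fix j
   have "e $ j * ((A j *v v) \<bullet> v) \<le> \<bar>e $ j\<bar> * \<bar>(A j *v v) \<bullet> v\<bar>" by (simp add: abs_mult[symmetric])
   also have "\<dots> \<le> 1 * (K j * norm v * norm v)"
    using K(2)[of j v] component_le_norm_cart[of e j] e by (intro mult_mono) auto
   finally show "e $ j * ((A j *v v) \<bullet> v) \<le> 1 * (K j * norm v * norm v)" .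
  qed
  also have "\<dots> = S / m * (m * (norm v)^2)"
  proof -
   have "(\<Sum>j\<in>UNIV. 1 * (K j * norm v * norm v)) = S * (norm v)^2"
    by (simp add: S_def sum_distrib_right power2_eq_square mult.assoc)
   then show ?thesis using m by simp
  qed
  also have "\<dots> \<le> S / m * ((A0 *v v) \<bullet> v)" using S m low by (intro mult_left_mono) auto
  finally show "(\<Sum>j\<in>UNIV. e $ j * ((A j *v v) \<bullet> v)) \<le> S / m * ((A0 *v v) \<bullet> v)" .
 qed (use S m in simp)
qed

text \<open>The square makes the positive part continuously differentiable; it is the profile of the
  weight in the local energy.\<close>

lemma has_field_derivative_max_0_squared: "((\<lambda>r::real. (max 0 r)^2) has_field_derivative 2 * max 0 r) (at r)"
proof -
 consider "r > 0" | "r < 0" | "r = 0" by linarith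
 then show ?thesis
 proof cases
  case 1
  have "((\<lambda>r. r^2) has_field_derivative 2 * max 0 r) (at r)" using 1 by (auto intro!: derivative_eq_intros)
  then show ?thesis by (rule has_field_derivative_transform_within_open[where S = "{0<..}"]) (use 1 in auto)
 next
  case 2
  have "((\<lambda>r. 0) has_field_derivative 2 * max 0 r) (at r)" using 2 by (auto intro!: derivative_eq_intros)
  then show ?thesis by (rule has_field_derivative_transform_within_open[where S = "{..<0}"]) (use 2 in auto)
 next
  case 3
  have "((\<lambda>h. ((max 0 (0 + h))^2 - (max 0 0)^2) / h) \<longlongrightarrow> 0) (at (0::real))"
  proof (rule Lim_null_comparison[where g = "\<lambda>h. \<bar>h\<bar>"])
   show "((\<lambda>h. \<bar>h\<bar>) \<longlongrightarrow> 0) (at (0::real))" by (auto intro!: tendsto_eq_intros)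
   have "norm (((max 0 (0 + h))^2 - (max 0 0)^2) / h) \<le> \<bar>h\<bar>" for h :: real
    by (cases "h \<le> 0") (auto simp: power2_eq_square)
   then show "\<forall>\<^sub>F h in at (0::real). norm (((max 0 (0 + h))^2 - (max 0 0)^2) / h) \<le> \<bar>h\<bar>" by simp
  qed
  then show ?thesis using 3 by (simp add: DERIV_def)
 qed
qed

lemma japanese_bracket_derivative:
 "((\<lambda>s. sqrt (1 + (norm (x + s *\<^sub>R axis j 1))^2)) has_field_derivative x $ j / sqrt (1 + (norm x)^2)) (at 0)"
 for x :: "real^'n::finite"
proof -
 have eq: "(norm (x + s *\<^sub>R axis j 1))^2 = (norm x)^2 + 2 * s * (x $ j) + s^2" for s
  by (simp only: power2_norm_eq_inner) (simp add: inner_add_left inner_add_right inner_axis inner_axis' power2_eq_square algebra_simps)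
 have "0 < 1 + (norm x)^2" by (rule add_pos_nonneg) auto
 then show ?thesis unfolding eq by (auto intro!: derivative_eq_intros simp: field_simps)
qed

text \<open>Energy method with weight m(t,x)^2, where m is the positive part of R - sp t - sqrt(1 +
  |x|^2). The smoothed cone is differentiable at the origin and has slope at most 1. The shrinking
  of the weight beats the flux by the choice of \<open>sp\<close>, and the term with
  \<open>L\<close> has the good sign, so the energy cannot grow. It tends to 0 as t tends to 0 and
  hence vanishes.\<close>

lemma finite_speed:
 fixes A0 L :: "real^'m^'m" and A :: "'n::finite \<Rightarrow> real^'m^'m"
  and d dt :: "real \<Rightarrow> real^'n \<Rightarrow> real^'m" and dx :: "'n \<Rightarrow> real \<Rightarrow> real^'n \<Rightarrow> real^'m"
 assumes A: "condition_A A0 A L"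
  and sp: "0 < sp" "\<And>(e :: real^'n) v. norm e \<le> 1 \<Longrightarrow> (\<Sum>j\<in>UNIV. e $ j * ((A j *v v) \<bullet> v)) \<le> sp * ((A0 *v v) \<bullet> v)"
  and der_t: "\<And>t x. 0 < t \<Longrightarrow> ((\<lambda>s. d s x) has_vector_derivative dt t x) (at t)"
  and der_x: "\<And>t x j. 0 < t \<Longrightarrow> ((\<lambda>s. d t (x + s *\<^sub>R axis j 1)) has_vector_derivative dx j t x) (at 0)"
  and pde: "\<And>t x. 0 < t \<Longrightarrow> A0 *v dt t x + (\<Sum>j\<in>UNIV. A j *v dx j t x) + L *v d t x = 0"
  and meas: "\<And>t. 0 < t \<Longrightarrow> d t \<in> \<B>" "\<And>t. 0 < t \<Longrightarrow> dt t \<in> \<B>"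
   "\<And>t j. 0 < t \<Longrightarrow> dx j t \<in> \<B>"
  and bound: "\<And>t x. 0 < t \<Longrightarrow> t < T \<Longrightarrow> norm x \<le> R \<Longrightarrow> norm (d t x) \<le> B"
   "\<And>t x. 0 < t \<Longrightarrow> t < T \<Longrightarrow> norm x \<le> R \<Longrightarrow> norm (dt t x) \<le> B"
   "\<And>t x j. 0 < t \<Longrightarrow> t < T \<Longrightarrow> norm x \<le> R \<Longrightarrow> norm (dx j t x) \<le> B"
  and init: "\<And>x. norm x \<le> R \<Longrightarrow> ((\<lambda>t. d t x) \<longlongrightarrow> 0) (at_right 0)"
  and t: "0 < t" "t < T" and B: "0 \<le> B"
 shows "AE x in lborel. sqrt (1 + (norm x)^2) + sp * t < R \<longrightarrow> d t x = 0"
proof -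
 obtain K0 where K0: "0 < K0" "\<And>u v. \<bar>(A0 *v u) \<bullet> v\<bar> \<le> K0 * norm u * norm v"
  by (rule matrix_form_bound[of A0]) (rule that)
 have "\<exists>K>0. \<forall>u v. \<bar>(A j *v u) \<bullet> v\<bar> \<le> K * norm u * norm v" for j
  by (rule matrix_form_bound[of "A j"]) auto
 then obtain K where K: "\<And>j. 0 < K j" "\<And>j u v. \<bar>(A j *v u) \<bullet> v\<bar> \<le> K j * norm u * norm v" by metis
 define m where "m t x = max 0 (R - sp * t - sqrt (1 + (norm x)^2))" for t and x :: "real^'n"
 define q where "q t x = (A0 *v d t x) \<bullet> d t x" for t x
 define e where "e t = (LBINT x. (m t x)\<^sup>2 * q t x)" for t
 have s1: "norm x \<le> sqrt (1 + (norm x)^2)" for x :: "real^'n" by (rule real_le_rsqrt) simp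
 have m_bounds: "0 \<le> m t x" "norm x > R \<Longrightarrow> m t x = 0" "m t x \<le> \<bar>R\<bar>" if "0 < t" for t x
 proof -
  have "0 < sp * t" using sp(1) that by simp
  then show "0 \<le> m t x" "norm x > R \<Longrightarrow> m t x = 0" "m t x \<le> \<bar>R\<bar>"
   using s1[of x] norm_ge_zero[of x] abs_ge_self[of R] abs_ge_zero[of R] unfolding m_def max_def by (simp_all, linarith+)
 qed
 have m_meas[measurable]: "m t \<in> \<B>" for t unfolding m_def[abs_def] by measurable
 have mv[measurable]: "(\<lambda>v. X *v v) \<in> \<B>" for X :: "real^'m^'m"
  by (intro borel_measurable_continuous_onI linear_continuous_on matrix_vector_mul_bounded_linear)
 note [measurable] = meas
 have q_meas[measurable]: "q t \<in> \<B>" if "0 < t" for t unfolding q_def[abs_def] using that by measurable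
 have A0p: "0 \<le> (A0 *v v) \<bullet> v" for v using condition_A_real(1)[OF A, of v] by (cases "v = 0") auto
 have q0: "0 \<le> q t x" for t x unfolding q_def by (rule A0p)
 have prod: "a * (b * c) \<le> a' * (b' * c')" if "0 \<le> a" "a \<le> a'" "0 \<le> b" "b \<le> b'" "0 \<le> c" "c \<le> c'" for a b c a' b' c' :: real
  using that by (intro mult_mono) auto
 have form: "\<bar>(A0 *v u) \<bullet> v\<bar> \<le> K0 * B * B" if "norm u \<le> B" "norm v \<le> B" for u v
  by (rule order_trans[OF K0(2)]) (use that K0(1) B in \<open>auto intro!: mult_mono\<close>)
 have formj: "\<bar>(A j *v u) \<bullet> v\<bar> \<le> K j * B * B" if "norm u \<le> B" "norm v \<le> B" for u v j
  by (rule order_trans[OF K(2)]) (use that K(1)[of j] B in \<open>auto intro!: mult_mono simp: less_imp_le\<close>)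
 have ball_int: "L1 (\<lambda>x::real^'n. M * ball_ind R x)" for M
  using emeasure_lborel_cball_finite[of "0::real^'n" R] by (intro integrable_mult_right integrable_real_indicator) simp_all
 \<comment> \<open>The weight vanishes outside the ball of radius R, so bounds on that ball alone
   give integrability; nothing is assumed about \<open>d\<close> at infinity.\<close>
 have cut_int: "L1 f" if "f \<in> \<B>" "\<And>x. norm x \<le> R \<Longrightarrow> \<bar>f x\<bar> \<le> M" "\<And>x. norm x > R \<Longrightarrow> f x = 0" for f :: "real^'n \<Rightarrow> real" and M
  by (rule int_bound[OF ball_int[of M]])
   (use that in \<open>auto intro!: AE_I2 simp: indicator_def intro: order_trans[OF _ abs_ge_self]\<close>)
 have m2: "(m t x)^2 \<le> R^2" if "0 < t" for t x using power_mono[OF m_bounds(3)[OF that] m_bounds(1)[OF that], of x 2] by simp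
 have mq_le: "\<bar>(m t x)^2 * q t x\<bar> \<le> R^2 * (K0 * B * B)" if "0 < t" "t < T" "norm x \<le> R" for t x
  unfolding abs_mult q_def using m2[OF that(1), of x] form[OF bound(1) bound(1), OF that that] by (intro mult_mono) auto
 have mq_int: "L1 (\<lambda>x. (m t x)^2 * q t x)" if "0 < t" "t < T" for t
  by (rule cut_int[OF _ mq_le[OF that]]) (use that m_bounds(2) in auto)
 define e' where "e' t x = (m t x)^2 * (2 * ((A0 *v dt t x) \<bullet> d t x)) - 2 * sp * m t x * q t x" for t x
 have e_der: "(e has_vector_derivative (LBINT x. e' t x)) (at t)" if t: "0 < t" "t < T" for t unfolding e_def
 proof (rule has_vector_derivative_lebesgue_integral[where a = 0 and b = T and g = "\<lambda>x. (R^2 * (2 * (K0 * B * B)) + 2 * sp * \<bar>R\<bar> * (K0 * B * B)) * ball_ind R x"])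
  show "((\<lambda>s. (m s x)^2 * q s x) has_vector_derivative e' s x) (at s)" if s: "s \<in> {0<..<T}" for s x
  proof -
   have "((\<lambda>s. (m s x)^2) has_field_derivative (2 * m s x) * (- sp)) (at s)"
    unfolding m_def by (rule DERIV_chain2[OF has_field_derivative_max_0_squared]) (auto intro!: derivative_eq_intros)
   moreover have "((\<lambda>s. q s x) has_field_derivative 2 * ((A0 *v dt s x) \<bullet> d s x)) (at s)"
   proof -
    have d: "((\<lambda>s. d s x) has_vector_derivative dt s x) (at s)" using s by (intro der_t) simp
    have "((\<lambda>s. (A0 *v d s x) \<bullet> d s x) has_vector_derivative ((A0 *v d s x) \<bullet> dt s x + (A0 *v dt s x) \<bullet> d s x)) (at s)"
     by (intro bounded_bilinear.has_vector_derivative[OF bounded_bilinear_inner] d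
      bounded_linear.has_vector_derivative[OF matrix_vector_mul_bounded_linear])
    then show ?thesis unfolding q_def has_real_derivative_iff_has_vector_derivative
     using inner_symmetric_matrix[OF condition_A_D(1)[OF A], of "d s x" "dt s x"] by simp
   qed
   ultimately have "((\<lambda>s. (m s x)^2 * q s x) has_field_derivative e' s x) (at s)"
    unfolding e'_def by (drule_tac DERIV_mult) (auto simp: mult_ac)
   then show ?thesis by (simp add: has_real_derivative_iff_has_vector_derivative)
  qed
  show "norm (e' s x) \<le> (R^2 * (2 * (K0 * B * B)) + 2 * sp * \<bar>R\<bar> * (K0 * B * B)) * ball_ind R x" if s: "s \<in> {0<..<T}" for s x
  proof (cases "norm x \<le> R")
   case True
   have s': "0 < s" "s < T" using s by auto
   have "\<bar>(m s x)^2 * (2 * ((A0 *v dt s x) \<bullet> d s x))\<bar> \<le> R^2 * (2 * (K0 * B * B))"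
    unfolding abs_mult using m2[OF s'(1), of x] form[OF bound(2)[OF s' True] bound(1)[OF s' True]] by (intro mult_mono) auto
   moreover have "\<bar>2 * sp * m s x * q s x\<bar> \<le> 2 * sp * \<bar>R\<bar> * (K0 * B * B)"
    unfolding abs_mult q_def using sp m_bounds[OF s'(1), of x] form[OF bound(1)[OF s' True] bound(1)[OF s' True]] by (intro mult_mono) auto
   ultimately show ?thesis using True unfolding e'_def by simp
  next
   case False
   then show ?thesis using m_bounds(2)[of s x] s by (simp add: e'_def)
  qed
  show "e' t \<in> borel_measurable lborel" unfolding e'_def[abs_def] using t by measurable
 qed (use t mq_int ball_int in auto)
 have e'_le: "(LBINT x. e' t x) \<le> 0" if t: "0 < t" "t < T" for t
 proof -
  define s where "s x = sqrt (1 + (norm x)^2)" for x :: "real^'n"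
  have s: "0 < s x" "norm x \<le> s x" for x using s1[of x] by (auto simp: s_def add_pos_nonneg)
  have smeas[measurable]: "s \<in> \<B>" unfolding s_def[abs_def] by measurable
  have xm[measurable]: "(\<lambda>x::real^'n. x $ j) \<in> \<B>" for j
   by (intro borel_measurable_continuous_onI continuous_intros)
  \<comment> \<open>The flux through the weight in direction j. Its derivative \<open>F'\<close>
    integrates to 0, and adding these to the derivative of the energy brings the differential
    equation in.\<close>
  define F where "F j x = (m t x)^2 * ((A j *v d t x) \<bullet> d t x)" for j x
  define F' where "F' j x = (m t x)^2 * (2 * ((A j *v dx j t x) \<bullet> d t x)) - 2 * m t x * (x $ j / s x) * ((A j *v d t x) \<bullet> d t x)" for j x
  have F'_le: "\<bar>F' j x\<bar> \<le> R^2 * (2 * (K j * B * B)) + 2 * \<bar>R\<bar> * 1 * (K j * B * B)" if x: "norm x \<le> R" for j x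
  proof -
   have "\<bar>(m t x)^2 * (2 * ((A j *v dx j t x) \<bullet> d t x))\<bar> \<le> R^2 * (2 * (K j * B * B))"
    unfolding abs_mult using m2[OF t(1), of x] formj[OF bound(3)[OF t x] bound(1)[OF t x]] by (intro mult_mono) auto
   moreover have "\<bar>x $ j / s x\<bar> \<le> 1" using component_le_norm_cart[of x j] s[of x] by (simp add: abs_divide)
   then have "\<bar>2 * m t x * (x $ j / s x) * ((A j *v d t x) \<bullet> d t x)\<bar> \<le> 2 * \<bar>R\<bar> * 1 * (K j * B * B)"
    unfolding abs_mult[of _ "(A j *v d t x) \<bullet> d t x"] abs_mult[of _ "x $ j / s x"] abs_mult[of 2]
    using m_bounds[OF t(1), of x] formj[OF bound(1)[OF t x] bound(1)[OF t x]] by (intro mult_mono) auto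
   ultimately show ?thesis unfolding F'_def by linarith
  qed
  have F'0: "F' j x = 0" if "norm x > R" for j x using m_bounds(2)[OF t(1) that] by (simp add: F'_def)
  have F'm: "F' j \<in> \<B>" for j unfolding F'_def[abs_def] using t by measurable
  have F'i: "L1 (F' j)" for j by (rule cut_int[OF F'm F'_le F'0])
  have "(LBINT x. F' j x) = 0" for j
  proof (rule integral_directional_derivative_eq_0[where e = "axis j 1" and R = R and f = "F j"])
   fix x
   have "((\<lambda>s. (m t (x + s *\<^sub>R axis j 1))^2) has_field_derivative (2 * m t x) * (- (x $ j / s x))) (at 0)"
    unfolding m_def s_def by (rule DERIV_chain2[where f = "\<lambda>r. (max 0 r)^2"])
     (use has_field_derivative_max_0_squared[of "R - sp * t - sqrt (1 + (norm x)^2)"] DERIV_diff[OF DERIV_const japanese_bracket_derivative[of x j]] in simp_all)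
   moreover have "((\<lambda>s. (A j *v d t (x + s *\<^sub>R axis j 1)) \<bullet> d t (x + s *\<^sub>R axis j 1)) has_field_derivative 2 * ((A j *v dx j t x) \<bullet> d t x)) (at 0)"
   proof -
    have d: "((\<lambda>s. d t (x + s *\<^sub>R axis j 1)) has_vector_derivative dx j t x) (at 0)" by (rule der_x[OF t(1)])
    have "((\<lambda>s. (A j *v d t (x + s *\<^sub>R axis j 1)) \<bullet> d t (x + s *\<^sub>R axis j 1)) has_vector_derivative
     ((A j *v d t (x + 0 *\<^sub>R axis j 1)) \<bullet> dx j t x + (A j *v dx j t x) \<bullet> d t (x + 0 *\<^sub>R axis j 1))) (at 0)"
     by (intro bounded_bilinear.has_vector_derivative[OF bounded_bilinear_inner] d
      bounded_linear.has_vector_derivative[OF matrix_vector_mul_bounded_linear])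
    then show ?thesis unfolding has_real_derivative_iff_has_vector_derivative
     using inner_symmetric_matrix[OF condition_A_D(2)[OF A], of j "d t x" "dx j t x"] by simp
   qed
   ultimately have "((\<lambda>s. F j (x + s *\<^sub>R axis j 1)) has_field_derivative F' j x) (at 0)"
    unfolding F_def F'_def by (drule_tac DERIV_mult) (auto simp: mult_ac)
   then show "((\<lambda>s. F j (x + s *\<^sub>R axis j 1)) has_vector_derivative F' j x) (at 0)"
    by (simp add: has_real_derivative_iff_has_vector_derivative)
   show "norm (F' j x) \<le> \<bar>R^2 * (2 * (K j * B * B)) + 2 * \<bar>R\<bar> * 1 * (K j * B * B)\<bar>"
    using F'_le[of x j] F'0[of x j] by (cases "norm x \<le> R") auto
   show "norm x > R \<Longrightarrow> F j x = 0" using m_bounds(2)[OF t(1)] by (simp add: F_def)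
  next
   show Fm: "F j \<in> \<B>" unfolding F_def[abs_def] using t by measurable
   show "F' j \<in> \<B>" by (rule F'm)
   show "L1 (F j)"
   proof (rule cut_int[OF Fm])
    show "\<bar>F j x\<bar> \<le> R^2 * (K j * B * B)" if "norm x \<le> R" for x
     unfolding abs_mult F_def using m2[OF t(1), of x] formj[OF bound(1)[OF t that] bound(1)[OF t that]] by (intro mult_mono) auto
   qed (use m_bounds(2)[OF t(1)] in \<open>simp add: F_def\<close>)
  qed
  then have "(LBINT x. (\<Sum>j\<in>UNIV. F' j x)) = 0" using F'i by simp
  moreover have le: "e' t x \<le> - (\<Sum>j\<in>UNIV. F' j x)" for x
  proof -
   define g where "g = (\<Sum>j\<in>UNIV. (x $ j / s x) * ((A j *v d t x) \<bullet> d t x))"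
   define h where "h = (\<Sum>j\<in>UNIV. (A j *v dx j t x) \<bullet> d t x)"
   have "A0 *v dt t x = - (\<Sum>j\<in>UNIV. A j *v dx j t x) - L *v d t x"
    using pde[OF t(1), of x] by (simp add: algebra_simps eq_neg_iff_add_eq_0)
   then have A0: "(A0 *v dt t x) \<bullet> d t x = - h - (L *v d t x) \<bullet> d t x"
    by (simp add: inner_diff_left inner_sum_left h_def)
   \<comment> \<open>The slope -x/s(x) of the smoothed cone has length at most 1, so the speed bound
     applies to it.\<close>
   have "- g = (\<Sum>j\<in>UNIV. ((-1 / s x) *\<^sub>R x) $ j * ((A j *v d t x) \<bullet> d t x))"
    by (simp add: g_def sum_negf[symmetric])
   also have "\<dots> \<le> sp * ((A0 *v d t x) \<bullet> d t x)" by (rule sp(2)) (use s[of x] in simp)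
   finally have g: "- g \<le> sp * q t x" by (simp add: q_def)
   have "(\<Sum>j\<in>UNIV. F' j x) = (m t x)^2 * (2 * h) - 2 * m t x * g"
    by (simp add: F'_def sum_subtractf sum_distrib_left h_def g_def mult_ac)
   then have "e' t x + (\<Sum>j\<in>UNIV. F' j x) = 2 * m t x * (- g - sp * q t x) - 2 * ((m t x)^2 * ((L *v d t x) \<bullet> d t x))"
    unfolding e'_def A0 by (simp add: algebra_simps)
   moreover have "2 * m t x * (- g - sp * q t x) \<le> 0" using g m_bounds(1)[OF t(1), of x] by (intro mult_nonneg_nonpos) auto
   moreover have "0 \<le> (m t x)^2 * ((L *v d t x) \<bullet> d t x)" using condition_A_real(2)[OF A] by simp
   ultimately show ?thesis by linarith
  qed
  \<comment> \<open>If \<open>e' t\<close> were not integrable, its integral would be 0 by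
    convention and the inequality would still hold.\<close>
  show ?thesis
  proof (cases "L1 (e' t)")
   case True
   have "(LBINT x. e' t x) \<le> (LBINT x. - (\<Sum>j\<in>UNIV. F' j x))" using True F'i le by (intro integral_mono) auto
   with \<open>(LBINT x. (\<Sum>j\<in>UNIV. F' j x)) = 0\<close> show ?thesis using F'i by simp
  qed (simp add: not_integrable_integral_eq)
 qed
 have e_mono: "e t \<le> e s" if "0 < s" "s \<le> t" for s
 proof (rule DERIV_nonpos_imp_nonincreasing[OF that(2)])
  fix r assume "s \<le> r" "r \<le> t"
  then have "0 < r" "r < T" using t that by auto
  then show "\<exists>y. (e has_real_derivative y) (at r) \<and> y \<le> 0"
   using e_der e'_le has_real_derivative_iff_has_vector_derivative by blast
 qed
 \<comment> \<open>Times in (0, t] tending to 0. The energy is differentiated only at positive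
   times, so the initial value enters as a limit.\<close>
 define a where "a i = t / real (Suc (Suc i))" for i
 have a: "0 < a i" "a i \<le> t" "a i < T" for i
 proof -
  show "0 < a i" using t by (simp add: a_def)
  show "a i \<le> t" unfolding a_def using t by (simp add: divide_le_eq mult_le_cancel_left1)
  then show "a i < T" using t by simp
 qed
 have a0: "filterlim a (at_right 0) sequentially" unfolding filterlim_at
 proof
  have "(\<lambda>i. t * inverse (real (Suc (Suc i)))) \<longlonglongrightarrow> t * 0"
   by (intro tendsto_mult tendsto_const LIMSEQ_Suc[OF LIMSEQ_inverse_real_of_nat])
  then show "a \<longlonglongrightarrow> 0" by (simp add: a_def[abs_def] divide_inverse)
 qed (use a(1) in \<open>auto simp: less_imp_neq[symmetric] intro: always_eventually\<close>)
 have "(\<lambda>i. e (a i)) \<longlonglongrightarrow> (LINT x|(lborel::(real^'n) measure). 0)" unfolding e_def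
 proof (rule integral_dominated_convergence[where w = "\<lambda>x. (R^2 * (K0 * B * B)) * ball_ind R x"])
  show "AE x in lborel. (\<lambda>i. (m (a i) x)^2 * q (a i) x) \<longlonglongrightarrow> 0"
  proof (rule AE_I2)
   fix x :: "real^'n"
   show "(\<lambda>i. (m (a i) x)^2 * q (a i) x) \<longlonglongrightarrow> 0"
   proof (cases "norm x \<le> R")
    case True
    have "(\<lambda>i. d (a i) x) \<longlonglongrightarrow> 0" by (rule filterlim_compose[OF init[OF True] a0])
    then have "(\<lambda>i. (K0 * norm (d (a i) x) * norm (d (a i) x))) \<longlonglongrightarrow> K0 * 0 * 0"
     by (intro tendsto_mult tendsto_const tendsto_norm_zero)
    then have lim: "(\<lambda>i. R^2 * (K0 * norm (d (a i) x) * norm (d (a i) x))) \<longlonglongrightarrow> 0"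
     using tendsto_mult_left[of _ "0::real" sequentially "R^2"] by simp
    show ?thesis
    proof (rule Lim_null_comparison[OF _ lim], rule always_eventually, rule allI)
     fix i
     show "norm ((m (a i) x)^2 * q (a i) x) \<le> R^2 * (K0 * norm (d (a i) x) * norm (d (a i) x))"
      using m2[OF a(1), of i x] K0(2)[of "d (a i) x" "d (a i) x"] unfolding real_norm_def abs_mult q_def by (intro mult_mono) auto
    qed
   next
    case False
    then show ?thesis using m_bounds(2)[OF a(1)] by simp
   qed
  qed
  show "AE x in lborel. norm ((m (a i) x)^2 * q (a i) x) \<le> (R^2 * (K0 * B * B)) * ball_ind R x" for i
  proof (rule AE_I2)
   fix x
   show "norm ((m (a i) x)^2 * q (a i) x) \<le> (R^2 * (K0 * B * B)) * ball_ind R x"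
    using mq_le[OF a(1)[of i] a(3)[of i], of x] m_bounds(2)[OF a(1)[of i], of x] by (cases "norm x \<le> R") auto
  qed
  show "(\<lambda>x. (m (a i) x)^2 * q (a i) x) \<in> borel_measurable lborel" for i
   using m_meas[of "a i"] q_meas[OF a(1)[of i]] by simp
 qed (use ball_int in simp_all)
 then have "(\<lambda>i. e (a i)) \<longlonglongrightarrow> 0" by simp
 then have "e t \<le> 0" by (rule LIMSEQ_le_const) (use e_mono a in auto)
 moreover have "0 \<le> e t" unfolding e_def by (intro integral_nonneg_AE AE_I2 mult_nonneg_nonneg q0) auto
 ultimately have "(LBINT x. (m t x)\<^sup>2 * q t x) = 0" unfolding e_def by simp
 then have "AE x in lborel. (m t x)\<^sup>2 * q t x = 0" using integral_nonneg_eq_0_iff_AE[OF mq_int[OF t]] q0 by simp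
 then show ?thesis
 proof eventually_elim
  case (elim x)
  show ?case
  proof
  assume x: "sqrt (1 + (norm x)^2) + sp * t < R"
  have "0 < m t x" using x by (simp add: m_def)
  with elim have "q t x = 0" by simp
  then show "d t x = 0" using condition_A_real(1)[OF A, of "d t x"] unfolding q_def by fastforce
  qed
 qed
qed

section \<open>Borel representatives\<close>

lemma exponent_cases:
 assumes "1 \<le> (p::ennreal)"
 obtains "p = \<infinity>" "enn2real (inverse p) = 0"
 | P where "1 \<le> P" "p \<noteq> \<infinity>" "p = ennreal P" "enn2real p = P" "enn2real (inverse p) = 1 / P"
proof (cases p)
 case (real P)
 then have P: "1 \<le> P" using assms by (simp add: ennreal_1[symmetric] del: ennreal_1)
 then show ?thesis using real that(2)[of P] by (simp add: inverse_ennreal inverse_eq_divide)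
next
 case top then show ?thesis using that(1) by simp
qed

lemma borel_measurable_lebesgue_AE:
 fixes f :: "'a::euclidean_space \<Rightarrow> 'b::euclidean_space"
 assumes f': "f' \<in> borel_measurable lebesgue" and eq: "AE x in lebesgue. f x = f' x"
 shows "f \<in> borel_measurable lebesgue"
proof (rule measurableI)
 fix A :: "'b set" assume A: "A \<in> sets borel"
 have 1: "f' -` A \<inter> space lebesgue \<in> sets lebesgue" by (rule measurable_sets[OF f' A])
 have 2: "AE x in lebesgue. x \<in> f' -` A \<inter> space lebesgue \<longleftrightarrow> x \<in> f -` A \<inter> space lebesgue"
  using eq by eventually_elim simp
 show "f -` A \<inter> space lebesgue \<in> sets lebesgue" by (rule completion.in_sets_AE[OF 2 1]) (rule Int_lower2)
qed simp

lemma borel_representative: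
 fixes f :: "'a::euclidean_space \<Rightarrow> 'b::euclidean_space"
 assumes f: "f \<in> borel_measurable lebesgue"
 shows "\<exists>f'. f' \<in> \<B> \<and> (AE x in lebesgue. f x = f' x)"
proof -
 have "\<exists>g. g \<in> \<B> \<and> (AE x in lebesgue. f x \<bullet> b = g x)" for b
 proof -
  have "(\<lambda>x. f x \<bullet> b) \<in> borel_measurable lebesgue" using f by (intro borel_measurable_inner) auto
  from completion_ex_borel_measurable_real[OF this] show ?thesis by (auto simp: AE_completion_iff)
 qed
 then obtain g where g: "\<And>b. g b \<in> \<B>" "\<And>b. AE x in lebesgue. f x \<bullet> b = g b x" by metis
 have "AE x in lebesgue. \<forall>b\<in>Basis. f x \<bullet> b = g b x" by (intro AE_finite_allI g) simp
 then have "AE x in lebesgue. f x = (\<Sum>b\<in>Basis. g b x *\<^sub>R b)"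
 proof (rule eventually_mono, goal_cases)
  case (1 x)
  have "f x = (\<Sum>b\<in>Basis. (f x \<bullet> b) *\<^sub>R b)" by (simp only: euclidean_representation)
  then show ?case using 1 by simp
 qed
 moreover have "(\<lambda>x. \<Sum>b\<in>Basis. g b x *\<^sub>R b) \<in> \<B>"
  using g by (intro borel_measurable_sum borel_measurable_scaleR) auto
 ultimately show ?thesis by (intro exI[of _ "\<lambda>x. \<Sum>b\<in>Basis. g b x *\<^sub>R b"] conjI)
qed

lemma borel_measurable_lebesgueI: "f \<in> \<B> \<Longrightarrow> f \<in> borel_measurable lebesgue"
 for f :: "'a::euclidean_space \<Rightarrow> 'b::topological_space"
 by (rule measurable_completion) (simp only: measurable_lborel2)

lemma in_Lp_imp_Lb:
 fixes f :: "real^'n::finite \<Rightarrow> 'b::euclidean_space"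
 assumes p: "1 \<le> p" and f: "in_Lp p f" and f'[measurable]: "f' \<in> \<B>" and eq: "AE x in lebesgue. f x = f' x"
 shows "Lb (enn2real (inverse p)) (Lp_norm p f) f'"
 using p
proof (cases rule: exponent_cases)
 case 1
 have fm[measurable]: "f \<in> borel_measurable lebesgue" using f by (simp add: in_Lp_def)
 obtain B where B: "AE x in lebesgue. norm (f x) \<le> B" using f 1 by (auto simp: in_Lp_def)
 let ?s = "esssup lebesgue (\<lambda>x. ennreal (norm (f x)))"
 \<comment> \<open>Finiteness comes first: \<open>enn2real\<close> sends infinity to 0 and would
   destroy the bound.\<close>
 have "?s \<le> ennreal B"
 proof (rule esssup_I)
  show "AE x in lebesgue. ennreal (norm (f x)) \<le> ennreal B" using B by eventually_elim (rule ennreal_leI)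
 qed measurable
 then have s: "?s < top" by (rule order_le_less_trans) simp
 have "AE x in lebesgue. ennreal (norm (f x)) \<le> ?s" by (rule esssup_AE)
 then have "AE x in lebesgue. norm (f' x) \<le> enn2real ?s" using eq
 proof eventually_elim
  case (elim x)
  have "enn2real (ennreal (norm (f x))) \<le> enn2real ?s" by (rule enn2real_mono[OF elim(1) s])
  then show ?case using elim(2) by simp
 qed
 then show ?thesis using 1 by (simp add: Lb_def Lp_norm_def AE_completion_iff)
next
 case (2 P)
 have i: "integrable lebesgue (\<lambda>x. norm (f x) powr P)" using f 2 by (simp add: in_Lp_def)
 let ?I = "LINT x|lebesgue. norm (f x) powr P"
 have "nnint (\<lambda>x. norm (f' x) powr P) = (\<integral>\<^sup>+x. ennreal (norm (f' x) powr P) \<partial>lebesgue)"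
  by (simp add: nn_integral_completion)
 also have "\<dots> = (\<integral>\<^sup>+x. ennreal (norm (f x) powr P) \<partial>lebesgue)"
  using eq by (intro nn_integral_cong_AE) auto
 also have "\<dots> = ennreal ?I" by (rule nn_integral_eq_integral[OF i]) simp
 also have "?I = (?I powr (1 / P)) powr P" using 2 by (simp add: powr_powr integral_nonneg_AE)
 finally show ?thesis using 2 by (simp add: Lb_def Lp_norm_def)
qed

lemma Lb_imp_in_Lp:
 fixes f :: "real^'n::finite \<Rightarrow> 'b::euclidean_space"
 assumes p: "1 \<le> p" and f: "Lb (enn2real (inverse p)) B f'" and eq: "AE x in lebesgue. f x = f' x"
 shows "in_Lp p f \<and> Lp_norm p f \<le> B"
proof -
 have B: "0 \<le> B" and f'm[measurable]: "f' \<in> \<B>" using f by (auto simp: Lb_def)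
 have fm[measurable]: "f \<in> borel_measurable lebesgue"
  by (rule borel_measurable_lebesgue_AE[OF borel_measurable_lebesgueI[OF f'm] eq])
 show ?thesis using p
 proof (cases rule: exponent_cases)
  case 1
  then have "AE x in lebesgue. norm (f' x) \<le> B" using f by (simp add: Lb_def AE_completion_iff)
  then have le: "AE x in lebesgue. norm (f x) \<le> B" using eq by eventually_elim simp
  have "esssup lebesgue (\<lambda>x. ennreal (norm (f x))) \<le> ennreal B"
  proof (rule esssup_I)
   show "AE x in lebesgue. ennreal (norm (f x)) \<le> ennreal B" using le by eventually_elim (rule ennreal_leI)
  qed measurable
  then have "enn2real (esssup lebesgue (\<lambda>x. ennreal (norm (f x)))) \<le> B" by (rule enn2real_leI[OF B])
  then show ?thesis using le 1 fm by (auto simp: in_Lp_def Lp_norm_def)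
 next
  case (2 P)
  have "(\<integral>\<^sup>+x. ennreal (norm (f x) powr P) \<partial>lebesgue) = (\<integral>\<^sup>+x. ennreal (norm (f' x) powr P) \<partial>lebesgue)"
   using eq by (intro nn_integral_cong_AE) auto
  also have "\<dots> = nnint (\<lambda>x. norm (f' x) powr P)" by (simp add: nn_integral_completion)
  also have "\<dots> \<le> ennreal (B powr P)" using f 2 by (simp add: Lb_def)
  finally have le: "(\<integral>\<^sup>+x. ennreal (norm (f x) powr P) \<partial>lebesgue) \<le> ennreal (B powr P)" .
  have i: "integrable lebesgue (\<lambda>x. norm (f x) powr P)"
  proof (rule integrableI_bounded)
   show "(\<integral>\<^sup>+x. ennreal (norm (norm (f x) powr P)) \<partial>lebesgue) < \<infinity>" using order_le_less_trans[OF le, of top] by simp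
  qed measurable
  have "ennreal (LINT x|lebesgue. norm (f x) powr P) \<le> ennreal (B powr P)" using le nn_integral_eq_integral[OF i] by simp
  then have "(LINT x|lebesgue. norm (f x) powr P) \<le> B powr P" by simp
  then have "(LINT x|lebesgue. norm (f x) powr P) powr (1 / P) \<le> (B powr P) powr (1 / P)"
   using 2 by (intro powr_mono2) (auto simp: integral_nonneg_AE)
  also have "\<dots> = B" using 2 B by (simp add: powr_powr)
  finally show ?thesis using i 2 fm by (simp add: in_Lp_def Lp_norm_def)
 qed
qed

lemma locally_integrable_iff_locint:
 fixes f :: "real^'n::finite \<Rightarrow> 'b::euclidean_space"
 assumes f': "f' \<in> \<B>" and eq: "AE x in lebesgue. f x = f' x"
 shows "locally_integrable f \<longleftrightarrow> locint f'"
proof -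
 note f'[measurable]
 have fm[measurable]: "f \<in> borel_measurable lebesgue"
  by (rule borel_measurable_lebesgue_AE[OF borel_measurable_lebesgueI[OF f'] eq])
 have iff: "f absolutely_integrable_on cball 0 R \<longleftrightarrow> L1 (\<lambda>y. ball_ind R y *\<^sub>R f' y)" for R
 proof -
  have "f absolutely_integrable_on cball 0 R \<longleftrightarrow> integrable lebesgue (\<lambda>y. ball_ind R y *\<^sub>R f' y)"
   unfolding set_integrable_def
  proof (rule integrable_cong_AE)
   show "(\<lambda>x. ball_ind R x *\<^sub>R f x) \<in> borel_measurable lebesgue"
    by (intro borel_measurable_scaleR borel_measurable_indicator fm) simp
   show "(\<lambda>x. ball_ind R x *\<^sub>R f' x) \<in> borel_measurable lebesgue"
    by (rule borel_measurable_lebesgueI) (intro borel_measurable_scaleR borel_measurable_indicator f', simp)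
   show "AE x in lebesgue. ball_ind R x *\<^sub>R f x = ball_ind R x *\<^sub>R f' x" using eq by eventually_elim simp
  qed
  also have "\<dots> \<longleftrightarrow> L1 (\<lambda>y. ball_ind R y *\<^sub>R f' y)"
   by (rule integrable_completion) (simp only: measurable_lborel2, intro borel_measurable_scaleR borel_measurable_indicator f', simp)
  finally show ?thesis .
 qed
 show ?thesis
 proof
  assume "locally_integrable f" then show "locint f'" using iff f' by (simp add: locint_def locally_integrable_def)
 next
  assume "locint f'"
  then have b: "f absolutely_integrable_on cball 0 R" for R using iff by (simp add: locint_def)
  show "locally_integrable f" unfolding locally_integrable_def
  proof (intro allI impI)
   fix K :: "(real^'n) set" assume K: "compact K"
   from compact_imp_bounded[OF K] obtain R where R: "\<forall>x\<in>K. norm x \<le> R" unfolding bounded_iff by (elim exE)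
   have "K \<in> sets lebesgue" using K by (intro sets_completionI_sets) (simp add: borel_compact)
   then show "f absolutely_integrable_on K" by (rule set_integrable_subset[OF b]) (use R in auto)
  qed
 qed
qed

lemma locally_integrable_measurable:
 fixes f :: "real^'n::finite \<Rightarrow> 'b::euclidean_space"
 assumes "locally_integrable f" shows "f \<in> borel_measurable lebesgue"
proof (rule borel_measurable_LIMSEQ_metric)
 show "(\<lambda>x. ball_ind (real i) x *\<^sub>R f x) \<in> borel_measurable lebesgue" for i
 proof (rule borel_measurable_integrable)
  have "f absolutely_integrable_on cball 0 (real i)"
   using assms compact_cball unfolding locally_integrable_def by (elim allE impE)
  then show "integrable lebesgue (\<lambda>x. ball_ind (real i) x *\<^sub>R f x)" by (simp only: set_integrable_def)
 qed
 show "(\<lambda>i. ball_ind (real i) x *\<^sub>R f x) \<longlonglongrightarrow> f x" for x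
 proof (rule tendsto_eventually)
  obtain N where "norm x \<le> real N" using real_arch_simple[of "norm x"] by (elim exE)
  then have "ball_ind (real i) x *\<^sub>R f x = f x" if "N \<le> i" for i using that by (simp add: indicator_def)
  then show "\<forall>\<^sub>F i in sequentially. ball_ind (real i) x *\<^sub>R f x = f x"
   unfolding eventually_sequentially by (intro exI[of _ N] allI impI)
 qed
qed

lemma locint_representative:
 fixes f :: "real^'n::finite \<Rightarrow> 'b::euclidean_space"
 assumes f: "locally_integrable f"
 shows "\<exists>f'. locint f' \<and> (AE x in lebesgue. f x = f' x)"
proof -
 obtain f' where f': "f' \<in> \<B>" "AE x in lebesgue. f x = f' x"
  using borel_representative[OF locally_integrable_measurable[OF f]] by (elim exE conjE)
 have "locint f'" using f by (simp only: locally_integrable_iff_locint[OF f'])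
 with f'(2) show ?thesis by (intro exI[of _ f'] conjI)
qed

lemma integral_representative:
 fixes f :: "real^'n::finite \<Rightarrow> 'b::{banach, second_countable_topology}"
 assumes "f' \<in> \<B>" "f \<in> borel_measurable lebesgue" "AE x in lebesgue. f x = f' x"
 shows "(LINT x|lebesgue. f x) = (LBINT x. f' x)"
proof -
 have "(LINT x|lebesgue. f x) = (LINT x|lebesgue. f' x)"
  by (rule integral_cong_AE[OF assms(2) borel_measurable_lebesgueI[OF assms(1)] assms(3)])
 also have "\<dots> = (LBINT x. f' x)" by (rule integral_completion) (use assms in simp)
 finally show ?thesis .
qed

text \<open>The Borel counterpart of \<open>has_weak_deriv\<close>, with which it agrees after
  passing to representatives.\<close>

definition wderiv :: "'n::finite list \<Rightarrow> (real^'n \<Rightarrow> 'b::euclidean_space) \<Rightarrow> (real^'n \<Rightarrow> 'b) \<Rightarrow> bool" where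
 "wderiv js u v \<longleftrightarrow> locint u \<and> locint v \<and>
  (\<forall>\<phi>. smooth_csupp \<phi> \<longrightarrow> (LBINT x. pds js \<phi> x *\<^sub>R u x) = (-1) ^ length js *\<^sub>R (LBINT x. \<phi> x *\<^sub>R v x))"

lemma integral_test_representative:
 fixes f :: "real^'n::finite \<Rightarrow> 'b::euclidean_space"
 assumes f': "f' \<in> \<B>" and eq: "AE x in lebesgue. f x = f' x" and \<phi>: "smooth_csupp \<phi>"
 shows "(LINT x|lebesgue. \<phi> x *\<^sub>R f x) = (LBINT x. \<phi> x *\<^sub>R f' x)"
proof (rule integral_representative)
 have [measurable]: "\<phi> \<in> \<B>" using \<phi> smooth_borel_measurable[of \<phi>] by (simp add: smooth_csupp_def)
 show m: "(\<lambda>x. \<phi> x *\<^sub>R f' x) \<in> \<B>" using f' by measurable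
 show e: "AE x in lebesgue. \<phi> x *\<^sub>R f x = \<phi> x *\<^sub>R f' x" using eq by eventually_elim simp
 show "(\<lambda>x. \<phi> x *\<^sub>R f x) \<in> borel_measurable lebesgue"
 proof (rule borel_measurable_scaleR)
  show "\<phi> \<in> borel_measurable lebesgue" by (rule borel_measurable_lebesgueI) measurable
 qed (rule borel_measurable_lebesgue_AE[OF borel_measurable_lebesgueI[OF f'] eq])
qed

lemma has_weak_deriv_iff_wderiv:
 fixes u v :: "real^'n::finite \<Rightarrow> 'b::euclidean_space"
 assumes u: "u' \<in> \<B>" "AE x in lebesgue. u x = u' x"
  and v: "v' \<in> \<B>" "AE x in lebesgue. v x = v' x"
 shows "has_weak_deriv js u v \<longleftrightarrow> wderiv js u' v'"
 unfolding has_weak_deriv_def wderiv_def test_function_iff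
  locally_integrable_iff_locint[OF u] locally_integrable_iff_locint[OF v]
 by (simp add: integral_test_representative[OF u] integral_test_representative[OF v] smooth_csupp_partial_derivs)

section \<open>Approximation by test functions\<close>

lemma locint_norm_integrable: "locint f \<Longrightarrow> L1 (\<lambda>y. ball_ind R y * norm (f y))"
proof -
 assume "locint f"
 then have "L1 (\<lambda>y. norm (ball_ind R y *\<^sub>R f y))" unfolding locint_def by (intro integrable_norm) auto
 then show ?thesis by simp
qed

lemma locint_diff: "locint f \<Longrightarrow> locint g \<Longrightarrow> locint (\<lambda>x. f x - g x)"
 unfolding locint_def by (auto simp: scaleR_right_diff_distrib intro: borel_measurable_diff)

lemma locint_continuous:
 fixes f :: "'a::euclidean_space \<Rightarrow> 'b::{banach, second_countable_topology}"
 assumes "continuous_on UNIV f" shows "locint f"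
 unfolding locint_def
proof (intro conjI allI)
 show "f \<in> \<B>" by (rule borel_measurable_continuous_onI[OF assms])
 show "L1 (\<lambda>y. ball_ind R y *\<^sub>R f y)" for R
  using continuous_on_subset[OF assms] by (intro borel_integrable_compact) auto
qed

lemma conv_norm_le:
 fixes f :: "real^'n::finite \<Rightarrow> 'b::euclidean_space"
 assumes r: "smooth_csupp r" "\<And>x. \<bar>r x\<bar> \<le> M" "\<And>x. norm x > S \<Longrightarrow> r x = 0" and f: "locint f" and x: "norm x \<le> R"
 shows "norm (conv r f x) \<le> M * (LBINT y. ball_ind (R + S) y * norm (f y))"
proof -
 have "norm (conv r f x) \<le> (LBINT y. norm (r (x - y) *\<^sub>R f y))" unfolding conv_def by (rule integral_norm_bound)
 also have "\<dots> \<le> (LBINT y. M * (ball_ind (R + S) y * norm (f y)))"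
 proof (intro integral_mono integrable_norm conv_integrable r(1) f integrable_mult_right locint_norm_integrable)
  fix y
  show "norm (r (x - y) *\<^sub>R f y) \<le> M * (ball_ind (R + S) y * norm (f y))"
  proof (cases "norm y \<le> R + S")
   case True then show ?thesis using r(2)[of "x - y"] by (simp add: mult_right_mono)
  next
   case False
   then have "norm (x - y) > S" using x norm_triangle_ineq2[of y x] by (simp add: norm_minus_commute)
   then show ?thesis using False by (simp add: r(3))
  qed
 qed
 finally show ?thesis by simp
qed

lemma conv_diff:
 assumes "smooth_csupp r" "locint f" "locint g"
 shows "conv r (\<lambda>x. f x - g x) x = conv r f x - conv r g x"
 unfolding conv_def by (simp add: scaleR_right_diff_distrib conv_integrable assms)

lemma conv_cong_AE:
 assumes r: "smooth_csupp r" and f: "locint f" "locint g" and eq: "AE x in lborel. f x = g x"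
 shows "conv r f x = conv r g x"
 unfolding conv_def
proof (rule integral_cong_AE)
 show "AE y in lborel. r (x - y) *\<^sub>R f y = r (x - y) *\<^sub>R g y" using eq by eventually_elim simp
qed (use conv_integrable[OF r f(1)] conv_integrable[OF r f(2)] in \<open>auto dest: borel_measurable_integrable\<close>)

lemma smooth_csupp_reflect:
 assumes r: "smooth_csupp r"
 shows "smooth_csupp (\<lambda>y. r (x - y))"
  "pds js (\<lambda>y. r (x - y)) y = (-1) ^ length js *\<^sub>R pds js r (x - y)"
proof -
 have s: "smooth_on UNIV r" using r by (simp add: smooth_csupp_def)
 obtain R where R: "\<And>x. norm x > R \<Longrightarrow> r x = 0" using r unfolding smooth_csupp_def by auto
 have "r (x - y) = 0" if "norm y > R + norm x" for y
  using that norm_triangle_ineq2[of y x] by (intro R) (simp add: norm_minus_commute)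
 then show "smooth_csupp (\<lambda>y. r (x - y))" using smooth_affine[OF s, of x "-1"] unfolding smooth_csupp_def by auto
 show "pds js (\<lambda>y. r (x - y)) y = (-1) ^ length js *\<^sub>R pds js r (x - y)"
  using fun_cong[OF partial_derivs_affine[OF s, of js x "-1"], of y] by simp
qed

lemma Lb_1_integrable:
 fixes f :: "'a::euclidean_space \<Rightarrow> 'b::euclidean_space"
 assumes "L1 f" shows "Lb 1 (LBINT x. norm (f x)) f"
 using assms nn_integral_eq_integral[OF integrable_norm[OF assms]]
 by (auto simp: Lb_def integral_nonneg_AE dest: borel_measurable_integrable)

lemma Lb_1_D:
 fixes f :: "'a::euclidean_space \<Rightarrow> 'b::euclidean_space"
 assumes "Lb 1 B f" shows "L1 f" "(LBINT x. norm (f x)) \<le> B"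
proof -
 have m[measurable]: "f \<in> \<B>" and B: "0 \<le> B" and le: "nnint (\<lambda>x. norm (f x)) \<le> ennreal B"
  using assms by (auto simp: Lb_def)
 show i: "L1 f"
 proof (rule integrableI_bounded)
  show "nnint (\<lambda>x. norm (f x)) < \<infinity>" using order_le_less_trans[OF le, of top] by simp
 qed measurable
 show "(LBINT x. norm (f x)) \<le> B" using le B nn_integral_eq_integral[OF integrable_norm[OF i]] by simp
qed

lemma mollifier_D:
 assumes "mollifier r \<epsilon>"
 shows "smooth_csupp r" "\<And>x. 0 \<le> r x" "\<And>x. norm x > \<epsilon> \<Longrightarrow> r x = 0" "(LBINT x. r x) = 1"
 using assms by (auto simp: mollifier_def)

text \<open>\<open>f\<close> is only locally integrable, but against \<psi> its mollifications see
  \<open>f\<close> within radius R + 1 alone. Cutting \<open>f\<close> there makes it integrable,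
  and mollification converges in L^1.\<close>

lemma conv_tendsto:
 fixes f :: "real^'n::finite \<Rightarrow> 'b::euclidean_space"
 assumes r: "\<And>j. mollifier (r j) (1 / real (Suc j))" and f: "locint f"
  and \<psi>: "\<psi> \<in> \<B>" "\<And>x. \<bar>\<psi> x\<bar> \<le> C" "\<And>x. norm x > R \<Longrightarrow> \<psi> x = 0"
 shows "(\<lambda>j. LBINT x. \<psi> x *\<^sub>R conv (r j) f x) \<longlonglongrightarrow> (LBINT x. \<psi> x *\<^sub>R f x)"
proof (rule LIMSEQ_I)
 fix e :: real assume e: "0 < e"
 have C: "0 \<le> C" using \<psi>(2)[of 0] by linarith
 define f' where "f' y = ball_ind (R + 1) y *\<^sub>R f y" for y
 have i: "L1 f'" using f by (simp add: f'_def[abs_def] locint_def)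
 obtain N where N: "\<And>j. j \<ge> N \<Longrightarrow> Lb 1 (e / (C + 1)) (\<lambda>x. conv (r j) f' x - f' x)"
  using mollify_Lb[OF _ _ Lb_1_integrable[OF i] r, of "e / (C + 1)"] e C by auto
 have eq: "\<psi> x *\<^sub>R conv (r j) f x - \<psi> x *\<^sub>R f x = \<psi> x *\<^sub>R (conv (r j) f' x - f' x)" for j x
 proof (cases "norm x \<le> R")
  case True
  have "conv (r j) f x = conv (r j) f' x" unfolding conv_def
  proof (rule Bochner_Integration.integral_cong[OF refl])
   fix y
   show "r j (x - y) *\<^sub>R f y = r j (x - y) *\<^sub>R f' y"
   proof (cases "norm y \<le> R + 1")
    case False
    then have "norm (x - y) > 1" using True norm_triangle_ineq2[of y x] by (simp add: norm_minus_commute)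
    then have "norm (x - y) > 1 / real (Suc j)" by (rule order_le_less_trans[rotated]) simp
    then show ?thesis using mollifier_D(3)[OF r] by simp
   qed (simp add: f'_def)
  qed
  then show ?thesis using True by (simp add: f'_def scaleR_right_diff_distrib)
 qed (simp add: \<psi>(3))
 show "\<exists>N. \<forall>j\<ge>N. norm ((LBINT x. \<psi> x *\<^sub>R conv (r j) f x) - (LBINT x. \<psi> x *\<^sub>R f x)) < e"
 proof (intro exI allI impI)
  fix j assume j: "N \<le> j"
  note L = Lb_1_D[OF N[OF j]]
  have "locint (conv (r j) f)" by (intro locint_continuous smooth_continuous smooth_conv mollifier_D(1)[OF r] f)
  then have "(LBINT x. \<psi> x *\<^sub>R conv (r j) f x) - (LBINT x. \<psi> x *\<^sub>R f x) = (LBINT x. \<psi> x *\<^sub>R (conv (r j) f' x - f' x))"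
   unfolding eq[symmetric] by (intro Bochner_Integration.integral_diff[symmetric] integrable_csupp_mult[OF _ \<psi>] f)
  also have "norm \<dots> \<le> (LBINT x. norm (\<psi> x *\<^sub>R (conv (r j) f' x - f' x)))" by (rule integral_norm_bound)
  also have "\<dots> \<le> (LBINT x. C * norm (conv (r j) f' x - f' x))"
  proof (rule integral_mono)
   show "L1 (\<lambda>x. norm (\<psi> x *\<^sub>R (conv (r j) f' x - f' x)))"
    unfolding eq[symmetric] using \<open>locint (conv (r j) f)\<close>
    by (intro integrable_norm Bochner_Integration.integrable_diff integrable_csupp_mult[OF _ \<psi>] f)
  qed (use L \<psi>(2) in \<open>auto intro!: mult_right_mono integrable_mult_right\<close>)
  also have "\<dots> = C * (LBINT x. norm (conv (r j) f' x - f' x))" by simp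
  also have "\<dots> \<le> C * (e / (C + 1))" using L C by (intro mult_left_mono)
  also have "\<dots> < e" using e C by (simp add: field_simps)
  finally show "norm ((LBINT x. \<psi> x *\<^sub>R conv (r j) f x) - (LBINT x. \<psi> x *\<^sub>R f x)) < e" .
 qed
qed

text \<open>The weak derivative is tested with y \<mapsto> r(x - y); the sign of the reflection
  cancels the one in the definition.\<close>

lemma conv_wderiv:
 assumes w: "wderiv ks u v" and r: "smooth_csupp r"
 shows "pds ks (conv r u) = conv r v"
proof
 fix x
 have "(LBINT y. pds ks (\<lambda>y. r (x - y)) y *\<^sub>R u y) = (-1) ^ length ks *\<^sub>R (LBINT y. r (x - y) *\<^sub>R v y)"
  using w smooth_csupp_reflect(1)[OF r] unfolding wderiv_def by auto
 then have "(-1) ^ length ks *\<^sub>R conv (pds ks r) u x = (-1) ^ length ks *\<^sub>R conv r v x"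
  by (simp only: smooth_csupp_reflect(2)[OF r] real_scaleR_def scaleR_scaleR[symmetric] integral_scaleR_right conv_def)
 then show "pds ks (conv r u) x = conv r v x" using w by (simp add: partial_derivs_conv[OF r] wderiv_def)
qed

text \<open>The difference \<open>d\<close> of two weak derivatives has vanishing mollifications,
  hence vanishing integral against bounded functions of bounded support. Taking the sign of a
  component of \<open>d\<close> on a ball makes that integral the L^1 norm of the component.\<close>

lemma wderiv_unique:
 fixes u v v' :: "real^'n::finite \<Rightarrow> 'b::euclidean_space"
 assumes v: "wderiv js u v" and v': "wderiv js u v'"
 shows "AE x in lborel. v x = v' x"
proof -
 obtain r :: "nat \<Rightarrow> real^'n \<Rightarrow> real" where r: "\<And>j. mollifier (r j) (1 / real (Suc j))"
  by (rule mollifier_sequence_exists) (rule that)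
 define d where "d x = v x - v' x" for x
 have l: "locint v" "locint v'" using v v' by (simp_all add: wderiv_def)
 have d: "locint d" unfolding d_def[abs_def] using l by (rule locint_diff)
 note dm[measurable] = locint_measurable[OF d]
 have c: "conv (r j) d x = 0" for j x
 proof -
  note s = mollifier_D(1)[OF r[of j]]
  have "conv (r j) d x = conv (r j) v x - conv (r j) v' x" unfolding d_def[abs_def] by (rule conv_diff[OF s l])
  also have "conv (r j) v = conv (r j) v'" using conv_wderiv[OF v s] conv_wderiv[OF v' s] by simp
  finally show ?thesis by simp
 qed
 have "AE x in lborel. \<forall>b\<in>Basis. \<forall>N::nat. ball_ind (real N) x * \<bar>d x \<bullet> b\<bar> = 0"
 proof (intro AE_finite_allI finite_Basis, unfold AE_all_countable, rule allI)
  fix b :: 'b and N :: nat assume b: "b \<in> Basis"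
  define \<psi> where "\<psi> x = sgn (d x \<bullet> b) * ball_ind (real N) x" for x
  have [measurable]: "cball (0 :: real^'n) (real N) \<in> sets borel" by simp
  have m: "\<psi> \<in> \<B>" unfolding \<psi>_def[abs_def] by measurable
  have le: "\<bar>\<psi> x\<bar> \<le> 1" for x by (simp add: \<psi>_def indicator_def sgn_if)
  have z: "norm x > real N \<Longrightarrow> \<psi> x = 0" for x by (simp add: \<psi>_def)
  have i: "L1 (\<lambda>x. \<psi> x *\<^sub>R d x)" by (rule integrable_csupp_mult[OF d m le z])
  have "(\<lambda>j. LBINT x. \<psi> x *\<^sub>R conv (r j) d x) \<longlonglongrightarrow> (LBINT x. \<psi> x *\<^sub>R d x)"
   by (rule conv_tendsto[OF r d m le z])
  then have "(LBINT x. \<psi> x *\<^sub>R d x) = 0" unfolding c by (simp add: LIMSEQ_const_iff)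
  then have "(LBINT x. (\<psi> x *\<^sub>R d x) \<bullet> b) = 0" using i by (simp del: inner_scaleR_left)
  moreover have e: "(\<psi> x *\<^sub>R d x) \<bullet> b = ball_ind (real N) x * \<bar>d x \<bullet> b\<bar>" for x
   by (simp add: \<psi>_def sgn_if abs_if)
  moreover have "L1 (\<lambda>x. (\<psi> x *\<^sub>R d x) \<bullet> b)" by (rule integrable_inner_left) (rule i)
  ultimately show "AE x in lborel. ball_ind (real N) x * \<bar>d x \<bullet> b\<bar> = 0"
   using integral_nonneg_eq_0_iff_AE[of lborel "\<lambda>x. ball_ind (real N) x * \<bar>d x \<bullet> b\<bar>"] by (simp only: e) simp
 qed
 then show ?thesis
 proof eventually_elim
  case (elim x)
  obtain N where "norm x \<le> real N" using real_arch_simple[of "norm x"] by (elim exE)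
  then have "d x \<bullet> b = 0" if "b \<in> Basis" for b using bspec[OF elim that] by (auto simp: indicator_def dest: spec[of _ N])
  then have "d x = 0" by (rule euclidean_eqI[where y = 0, simplified])
  then show ?case by (simp add: d_def)
 qed
qed

section \<open>Convergence of approximate data in Lebesgue norms\<close>

definition tends_Lb :: "real \<Rightarrow> (nat \<Rightarrow> 'a::euclidean_space \<Rightarrow> 'b::euclidean_space) \<Rightarrow> ('a \<Rightarrow> 'b) \<Rightarrow> bool" where
 "tends_Lb a F G \<longleftrightarrow> (\<forall>\<delta>>0. \<exists>N. \<forall>j\<ge>N. Lb a \<delta> (\<lambda>x. F j x - G x))"

lemma tends_Lb_D: "tends_Lb a F G \<Longrightarrow> 0 < \<delta> \<Longrightarrow> \<exists>N. \<forall>j\<ge>N. Lb a \<delta> (\<lambda>x. F j x - G x)"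
 unfolding tends_Lb_def by simp

lemma tends_Lb_add:
 assumes a: "0 \<le> a" "a \<le> 1" and F: "tends_Lb a F G" "tends_Lb a F' G'"
 shows "tends_Lb a (\<lambda>j x. F j x + F' j x) (\<lambda>x. G x + G' x)"
 unfolding tends_Lb_def
proof (intro allI impI)
 fix \<delta> :: real assume \<delta>: "0 < \<delta>"
 then have \<delta>8: "0 < \<delta> / 8" by simp
 obtain N where N: "\<forall>j\<ge>N. Lb a (\<delta> / 8) (\<lambda>x. F j x - G x)" using tends_Lb_D[OF F(1) \<delta>8] by (elim exE)
 obtain N' where N': "\<forall>j\<ge>N'. Lb a (\<delta> / 8) (\<lambda>x. F' j x - G' x)" using tends_Lb_D[OF F(2) \<delta>8] by (elim exE)
 show "\<exists>N. \<forall>j\<ge>N. Lb a \<delta> (\<lambda>x. F j x + F' j x - (G x + G' x))"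
 proof (intro exI allI impI)
  fix j assume j: "max N N' \<le> j"
  have "Lb a (4 * (\<delta> / 8 + \<delta> / 8)) (\<lambda>x. (F j x - G x) + (F' j x - G' x))"
   using j N N' by (intro Lb_add a) auto
  then show "Lb a \<delta> (\<lambda>x. F j x + F' j x - (G x + G' x))" by (simp add: algebra_simps)
 qed
qed

lemma Lb_zero: "0 \<le> B \<Longrightarrow> Lb a B (\<lambda>x. 0)"
 by (simp add: Lb_def)

lemma tends_Lb_sum_list:
 assumes a: "0 \<le> a" "a \<le> 1" and F: "\<And>s. s \<in> set S \<Longrightarrow> tends_Lb a (F s) (G s)"
 shows "tends_Lb a (\<lambda>j x. \<Sum>s\<leftarrow>S. F s j x) (\<lambda>x. \<Sum>s\<leftarrow>S. G s x)"
 using F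
proof (induction S)
 case Nil show ?case by (simp add: tends_Lb_def Lb_zero)
next
 case (Cons s S)
 have "tends_Lb a (\<lambda>j x. F s j x + (\<Sum>s\<leftarrow>S. F s j x)) (\<lambda>x. G s x + (\<Sum>s\<leftarrow>S. G s x))"
  by (rule tends_Lb_add[OF a]) (use Cons in auto)
 then show ?case by simp
qed

lemma tends_Lb_bounded:
 assumes a: "0 \<le> a" "a \<le> 1" and F: "tends_Lb a F G" and G: "Lb a B G" and \<delta>: "0 < \<delta>"
 shows "\<exists>N. \<forall>j\<ge>N. Lb a (4 * (\<delta> + B)) (F j)"
proof -
 obtain N where N: "\<forall>j\<ge>N. Lb a \<delta> (\<lambda>x. F j x - G x)" using tends_Lb_D[OF F \<delta>] by (elim exE)
 have "Lb a (4 * (\<delta> + B)) (F j)" if "j \<ge> N" for j using Lb_add[OF a N[rule_format, OF that] G] by simp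
 then show ?thesis by (intro exI[of _ N] allI impI)
qed

lemma tends_Lb_Cauchy:
 assumes a: "0 \<le> a" "a \<le> 1" and F: "tends_Lb a F G" and \<delta>: "0 < \<delta>"
 shows "\<exists>N. \<forall>i\<ge>N. \<forall>j\<ge>N. Lb a \<delta> (\<lambda>x. F i x - F j x)"
proof -
 have "0 < \<delta> / 8" using \<delta> by simp
 from tends_Lb_D[OF F this] obtain N where N: "\<forall>j\<ge>N. Lb a (\<delta> / 8) (\<lambda>x. F j x - G x)" by (elim exE)
 have "Lb a \<delta> (\<lambda>x. F i x - F j x)" if ij: "i \<ge> N" "j \<ge> N" for i j
 proof -
  have "Lb a (\<delta> / 8) (\<lambda>x. G x - F j x)" using Lb_scaleR[OF N[rule_format, OF ij(2)] a(1), of "-1"] by simp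
  from Lb_add[OF a N[rule_format, OF ij(1)] this] show ?thesis by simp
 qed
 then show ?thesis by (intro exI[of _ N] allI impI)
qed

lemma cutoff_exists:
 obtains \<eta> :: "real^'n::finite \<Rightarrow> real" where "smooth_csupp \<eta>" "\<And>x. \<bar>\<eta> x\<bar> \<le> 1" "\<And>x. norm x \<le> 1 \<Longrightarrow> \<eta> x = 1"
proof -
 obtain r' :: "nat \<Rightarrow> real^'n \<Rightarrow> real" where r': "\<And>j. mollifier (r' j) (1 / real (Suc j))"
  by (rule mollifier_sequence_exists) (rule that)
 define r where "r = r' 0"
 have "mollifier r 1" using r'[of 0] by (simp add: r_def)
 note r = mollifier_D[OF this]
 have f: "locint (indicat_real (cball (0::real^'n) 2))"
 proof -
  have "L1 (\<lambda>y::real^'n. (ball_ind R y * ball_ind 2 y) *\<^sub>R (1::real))" for R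
   by (rule integrable_csupp_mult[OF locint_const, where B = 1 and R = 2]) (auto simp: indicator_def)
  then show ?thesis by (simp add: locint_def borel_measurable_indicator)
 qed
 have one: "(LBINT y. r (x - y)) = 1" for x using integral_lborel_reflect[of r x] r(4) by simp
 have i: "L1 (\<lambda>y. r (x - y))" for x by (rule smooth_csupp_integrable[OF smooth_csupp_reflect(1)[OF r(1)]])
 let ?\<eta> = "conv r (ball_ind 2)"
 have far: "r (x - y) = 0" if "norm x > 3" "norm y \<le> 2" for x y
  using that norm_triangle_ineq2[of x y] by (intro r(3)) linarith
 show ?thesis
 proof (rule that[of ?\<eta>])
  have "?\<eta> x = 0" if "norm x > 3" for x
  proof -
   have "r (x - y) *\<^sub>R ball_ind 2 y = 0" for y using far[OF that, of y] by (cases "norm y \<le> 2") simp_all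
   then show ?thesis unfolding conv_def by (simp only: integral_zero)
  qed
  then show "smooth_csupp ?\<eta>" unfolding smooth_csupp_def using smooth_conv[OF r(1) f] by auto
  show "\<bar>?\<eta> x\<bar> \<le> 1" for x
  proof -
   have "norm (?\<eta> x) \<le> (LBINT y. norm (r (x - y) *\<^sub>R ball_ind 2 y))"
    unfolding conv_def by (rule integral_norm_bound)
   also have "\<dots> \<le> (LBINT y. r (x - y))"
    by (intro integral_mono integrable_norm conv_integrable[OF r(1) f] i) (simp add: indicator_def r(2))
   finally show ?thesis using one by simp
  qed
  show "?\<eta> x = 1" if "norm x \<le> 1" for x
  proof -
   have "r (x - y) *\<^sub>R ball_ind 2 y = r (x - y)" for y
   proof (cases "norm y \<le> 2")
    case False
    then have "norm (x - y) > 1" using that norm_triangle_ineq2[of y x] by (simp add: norm_minus_commute)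
    then show ?thesis by (simp add: r(3))
   qed simp
   then show ?thesis unfolding conv_def by (simp only: one)
  qed
 qed
qed

locale approximation =
 fixes r :: "nat \<Rightarrow> real^'n::finite \<Rightarrow> real" and \<eta> :: "real^'n \<Rightarrow> real"
 assumes r: "\<And>j. mollifier (r j) (1 / real (Suc j))"
  and \<eta>: "smooth_csupp \<eta>" "\<And>x. \<bar>\<eta> x\<bar> \<le> 1" "\<And>x. norm x \<le> 1 \<Longrightarrow> \<eta> x = 1"
begin

definition cutoff :: "nat \<Rightarrow> real^'n \<Rightarrow> real" where
 "cutoff j x = \<eta> (0 + (1 / real (Suc j)) *\<^sub>R x)"

text \<open>Mollification before truncation: within radius j + 1 the result is exactly the
  mollification, so that by finite speed it has the same evolution on a large ball as the mollified
  solution.\<close>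

definition approx :: "(real^'n \<Rightarrow> 'b::euclidean_space) \<Rightarrow> nat \<Rightarrow> real^'n \<Rightarrow> 'b" where
 "approx u j x = cutoff j x *\<^sub>R conv (r j) u x"

lemma r_smooth: "smooth_csupp (r j)"
 by (rule mollifier_D(1)[OF r])

lemma cutoff_smooth: "smooth_on UNIV (cutoff j)"
 unfolding cutoff_def[abs_def] using \<eta>(1) by (intro smooth_affine) (simp add: smooth_csupp_def)

lemma cutoff_vanish: obtains R where "\<And>x. norm x > R \<Longrightarrow> cutoff j x = 0"
proof -
 obtain R where R: "\<And>x. norm x > R \<Longrightarrow> \<eta> x = 0" using \<eta>(1) unfolding smooth_csupp_def by auto
 have "cutoff j x = 0" if "norm x > R * real (Suc j)" for x unfolding cutoff_def using that by (intro R) (simp add: field_simps)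
 then show ?thesis by (rule that)
qed

lemma cutoff_eq_1: "norm x \<le> real (Suc j) \<Longrightarrow> cutoff j x = 1"
 unfolding cutoff_def by (intro \<eta>(3)) (simp add: field_simps)

lemma cutoff_le: "\<bar>cutoff j x\<bar> \<le> 1"
 unfolding cutoff_def by (rule \<eta>(2))

lemma cutoff_derivs_bound:
 assumes "as \<noteq> []"
 obtains M where "0 < M" "\<And>j x. \<bar>pds as (cutoff j) x\<bar> \<le> M / real (Suc j)"
proof -
 obtain M where M: "0 < M" "\<And>x. norm (pds as \<eta> x) \<le> M"
  by (rule smooth_csupp_bounded[OF smooth_csupp_partial_derivs[OF \<eta>(1)]]) (rule that)
 have "\<bar>pds as (cutoff j) x\<bar> \<le> M / real (Suc j)" for j x
 proof -
  have "pds as (cutoff j) x = (1 / real (Suc j)) ^ length as *\<^sub>R pds as \<eta> (0 + (1 / real (Suc j)) *\<^sub>R x)"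
   unfolding cutoff_def[abs_def] using \<eta>(1) by (subst partial_derivs_affine) (simp_all add: smooth_csupp_def)
  also have "\<bar>\<dots>\<bar> \<le> (1 / real (Suc j)) ^ 1 * M" unfolding real_scaleR_def abs_mult
  proof (rule mult_mono)
   have "1 \<le> length as" using assms by (cases as) auto
   then have "(1 / real (Suc j)) ^ length as \<le> (1 / real (Suc j)) ^ 1" by (rule power_decreasing) auto
   then show "\<bar>(1 / real (Suc j)) ^ length as\<bar> \<le> (1 / real (Suc j)) ^ 1" by simp
   show "\<bar>pds as \<eta> (0 + (1 / real (Suc j)) *\<^sub>R x)\<bar> \<le> M" using M(2) by simp
  qed auto
  finally show ?thesis by simp
 qed
 with M(1) show ?thesis by (rule that)
qed

lemma approx_smooth_csupp: "locint u \<Longrightarrow> smooth_csupp (approx u j)"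
proof -
 assume u: "locint u"
 obtain R where "\<And>x. norm x > R \<Longrightarrow> cutoff j x = 0" by (rule cutoff_vanish) (rule that)
 then show ?thesis unfolding smooth_csupp_def approx_def[abs_def]
  using smooth_scaleR[OF cutoff_smooth smooth_conv[OF r_smooth u]] by auto
qed

lemma approx_eq: "norm x \<le> real (Suc j) \<Longrightarrow> approx u j x = conv (r j) u x"
 by (simp add: approx_def cutoff_eq_1 del: of_nat_Suc)

lemma conv_measurable: "locint u \<Longrightarrow> conv (r j) u \<in> \<B>"
 by (intro smooth_borel_measurable smooth_conv r_smooth)

lemma cutoff_derivs_measurable: "pds as (cutoff j) \<in> \<B>"
 by (intro smooth_borel_measurable smooth_partial_derivs cutoff_smooth)

lemma tends_approx:
 fixes v :: "real^'n \<Rightarrow> 'b::euclidean_space"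
 assumes a: "0 < a" "a \<le> 1" and v: "Lb a B v"
 shows "tends_Lb a (approx v) v"
proof -
 have a': "0 \<le> a" using a by simp
 have l: "locint v" by (rule Lb_locint[OF v a' a(2)])
 have [measurable]: "conv (r j) v \<in> \<B>" "cutoff j \<in> \<B>" "v \<in> \<B>" for j
  using conv_measurable[OF l] cutoff_derivs_measurable[of "[]"] Lb_measurable[OF v] by simp_all
 \<comment> \<open>The error is split as cutoff (conv v - v) + (cutoff - 1) v: the first part is a
   mollification error, the second tends to 0 by dominated convergence.\<close>
 have "tends_Lb a (\<lambda>j x. cutoff j x *\<^sub>R (conv (r j) v x - v x)) (\<lambda>x. 0)" unfolding tends_Lb_def
 proof (intro allI impI)
  fix \<delta> :: real assume \<delta>: "0 < \<delta>"
  obtain N where N: "\<forall>j\<ge>N. Lb a \<delta> (\<lambda>x. conv (r j) v x - v x)"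
   using mollify_Lb[OF a v r \<delta>] by (elim exE)
  have "Lb a \<delta> (\<lambda>x. cutoff j x *\<^sub>R (conv (r j) v x - v x) - 0)" if "j \<ge> N" for j
   by (rule Lb_cong_norm[OF N[rule_format, OF that] _ _ a']) (use cutoff_le in \<open>simp_all add: mult_left_le_one_le\<close>)
  then show "\<exists>N. \<forall>j\<ge>N. Lb a \<delta> (\<lambda>x. cutoff j x *\<^sub>R (conv (r j) v x - v x) - 0)" by (intro exI[of _ N] allI impI)
 qed
 moreover have "tends_Lb a (\<lambda>j x. (cutoff j x - 1) *\<^sub>R v x) (\<lambda>x. 0)" unfolding tends_Lb_def
 proof (intro allI impI)
  fix \<delta> :: real assume \<delta>: "0 < \<delta>"
  have "\<exists>N. \<forall>j\<ge>N. Lb a \<delta> ((\<lambda>j x. (cutoff j x - 1) *\<^sub>R v x) j)"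
  proof (rule Lb_tendsto_0[OF a _ Lb_scaleR[OF v a', of 2] _ _ \<delta>])
   show "AE x in lborel. norm ((cutoff j x - 1) *\<^sub>R v x) \<le> norm (2 *\<^sub>R v x)" for j
   proof (rule AE_I2)
    fix x :: "real^'n" show "norm ((cutoff j x - 1) *\<^sub>R v x) \<le> norm (2 *\<^sub>R v x)"
     using cutoff_le[of j x] by (simp add: mult_right_mono)
   qed
   show "AE x in lborel. (\<lambda>j. (cutoff j x - 1) *\<^sub>R v x) \<longlonglongrightarrow> 0"
   proof (intro AE_I2 tendsto_eventually)
    fix x :: "real^'n"
    obtain N where N: "norm x \<le> real N" using real_arch_simple[of "norm x"] by (elim exE)
    have "(cutoff j x - 1) *\<^sub>R v x = 0" if "j \<ge> N" for j using cutoff_eq_1[of x j] N that by simp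
    then show "\<forall>\<^sub>F j in sequentially. (cutoff j x - 1) *\<^sub>R v x = 0"
     unfolding eventually_sequentially by (intro exI[of _ N] allI impI)
   qed
  qed measurable
  then show "\<exists>N. \<forall>j\<ge>N. Lb a \<delta> (\<lambda>x. (cutoff j x - 1) *\<^sub>R v x - 0)" by simp
 qed
 ultimately have "tends_Lb a (\<lambda>j x. cutoff j x *\<^sub>R (conv (r j) v x - v x) + (cutoff j x - 1) *\<^sub>R v x) (\<lambda>x. 0 + 0)"
  by (rule tends_Lb_add[OF a' a(2)])
 then show ?thesis unfolding tends_Lb_def approx_def by (simp add: algebra_simps)
qed

lemma tends_cutoff_derivs:
 fixes v :: "real^'n \<Rightarrow> 'b::euclidean_space"
 assumes a: "0 < a" "a \<le> 1" and v: "Lb a B v" and as: "as \<noteq> []"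
 shows "tends_Lb a (\<lambda>j x. pds as (cutoff j) x *\<^sub>R conv (r j) v x) (\<lambda>x. 0)"
 unfolding tends_Lb_def
proof (intro allI impI)
 fix \<delta> :: real assume \<delta>: "0 < \<delta>"
 have a': "0 \<le> a" using a by simp
 have l: "locint v" by (rule Lb_locint[OF v a' a(2)])
 note [measurable] = conv_measurable[OF l] cutoff_derivs_measurable
 obtain M where M: "0 < M" "\<And>j x. \<bar>pds as (cutoff j) x\<bar> \<le> M / real (Suc j)"
  by (rule cutoff_derivs_bound[OF as]) (rule that)
 have "tends_Lb a (\<lambda>j. conv (r j) v) v" unfolding tends_Lb_def using mollify_Lb[OF a v r] by (intro allI impI)
 from tends_Lb_bounded[OF a' a(2) this v zero_less_one]
 obtain N where N: "\<forall>j\<ge>N. Lb a (4 * (1 + B)) (conv (r j) v)" by (elim exE)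
 have B: "0 \<le> B" by (rule Lb_nonneg[OF v])
 obtain N' :: nat where N': "M * (4 * (1 + B)) / \<delta> \<le> real N'" using real_arch_simple[of "M * (4 * (1 + B)) / \<delta>"] by (elim exE)
 show "\<exists>N. \<forall>j\<ge>N. Lb a \<delta> (\<lambda>x. pds as (cutoff j) x *\<^sub>R conv (r j) v x - 0)"
 proof (intro exI allI impI)
  fix j assume j: "max N N' \<le> j"
  then have "Lb a (4 * (1 + B)) (conv (r j) v)" using N by simp
  from Lb_scaleR[OF this a', of "M / real (Suc j)"]
  have "Lb a (M / real (Suc j) * (4 * (1 + B))) (\<lambda>x. (M / real (Suc j)) *\<^sub>R conv (r j) v x)" using M(1) by simp
  then have "Lb a (M / real (Suc j) * (4 * (1 + B))) (\<lambda>x. pds as (cutoff j) x *\<^sub>R conv (r j) v x - 0)"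
  proof (rule Lb_cong_norm[OF _ _ _ a'])
   show "norm (pds as (cutoff j) x *\<^sub>R conv (r j) v x - 0) \<le> norm ((M / real (Suc j)) *\<^sub>R conv (r j) v x)" for x
    using M(1) mult_right_mono[OF M(2)[of j x] norm_ge_zero[of "conv (r j) v x"]] by (simp del: of_nat_Suc)
  qed measurable
  moreover have "M / real (Suc j) * (4 * (1 + B)) \<le> \<delta>"
  proof -
   have "real N' \<le> real (Suc j)" using j by simp
   then have "M * (4 * (1 + B)) / \<delta> \<le> real (Suc j)" using N' by linarith
   then show ?thesis using \<delta> by (simp add: field_simps del: of_nat_Suc)
  qed
  ultimately show "Lb a \<delta> (\<lambda>x. pds as (cutoff j) x *\<^sub>R conv (r j) v x - 0)" using a' by (rule Lb_weaken)
 qed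
qed

text \<open>Exactly one split gives all derivatives to the second factor; it is the one term of the
  Leibniz rule that survives in the limit.\<close>

lemma sum_splits_nil: "(\<Sum>s\<leftarrow>splits ks. if fst s = [] then g (snd s) else 0) = g ks" for g :: "'c list \<Rightarrow> 'b::euclidean_space"
proof (induction ks arbitrary: g)
 case (Cons k ks)
 show ?case using Cons[of "\<lambda>b. g (k # b)"] by (simp add: o_def case_prod_unfold cong: if_cong)
qed simp

text \<open>A derivative falling on the cutoff gains a factor 1/(j + 1), but leaves a lower order
  derivative of \<open>u\<close> behind. For this reason bounds on the derivatives of every order up
  to that of \<open>ks\<close> enter, although the final estimate contains only the highest.\<close>

lemma tends_approx_derivs:
 fixes u :: "real^'n \<Rightarrow> 'b::euclidean_space"
 assumes a: "0 < a" "a \<le> 1" and V: "\<And>bs. length bs \<le> length ks \<Longrightarrow> wderiv bs u (V bs)"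
  "\<And>bs. length bs \<le> length ks \<Longrightarrow> Lb a (B bs) (V bs)"
 shows "tends_Lb a (\<lambda>j. pds ks (approx u j)) (V ks)"
proof -
 have u: "locint u" using V(1)[of "[]"] by (simp add: wderiv_def)
 have le: "length (snd s) \<le> length ks" if "s \<in> set (splits ks)" for s
  using splits_length[of "fst s" "snd s" ks] that by simp
 have "pds ks (approx u j) x = (\<Sum>s\<leftarrow>splits ks. pds (fst s) (cutoff j) x *\<^sub>R conv (r j) (V (snd s)) x)" for j x
 proof -
  have "pds ks (approx u j) x = (\<Sum>s\<leftarrow>splits ks. pds (fst s) (cutoff j) x *\<^sub>R pds (snd s) (conv (r j) u) x)"
   unfolding approx_def[abs_def] by (subst partial_derivs_scaleR[OF cutoff_smooth smooth_conv[OF r_smooth u]]) simp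
  also have "\<dots> = (\<Sum>s\<leftarrow>splits ks. pds (fst s) (cutoff j) x *\<^sub>R conv (r j) (V (snd s)) x)"
   by (intro arg_cong[of _ _ sum_list] map_cong refl) (simp only: conv_wderiv[OF V(1)[OF le] r_smooth])
  finally show ?thesis .
 qed
 moreover have "tends_Lb a (\<lambda>j x. \<Sum>s\<leftarrow>splits ks. pds (fst s) (cutoff j) x *\<^sub>R conv (r j) (V (snd s)) x)
  (\<lambda>x. \<Sum>s\<leftarrow>splits ks. if fst s = [] then V (snd s) x else 0)"
 proof (rule tends_Lb_sum_list)
  fix s assume s: "s \<in> set (splits ks)"
  show "tends_Lb a (\<lambda>j x. pds (fst s) (cutoff j) x *\<^sub>R conv (r j) (V (snd s)) x) (\<lambda>x. if fst s = [] then V (snd s) x else 0)"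
  proof (cases "fst s = []")
   case True
   then show ?thesis using tends_approx[OF a V(2)[OF le[OF s]]] by (simp add: approx_def[abs_def])
  next
   case False
   then show ?thesis using tends_cutoff_derivs[OF a V(2)[OF le[OF s]] False] by simp
  qed
 qed (use a in auto)
 ultimately show ?thesis by (simp add: tends_Lb_def sum_splits_nil[of "\<lambda>bs. V bs x" ks for x])
qed

end

section \<open>Distributional solutions\<close>

lemma smooth_csupp_diff:
 assumes f: "smooth_csupp f" and g: "smooth_csupp g"
 shows "smooth_csupp (\<lambda>x. f x - g x)"
  "pds js (\<lambda>x. f x - g x) = (\<lambda>x. pds js f x - pds js g x)"
proof -
 have s: "smooth_on UNIV f" "smooth_on UNIV g" using f g by (simp_all add: smooth_csupp_def)
 have d: "pds js f differentiable (at x)" "pds js g differentiable (at x)" for js x using s by (auto simp: smooth_on_def)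
 show eq: "pds js (\<lambda>x. f x - g x) = (\<lambda>x. pds js f x - pds js g x)" for js
 proof (induction js)
  case (Cons j js)
  have "((\<lambda>x. pds js f x - pds js g x) has_derivative
    (\<lambda>h. (\<Sum>j\<in>UNIV. (h $ j) *\<^sub>R pd j (pds js f) x) - (\<Sum>j\<in>UNIV. (h $ j) *\<^sub>R pd j (pds js g) x))) (at x)" for x
   by (intro has_derivative_diff has_derivative_partial_deriv d)
  from partial_deriv_eqI[OF this, of j] show ?case by (simp add: Cons axis_def if_distrib if_distribR fun_eq_iff cong: if_cong)
 qed simp
 obtain R R' where R: "\<And>x. norm x > R \<Longrightarrow> f x = 0" "\<And>x. norm x > R' \<Longrightarrow> g x = 0"
  using f g unfolding smooth_csupp_def by auto
 have "\<exists>R. \<forall>x. norm x > R \<longrightarrow> f x - g x = 0" by (rule exI[of _ "max R R'"]) (use R in simp)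
 then show "smooth_csupp (\<lambda>x. f x - g x)"
  unfolding smooth_csupp_def smooth_on_def eq using d by (auto intro!: differentiable_diff)
qed

lemma finite_uniform_bound:
 assumes "finite J" "\<And>k. k \<in> J \<Longrightarrow> \<exists>N::nat. \<forall>j\<ge>N. P k j"
 shows "\<exists>N. \<forall>j\<ge>N. \<forall>k\<in>J. P k j"
proof -
 have "\<forall>\<^sub>F j in sequentially. \<forall>k\<in>J. P k j"
  by (rule eventually_ball_finite[OF assms(1)]) (use assms(2) in \<open>simp add: eventually_sequentially\<close>)
 then show ?thesis by (simp add: eventually_sequentially)
qed

lemma finite_uniform_Cauchy:
 assumes "finite J" "\<And>k. k \<in> J \<Longrightarrow> \<exists>N::nat. \<forall>i\<ge>N. \<forall>j\<ge>N. P k i j"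
 shows "\<exists>N. \<forall>i\<ge>N. \<forall>j\<ge>N. \<forall>k\<in>J. P k i j"
proof -
 have "\<exists>N. \<forall>n\<ge>N. \<forall>k\<in>J. \<forall>i\<ge>n. \<forall>j\<ge>n. P k i j"
 proof (rule finite_uniform_bound[OF assms(1)])
  fix k assume "k \<in> J"
  then obtain N where "\<forall>i\<ge>N. \<forall>j\<ge>N. P k i j" using assms(2) by blast
  then show "\<exists>N. \<forall>n\<ge>N. \<forall>i\<ge>n. \<forall>j\<ge>n. P k i j" by (intro exI[of _ N]) auto
 qed
 then show ?thesis by blast
qed

abbreviation weak_rhs :: "('n::finite \<Rightarrow> real^'m^'m) \<Rightarrow> real^'m^'m \<Rightarrow> (real^'n \<Rightarrow> real) \<Rightarrow> (real^'n \<Rightarrow> real^'m) \<Rightarrow> real^'n \<Rightarrow> real^'m" where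
 "weak_rhs A L \<phi> v x \<equiv> (\<Sum>j\<in>UNIV. pd j \<phi> x *\<^sub>R (A j *v v x)) - \<phi> x *\<^sub>R (L *v v x)"

definition borel_solution :: "real^'m^'m \<Rightarrow> ('n::finite \<Rightarrow> real^'m^'m) \<Rightarrow> real^'m^'m \<Rightarrow> (real^'n \<Rightarrow> real^'m) \<Rightarrow> (real \<Rightarrow> real^'n \<Rightarrow> real^'m) \<Rightarrow> bool" where
 "borel_solution A0 A L u0 u \<longleftrightarrow> locint u0 \<and> (\<forall>t\<ge>0. locint (u t)) \<and> (AE x in lborel. u 0 x = u0 x) \<and>
  (\<forall>R. \<forall>t\<ge>0. ((\<lambda>s. LBINT x. ball_ind R x * norm (u s x - u t x)) \<longlongrightarrow> 0) (at t within {0..})) \<and>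
  (\<forall>\<phi>. smooth_csupp \<phi> \<longrightarrow> (\<forall>t>0. ((\<lambda>s. LBINT x. \<phi> x *\<^sub>R (A0 *v u s x)) has_vector_derivative
   (LBINT x. weak_rhs A L \<phi> (u t) x)) (at t)))"

lemma borel_solution_D:
 assumes "borel_solution A0 A L u0 u"
 shows "locint u0" "0 \<le> t \<Longrightarrow> locint (u t)" "AE x in lborel. u 0 x = u0 x"
  "0 \<le> t \<Longrightarrow> ((\<lambda>s. LBINT x. ball_ind R x * norm (u s x - u t x)) \<longlongrightarrow> 0) (at t within {0..})"
  "smooth_csupp \<phi> \<Longrightarrow> 0 < t \<Longrightarrow> ((\<lambda>s. LBINT x. \<phi> x *\<^sub>R (A0 *v u s x)) has_vector_derivative
   (LBINT x. weak_rhs A L \<phi> (u t) x)) (at t)" using assms by (simp_all add: borel_solution_def)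

text \<open>The local L^1 norm is continuous in time, hence bounded on a compact interval. This
  produces the bounds up to time 0 that \<open>finite_speed\<close> requires of the mollified
  solution.\<close>

lemma borel_solution_bounded:
 assumes u: "borel_solution A0 A L u0 u"
 obtains U where "0 \<le> U" "\<And>t. 0 \<le> t \<Longrightarrow> t \<le> T \<Longrightarrow> (LBINT x. ball_ind R x * norm (u t x)) \<le> U"
proof -
 define N where "N t = (LBINT x. ball_ind R x * norm (u t x))" for t
 have "continuous_on {0..T} N" unfolding continuous_on_def
 proof
  fix t assume t: "t \<in> {0..T}"
  then have t0: "0 \<le> t" by simp
  have "((\<lambda>s. N s - N t) \<longlongrightarrow> 0) (at t within {0..})"
  proof (rule Lim_null_comparison[OF _ borel_solution_D(4)[OF u t0, of R]])
   show "\<forall>\<^sub>F s in at t within {0..}. norm (N s - N t) \<le> (LBINT x. ball_ind R x * norm (u s x - u t x))"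
    unfolding eventually_at_filter
   proof (intro always_eventually allI impI)
    fix s :: real assume "s \<in> {0..}"
    then have s: "0 \<le> s" by simp
    note i = locint_norm_integrable[OF borel_solution_D(2)[OF u s], of R] locint_norm_integrable[OF borel_solution_D(2)[OF u t0], of R]
    have "N s - N t = (LBINT x. ball_ind R x * norm (u s x) - ball_ind R x * norm (u t x))" unfolding N_def using i by simp
    also have "norm \<dots> \<le> (LBINT x. norm (ball_ind R x * norm (u s x) - ball_ind R x * norm (u t x)))"
     by (rule integral_norm_bound)
    also have "\<dots> \<le> (LBINT x. ball_ind R x * norm (u s x - u t x))"
    proof (intro integral_mono integrable_norm Bochner_Integration.integrable_diff i locint_norm_integrable locint_diff borel_solution_D(2)[OF u] s t0)
     fix x
     show "norm (ball_ind R x * norm (u s x) - ball_ind R x * norm (u t x)) \<le> ball_ind R x * norm (u s x - u t x)"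
      using norm_triangle_ineq3[of "u s x" "u t x"] by (simp add: indicator_def)
    qed
    finally show "norm (N s - N t) \<le> (LBINT x. ball_ind R x * norm (u s x - u t x))" .
   qed
  qed
  then have "(N \<longlongrightarrow> N t) (at t within {0..})" by (simp add: LIM_zero_iff)
  then show "(N \<longlongrightarrow> N t) (at t within {0..T})" by (rule tendsto_within_subset) auto
 qed
 then have "compact (N ` {0..T})" by (intro compact_continuous_image compact_Icc)
 from compact_imp_bounded[OF this] obtain U where U: "\<forall>y\<in>N ` {0..T}. norm y \<le> U" unfolding bounded_iff by (elim exE)
 show ?thesis
 proof (rule that[of "\<bar>U\<bar>"])
  fix t assume "0 \<le> t" "t \<le> T"
  then have "norm (N t) \<le> U" using U by simp
  then show "(LBINT x. ball_ind R x * norm (u t x)) \<le> \<bar>U\<bar>" by (simp add: N_def)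
 qed simp
qed

lemma matrix_conv:
 fixes X :: "real^'m^'m"
 assumes "smooth_csupp r" "locint f"
 shows "(LBINT y. r (x - y) *\<^sub>R (X *v f y)) = X *v conv r f x" "L1 (\<lambda>y. r (x - y) *\<^sub>R (X *v f y))"
 using integral_bounded_linear[OF matrix_vector_mul_bounded_linear[of X] conv_integrable[OF assms, of x]]
  integrable_bounded_linear[OF matrix_vector_mul_bounded_linear[of X] conv_integrable[OF assms, of x]]
 by (simp_all add: conv_def matrix_vector_mult_scaleR)

text \<open>With the test function y \<mapsto> r(x - y), the weak equation becomes a differential
  equation in time at each point x. Mollification in space alone therefore already gives a classical
  solution.\<close>

lemma conv_time_derivative:
 fixes A0 B L :: "real^'m^'m" and A :: "'n::finite \<Rightarrow> real^'m^'m"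
 assumes u: "borel_solution A0 A L u0 u" and r: "smooth_csupp r" and B: "B ** A0 = mat 1" and t: "0 < t"
 shows "((\<lambda>s. conv r (u s) x) has_vector_derivative
  B *v (- (\<Sum>j\<in>UNIV. A j *v conv (pd j r) (u t) x) - L *v conv r (u t) x)) (at t)"
proof -
 have ut: "locint (u t)" using borel_solution_D(2)[OF u] t by simp
 have rj: "smooth_csupp (pd j r)" for j by (rule smooth_csupp_partial_deriv[OF r])
 have pd: "pd j (\<lambda>y. r (x - y)) y = - pd j r (x - y)" for j y using smooth_csupp_reflect(2)[OF r, of "[j]" x y] by simp
 have "(LBINT y. (\<Sum>j\<in>UNIV. pd j (\<lambda>y. r (x - y)) y *\<^sub>R (A j *v u t y)) - r (x - y) *\<^sub>R (L *v u t y))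
  = - (\<Sum>j\<in>UNIV. A j *v conv (pd j r) (u t) x) - L *v conv r (u t) x"
  unfolding pd using matrix_conv[OF rj ut] matrix_conv[OF r ut] by (simp add: sum_negf)
 then have "((\<lambda>s. LBINT y. r (x - y) *\<^sub>R (A0 *v u s y)) has_vector_derivative
   - (\<Sum>j\<in>UNIV. A j *v conv (pd j r) (u t) x) - L *v conv r (u t) x) (at t)"
  using borel_solution_D(5)[OF u smooth_csupp_reflect(1)[OF r] t, of x] by simp
 from bounded_linear.has_vector_derivative[OF matrix_vector_mul_bounded_linear[of B] this]
 show ?thesis
 proof (rule has_vector_derivative_transform_within_open[where S = "{0<..}"])
  fix s :: real assume "s \<in> {0<..}"
  then have "locint (u s)" using borel_solution_D(2)[OF u] by simp
  then show "B *v (LBINT y. r (x - y) *\<^sub>R (A0 *v u s y)) = conv r (u s) x"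
   by (simp add: matrix_conv[OF r] matrix_vector_mul_assoc B)
 qed (use t in auto)
qed

lemma conv_initial:
 assumes u: "borel_solution A0 A L u0 u" and r: "smooth_csupp r"
 shows "conv r (u 0) = conv r u0" "((\<lambda>t. conv r (u t) x) \<longlongrightarrow> conv r u0 x) (at_right 0)"
proof -
 have l: "locint (u 0)" "locint u0" using borel_solution_D(1,2)[OF u] by auto
 show eq: "conv r (u 0) = conv r u0" by (intro ext conv_cong_AE[OF r l borel_solution_D(3)[OF u]])
 obtain M where M: "0 < M" "\<And>x. norm (r x) \<le> M" by (rule smooth_csupp_bounded[OF r]) (rule that)
 obtain S where S: "\<And>x. norm x > S \<Longrightarrow> r x = 0" using r unfolding smooth_csupp_def by auto
 have "((\<lambda>t. conv r (u t) x - conv r (u 0) x) \<longlongrightarrow> 0) (at 0 within {0..})"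
 proof (rule Lim_null_comparison)
  show "((\<lambda>s. M * (LBINT y. ball_ind (norm x + S) y * norm (u s y - u 0 y))) \<longlongrightarrow> 0) (at 0 within {0..})"
   using tendsto_mult_left[OF borel_solution_D(4)[OF u order_refl, of "norm x + S"], of M] by simp
  show "\<forall>\<^sub>F s in at 0 within {0..}. norm (conv r (u s) x - conv r (u 0) x) \<le> M * (LBINT y. ball_ind (norm x + S) y * norm (u s y - u 0 y))"
   unfolding eventually_at_filter
  proof (intro always_eventually allI impI)
   fix s :: real assume "s \<in> {0..}"
   then have s: "locint (u s)" using borel_solution_D(2)[OF u] by simp
   show "norm (conv r (u s) x - conv r (u 0) x) \<le> M * (LBINT y. ball_ind (norm x + S) y * norm (u s y - u 0 y))"
    unfolding conv_diff[OF r s l(1), symmetric] using M(2) by (intro conv_norm_le[OF r _ S] locint_diff s l(1)) auto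
  qed
 qed
 then have "((\<lambda>t. conv r (u t) x) \<longlongrightarrow> conv r u0 x) (at 0 within {0..})" by (simp add: LIM_zero_iff eq)
 then show "((\<lambda>t. conv r (u t) x) \<longlongrightarrow> conv r u0 x) (at_right 0)" by (rule tendsto_within_subset) auto
qed

lemma conv_solution_bounded:
 fixes A0 L :: "real^'m^'m" and A :: "'n::finite \<Rightarrow> real^'m^'m"
 assumes u: "borel_solution A0 A L u0 u" and r: "smooth_csupp r"
 obtains M where "\<And>t x. 0 \<le> t \<Longrightarrow> t \<le> T \<Longrightarrow> norm x \<le> R \<Longrightarrow> norm (conv r (u t) x) \<le> M"
proof -
 obtain M where M: "0 < M" "\<And>x. norm (r x) \<le> M" by (rule smooth_csupp_bounded[OF r]) (rule that)
 obtain S where S: "\<And>x. norm x > S \<Longrightarrow> r x = 0" using r unfolding smooth_csupp_def by auto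
 obtain U where U: "0 \<le> U" "\<And>t. 0 \<le> t \<Longrightarrow> t \<le> T \<Longrightarrow> (LBINT x. ball_ind (R + S) x * norm (u t x)) \<le> U"
  by (rule borel_solution_bounded[OF u]) (rule that)
 show ?thesis
 proof (rule that[of "M * U"])
  fix t :: real and x :: "real^'n" assume t: "0 \<le> t" "t \<le> T" and x: "norm x \<le> R"
  have "norm (conv r (u t) x) \<le> M * (LBINT y. ball_ind (R + S) y * norm (u t y))"
   using M(2) by (intro conv_norm_le[OF r _ S] borel_solution_D(2)[OF u] t x) auto
  also have "\<dots> \<le> M * U" using M U t by (intro mult_left_mono) auto
  finally show "norm (conv r (u t) x) \<le> M * U" .
 qed
qed

lemma matrix_norm_bound:
 fixes X :: "real^'m^'m"
 obtains K where "0 < K" "\<And>v. norm (X *v v) \<le> K * norm v"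
 using bounded_linear.pos_bounded[OF matrix_vector_mul_bounded_linear[of X]] by (auto simp: mult.commute)

context propagation
begin

text \<open>The difference between the Fourier solution with data \<open>f\<close> and the mollified
  solution solves the system classically and vanishes initially on the ball of radius R, hence also
  on its domain of dependence. Time 0 is separate because \<open>finite_speed\<close> concerns
  positive times.\<close>

lemma dsol_eq_conv:
 assumes A: "condition_A A0 A L" and BA0: "B ** A0 = mat 1" "A0 ** B = mat 1"
  and sp: "0 < sp" "\<And>(e :: real^'n) v. norm e \<le> 1 \<Longrightarrow> (\<Sum>j\<in>UNIV. e $ j * ((A j *v v) \<bullet> v)) \<le> sp * ((A0 *v v) \<bullet> v)"
  and u: "borel_solution A0 A L u0 u" and r: "smooth_csupp r" and f: "smooth_csupp f"
  and eq: "\<And>x. norm x \<le> R \<Longrightarrow> f x = conv r u0 x" and t: "0 \<le> t"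
 shows "AE x in lborel. sqrt (1 + (norm x)^2) + sp * t < R \<longrightarrow> dsol [] t f x = conv r (u t) x"
proof (cases "t = 0")
 case True
 have "dsol [] t f x = conv r (u t) x" if "sqrt (1 + (norm x)^2) + sp * t < R" for x
 proof -
  have "norm x \<le> sqrt (1 + (norm x)^2)" by (rule real_le_rsqrt) simp
  then have "norm x \<le> R" using that True by simp
  then show ?thesis using True eq by (simp add: dsol_0[OF f] conv_initial(1)[OF u r])
 qed
 then show ?thesis by simp
next
 case False
 then have t0: "0 < t" using t by simp
 \<comment> \<open>Any time horizon beyond t would do; it only has to be finite for the
   bounds.\<close>
 define T where "T = t + 1"
 have ul: "locint (u s)" if "0 < s" for s using borel_solution_D(2)[OF u] that by simp
 have rj: "smooth_csupp (pd j r)" for j by (rule smooth_csupp_partial_deriv[OF r])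
 define ct where "ct s x = - (\<Sum>j\<in>UNIV. A j *v conv (pd j r) (u s) x) - L *v conv r (u s) x" for s x
 define d where "d s x = dsol [] s f x - conv r (u s) x" for s x
 define dt where "dt s x = tsol s f x - B *v ct s x" for s x
 define dx where "dx j s x = dsol [j] s f x - conv (pd j r) (u s) x" for j s x
 have cm: "conv r' (u s) \<in> \<B>" if "0 < s" "smooth_csupp r'" for s and r' :: "real^'n \<Rightarrow> real"
  by (intro smooth_borel_measurable smooth_conv that ul)
 have mm: "(\<lambda>x. X *v g x) \<in> \<B>" if "g \<in> \<B>" for X :: "real^'m^'m" and g :: "real^'n \<Rightarrow> real^'m"
  using that by (rule measurable_compose) (intro borel_measurable_continuous_onI linear_continuous_on matrix_vector_mul_bounded_linear)
 obtain Mc where Mc: "\<And>s x. 0 \<le> s \<Longrightarrow> s \<le> T \<Longrightarrow> norm x \<le> R \<Longrightarrow> norm (conv r (u s) x) \<le> Mc"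
  by (rule conv_solution_bounded[OF u r]) (rule that)
 have "\<exists>M. \<forall>s x. 0 \<le> s \<longrightarrow> s \<le> T \<longrightarrow> norm x \<le> R \<longrightarrow> norm (conv (pd j r) (u s) x) \<le> M" for j
  by (rule conv_solution_bounded[OF u rj, where T = T and R = R]) (intro exI allI impI)
 then obtain Mj where Mj: "\<And>j s x. 0 \<le> s \<Longrightarrow> s \<le> T \<Longrightarrow> norm x \<le> R \<Longrightarrow> norm (conv (pd j r) (u s) x) \<le> Mj j" by metis
 obtain Md where Md: "\<And>s x. 0 \<le> s \<Longrightarrow> norm (dsol [] s f x) \<le> Md" by (rule dsol_bounded[OF f]) (rule that)
 have "\<exists>M. \<forall>s x. 0 \<le> s \<longrightarrow> norm (dsol [j] s f x) \<le> M" for j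
  by (rule dsol_bounded[OF f, of "[j]"]) (intro exI allI impI)
 then obtain Mdj where Mdj: "\<And>j s x. 0 \<le> s \<Longrightarrow> norm (dsol [j] s f x) \<le> Mdj j" by metis
 obtain Mt where Mt: "\<And>s x. 0 \<le> s \<Longrightarrow> norm (tsol s f x) \<le> Mt" by (rule tsol_bounded[OF f]) (rule that)
 have "\<exists>K>0. \<forall>v. norm (X *v v) \<le> K * norm v" for X :: "real^'m^'m" by (rule matrix_norm_bound[of X]) auto
 then obtain K where K: "\<And>X. 0 < K X" "\<And>(X :: real^'m^'m) v. norm (X *v v) \<le> K X * norm v" by metis
 define Bt where "Bt = Mt + K B * ((\<Sum>j\<in>UNIV. K (A j) * Mj j) + K L * Mc)"
 define Bx where "Bx = (\<Sum>j\<in>UNIV. \<bar>Mdj j + Mj j\<bar>)"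
 define BB where "BB = \<bar>Md + Mc\<bar> + \<bar>Bt\<bar> + Bx"
 have Bx: "\<bar>Mdj j + Mj j\<bar> \<le> Bx" for j unfolding Bx_def by (rule member_le_sum) auto
 have BB: "Md + Mc \<le> BB" "Bt \<le> BB" "Mdj j + Mj j \<le> BB" "0 \<le> BB" for j using Bx[of j] by (auto simp: BB_def)
 have "AE x in lborel. sqrt (1 + (norm x)^2) + sp * t < R \<longrightarrow> d t x = 0"
 proof (rule finite_speed[OF A sp, where dt = dt and dx = dx and T = T and B = BB])
  show "((\<lambda>s. d s x) has_vector_derivative dt s x) (at s)" if "0 < s" for s x unfolding d_def dt_def ct_def
   by (intro has_vector_derivative_diff dsol_time_derivative[OF f that] conv_time_derivative[OF u r BA0(1) that])
  show "((\<lambda>h. d s (x + h *\<^sub>R axis j 1)) has_vector_derivative dx j s x) (at 0)" if s: "0 < s" for s x j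
  proof -
   have "((\<lambda>h. conv r (u s) (x + h *\<^sub>R axis j 1)) has_vector_derivative conv (pd j r) (u s) x) (at 0)"
    using has_vector_derivative_partial_deriv[OF smooth_differentiable[OF smooth_conv[OF r ul[OF s]]], of x j]
    by (simp add: partial_deriv_conv[OF r ul[OF s]])
   then show ?thesis unfolding d_def dx_def by (intro has_vector_derivative_diff dsol_space_derivative f) (use s in auto)
  qed
  show "A0 *v dt s x + (\<Sum>j\<in>UNIV. A j *v dx j s x) + L *v d s x = 0" if "0 < s" for s x
  proof -
   have "A0 *v (B *v ct s x) = ct s x" by (simp add: matrix_vector_mul_assoc BA0)
   then have "A0 *v dt s x + (\<Sum>j\<in>UNIV. A j *v dx j s x) + L *v d s x =
     (A0 *v tsol s f x + (\<Sum>j\<in>UNIV. A j *v dsol [j] s f x) + L *v dsol [] s f x) - (ct s x + (\<Sum>j\<in>UNIV. A j *v conv (pd j r) (u s) x) + L *v conv r (u s) x)"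
    by (simp add: dt_def dx_def d_def matrix_vector_mult_diff_distrib sum_subtractf)
   also have "\<dots> = 0" using dsol_pde[OF f, of s x] that by (simp add: ct_def)
   finally show ?thesis .
  qed
  show "d s \<in> \<B>" if "0 < s" for s unfolding d_def[abs_def] by (intro borel_measurable_diff dsol_measurable f cm that r)
  show "dt s \<in> \<B>" if "0 < s" for s unfolding dt_def[abs_def] ct_def
   by (intro borel_measurable_diff borel_measurable_uminus borel_measurable_sum mm tsol_measurable f cm that r rj)
  show "dx j s \<in> \<B>" if "0 < s" for s j
   unfolding dx_def[abs_def] by (intro borel_measurable_diff dsol_measurable f cm that rj)
  show "norm (d s x) \<le> BB" if "0 < s" "s < T" "norm x \<le> R" for s x
   unfolding d_def using that BB(1) Md[of s x] Mc[of s x] by (intro order_trans[OF norm_triangle_ineq4]) auto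
  show "norm (dx j s x) \<le> BB" if "0 < s" "s < T" "norm x \<le> R" for s x j
   unfolding dx_def using that BB(3)[of j] Mdj[of s j x] Mj[of s x j] by (intro order_trans[OF norm_triangle_ineq4]) auto
  show "norm (dt s x) \<le> BB" if s: "0 < s" "s < T" and x: "norm x \<le> R" for s x
  proof -
   have s': "0 \<le> s" "s \<le> T" using s by auto
   have "norm (ct s x) \<le> norm (\<Sum>j\<in>UNIV. A j *v conv (pd j r) (u s) x) + norm (L *v conv r (u s) x)"
    unfolding ct_def by (rule order_trans[OF norm_triangle_ineq4]) simp
   also have "\<dots> \<le> (\<Sum>j\<in>UNIV. K (A j) * Mj j) + K L * Mc"
   proof (rule add_mono)
    show "norm (\<Sum>j\<in>UNIV. A j *v conv (pd j r) (u s) x) \<le> (\<Sum>j\<in>UNIV. K (A j) * Mj j)"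
    proof (rule order_trans[OF norm_sum sum_mono])
     show "norm (A j *v conv (pd j r) (u s) x) \<le> K (A j) * Mj j" for j
      using mult_left_mono[OF Mj[OF s' x, of j], of "K (A j)"] K(1)[of "A j"] by (intro order_trans[OF K(2)]) simp
    qed
    show "norm (L *v conv r (u s) x) \<le> K L * Mc"
     using mult_left_mono[OF Mc[OF s' x], of "K L"] K(1)[of L] by (intro order_trans[OF K(2)]) simp
   qed
   finally have "norm (B *v ct s x) \<le> K B * ((\<Sum>j\<in>UNIV. K (A j) * Mj j) + K L * Mc)"
    using K(1)[of B] by (intro order_trans[OF K(2)] mult_left_mono) auto
   then have "norm (dt s x) \<le> Bt"
    unfolding dt_def Bt_def using Mt[OF s'(1), of x] by (intro order_trans[OF norm_triangle_ineq4] add_mono)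
   then show ?thesis using BB(2) by simp
  qed
  show "((\<lambda>s. d s x) \<longlongrightarrow> 0) (at_right 0)" if x: "norm x \<le> R" for x
  proof -
   obtain M where M: "\<And>s t x. 0 \<le> s \<Longrightarrow> 0 \<le> t \<Longrightarrow> norm (dsol [] t f x - dsol [] s f x) \<le> M * \<bar>t - s\<bar>"
    by (rule dsol_lipschitz[OF f]) (rule that)
   have "((\<lambda>s. dsol [] s f x - f x) \<longlongrightarrow> 0) (at_right 0)"
   proof (rule Lim_null_comparison)
    show "\<forall>\<^sub>F s in at_right 0. norm (dsol [] s f x - f x) \<le> M * \<bar>s\<bar>" unfolding eventually_at_filter
     using M[of 0 _ x] dsol_0[OF f] by (intro always_eventually) auto
    show "((\<lambda>s. M * \<bar>s\<bar>) \<longlongrightarrow> 0) (at_right 0)" by (auto intro!: tendsto_eq_intros)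
   qed
   then have "((\<lambda>s. dsol [] s f x) \<longlongrightarrow> f x) (at_right 0)" by (simp add: LIM_zero_iff)
   from tendsto_diff[OF this conv_initial(2)[OF u r, of x]] show ?thesis by (simp add: d_def eq[OF x])
  qed
 qed (use t0 T_def BB in auto)
 then show ?thesis by (simp add: d_def)
qed

text \<open>K(4) is the smooth estimate at fixed time and order. Applied to differences of
  approximate data it shows that the derivatives of the approximate solutions are Cauchy in L^p,
  which works for p = \<infinity> as well. Finite speed identifies the limit \<open>g\<close> as a
  weak derivative of the given solution. Since \<open>g\<close> does not depend on \<delta>, the
  positive \<delta> demanded by the smooth estimate can be removed afterwards.\<close>

lemma solution_decay:
 assumes A: "condition_A A0 A L" and u: "borel_solution A0 A L u0 u"
  and aq: "0 < aq" "aq \<le> 1" and ar: "0 < ar" "ar \<le> 1" and ap: "0 \<le> ap" "ap \<le> 1"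
  and u0: "Lb aq Bq u0"
  and V: "\<And>bs. length bs \<le> k + ell \<Longrightarrow> wderiv bs u0 (V bs) \<and> (\<exists>B. Lb ar B (V bs))"
  and Vr: "\<And>bs. length bs = k + ell \<Longrightarrow> Lb ar Br (V bs)"
  and K: "0 < K" "0 < Rl" "0 < Rh" "\<And>f Bq Br. smooth_csupp f \<Longrightarrow> 0 < Bq \<Longrightarrow> 0 < Br \<Longrightarrow> Lb aq Bq f \<Longrightarrow>
   \<forall>ks. length ks = k + ell \<longrightarrow> Lb ar Br (pds ks f) \<Longrightarrow> Lb ap (K * (Rl * Bq + Rh * Br)) (dsol js t f)"
  and t: "0 \<le> t"
 shows "\<exists>g. wderiv js (u t) g \<and> (\<forall>\<delta>>0. Lb ap (K * (Rl * (4 * (\<delta> + Bq)) + Rh * (4 * (\<delta> + Br)))) g)"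
proof -
 obtain r :: "nat \<Rightarrow> real^'n \<Rightarrow> real" where r: "\<And>j. mollifier (r j) (1 / real (Suc j))"
  by (rule mollifier_sequence_exists) (rule that)
 obtain \<eta> :: "real^'n \<Rightarrow> real" where \<eta>: "smooth_csupp \<eta>" "\<And>x. \<bar>\<eta> x\<bar> \<le> 1" "\<And>x. norm x \<le> 1 \<Longrightarrow> \<eta> x = 1"
  by (rule cutoff_exists) (rule that)
 interpret approximation r \<eta> by unfold_locales (use r \<eta> in auto)
 have l: "locint u0" by (rule borel_solution_D(1)[OF u])
 have ut: "locint (u t)" by (rule borel_solution_D(2)[OF u t])
 define f where "f = approx u0"
 have f: "smooth_csupp (f j)" for j unfolding f_def by (rule approx_smooth_csupp[OF l])
 have aq0: "0 \<le> aq" and ar0: "0 \<le> ar" using aq ar by auto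
 define J where "J = {ks :: 'n list. length ks = k + ell}"
 have J: "finite J" unfolding J_def by (rule finite_lists)
 have tq: "tends_Lb aq f u0" unfolding f_def by (rule tends_approx[OF aq u0])
 obtain BV where BV: "\<And>bs. length bs \<le> k + ell \<Longrightarrow> Lb ar (BV bs) (V bs)" using V by metis
 have tr: "tends_Lb ar (\<lambda>j. pds ks (f j)) (V ks)" if "ks \<in> J" for ks
  unfolding f_def using that V BV by (intro tends_approx_derivs[OF ar, where B = BV]) (auto simp: J_def)
 have Bqr: "0 \<le> Bq" "0 \<le> Br" using Lb_nonneg[OF u0] Lb_nonneg[OF Vr] Ex_list_of_length[of "k + ell"] by auto
 define bound where "bound \<delta> = K * (Rl * (4 * (\<delta> + Bq)) + Rh * (4 * (\<delta> + Br)))" for \<delta>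
 have ev: "\<exists>N. \<forall>j\<ge>N. Lb ap (bound \<delta>) (dsol js t (f j))" if \<delta>: "0 < \<delta>" for \<delta>
 proof -
  obtain N1 where N1: "\<forall>j\<ge>N1. Lb aq (4 * (\<delta> + Bq)) (f j)"
   using tends_Lb_bounded[OF aq0 aq(2) tq u0 \<delta>] by (elim exE)
  have "\<exists>N. \<forall>j\<ge>N. \<forall>ks\<in>J. Lb ar (4 * (\<delta> + Br)) (pds ks (f j))"
   by (rule finite_uniform_bound[OF J]) (rule tends_Lb_bounded[OF ar0 ar(2) tr Vr \<delta>], auto simp: J_def)
  then obtain N2 where N2: "\<forall>j\<ge>N2. \<forall>ks\<in>J. Lb ar (4 * (\<delta> + Br)) (pds ks (f j))" by (elim exE)
  have "Lb ap (bound \<delta>) (dsol js t (f j))" if "max N1 N2 \<le> j" for j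
   unfolding bound_def using that N1 N2 \<delta> Bqr by (intro K(4) f) (auto simp: J_def)
  then show ?thesis by (intro exI[of _ "max N1 N2"] allI impI)
 qed
 have cauchy: "\<exists>N. \<forall>i\<ge>N. \<forall>j\<ge>N. Lb ap \<epsilon> (\<lambda>x. dsol js t (f i) x - dsol js t (f j) x)" if \<epsilon>: "0 < \<epsilon>" for \<epsilon>
 proof -
  \<comment> \<open>The accuracy of the data for which the smooth estimate, with both bounds equal
    to \<delta>, returns \<epsilon>.\<close>
  define \<delta> where "\<delta> = \<epsilon> / (K * (Rl + Rh))"
  have \<delta>: "0 < \<delta>" "K * (Rl * \<delta> + Rh * \<delta>) = \<epsilon>"
  proof -
   have nz: "0 < K * (Rl + Rh)" using K(1-3) by simp
   show "0 < \<delta>" unfolding \<delta>_def using nz \<epsilon> by (rule divide_pos_pos[rotated])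
   have "K * (Rl * \<delta> + Rh * \<delta>) = K * (Rl + Rh) * \<delta>" by (simp add: algebra_simps)
   also have "\<dots> = \<epsilon>" unfolding \<delta>_def by (simp only: times_divide_eq_right nonzero_mult_div_cancel_left[OF less_imp_neq[OF nz, symmetric]])
   finally show "K * (Rl * \<delta> + Rh * \<delta>) = \<epsilon>" .
  qed
  obtain N1 where N1: "\<forall>i\<ge>N1. \<forall>j\<ge>N1. Lb aq \<delta> (\<lambda>x. f i x - f j x)"
   using tends_Lb_Cauchy[OF aq0 aq(2) tq \<delta>(1)] by (elim exE)
  have "\<exists>N. \<forall>i\<ge>N. \<forall>j\<ge>N. \<forall>ks\<in>J. Lb ar \<delta> (\<lambda>x. pds ks (f i) x - pds ks (f j) x)"
   by (rule finite_uniform_Cauchy[OF J]) (rule tends_Lb_Cauchy[OF ar0 ar(2) tr \<delta>(1)])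
  then obtain N2 where N2: "\<forall>i\<ge>N2. \<forall>j\<ge>N2. \<forall>ks\<in>J. Lb ar \<delta> (\<lambda>x. pds ks (f i) x - pds ks (f j) x)" by (elim exE)
  have "Lb ap \<epsilon> (\<lambda>x. dsol js t (f i) x - dsol js t (f j) x)" if "max N1 N2 \<le> i" "max N1 N2 \<le> j" for i j
  proof -
   have "Lb ap (K * (Rl * \<delta> + Rh * \<delta>)) (dsol js t (\<lambda>x. f i x - f j x))"
    using that N1 N2 by (intro K(4) \<delta>(1) smooth_csupp_diff f) (auto simp: smooth_csupp_diff[OF f f] J_def)
   moreover have "dsol js t (\<lambda>x. f i x - f j x) = (\<lambda>x. dsol js t (f i) x - dsol js t (f j) x)"
    by (rule ext) (rule dsol_diff[OF f f t])
   ultimately show ?thesis by (simp add: \<delta>(2))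
  qed
  then show ?thesis by (intro exI[of _ "max N1 N2"] allI impI)
 qed
 \<comment> \<open>\<open>Lb_complete\<close> wants a bound on the whole sequence; the sequence is
   shifted so that the eventual bound holds from its start.\<close>
 from ev[OF zero_less_one] obtain N0 where N0: "\<forall>j\<ge>N0. Lb ap (bound 1) (dsol js t (f j))" by (elim exE)
 have c0: "\<exists>N. \<forall>i\<ge>N. \<forall>j\<ge>N. Lb ap \<epsilon> (\<lambda>x. dsol js t (f (N0 + i)) x - dsol js t (f (N0 + j)) x)" if "0 < \<epsilon>" for \<epsilon>
 proof -
  obtain N where N: "\<forall>i\<ge>N. \<forall>j\<ge>N. Lb ap \<epsilon> (\<lambda>x. dsol js t (f i) x - dsol js t (f j) x)" using cauchy[OF \<open>0 < \<epsilon>\<close>] by (elim exE)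
  show ?thesis by (intro exI[of _ N] allI impI) (use N in simp)
 qed
 have b0: "Lb ap (bound 1) (dsol js t (f (N0 + j)))" for j using N0 by simp
 obtain g \<sigma> where \<sigma>: "strict_mono \<sigma>" and gm: "g \<in> \<B>"
  and gae: "AE x in lborel. (\<lambda>j. dsol js t (f (N0 + \<sigma> j)) x) \<longlonglongrightarrow> g x"
  and glim: "\<And>\<psi> R C. \<psi> \<in> \<B> \<Longrightarrow> (\<And>x. \<bar>\<psi> x\<bar> \<le> C) \<Longrightarrow> (\<And>x. norm x > R \<Longrightarrow> \<psi> x = 0) \<Longrightarrow>
   (\<lambda>j. LBINT x. \<psi> x *\<^sub>R dsol js t (f (N0 + \<sigma> j)) x) \<longlonglongrightarrow> (LBINT x. \<psi> x *\<^sub>R g x)"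
  by (rule Lb_complete[where h = "\<lambda>j. dsol js t (f (N0 + j))", OF ap c0 b0]) auto
 have gb: "Lb ap (bound \<delta>) g" if \<delta>: "0 < \<delta>" for \<delta>
 proof -
  obtain N where N: "\<forall>j\<ge>N. Lb ap (bound \<delta>) (dsol js t (f j))" using ev[OF \<delta>] by (elim exE)
  show ?thesis
  proof (rule Lb_Fatou[OF _ gm _ ap(1)])
   \<comment> \<open>Passing to the tail makes the bound hold for every member; \<sigma> is at least
     the identity, so the index is beyond N.\<close>
   show "Lb ap (bound \<delta>) (dsol js t (f (N0 + \<sigma> (j + N))))" for j using N seq_suble[OF \<sigma>, of "j + N"] by simp
   show "AE x in lborel. (\<lambda>j. dsol js t (f (N0 + \<sigma> (j + N))) x) \<longlonglongrightarrow> g x"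
    using gae by eventually_elim (rule LIMSEQ_ignore_initial_segment)
  qed
 qed
 obtain sp where sp: "0 < sp" "\<And>(e :: real^'n) v. norm e \<le> 1 \<Longrightarrow> (\<Sum>j\<in>UNIV. e $ j * ((A j *v v) \<bullet> v)) \<le> sp * ((A0 *v v) \<bullet> v)"
  by (rule speed_exists[OF A]) (rule that)
 obtain B where B: "B ** A0 = mat 1" "A0 ** B = mat 1" by (rule pos_invertible, erule condition_A_D(3)[OF A]) (rule that)
 have "wderiv js (u t) g" unfolding wderiv_def
 proof (intro conjI allI impI ut)
  show "locint g" by (rule Lb_locint[OF gb[OF zero_less_one] ap])
  fix \<phi> :: "real^'n \<Rightarrow> real" assume \<phi>: "smooth_csupp \<phi>"
  have \<phi>': "smooth_csupp (pds js \<phi>)" by (rule smooth_csupp_partial_derivs[OF \<phi>])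
  have m: "\<phi> \<in> \<B>" "pds js \<phi> \<in> \<B>"
   using \<phi> \<phi>' smooth_borel_measurable unfolding smooth_csupp_def by auto
  obtain M where M: "0 < M" "\<And>x. norm (\<phi> x) \<le> M" by (rule smooth_csupp_bounded[OF \<phi>]) (rule that)
  obtain M' where M': "0 < M'" "\<And>x. norm (pds js \<phi> x) \<le> M'" by (rule smooth_csupp_bounded[OF \<phi>']) (rule that)
  obtain R where R: "\<And>x. norm x > R \<Longrightarrow> \<phi> x = 0" using \<phi> unfolding smooth_csupp_def by auto
  have R': "norm x > R \<Longrightarrow> pds js \<phi> x = 0" for x using partial_derivs_vanish[of R \<phi> x js] R by simp
  define i where "i j = N0 + \<sigma> j" for j
  have i: "filterlim i sequentially sequentially"
   by (rule filterlim_subseq) (use \<sigma> in \<open>simp add: strict_mono_def i_def\<close>)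
  have "(\<lambda>j. LBINT x. \<phi> x *\<^sub>R dsol js t (f (i j)) x) \<longlonglongrightarrow> (LBINT x. \<phi> x *\<^sub>R g x)"
   unfolding i_def using M(2) by (intro glim[OF m(1) _ R]) auto
  then have 1: "(\<lambda>j. (-1) ^ length js *\<^sub>R (LBINT x. \<phi> x *\<^sub>R dsol js t (f (i j)) x)) \<longlonglongrightarrow> (-1) ^ length js *\<^sub>R (LBINT x. \<phi> x *\<^sub>R g x)"
   by (intro tendsto_scaleR tendsto_const)
  have "(\<lambda>j. LBINT x. pds js \<phi> x *\<^sub>R conv (r j) (u t) x) \<longlonglongrightarrow> (LBINT x. pds js \<phi> x *\<^sub>R u t x)"
   using M'(2) by (intro conv_tendsto[OF r ut m(2) _ R']) auto
  then have 2: "(\<lambda>j. LBINT x. pds js \<phi> x *\<^sub>R conv (r (i j)) (u t) x) \<longlonglongrightarrow> (LBINT x. pds js \<phi> x *\<^sub>R u t x)"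
   by (rule filterlim_compose[OF _ i])
  \<comment> \<open>For j \<ge> N the domain of dependence of the ball of radius j + 1 contains the
    support of \<phi> at time t.\<close>
  obtain N where N: "sqrt (1 + R^2) + sp * t < real N" using reals_Archimedean2[of "sqrt (1 + R^2) + sp * t"] by (elim exE)
  have eq: "(LBINT x. pds js \<phi> x *\<^sub>R conv (r j) (u t) x) = (-1) ^ length js *\<^sub>R (LBINT x. \<phi> x *\<^sub>R dsol js t (f j) x)" if j: "j \<ge> N" for j
  proof -
   have ae: "AE x in lborel. sqrt (1 + (norm x)^2) + sp * t < real (Suc j) \<longrightarrow> dsol [] t (f j) x = conv (r j) (u t) x"
    by (rule dsol_eq_conv[OF A B sp u r_smooth f _ t]) (assumption, unfold f_def, rule approx_eq)
   \<comment> \<open>On that support the mollified solution is replaced by the Fourier solution,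
     whose weak derivatives are known.\<close>
   have "(LBINT x. pds js \<phi> x *\<^sub>R conv (r j) (u t) x) = (LBINT x. pds js \<phi> x *\<^sub>R dsol [] t (f j) x)"
   proof (rule integral_cong_AE)
    show "AE x in lborel. pds js \<phi> x *\<^sub>R conv (r j) (u t) x = pds js \<phi> x *\<^sub>R dsol [] t (f j) x" using ae
    proof eventually_elim
     case (elim x)
     show ?case
     proof (cases "norm x \<le> R")
      case True
      then have "(norm x)^2 \<le> R^2" by (intro power_mono) auto
      then have "sqrt (1 + (norm x)^2) \<le> sqrt (1 + R^2)" by simp
      moreover have "real N \<le> real (Suc j)" using j by simp
      ultimately have "sqrt (1 + (norm x)^2) + sp * t < real (Suc j)" using N by linarith
      then show ?thesis using elim by simp
     next
      case False then show ?thesis using R' by simp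
     qed
    qed
    show "(\<lambda>x. pds js \<phi> x *\<^sub>R conv (r j) (u t) x) \<in> borel_measurable lborel"
     "(\<lambda>x. pds js \<phi> x *\<^sub>R dsol [] t (f j) x) \<in> borel_measurable lborel"
     unfolding measurable_lborel2 by (intro borel_measurable_scaleR m conv_measurable[OF ut] dsol_measurable[OF f])+
   qed
   also have "\<dots> = (-1) ^ length js *\<^sub>R (LBINT x. \<phi> x *\<^sub>R dsol js t (f j) x)"
    by (rule dsol_weak_derivative[OF f t \<phi>])
   finally show ?thesis .
  qed
  have "\<forall>\<^sub>F j in sequentially. i j \<ge> N" using i by (simp add: filterlim_at_top)
  then have "\<forall>\<^sub>F j in sequentially. (LBINT x. pds js \<phi> x *\<^sub>R conv (r (i j)) (u t) x) = (-1) ^ length js *\<^sub>R (LBINT x. \<phi> x *\<^sub>R dsol js t (f (i j)) x)"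
   by eventually_elim (rule eq)
  with 2 have "(\<lambda>j. (-1) ^ length js *\<^sub>R (LBINT x. \<phi> x *\<^sub>R dsol js t (f (i j)) x)) \<longlonglongrightarrow> (LBINT x. pds js \<phi> x *\<^sub>R u t x)"
   by (rule Lim_transform_eventually)
  from LIMSEQ_unique[OF this 1]
  show "(LBINT x. pds js \<phi> x *\<^sub>R u t x) = (-1) ^ length js *\<^sub>R (LBINT x. \<phi> x *\<^sub>R g x)" .
 qed
 with gb show ?thesis unfolding bound_def by (intro exI[of _ g] conjI allI impI)
qed

end

section \<open>The decay estimate\<close>

lemma integral_borel_representative:
 fixes f :: "real^'n::finite \<Rightarrow> 'b::euclidean_space"
 assumes "f' \<in> \<B>" "AE x in lebesgue. f x = f' x"
 shows "(LINT x|lebesgue. f x) = (LBINT x. f' x)"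
 by (rule integral_representative[OF assms(1) borel_measurable_lebesgue_AE[OF borel_measurable_lebesgueI[OF assms(1)] assms(2)] assms(2)])

lemma matrix_vector_mult_measurable:
 fixes X :: "real^'m^'m"
 shows "g \<in> borel_measurable M \<Longrightarrow> (\<lambda>x. X *v g x) \<in> borel_measurable M"
 by (erule measurable_compose) (intro borel_measurable_continuous_onI linear_continuous_on matrix_vector_mul_bounded_linear)

lemma solution_representative:
 fixes A0 L :: "real^'m^'m" and A :: "'n::finite \<Rightarrow> real^'m^'m"
 assumes w: "is_solution A0 A L w0 w" and u0: "locint u0" "AE x in lebesgue. w0 x = u0 x"
 shows "\<exists>u. borel_solution A0 A L u0 u \<and> (\<forall>t\<ge>0. AE x in lebesgue. w t x = u t x)"
proof -
 \<comment> \<open>A solution is constrained at non-negative times only; the implication lets one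
   choice function cover all reals.\<close>
 have "\<exists>v. 0 \<le> t \<longrightarrow> locint v \<and> (AE x in lebesgue. w t x = v x)" for t
 proof (cases "0 \<le> t")
  case True
  then have "locally_integrable (w t)" using w by (simp add: is_solution_def)
  from locint_representative[OF this] show ?thesis by simp
 qed simp
 then have "\<forall>t. \<exists>v. 0 \<le> t \<longrightarrow> locint v \<and> (AE x in lebesgue. w t x = v x)" ..
 then obtain u where u0t: "\<forall>t. 0 \<le> t \<longrightarrow> locint (u t) \<and> (AE x in lebesgue. w t x = u t x)" by (elim choice[THEN exE])
 have u: "locint (u t)" "AE x in lebesgue. w t x = u t x" if "0 \<le> t" for t using u0t that by auto
 have um: "u t \<in> \<B>" if "0 \<le> t" for t by (rule locint_measurable[OF u(1)[OF that]])
 have i1: "(LINT x:cball 0 R|lebesgue. norm (w s x - w t x)) = (LBINT x. ball_ind R x * norm (u s x - u t x))"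
  if s: "0 \<le> s" and t: "0 \<le> t" for R s t unfolding set_lebesgue_integral_def real_scaleR_def
 proof (rule integral_borel_representative)
  show "(\<lambda>x. ball_ind R x * norm (u s x - u t x)) \<in> \<B>"
   using um[OF s] um[OF t] by (intro borel_measurable_times borel_measurable_indicator) auto
  show "AE x in lebesgue. ball_ind R x * norm (w s x - w t x) = ball_ind R x * norm (u s x - u t x)"
   using u(2)[OF s] u(2)[OF t] by eventually_elim simp
 qed
 have i2: "(LINT x|lebesgue. \<phi> x *\<^sub>R (A0 *v w s x)) = (LBINT x. \<phi> x *\<^sub>R (A0 *v u s x))"
  if \<phi>: "smooth_csupp \<phi>" and s: "0 \<le> s" for \<phi> s
 proof (rule integral_test_representative[OF matrix_vector_mult_measurable[OF um[OF s]] _ \<phi>])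
  show "AE x in lebesgue. A0 *v w s x = A0 *v u s x" using u(2)[OF s] by eventually_elim simp
 qed
 have i3: "(LINT x|lebesgue. weak_rhs A L \<phi> (w t) x)
   = (LBINT x. weak_rhs A L \<phi> (u t) x)"
  if \<phi>: "smooth_csupp \<phi>" and t: "0 \<le> t" for \<phi> t
 proof (rule integral_borel_representative)
  have "\<phi> \<in> \<B>" "pd j \<phi> \<in> \<B>" for j
   using \<phi> smooth_csupp_partial_deriv[OF \<phi>, of j] by (auto simp: smooth_csupp_def intro: smooth_borel_measurable)
  then show "(\<lambda>x. weak_rhs A L \<phi> (u t) x) \<in> \<B>"
   by (intro borel_measurable_diff borel_measurable_sum borel_measurable_scaleR matrix_vector_mult_measurable um t)
  show "AE x in lebesgue. weak_rhs A L \<phi> (w t) x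
   = weak_rhs A L \<phi> (u t) x" using u(2)[OF t] by eventually_elim simp
 qed
 have "borel_solution A0 A L u0 u" unfolding borel_solution_def
 proof (intro conjI allI impI)
  show "locint u0" by (rule u0)
  show "locint (u t)" if "0 \<le> t" for t by (rule u(1)[OF that])
  have "AE x in lebesgue. w 0 x = w0 x" using w by (simp add: is_solution_def)
  then have "AE x in lebesgue. u 0 x = u0 x" using u0(2) u(2)[OF order_refl] by eventually_elim simp
  then show "AE x in lborel. u 0 x = u0 x" by (simp add: AE_completion_iff)
  show "((\<lambda>s. LBINT x. ball_ind R x * norm (u s x - u t x)) \<longlongrightarrow> 0) (at t within {0..})" if t: "0 \<le> t" for R t
  proof (rule Lim_transform_eventually)
   show "((\<lambda>s. LINT x:cball 0 R|lebesgue. norm (w s x - w t x)) \<longlongrightarrow> 0) (at t within {0..})"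
    using w t compact_cball unfolding is_solution_def by simp
   show "\<forall>\<^sub>F s in at t within {0..}. (LINT x:cball 0 R|lebesgue. norm (w s x - w t x)) = (LBINT x. ball_ind R x * norm (u s x - u t x))"
    unfolding eventually_at_filter by (intro always_eventually) (simp add: i1[OF _ t])
  qed
  show "((\<lambda>s. LBINT x. \<phi> x *\<^sub>R (A0 *v u s x)) has_vector_derivative
   (LBINT x. weak_rhs A L \<phi> (u t) x)) (at t)" if \<phi>: "smooth_csupp \<phi>" and t: "0 < t" for \<phi> t
  proof (rule has_vector_derivative_transform_within_open[where S = "{0<..}"])
   show "((\<lambda>s. LINT x|lebesgue. \<phi> x *\<^sub>R (A0 *v w s x)) has_vector_derivative
    (LBINT x. weak_rhs A L \<phi> (u t) x)) (at t)"
    using w \<phi> t unfolding is_solution_def test_function_iff i3[OF \<phi> less_imp_le[OF t], symmetric] by simp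
  qed (use t i2[OF \<phi>] in auto)
 qed
 then show ?thesis using u(2) by (intro exI[of _ u]) simp
qed

text \<open>\<open>weak_deriv\<close> is an unspecified choice. By uniqueness it agrees almost
  everywhere with any exhibited weak derivative, so the norm of the collection can be computed from
  \<open>V\<close>. The third claim returns from the collection to its members and feeds the data
  norms into the estimate.\<close>

lemma derivs_Lp:
 fixes w u :: "real^'n::finite \<Rightarrow> 'b::euclidean_space"
 assumes p: "1 \<le> p" and u: "u \<in> \<B>" "AE x in lebesgue. w x = u x"
  and V: "\<And>js. length js = k \<Longrightarrow> wderiv js u (V js)" "\<And>js. length js = k \<Longrightarrow> Lb (enn2real (inverse p)) B (V js)"
 shows "derivs_in_Lp k p w" "derivs_Lp_norm k p w \<le> (real (card {js :: 'n list. length js = k}))^2 * B"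
  "length js = k \<Longrightarrow> Lb (enn2real (inverse p)) (derivs_Lp_norm k p w) (V js)"
proof -
 define a where "a = enn2real (inverse p)"
 have a: "0 \<le> a" "a \<le> 1" using p by (cases rule: exponent_cases; simp add: a_def)+
 define J where "J = {js :: 'n list. length js = k}"
 have J: "finite J" unfolding J_def by (rule finite_lists)
 have B: "0 \<le> B" using Lb_nonneg[OF V(2)] Ex_list_of_length[of k] by auto
 have Vm: "V js \<in> \<B>" if "js \<in> J" for js using Lb_measurable[OF V(2)] that by (simp add: J_def)
 have hw: "has_weak_deriv js w (V js)" if "js \<in> J" for js
  using V(1) that by (subst has_weak_deriv_iff_wderiv[OF u Vm[OF that]]) (simp_all add: J_def)
 have "in_Lp p (V js)" if "js \<in> J" for js using Lb_imp_in_Lp[OF p V(2)] that by (simp add: J_def)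
 then show "derivs_in_Lp k p w" using hw unfolding derivs_in_Lp_def J_def by blast
 define G where "G x = L2_set (\<lambda>js. norm (weak_deriv js w x)) J" for x
 define G' where "G' x = L2_set (\<lambda>js. norm (V js x)) J" for x
 have "AE x in lebesgue. weak_deriv js w x = V js x" if js: "js \<in> J" for js
 proof -
  have h: "has_weak_deriv js w (weak_deriv js w)" unfolding weak_deriv_def by (rule someI[of "has_weak_deriv js w", OF hw[OF js]])
  then have "locally_integrable (weak_deriv js w)" by (simp add: has_weak_deriv_def)
  from locint_representative[OF this] obtain W where W: "locint W" "AE x in lebesgue. weak_deriv js w x = W x" by (elim exE conjE)
  have "wderiv js u W" using h by (simp only: has_weak_deriv_iff_wderiv[OF u locint_measurable[OF W(1)] W(2)])
  moreover have "wderiv js u (V js)" using js V(1) by (simp add: J_def)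
  ultimately have "AE x in lborel. W x = V js x" by (rule wderiv_unique)
  then have "AE x in lebesgue. W x = V js x" by (rule AE_completion)
  with W(2) show ?thesis by eventually_elim simp
 qed
 then have "AE x in lebesgue. \<forall>js\<in>J. weak_deriv js w x = V js x" by (intro AE_finite_allI J)
 then have GG: "AE x in lebesgue. G x = G' x" by eventually_elim (simp add: G_def G'_def L2_set_def)
 have G'm: "G' \<in> \<B>"
 proof -
  have "(\<lambda>x. \<Sum>js\<in>J. (norm (V js x))^2) \<in> \<B>"
   by (intro borel_measurable_sum borel_measurable_power measurable_compose[OF Vm borel_measurable_norm])
  then show ?thesis unfolding G'_def[abs_def] L2_set_def by measurable
 qed
 have "Lb a ((real (card J))^2 * B) (\<lambda>x. \<Sum>js\<in>J. norm (V js x))"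
  using V(2) by (intro Lb_sum J a B Lb_norm) (simp add: J_def a_def)
 then have "Lb a ((real (card J))^2 * B) G'"
  by (rule Lb_cong_norm[OF _ G'm _ a(1)]) (simp add: G'_def L2_set_le_sum sum_nonneg L2_set_nonneg)
 from Lb_imp_in_Lp[OF p this[unfolded a_def] GG]
 have G: "in_Lp p G" "Lp_norm p G \<le> (real (card J))^2 * B" by simp_all
 have n: "derivs_Lp_norm k p w = Lp_norm p G" by (simp add: derivs_Lp_norm_def G_def[abs_def] J_def)
 show "derivs_Lp_norm k p w \<le> (real (card {js :: 'n list. length js = k}))^2 * B" using G n by (simp add: J_def)
 assume "length js = k"
 then have js: "js \<in> J" by (simp add: J_def)
 have "Lb a (Lp_norm p G) (V js)"
 proof (rule Lb_cong_norm[OF in_Lp_imp_Lb[OF p G(1) G'm GG, folded a_def] Vm[OF js] _ a(1)])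
  show "norm (V js x) \<le> norm (G' x)" for x
   using member_le_L2_set[OF J js, of "\<lambda>js. norm (V js x)"] by (simp add: G'_def L2_set_nonneg)
 qed
 then show "Lb (enn2real (inverse p)) (derivs_Lp_norm k p w) (V js)" by (simp add: n a_def)
qed

lemma data_representatives:
 fixes w0 u0 :: "real^'n::finite \<Rightarrow> 'b::euclidean_space"
 assumes r: "1 \<le> r" and u0: "u0 \<in> \<B>" "AE x in lebesgue. w0 x = u0 x"
  and w0: "in_Sobolev l r w0" and K: "K \<le> l"
 shows "\<exists>V. (\<forall>bs. length bs \<le> K \<longrightarrow> wderiv bs u0 (V bs) \<and> (\<exists>B. Lb (enn2real (inverse r)) B (V bs))) \<and>
  (\<forall>bs. length bs = K \<longrightarrow> Lb (enn2real (inverse r)) (derivs_Lp_norm K r w0) (V bs))"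
proof -
 have "\<exists>v. length bs \<le> K \<longrightarrow> wderiv bs u0 v \<and> (\<exists>B. Lb (enn2real (inverse r)) B v)" for bs
 proof (cases "length bs \<le> K")
  case True
  then have "derivs_in_Lp (length bs) r w0" using w0 K by (simp add: in_Sobolev_def)
  then obtain v where v: "has_weak_deriv bs w0 v" "in_Lp r v" unfolding derivs_in_Lp_def by blast
  then have "locally_integrable v" by (simp add: has_weak_deriv_def)
  from locint_representative[OF this] obtain v' where v': "locint v'" "AE x in lebesgue. v x = v' x" by (elim exE conjE)
  note m = locint_measurable[OF v'(1)]
  have "wderiv bs u0 v'" using v(1) by (simp only: has_weak_deriv_iff_wderiv[OF u0 m v'(2)])
  moreover have "Lb (enn2real (inverse r)) (Lp_norm r v) v'" by (rule in_Lp_imp_Lb[OF r v(2) m v'(2)])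
  ultimately show ?thesis by (intro exI[of _ v']) auto
 qed simp
 then obtain V where V: "\<And>bs. length bs \<le> K \<Longrightarrow> wderiv bs u0 (V bs) \<and> (\<exists>B. Lb (enn2real (inverse r)) B (V bs))" by metis
 \<comment> \<open>A provisional common bound, the sum of the individual ones:
   \<open>derivs_Lp\<close> asks for some bound before it gives the one by the norm of the
   collection.\<close>
 have "\<exists>b. \<forall>bs. length bs = K \<longrightarrow> Lb (enn2real (inverse r)) b (V bs)"
 proof -
  obtain BV where BV: "\<And>bs. length bs \<le> K \<Longrightarrow> Lb (enn2real (inverse r)) (BV bs) (V bs)" using V by metis
  have "Lb (enn2real (inverse r)) (\<Sum>bs\<in>{bs. length bs = K}. \<bar>BV bs\<bar>) (V bs)" if "length bs = K" for bs
  proof (rule Lb_weaken[OF BV])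
   have "BV bs \<le> \<bar>BV bs\<bar>" by simp
   also have "\<dots> \<le> (\<Sum>bs\<in>{bs. length bs = K}. \<bar>BV bs\<bar>)"
    by (rule member_le_sum) (use that finite_lists in auto)
   finally show "BV bs \<le> (\<Sum>bs\<in>{bs. length bs = K}. \<bar>BV bs\<bar>)" .
  qed (use that in auto)
  then show ?thesis by (intro exI[of _ "\<Sum>bs\<in>{bs. length bs = K}. \<bar>BV bs\<bar>"]) simp
 qed
 then obtain b where b0: "\<forall>bs. length bs = K \<longrightarrow> Lb (enn2real (inverse r)) b (V bs)" by (elim exE)
 note b = b0[rule_format]
 have "Lb (enn2real (inverse r)) (derivs_Lp_norm K r w0) (V bs)" if "length bs = K" for bs
  by (rule derivs_Lp(3)[OF r u0 _ b that]) (use V in auto)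
 with V show ?thesis by (intro exI[of _ V]) simp
qed

lemma exponent_le_2:
 assumes "1 \<le> q" "q \<le> 2"
 shows "1 / 2 \<le> enn2real (inverse q)" "enn2real (inverse q) \<le> 1"
proof -
 from assms(1) have "1 / 2 \<le> enn2real (inverse q) \<and> enn2real (inverse q) \<le> 1"
 proof (cases rule: exponent_cases)
  case 1 then show ?thesis using assms(2) by (simp add: top_unique)
 next
  case (2 P)
  have "ennreal P \<le> ennreal 2" using assms(2) 2 by simp
  then have "P \<le> 2" by (subst (asm) ennreal_le_iff) auto
  then show ?thesis using 2(1) unfolding 2(5) by (simp add: field_simps)
 qed
 then show "1 / 2 \<le> enn2real (inverse q)" "enn2real (inverse q) \<le> 1" by auto
qed

lemma exponent_ge_2:
 assumes "2 \<le> (p::ennreal)" shows "1 \<le> p" "enn2real (inverse p) \<le> 1 / 2"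
proof -
 show p: "1 \<le> p" by (rule order_trans[OF _ assms]) simp
 from p show "enn2real (inverse p) \<le> 1 / 2"
 proof (cases rule: exponent_cases)
  case (2 P)
  have "ennreal 2 \<le> ennreal P" using assms 2 by simp
  then have "2 \<le> P" using 2(1) by (subst (asm) ennreal_le_iff) auto
  then show ?thesis unfolding 2(5) by (simp add: field_simps)
 qed simp
qed

theorem proposition4p1:
  fixes A0 L :: "real^'m^'m"
    and A :: "'n::finite \<Rightarrow> real^'m^'m"
    and p q r :: ennreal
    and l k ell :: nat
  assumes "condition_A A0 A L"
    and "condition_K A0 A L"
    and "\<exists>S. condition_S A0 L S \<and> condition_S1 A L S"
    and "1 \<le> q" "q \<le> 2" "1 \<le> r" "r \<le> 2" "2 \<le> p"
    and "k + ell \<le> l"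
    and "real ell > real CARD('n) * (enn2real (inverse r) - enn2real (inverse p))
         \<or> (p = 2 \<and> r = 2)"
  shows "\<exists>C>0. \<forall>(w0 :: real^'n \<Rightarrow> real^'m) w.
           in_Sobolev l r w0 \<and> in_Lp q w0 \<and> is_solution A0 A L w0 w \<longrightarrow>
           (\<forall>t\<ge>0. derivs_in_Lp k p (w t) \<and>
              derivs_Lp_norm k p (w t)
                \<le> C * (1 + t) powr (- gamma2 TYPE('n) q p - real k / 2) * Lp_norm q w0
                  + C * (1 + t) powr (- real ell / 2 + gamma2 TYPE('n) r p)
                      * derivs_Lp_norm (k + ell) r w0)"
proof -
 obtain S where S: "condition_S A0 L S" "condition_S1 A L S" using assms(3) by auto
 obtain E E' :: "real \<Rightarrow> real^'n \<Rightarrow> 'm \<Rightarrow> 'm \<Rightarrow> complex" and c CE :: real where "propagation A0 L A E E' c CE"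
  by (rule propagator[OF assms(1,2) S]) (rule that)
 then interpret propagation A0 L A E E' c CE .
 define aq where "aq = enn2real (inverse q)"
 define ar where "ar = enn2real (inverse r)"
 define ap where "ap = enn2real (inverse p)"
 have aq: "1 / 2 \<le> aq" "aq \<le> 1" and ar: "1 / 2 \<le> ar" "ar \<le> 1" and ap: "0 \<le> ap" "ap \<le> 1 / 2"
  unfolding aq_def ar_def ap_def by (rule exponent_le_2 exponent_ge_2(2) assms(4-8) enn2real_nonneg)+
 \<comment> \<open>The exceptional case p = r = 2 becomes ar = ap: the high-frequency multiplier is
   then measured in L^\<infinity>, where no integrability at infinity is required.\<close>
 have ell: "real CARD('n) * (ar - ap) < real ell \<or> ar - ap = 0" using assms(10) by (auto simp: ar_def ap_def)
 define J where "J = {js :: 'n list. length js = k}"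
 define nJ where "nJ = (real (card J))^2"
 have "J \<noteq> {}" using Ex_list_of_length[of k] by (auto simp: J_def)
 then have nJ: "0 < nJ" unfolding nJ_def J_def using finite_lists by (simp add: card_gt_0_iff)
 define Rl where "Rl t = (1 + t) powr (- (real CARD('n) * (aq - ap) / 2) - real k / 2)" for t
 define Rh where "Rh t = (1 + t) powr (- (real ell / 2) + real CARD('n) * (ar - ap) / 2)" for t
 obtain K where K: "0 < K" "\<forall>f Bq Br t js. smooth_csupp f \<longrightarrow> 0 < Bq \<longrightarrow> 0 < Br \<longrightarrow> Lb aq Bq f \<longrightarrow>
  (\<forall>ks. length ks = k + ell \<longrightarrow> Lb ar Br (pds ks f)) \<longrightarrow> 0 \<le> t \<longrightarrow> length js = k \<longrightarrow>
  Lb ap (K * (Rl t * Bq + Rh t * Br)) (dsol js t f)"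
  using dsol_decay[OF aq ar ap ell, of k] unfolding Rl_def Rh_def by (elim exE conjE)
 have main: "derivs_in_Lp k p (w t) \<and> derivs_Lp_norm k p (w t) \<le> 4 * nJ * K * Rl t * Lp_norm q w0 + 4 * nJ * K * Rh t * derivs_Lp_norm (k + ell) r w0"
  if w0: "in_Sobolev l r w0" "in_Lp q w0" and w: "is_solution A0 A L w0 w" and t: "0 \<le> t"
  for w0 :: "real^'n \<Rightarrow> real^'m" and w t
 proof -
  have R: "0 < Rl t" "0 < Rh t" using t by (simp_all add: Rl_def Rh_def)
  define Bq where "Bq = Lp_norm q w0"
  define Br where "Br = derivs_Lp_norm (k + ell) r w0"
  \<comment> \<open>The weak derivative of order 0 is used only to read off that \<open>w0\<close>
    is locally integrable.\<close>
  have "derivs_in_Lp 0 r w0" using w0(1) by (simp add: in_Sobolev_def)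
  then obtain v where "has_weak_deriv [] w0 v" unfolding derivs_in_Lp_def by auto
  then have "locally_integrable w0" by (simp add: has_weak_deriv_def)
  from locint_representative[OF this] obtain u0 where u0: "locint u0" "AE x in lebesgue. w0 x = u0 x" by (elim exE conjE)
  note u0m = locint_measurable[OF u0(1)]
  from solution_representative[OF w u0] obtain u where u: "borel_solution A0 A L u0 u" "\<forall>t\<ge>0. AE x in lebesgue. w t x = u t x"
   by (elim exE conjE)
  have ut: "u t \<in> \<B>" "AE x in lebesgue. w t x = u t x"
   using locint_measurable[OF borel_solution_D(2)[OF u(1) t]] u(2) t by auto
  have Lq: "Lb aq Bq u0" unfolding aq_def Bq_def by (rule in_Lp_imp_Lb[OF assms(4) w0(2) u0m u0(2)])
  obtain V where V0: "\<forall>bs. length bs \<le> k + ell \<longrightarrow> wderiv bs u0 (V bs) \<and> (\<exists>B. Lb ar B (V bs))"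
   "\<forall>bs. length bs = k + ell \<longrightarrow> Lb ar Br (V bs)"
   using data_representatives[OF assms(6) u0m u0(2) w0(1) assms(9)] unfolding ar_def Br_def by (elim exE conjE)
  note V = V0[rule_format]
  have "\<exists>g. wderiv js (u t) g \<and> (\<forall>\<delta>>0. Lb ap (K * (Rl t * (4 * (\<delta> + Bq)) + Rh t * (4 * (\<delta> + Br)))) g)" if js: "length js = k" for js
   by (rule solution_decay[OF assms(1) u(1) _ aq(2) _ ar(2) ap(1) _ Lq V K(1) R _ t]) (use aq ar ap K(2) js t in auto)
  then obtain g where g: "\<And>js. length js = k \<Longrightarrow> wderiv js (u t) (g js)"
   "\<And>js \<delta>. length js = k \<Longrightarrow> 0 < \<delta> \<Longrightarrow> Lb ap (K * (Rl t * (4 * (\<delta> + Bq)) + Rh t * (4 * (\<delta> + Br)))) (g js)" by metis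
  note D = derivs_Lp(1,2)[OF exponent_ge_2(1)[OF assms(8)] ut g(1), folded ap_def, OF _ g(2)]
  have "derivs_Lp_norm k p (w t) \<le> 4 * nJ * K * Rl t * Bq + 4 * nJ * K * Rh t * Br"
  \<comment> \<open>Here \<delta> tends to 0: it is chosen so that its contribution to the bound is
    exactly e.\<close>
  proof (rule field_le_epsilon)
   fix e :: real assume e: "0 < e"
   define \<delta> where "\<delta> = e / (4 * nJ * K * (Rl t + Rh t))"
   have nz: "0 < 4 * nJ * K * (Rl t + Rh t)" using nJ K(1) R by simp
   have \<delta>: "0 < \<delta>" unfolding \<delta>_def using e nz by (rule divide_pos_pos)
   have "4 * nJ * K * (Rl t + Rh t) * \<delta> = e"
    unfolding \<delta>_def by (simp only: times_divide_eq_right nonzero_mult_div_cancel_left[OF less_imp_neq[OF nz, symmetric]])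
   moreover have "derivs_Lp_norm k p (w t) \<le> nJ * (K * (Rl t * (4 * (\<delta> + Bq)) + Rh t * (4 * (\<delta> + Br))))"
    unfolding nJ_def J_def by (rule D(2)) (use \<delta> in auto)
   ultimately show "derivs_Lp_norm k p (w t) \<le> 4 * nJ * K * Rl t * Bq + 4 * nJ * K * Rh t * Br + e"
    by (simp add: algebra_simps)
  qed
  moreover have "derivs_in_Lp k p (w t)" by (rule D(1)) (auto intro: zero_less_one)
  ultimately show ?thesis by (simp add: Bq_def Br_def)
 qed
 have "Rl t = (1 + t) powr (- gamma2 TYPE('n) q p - real k / 2)" "Rh t = (1 + t) powr (- real ell / 2 + gamma2 TYPE('n) r p)" for t
  by (simp_all add: Rl_def Rh_def gamma2_def aq_def ar_def ap_def)
 note rates = this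
 have C: "0 < 4 * nJ * K" using nJ K(1) by simp
 show ?thesis
 proof (rule exI[of _ "4 * nJ * K"], rule conjI[OF C], intro allI impI, elim conjE)
  fix w0 :: "real^'n \<Rightarrow> real^'m" and w and t :: real
  assume "in_Sobolev l r w0" "in_Lp q w0" "is_solution A0 A L w0 w" "0 \<le> t"
  from main[OF this] show "derivs_in_Lp k p (w t) \<and> derivs_Lp_norm k p (w t)
    \<le> 4 * nJ * K * (1 + t) powr (- gamma2 TYPE('n) q p - real k / 2) * Lp_norm q w0
     + 4 * nJ * K * (1 + t) powr (- real ell / 2 + gamma2 TYPE('n) r p) * derivs_Lp_norm (k + ell) r w0" by (simp only: rates)
 qed
qed

end
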